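(* Let $l\ge 3$. The image of $\mathcal{B}_{l-1}^{(1),ap}$ under the map $\Phi_{\mathbb Z}:\mathbf a\mapsto \mathbf M(\mathbf a)$ coincides with $(\mathcal{BZ}_{\mathbb Z}^e)^{\sigma}(\mathbf O^* )$. In other words, $$\Phi_{\mathbb Z}:\bigl(\mathcal{B}_{l-1}^{(1),ap};\mathrm{wt},\widehat{\varepsilon}_p^*,\widehat{\varphi}_p^*,\widehat{e}_p^*,\widehat{f}_p^*\bigr)\longrightarrow \bigl((\mathcal{BZ}_{\mathbb Z}^e)^{\sigma}(\mathbf O^* );\mathrm{wt},\widehat{\varepsilon}_p^*,\widehat{\varphi}_p^*,\widehat{e}_p^*,\widehat{f}_p^*\bigr)$$ is an isomorphism of crystals of type $A_{l-1}^{(1)}$.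
   Context: **Affine root datum.** Fix $l\ge 3$, $\widehat I=\{0,1,\dots,l-1\}$. $\widehat\alpha_p,\widehat h_p$ ($p\in\widehat I$) are the simple roots and coroots of the affine Lie algebra of type $A_{l-1}^{(1)}$. Crystals, morphisms of crystals and $B(\infty)$ are in Kashiwara's sense. **Intervals and Maya diagrams.** For a finite interval $I=[n+1,n+m]\subset\mathbb Z$ put $\widetilde I=[n+1,n+m+1]$, $\mathcal M_I$ = set of all subsets of $\widetilde I$, $\mathcal M_I^\times=\mathcal M_I\setminus\{\emptyset,\widetilde I\}$. $\mathcal M_{\mathbb Z}$ is the set of Maya diagrams: subsets $\mathbf k\subset\mathbb Z$ such that for some $r\in\mathbb Z$ (the charge) and $p,q\ge0$, $\mathbb Z_{\le r-p}\subset\mathbf k\subset\mathbb Z_{\le r+q}$ and $|\mathbf k\cap\mathbb Z_{>r-p}|=p$. $\mathbf k^c=\mathbb Z\setminus\mathbf k$, and $\mathcal M_{\mathbb Z}^c=\{\mathbf k^c\mid\mathbf k\in\mathcal M_{\mathbb Z}\}$. $\mathcal M_{\mathbb Z}(I)=\{\mathbb Z_{\le n}\cup\mathbf k_I\mid \mathbf k_I\in\mathcal M_I^\times\}$, $\mathcal M_{\mathbb Z}^c(I)=\{\mathbf k_I\cup\mathbb Z_{\ge n+m+2}\mid\mathbf k_I\in\mathcal M_I^\times\}$. The bijections $\mathrm{res}_I:\mathcal M_{\mathbb Z}(I)\to\mathcal M_I^\times$ and $\mathrm{res}_I^c:\mathcal M_{\mathbb Z}^c(I)\to\mathcal M_I^\times$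 are $\mathbf k\mapsto\mathbf k\cap\widetilde I$. Put $\Omega_I(\mathbf k)=\mathbb Z_{\le n}\cup(\widetilde I\setminus\mathbf k)$ for $\mathbf k\in\mathcal M_{\mathbb Z}(I)$ and $\Omega_I^c(\mathbf k)=(\widetilde I\setminus\mathbf k)\cup\mathbb Z_{\ge n+m+2}$ for $\mathbf k\in\mathcal M^c_{\mathbb Z}(I)$. **Lusztig data.** $\Delta_{\mathbb Z}^+=\{(i,j)\in\mathbb Z^2\mid i<j\}$. $\mathcal B_{\mathbb Z}$ is the set of families $\mathbf a=(a_{i,j})_{(i,j)\in\Delta^+_{\mathbb Z}}$ of nonnegative integers for which there is $N_{\mathbf a}>0$ with $a_{i,j}=0$ whenever $j-i\ge N_{\mathbf a}$. $\mathcal B_{l-1}^{(1)}=\{\mathbf a\in\mathcal B_{\mathbb Z}\mid a_{i,j}=a_{i+l,j+l}\ \forall (i,j)\}$; $\mathcal B_{l-1}^{(1),ap}$ (aperiodic data) is the subset of those $\mathbf a\in\mathcal B_{l-1}^{(1)}$ such that for each $(i,j)\in\Delta_{\mathbb Z}^+$ at least one of $a_{i,j},a_{i+1,j+1},\dots,a_{i+l-1,j+l-1}$ is $0$. $\mathbf a^I$ denotes the restriction of $\mathbf a$ to $\Delta_I^+=\{(i,j)\mid i<j,\ i,j\in\widetilde I\}$. **$\ast$-crystal structure on Lusztig data.** For $\mathbf a\in\mathcal B_{\mathbb Z}$, $p\in\mathbb Z$, $k\ge p$: $A_k^{*(p)}(\mathbf a)=\sum_{t\ge k+1}(a_{p,t}-a_{p+1,t+1})$,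 $\varepsilon_p^*(\mathbf a)=\max_{k\ge p}A_k^{*(p)}(\mathbf a)\ge 0$. Let $k_f^*$ be the smallest $k\ge p$ with $A_k^{*(p)}(\mathbf a)=\varepsilon_p^*(\mathbf a)$ and, if $\varepsilon_p^*(\mathbf a)>0$, $k_e^*$ the largest such $k$. $\widetilde f_p^*\mathbf a$ is obtained from $\mathbf a$ by adding $1$ to $a_{p,k_f^*+1}$ and subtracting $1$ from $a_{p+1,k_f^*+1}$; if $\varepsilon_p^*(\mathbf a)>0$, $\widetilde e_p^*\mathbf a$ is obtained by subtracting $1$ from $a_{p,k_e^*+1}$ and adding $1$ to $a_{p+1,k_e^*+1}$ (changes at the non-existent index $(p+1,p+1)$ are ignored); if $\varepsilon_p^*(\mathbf a)=0$, $\widetilde e_p^*\mathbf a=0$. On $\mathcal B_{l-1}^{(1)}$, for $p\in\widehat I$: $\mathrm{wt}(\mathbf a)=-\sum_{p\in\widehat I}r_p(\mathbf a)\widehat\alpha_p$ with $r_p(\mathbf a)=\sum_{s\le p}\sum_{t\ge p+1}a_{s,t}$; $\widehat\varepsilon_p^*(\mathbf a)=\varepsilon_p^*(\mathbf a)$; $\widehat\varphi_p^*(\mathbf a)=\widehat\varepsilon_p^*(\mathbf a)+\langle\widehat h_p,\mathrm{wt}(\mathbf a)\rangle$; $\widehat e_p^*=\prod_{r\in\mathbb Z}\widetilde e_{p+rl}^*$, $\widehat f_p^*=\prod_{r\in\mathbb Z}\widetilde f_{p+rl}^*$ (commuting factors acting on disjoint sets of entries; $\widehat e_p^*\mathbf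 a=0$ if $\widehat\varepsilon_p^*(\mathbf a)=0$). This makes $\mathcal B_{l-1}^{(1),ap}$ a crystal of type $A_{l-1}^{(1)}$. **The map $\Phi_{\mathbb Z}$.** For $I=[n+1,n+m]$ and $\mathbf k=\{k_{n+1}<\dots<k_{n+u}\}\in\mathcal M_I^\times$, a $\mathbf k$-tableau is an upper triangular integer matrix $C=(c_{p,q})_{n+1\le p\le q\le n+u}$ with $c_{p,p}=k_p$, $c_{p,q}\le c_{p,q+1}$, $c_{p,q}<c_{p+1,q}$. Put $$M_{\mathbf k}(\mathbf a^I)=-\sum_{j=n+1}^{n+u}\sum_{i=n+1}^{k_j-1}a_{i,k_j}+\min_{C\ \mathbf k\text{-tableau}}\ \sum_{n+1\le p<q\le n+u}a_{c_{p,q},c_{p,q}+(q-p)}.$$ For $\mathbf a\in\mathcal B_{\mathbb Z}$, $\mathbf k\in\mathcal M_{\mathbb Z}$, $M_{\mathbf k}(\mathbf a)$ is the common value of $M_{\mathrm{res}_I(\mathbf k)}(\mathbf a^I)$ for all sufficiently large finite intervals $I$ (it stabilizes). $\Phi_{\mathbb Z}(\mathbf a)=\mathbf M(\mathbf a)=(M_{\mathbf k}(\mathbf a))_{\mathbf k\in\mathcal M_{\mathbb Z}}$. **Finite BZ data.** A BZ datum for $I$ is a family of integers $(M_{\mathbf k})_{\mathbf k\in\mathcal M_I^\times}$ such that, with $M_\emptyset=M_{\widetilde I}=0$: (BZ-1) $M_{\mathbf k\cup\{i\}}+M_{\mathbf k\cup\{j\}}\le M_{\mathbf k\cup\{i,j\}}+M_{\mathbf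 k}$ for $i\ne j$ in $\widetilde I$, $\mathbf k\in\mathcal M_I$, $\mathbf k\cap\{i,j\}=\emptyset$; (BZ-2) $M_{\mathbf k\cup\{i,k\}}+M_{\mathbf k\cup\{j\}}=\min\{M_{\mathbf k\cup\{i,j\}}+M_{\mathbf k\cup\{k\}},\,M_{\mathbf k\cup\{j,k\}}+M_{\mathbf k\cup\{i\}}\}$ for $i<j<k$ in $\widetilde I$, $\mathbf k\in\mathcal M_I$, $\mathbf k\cap\{i,j,k\}=\emptyset$. $\mathcal{BZ}_I$ is the set of BZ data with $M_{[i+1,n+m+1]}=0$ for all $i\in I$; $\mathcal{BZ}_I^e$ is the set of BZ data with $M_{[n+1,i]}=0$ for all $i\in I$. For $\mathbf M\in\mathcal{BZ}_I$, $i\in I$: $\varepsilon_i(\mathbf M)=-(M_{[n+1,i]}+M_{[n+1,i-1]\cup\{i+1\}}-M_{[n+1,i-1]}-M_{[n+1,i+1]})$; $\widetilde f_i\mathbf M$ (resp., if $\varepsilon_i(\mathbf M)>0$, $\widetilde e_i\mathbf M$) is the unique element of $\mathcal{BZ}_I$ whose $[n+1,i]$-component is $M_{[n+1,i]}-1$ (resp. $M_{[n+1,i]}+1$) and whose $\mathbf k$-component equals $M_{\mathbf k}$ for all $\mathbf k$ not satisfying ($i\in\mathbf k$ and $i+1\notin\mathbf k$); $\widetilde e_i\mathbf M=0$ if $\varepsilon_i(\mathbf M)=0$ (existence and uniqueness: Kamnitzer). **BZ data for $\mathbb Z$.** $\mathcal{BZ}_{\mathbb Z}$ is the set of families of integers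 $\mathbf M=(M_{\mathbf k})_{\mathbf k\in\mathcal M_{\mathbb Z}^c}$ such that (a) for every finite interval $K$, $\mathbf M_K:=(M_{\mathbf k})_{\mathbf k\in\mathcal M^c_{\mathbb Z}(K)}$, viewed as indexed by $\mathcal M_K^\times$ via $\mathrm{res}_K^c$, is in $\mathcal{BZ}_K$; (b) for each $\mathbf k\in\mathcal M_{\mathbb Z}^c$ there is a finite interval $I$ with $\mathbf k\in\mathcal M_{\mathbb Z}^c(I)$ and $M_{\Omega_J^c(\mathbf k)}=M_{\Omega_I^c(\mathbf k)}$ for all finite intervals $J\supset I$; the set of such $I$ is $\mathrm{Int}^c(\mathbf M;\mathbf k)$. $\mathcal{BZ}_{\mathbb Z}^e$ is the set of families $(M_{\mathbf k})_{\mathbf k\in\mathcal M_{\mathbb Z}}$ satisfying the same conditions with $\mathcal M_{\mathbb Z},\mathcal M_{\mathbb Z}(\cdot),\mathrm{res},\Omega,\mathcal{BZ}^e_K$ in place of $\mathcal M_{\mathbb Z}^c,\mathcal M_{\mathbb Z}^c(\cdot),\mathrm{res}^c,\Omega^c,\mathcal{BZ}_K$. The bijection $\ast:\mathcal{BZ}_{\mathbb Z}\leftrightarrow\mathcal{BZ}_{\mathbb Z}^e$ is $(\mathbf M^* )_{\mathbf k}=M_{\mathbf k^c}$. For $\mathbf M\in\mathcal{BZ}_{\mathbb Z}$, $\mathbf k\in\mathcal M_{\mathbb Z}$: $\Theta(\mathbf M)_{\mathbf k}=M_{\Omega_I^c(\mathbf k^c)}$ for any $I\in\mathrm{Int}^c(\mathbf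 M;\mathbf k^c)$. For $p\in\mathbb Z$, $\varepsilon_p(\mathbf M)=-(\Theta(\mathbf M)_{\mathbb Z_{\le p}}+\Theta(\mathbf M)_{\mathbb Z_{\le p-1}\cup\{p+1\}}-\Theta(\mathbf M)_{\mathbb Z_{\le p+1}}-\Theta(\mathbf M)_{\mathbb Z_{\le p-1}})$. If $\varepsilon_p(\mathbf M)=0$, $\widetilde e_p\mathbf M=0$; otherwise $(\widetilde e_p\mathbf M)_{\mathbf k}=(\widetilde e_p\mathbf M_I)_{\mathrm{res}_I^c(\mathbf k)}$, and always $(\widetilde f_p\mathbf M)_{\mathbf k}=(\widetilde f_p\mathbf M_I)_{\mathrm{res}_I^c(\mathbf k)}$, where $I$ is any finite interval with $\mathbf k\in\mathcal M_{\mathbb Z}^c(I)$ and $I\in\mathrm{Int}^c(\mathbf M;\mathbf m^c)$ for $\mathbf m=\mathbb Z_{\le p},\ \mathbb Z_{\le p-1}\cup\{p+1\}$ and, for $\widetilde e_p$, also $\mathbf m=\mathbb Z_{\le p+1},\mathbb Z_{\le p-1}$ (independent of $I$; result in $\mathcal{BZ}_{\mathbb Z}$). **Affine type.** $\sigma$ is the shift $x\mapsto x+l$ on $\mathbb Z$, hence on (complementary) Maya diagrams, and $\sigma(\mathbf M)_{\mathbf k}=M_{\sigma^{-1}(\mathbf k)}$. $\mathcal{BZ}_{\mathbb Z}^\sigma$ and $(\mathcal{BZ}_{\mathbb Z}^e)^\sigma$ are the $\sigma$-fixed subsets; $\ast$ restricts to a bijection between them. On $\mathcal{BZ}_{\mathbb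 Z}^\sigma$, for $p\in\widehat I$: $\mathrm{wt}(\mathbf M)=\sum_{p\in\widehat I}\Theta(\mathbf M)_{\mathbb Z_{\le p}}\widehat\alpha_p$, $\widehat\varepsilon_p=\varepsilon_p$, $\widehat\varphi_p=\widehat\varepsilon_p+\langle\widehat h_p,\mathrm{wt}\rangle$; $\widehat e_p\mathbf M=0$ if $\widehat\varepsilon_p(\mathbf M)=0$, otherwise $(\widehat e_p\mathbf M)_{\mathbf k}=\bigl(\prod_{q\in L(\mathbf k,p)}\widetilde e_q\,\mathbf M\bigr)_{\mathbf k}$, and $(\widehat f_p\mathbf M)_{\mathbf k}=\bigl(\prod_{q\in L(\mathbf k,p)}\widetilde f_q\,\mathbf M\bigr)_{\mathbf k}$, where $L(\mathbf k,p)=\{q\in p+l\mathbb Z\mid q\in\mathbf k,\ q+1\notin\mathbf k\}$ (finite; factors commute). On $(\mathcal{BZ}_{\mathbb Z}^e)^\sigma$: $\mathrm{wt}(\mathbf M)=\mathrm{wt}(\mathbf M^* )$, $\widehat\varepsilon_p^*(\mathbf M)=\widehat\varepsilon_p(\mathbf M^* )$, $\widehat\varphi_p^*(\mathbf M)=\widehat\varepsilon_p^*(\mathbf M)+\langle\widehat h_p,\mathrm{wt}(\mathbf M)\rangle$, $\widehat e_p^*\mathbf M=(\widehat e_p(\mathbf M^* ))^*$, $\widehat f_p^*\mathbf M=(\widehat f_p(\mathbf M^* ))^*$ (with $0^*=0$). These are crystals of type $A_{l-1}^{(1)}$ [Naito–Sagaki–Saito]. $\mathbf O^*\in(\mathcal{BZ}_{\mathbb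 Z}^e)^\sigma$ is the family with all components $0$, and $(\mathcal{BZ}_{\mathbb Z}^e)^\sigma(\mathbf O^* )$ is the connected component of the crystal $(\mathcal{BZ}_{\mathbb Z}^e)^\sigma$ containing $\mathbf O^*$. For $\mathbf a\in\mathcal B_{l-1}^{(1),ap}$ one has $\Phi_{\mathbb Z}(\mathbf a)\in(\mathcal{BZ}_{\mathbb Z}^e)^\sigma$. *)

theory Defs
  imports "HOL-Library.Poly_Mapping"
begin

definition Ihat :: "nat \<Rightarrow> int set" where
  "Ihat l = {0..<int l}"

text \<open>The affine weight lattice is the free abelian group on the fundamental weights
  \<open>\<Lambda>\<^sub>p\<close> and the null root \<open>\<delta>\<close>; only the \<open>Fund p\<close> with \<open>p \<in> Ihat l\<close> matter.
  In this lattice the simple roots are linearly independent.\<close>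

datatype weight_gen = Fund int | Null

type_synonym weight = "weight_gen \<Rightarrow>\<^sub>0 int"

definition simple_root :: "nat \<Rightarrow> int \<Rightarrow> weight" where
  "simple_root l p =
     frag_cmul 2 (frag_of (Fund p))
     - frag_of (Fund ((p - 1) mod int l)) - frag_of (Fund ((p + 1) mod int l))
     + (if p = 0 then frag_of Null else 0)"

definition coroot_pairing :: "int \<Rightarrow> weight \<Rightarrow> int" where
  "coroot_pairing p w = Poly_Mapping.lookup w (Fund p)"

text \<open>\<open>None\<close> plays the role of the extra element 0. Kashiwara also allows the value
  \<open>-\<infinity>\<close> for \<open>eps\<close> and \<open>phi\<close>; it does not occur in the crystals considered here, so these
  functions are integer valued.\<close>

record 'b crystal =
  carrier :: "'b set"
  wt :: "'b \<Rightarrow> weight"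
  eps :: "int \<Rightarrow> 'b \<Rightarrow> int"
  phi :: "int \<Rightarrow> 'b \<Rightarrow> int"
  e_op :: "int \<Rightarrow> 'b \<Rightarrow> 'b option"
  f_op :: "int \<Rightarrow> 'b \<Rightarrow> 'b option"

definition is_crystal :: "nat \<Rightarrow> 'b crystal \<Rightarrow> bool" where
  "is_crystal l C \<longleftrightarrow> (\<forall>p\<in>Ihat l. \<forall>b\<in>carrier C.
     phi C p b = eps C p b + coroot_pairing p (wt C b) \<and>
     (\<forall>b'. e_op C p b = Some b' \<longrightarrow> b' \<in> carrier C \<and>
        wt C b' = wt C b + simple_root l p \<and>
        eps C p b' = eps C p b - 1 \<and> phi C p b' = phi C p b + 1) \<and>
     (\<forall>b'. f_op C p b = Some b' \<longrightarrow> b' \<in> carrier C \<and>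
        wt C b' = wt C b - simple_root l p \<and>
        eps C p b' = eps C p b + 1 \<and> phi C p b' = phi C p b - 1) \<and>
     (\<forall>b'\<in>carrier C. f_op C p b = Some b' \<longleftrightarrow> e_op C p b' = Some b))"

definition crystal_morphism ::
  "nat \<Rightarrow> 'b crystal \<Rightarrow> 'c crystal \<Rightarrow> ('b option \<Rightarrow> 'c option) \<Rightarrow> bool" where
  "crystal_morphism l C D \<psi> \<longleftrightarrow> \<psi> None = None \<and>
     (\<forall>b\<in>carrier C. \<forall>c. \<psi> (Some b) = Some c \<longrightarrow>
        c \<in> carrier D \<and> wt D c = wt C b \<and>
        (\<forall>p\<in>Ihat l. eps D p c = eps C p b \<and> phi D p c = phi C p b \<and>
           (\<psi> (e_op C p b) \<noteq> None \<longrightarrow> \<psi> (e_op C p b) = e_op D p c) \<and>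
           (\<psi> (f_op C p b) \<noteq> None \<longrightarrow> \<psi> (f_op C p b) = f_op D p c)))"

definition crystal_iso :: "nat \<Rightarrow> 'b crystal \<Rightarrow> 'c crystal \<Rightarrow> ('b \<Rightarrow> 'c) \<Rightarrow> bool" where
  "crystal_iso l C D F \<longleftrightarrow>
     is_crystal l C \<and> is_crystal l D \<and> bij_betw F (carrier C) (carrier D) \<and>
     crystal_morphism l C D (map_option F) \<and>
     crystal_morphism l D C (map_option (inv_into (carrier C) F))"

definition crystal_edges :: "nat \<Rightarrow> 'b crystal \<Rightarrow> ('b \<times> 'b) set" where
  "crystal_edges l C = {(b, b'). b \<in> carrier C \<and> b' \<in> carrier C \<and>
     (\<exists>p\<in>Ihat l. f_op C p b = Some b')}"

definition connected_component :: "nat \<Rightarrow> 'b crystal \<Rightarrow> 'b \<Rightarrow> 'b set" where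
  "connected_component l C x =
     {b \<in> carrier C. (x, b) \<in> (crystal_edges l C \<union> (crystal_edges l C)\<inverse>)\<^sup>*}"

text \<open>An interval $I = [n+1, n+m]$ is represented by the set itself, so that
  $n + 1$ is \<open>Min I\<close> and $n + m$ is \<open>Max I\<close>.\<close>

definition fin_intervals :: "int set set" where
  "fin_intervals = {{a..b} | a b. a \<le> b}"

definition tilde :: "int set \<Rightarrow> int set" where
  "tilde I = {Min I..Max I + 1}"

definition M_fin :: "int set \<Rightarrow> int set set" where
  "M_fin I = Pow (tilde I)"

definition M_fin_x :: "int set \<Rightarrow> int set set" where
  "M_fin_x I = M_fin I - {{}, tilde I}"

definition maya :: "int set set" where
  "maya = {k. \<exists>(r::int) (p::nat) (q::nat).
     {..r - int p} \<subseteq> k \<and> k \<subseteq> {..r + int q} \<and>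
     finite (k \<inter> {r - int p<..}) \<and> card (k \<inter> {r - int p<..}) = p}"

definition maya_c :: "int set set" where
  "maya_c = uminus ` maya"

definition maya_on :: "int set \<Rightarrow> int set set" where
  "maya_on I = (\<lambda>k. {..<Min I} \<union> k) ` M_fin_x I"

definition maya_c_on :: "int set \<Rightarrow> int set set" where
  "maya_c_on I = (\<lambda>k. k \<union> {Max I + 2..}) ` M_fin_x I"

definition res :: "int set \<Rightarrow> int set \<Rightarrow> int set" where
  "res I k = k \<inter> tilde I"

definition Omega :: "int set \<Rightarrow> int set \<Rightarrow> int set" where
  "Omega I k = {..<Min I} \<union> (tilde I - k)"

definition Omega_c :: "int set \<Rightarrow> int set \<Rightarrow> int set" where
  "Omega_c I k = (tilde I - k) \<union> {Max I + 2..}"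

text \<open>Families of integers indexed by a collection \<open>D\<close> of subsets of \<open>\<int>\<close> are represented by
  functions that vanish off \<open>D\<close>. For \<open>D = M_fin_x I\<close> this builds in the convention that
  the components at \<open>{}\<close> and \<open>tilde I\<close> are 0.\<close>

type_synonym family = "int set \<Rightarrow> int"

definition families :: "int set set \<Rightarrow> family set" where
  "families D = {M. \<forall>k. k \<notin> D \<longrightarrow> M k = 0}"

text \<open>Lusztig data are likewise extended by 0 to all pairs \<open>(i, j)\<close>.\<close>

type_synonym lusztig = "int \<Rightarrow> int \<Rightarrow> nat"

definition lusztig_Z :: "lusztig set" where
  "lusztig_Z = {a. (\<forall>i j. \<not> i < j \<longrightarrow> a i j = 0) \<and>
     (\<exists>N>0. \<forall>i j. i < j \<and> N \<le> j - i \<longrightarrow> a i j = 0)}"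

definition lusztig_aff :: "nat \<Rightarrow> lusztig set" where
  "lusztig_aff l = {a \<in> lusztig_Z. \<forall>i j. i < j \<longrightarrow> a i j = a (i + int l) (j + int l)}"

definition lusztig_ap :: "nat \<Rightarrow> lusztig set" where
  "lusztig_ap l = {a \<in> lusztig_aff l.
     \<forall>i j. i < j \<longrightarrow> (\<exists>s\<in>{0..<int l}. a (i + s) (j + s) = 0)}"

definition lusztig_restr :: "int set \<Rightarrow> lusztig \<Rightarrow> lusztig" where
  "lusztig_restr I a =
     (\<lambda>i j. if i < j \<and> i \<in> tilde I \<and> j \<in> tilde I then a i j else 0)"

text \<open>The summation ranges in \<open>A_star\<close> and \<open>r_coeff\<close> are cut down to the support, which is
  finite for elements of \<open>lusztig_Z\<close>.\<close>

definition A_star :: "int \<Rightarrow> lusztig \<Rightarrow> int \<Rightarrow> int" where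
  "A_star p a k =
     (\<Sum>t\<in>{t. k + 1 \<le> t \<and> (a p t \<noteq> 0 \<or> a (p + 1) (t + 1) \<noteq> 0)}.
        int (a p t) - int (a (p + 1) (t + 1)))"

definition eps_star :: "int \<Rightarrow> lusztig \<Rightarrow> int" where
  "eps_star p a = Max (A_star p a ` {p..})"

definition k_f :: "int \<Rightarrow> lusztig \<Rightarrow> int" where
  "k_f p a = (LEAST k. p \<le> k \<and> A_star p a k = eps_star p a)"

definition k_e :: "int \<Rightarrow> lusztig \<Rightarrow> int" where
  "k_e p a = (GREATEST k. p \<le> k \<and> A_star p a k = eps_star p a)"

definition f_star :: "int \<Rightarrow> lusztig \<Rightarrow> lusztig" where
  "f_star p a = (\<lambda>i j.
     if i = p \<and> j = k_f p a + 1 then a i j + 1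
     else if i = p + 1 \<and> j = k_f p a + 1 \<and> i < j then a i j - 1
     else a i j)"

definition e_star :: "int \<Rightarrow> lusztig \<Rightarrow> lusztig option" where
  "e_star p a = (if eps_star p a = 0 then None else Some (\<lambda>i j.
     if i = p \<and> j = k_e p a + 1 then a i j - 1
     else if i = p + 1 \<and> j = k_e p a + 1 \<and> i < j then a i j + 1
     else a i j))"

definition r_coeff :: "int \<Rightarrow> lusztig \<Rightarrow> nat" where
  "r_coeff p a = (\<Sum>(s, t)\<in>{(s, t). s \<le> p \<and> p + 1 \<le> t \<and> a s t \<noteq> 0}. a s t)"

definition wt_lusztig :: "nat \<Rightarrow> lusztig \<Rightarrow> weight" where
  "wt_lusztig l a = - (\<Sum>p\<in>Ihat l. frag_cmul (int (r_coeff p a)) (simple_root l p))"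

text \<open>The operator indexed by \<open>q\<close> reads and changes rows \<open>q\<close> and \<open>q + 1\<close> only. So in the
  infinite product over \<open>q \<in> p + l\<int>\<close> at most one factor (\<open>q = i\<close> or \<open>q = i - 1\<close>) affects
  row \<open>i\<close>.\<close>

definition f_hat_star :: "nat \<Rightarrow> int \<Rightarrow> lusztig \<Rightarrow> lusztig" where
  "f_hat_star l p a = (\<lambda>i j.
     if i mod int l = p mod int l then f_star i a i j
     else if (i - 1) mod int l = p mod int l then f_star (i - 1) a i j
     else a i j)"

definition e_hat_star :: "nat \<Rightarrow> int \<Rightarrow> lusztig \<Rightarrow> lusztig option" where
  "e_hat_star l p a = (if eps_star p a = 0 then None else Some (\<lambda>i j.
     if i mod int l = p mod int l then the (e_star i a) i j
     else if (i - 1) mod int l = p mod int l then the (e_star (i - 1) a) i j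
     else a i j))"

definition lusztig_crystal :: "nat \<Rightarrow> lusztig crystal" where
  "lusztig_crystal l =
     \<lparr> carrier = lusztig_ap l,
       wt = wt_lusztig l,
       eps = eps_star,
       phi = (\<lambda>p a. eps_star p a + coroot_pairing p (wt_lusztig l a)),
       e_op = e_hat_star l,
       f_op = (\<lambda>p a. Some (f_hat_star l p a)) \<rparr>"

text \<open>The elements of \<open>k\<close> are listed as $k_{n+1} < \dots < k_{n+u}$, and tableaux carry the same
  index range $[n+1, n+u]$.\<close>

definition idx_range :: "int set \<Rightarrow> int set \<Rightarrow> int set" where
  "idx_range I k = {Min I..Min I + int (card k) - 1}"

definition entry :: "int set \<Rightarrow> int set \<Rightarrow> int \<Rightarrow> int" where
  "entry I k p = sorted_list_of_set k ! nat (p - Min I)"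

text \<open>Entries of \<open>C\<close> outside the upper triangle over \<open>idx_range I k\<close> are irrelevant.\<close>

definition tableaux :: "int set \<Rightarrow> int set \<Rightarrow> (int \<Rightarrow> int \<Rightarrow> int) set" where
  "tableaux I k = {C.
     (\<forall>p\<in>idx_range I k. C p p = entry I k p) \<and>
     (\<forall>p\<in>idx_range I k. \<forall>q. p \<le> q \<and> q + 1 \<in> idx_range I k \<longrightarrow> C p q \<le> C p (q + 1)) \<and>
     (\<forall>p\<in>idx_range I k. \<forall>q\<in>idx_range I k. p < q \<longrightarrow> C p q < C (p + 1) q)}"

definition M_of_fin :: "int set \<Rightarrow> lusztig \<Rightarrow> int set \<Rightarrow> int" where
  "M_of_fin I a k =
     - (\<Sum>j\<in>idx_range I k. \<Sum>i\<in>{Min I..entry I k j - 1}. int (a i (entry I k j)))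
     + Min ((\<lambda>C. \<Sum>(p, q)\<in>{(p, q). p \<in> idx_range I k \<and> q \<in> idx_range I k \<and> p < q}.
               int (a (C p q) (C p q + (q - p)))) ` tableaux I k)"

definition Phi_Z :: "lusztig \<Rightarrow> family" where
  "Phi_Z a = (\<lambda>k. if k \<in> maya
     then (THE v. \<exists>I\<^sub>0\<in>fin_intervals. \<forall>I\<in>fin_intervals. I\<^sub>0 \<subseteq> I \<longrightarrow>
             k \<in> maya_on I \<and> M_of_fin I (lusztig_restr I a) (res I k) = v)
     else 0)"

definition bz_data :: "int set \<Rightarrow> family set" where
  "bz_data I = {M \<in> families (M_fin_x I).
     (\<forall>i\<in>tilde I. \<forall>j\<in>tilde I. \<forall>k\<in>M_fin I. i \<noteq> j \<and> k \<inter> {i, j} = {} \<longrightarrow>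
        M (k \<union> {i}) + M (k \<union> {j}) \<le> M (k \<union> {i, j}) + M k) \<and>
     (\<forall>h\<in>tilde I. \<forall>i\<in>tilde I. \<forall>j\<in>tilde I. \<forall>k\<in>M_fin I.
        h < i \<and> i < j \<and> k \<inter> {h, i, j} = {} \<longrightarrow>
        M (k \<union> {h, j}) + M (k \<union> {i}) =
          min (M (k \<union> {h, i}) + M (k \<union> {j})) (M (k \<union> {i, j}) + M (k \<union> {h})))}"

definition BZ_fin :: "int set \<Rightarrow> family set" where
  "BZ_fin I = {M \<in> bz_data I. \<forall>i\<in>I. M {i + 1..Max I + 1} = 0}"

definition BZe_fin :: "int set \<Rightarrow> family set" where
  "BZe_fin I = {M \<in> bz_data I. \<forall>i\<in>I. M {Min I..i} = 0}"

definition eps_fin :: "int set \<Rightarrow> int \<Rightarrow> family \<Rightarrow> int" where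
  "eps_fin I i M =
     - (M {Min I..i} + M ({Min I..i - 1} \<union> {i + 1}) - M {Min I..i - 1} - M {Min I..i + 1})"

definition f_fin :: "int set \<Rightarrow> int \<Rightarrow> family \<Rightarrow> family" where
  "f_fin I i M = (THE M'. M' \<in> BZ_fin I \<and>
     M' {Min I..i} = M {Min I..i} - 1 \<and>
     (\<forall>k\<in>M_fin_x I. \<not> (i \<in> k \<and> i + 1 \<notin> k) \<longrightarrow> M' k = M k))"

definition e_fin :: "int set \<Rightarrow> int \<Rightarrow> family \<Rightarrow> family option" where
  "e_fin I i M = (if eps_fin I i M = 0 then None else Some (THE M'. M' \<in> BZ_fin I \<and>
     M' {Min I..i} = M {Min I..i} + 1 \<and>
     (\<forall>k\<in>M_fin_x I. \<not> (i \<in> k \<and> i + 1 \<notin> k) \<longrightarrow> M' k = M k)))"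

text \<open>The two restrictions below re-index along the inverses of \<open>res\<close> on \<open>maya_c_on K\<close> and on
  \<open>maya_on K\<close> respectively.\<close>

definition restr_c :: "int set \<Rightarrow> family \<Rightarrow> family" where
  "restr_c K M = (\<lambda>k. if k \<in> M_fin_x K then M (k \<union> {Max K + 2..}) else 0)"

definition restr_e :: "int set \<Rightarrow> family \<Rightarrow> family" where
  "restr_e K M = (\<lambda>k. if k \<in> M_fin_x K then M ({..<Min K} \<union> k) else 0)"

definition Int_c :: "family \<Rightarrow> int set \<Rightarrow> int set set" where
  "Int_c M k = {I \<in> fin_intervals. k \<in> maya_c_on I \<and>
     (\<forall>J\<in>fin_intervals. I \<subseteq> J \<longrightarrow> M (Omega_c J k) = M (Omega_c I k))}"

definition Int_e :: "family \<Rightarrow> int set \<Rightarrow> int set set" where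
  "Int_e M k = {I \<in> fin_intervals. k \<in> maya_on I \<and>
     (\<forall>J\<in>fin_intervals. I \<subseteq> J \<longrightarrow> M (Omega J k) = M (Omega I k))}"

definition BZ_Z :: "family set" where
  "BZ_Z = {M \<in> families maya_c.
     (\<forall>K\<in>fin_intervals. restr_c K M \<in> BZ_fin K) \<and> (\<forall>k\<in>maya_c. Int_c M k \<noteq> {})}"

definition BZe_Z :: "family set" where
  "BZe_Z = {M \<in> families maya.
     (\<forall>K\<in>fin_intervals. restr_e K M \<in> BZe_fin K) \<and> (\<forall>k\<in>maya. Int_e M k \<noteq> {})}"

text \<open>This map is used in both directions, between families indexed by \<open>maya\<close> and by
  \<open>maya_c\<close>.\<close>

definition star :: "family \<Rightarrow> family" where
  "star M = (\<lambda>k. M (- k))"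

definition Theta :: "family \<Rightarrow> family" where
  "Theta M = (\<lambda>k. if k \<in> maya then M (Omega_c (SOME I. I \<in> Int_c M (- k)) (- k)) else 0)"

definition eps_Z :: "int \<Rightarrow> family \<Rightarrow> int" where
  "eps_Z p M = - (Theta M {..p} + Theta M ({..p - 1} \<union> {p + 1})
                  - Theta M {..p + 1} - Theta M {..p - 1})"

definition f_Z :: "int \<Rightarrow> family \<Rightarrow> family" where
  "f_Z p M = (\<lambda>k. if k \<in> maya_c
     then (let I = (SOME I. I \<in> fin_intervals \<and> k \<in> maya_c_on I \<and>
                      (\<forall>m\<in>{{..p}, {..p - 1} \<union> {p + 1}}. I \<in> Int_c M (- m)))
           in f_fin I p (restr_c I M) (res I k))
     else 0)"

definition e_Z :: "int \<Rightarrow> family \<Rightarrow> family option" where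
  "e_Z p M = (if eps_Z p M = 0 then None else Some (\<lambda>k. if k \<in> maya_c
     then (let I = (SOME I. I \<in> fin_intervals \<and> k \<in> maya_c_on I \<and>
                      (\<forall>m\<in>{{..p}, {..p - 1} \<union> {p + 1}, {..p + 1}, {..p - 1}}.
                         I \<in> Int_c M (- m)))
           in the (e_fin I p (restr_c I M)) (res I k))
     else 0))"

definition sigma :: "nat \<Rightarrow> family \<Rightarrow> family" where
  "sigma l M = (\<lambda>k. M ((\<lambda>x. x - int l) ` k))"

definition BZe_sigma :: "nat \<Rightarrow> family set" where
  "BZe_sigma l = {M \<in> BZe_Z. sigma l M = M}"

definition wt_BZ :: "nat \<Rightarrow> family \<Rightarrow> weight" where
  "wt_BZ l M = (\<Sum>p\<in>Ihat l. frag_cmul (Theta M {..p}) (simple_root l p))"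

definition L_set :: "nat \<Rightarrow> int set \<Rightarrow> int \<Rightarrow> int set" where
  "L_set l k p = {q. q mod int l = p mod int l \<and> q \<in> k \<and> q + 1 \<notin> k}"

text \<open>The products over the finite set \<open>L_set l k p\<close> are taken in increasing order of \<open>q\<close>; the
  factors commute.\<close>

definition f_hat :: "nat \<Rightarrow> int \<Rightarrow> family \<Rightarrow> family" where
  "f_hat l p M = (\<lambda>k. if k \<in> maya_c
     then fold f_Z (sorted_list_of_set (L_set l k p)) M k else 0)"

definition e_hat :: "nat \<Rightarrow> int \<Rightarrow> family \<Rightarrow> family option" where
  "e_hat l p M = (if eps_Z p M = 0 then None else Some (\<lambda>k. if k \<in> maya_c
     then the (fold (\<lambda>q x. Option.bind x (e_Z q))
                 (sorted_list_of_set (L_set l k p)) (Some M)) k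
     else 0))"

definition BZe_crystal :: "nat \<Rightarrow> family crystal" where
  "BZe_crystal l =
     \<lparr> carrier = BZe_sigma l,
       wt = (\<lambda>M. wt_BZ l (star M)),
       eps = (\<lambda>p M. eps_Z p (star M)),
       phi = (\<lambda>p M. eps_Z p (star M) + coroot_pairing p (wt_BZ l (star M))),
       e_op = (\<lambda>p M. map_option star (e_hat l p (star M))),
       f_op = (\<lambda>p M. Some (star (f_hat l p (star M)))) \<rparr>"

definition O_star :: family where
  "O_star = (\<lambda>k. 0)"

definition BZe_component :: "nat \<Rightarrow> family crystal" where
  "BZe_component l =
     (BZe_crystal l)\<lparr>carrier := connected_component l (BZe_crystal l) O_star\<rparr>"

end

theory Submission
  imports Defs
begin

text \<open>Read a tableau diagonal by diagonal as a system of particles: particle \<open>p\<close> sits at time \<open>t\<close> at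
  \<open>c\<^bsub>p,p+t\<^esub>\<close>, moves to the right, and pays \<open>a\<^bsub>x,x+t\<^esub>\<close> for being at \<open>x\<close> at time \<open>t\<close>; so \<open>M\<^bsub>k\<^esub>(a)\<close> is a
  minimal cost. The operator \<open>f\<^sup>*\<^sub>p\<close> changes just two of these prices, and rerouting one particle
  between \<open>p\<close> and \<open>p + 1\<close> shows that on the complements \<open>k\<close> with \<open>p \<in> k\<close>, \<open>p + 1 \<notin> k\<close> it
  replaces \<open>M\<^bsub>k\<^esub>\<close> by \<open>min(M\<^bsub>k\<^esub>, M\<^bsub>s k\<^esub> + c)\<close>, where \<open>s\<close> exchanges \<open>p\<close> and \<open>p + 1\<close>. This
  operation (the Anderson-Mirkovic formula) preserves the tropical Pluecker relations, hence by
  uniqueness it is Kamnitzer's \<open>f\<^sub>p\<close> once \<open>c\<close> is matched. All of \<open>\<Phi>\<close> is thereby obtained from the zero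
  datum by induction along \<open>f\<^sup>*\<close>. Aperiodicity supplies zero prices at which the particles
  below a gap can be parked, which yields the values of \<open>\<Theta>\<close>, and with them \<open>c\<close>, the weights and \<open>\<epsilon>\<^sup>*\<close>. The
  image is closed under \<open>e\<close> and \<open>f\<close> because \<open>f\<close> is injective on BZ data, so it is the whole component.\<close>

section \<open>Tropical Pluecker relations\<close>

text \<open>A nonzero periodic datum has infinite support, so it cannot be built from zero by
  finitely many single operators \<open>f_star\<close>. Two inductions replace this. The finite BZ
  conditions are local: a window of components reads finitely many entries, so the datum may be cut
  to finite support and dismantled by \<open>e_fun\<close>; aperiodicity plays no part there.
  Stabilization is not local and is carried along the affine operators, which reach every aperiodic
  datum from zero. The constant of the min-formula arises twice. On Lusztig data it is a maximal
  partial sum of price differences minus one (\<open>f_const\<close>); on BZ data it is what lowers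
  \<Theta> at the half-line ending in p by exactly one (\<open>Theta_const\<close>). Evaluating
  \<Phi> on sets with a long gap identifies the two; the gap must be long because the particles
  below it need room for parking. Infinite products are tamed by a finiteness: call q bad for k if q
  is in k and q + 1 is not. A component has finitely many bad positions, and only the factors at
  these act on it.\<close>

lemma five_index_polarization:
  fixes m12 m13 m14 m15 m23 m24 m25 m34 m35 m45 m123 m124 m125 m134 m135 m145 m234 m235 m245 m345 :: int
  assumes r1_234: "m124 + m13 = min (m123 + m14) (m134 + m12)"
    and r1_235: "m125 + m13 = min (m123 + m15) (m135 + m12)"
    and r1_245: "m125 + m14 = min (m124 + m15) (m145 + m12)"
    and r1_345: "m135 + m14 = min (m134 + m15) (m145 + m13)"
    and r2_134: "m124 + m23 = min (m123 + m24) (m234 + m12)"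
    and r2_135: "m125 + m23 = min (m123 + m25) (m235 + m12)"
    and r2_145: "m125 + m24 = min (m124 + m25) (m245 + m12)"
    and r2_345: "m235 + m24 = min (m234 + m25) (m245 + m23)"
    and r3_124: "m134 + m23 = min (m123 + m34) (m234 + m13)"
    and r3_125: "m135 + m23 = min (m123 + m35) (m235 + m13)"
    and r3_145: "m135 + m34 = min (m134 + m35) (m345 + m13)"
    and r3_245: "m235 + m34 = min (m234 + m35) (m345 + m23)"
    and r4_123: "m134 + m24 = min (m124 + m34) (m234 + m14)"
    and r4_125: "m145 + m24 = min (m124 + m45) (m245 + m14)"
    and r4_135: "m145 + m34 = min (m134 + m45) (m345 + m14)"
    and r4_235: "m245 + m34 = min (m234 + m45) (m345 + m24)"
    and r5_123: "m135 + m25 = min (m125 + m35) (m235 + m15)"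
    and r5_124: "m145 + m25 = min (m125 + m45) (m245 + m15)"
    and r5_134: "m145 + m35 = min (m135 + m45) (m345 + m15)"
    and r5_234: "m245 + m35 = min (m235 + m45) (m345 + m25)"
  shows "min (m135 + m24) (m235 + m14) =
      min (min (m134 + m25) (m234 + m15)) (min (m145 + m23) (m245 + m13))"
    and "min (m125 + m34) (m135 + m24) =
      min (min (m124 + m35) (m134 + m25)) (min (m245 + m13) (m345 + m12))"
    and "min (m135 + m24) (m145 + m23) =
      min (min (m123 + m45) (m124 + m35)) (min (m235 + m14) (m245 + m13))"
    and "min (m134 + m25) (m135 + m24) =
      min (min (m124 + m35) (m125 + m34)) (min (m234 + m15) (m235 + m14))"
proof -
  \<comment> \<open>A tropical identity does not follow from its classical counterpart, so each
    equality is split into linear inequalities: every term on the left dominates the minimum on the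
    right, and conversely. The cited relations are those whose branches decide the case.\<close>
  have g10: "m135 + m24 \<ge> min (min (m134 + m25) (m234 + m15)) (min (m145 + m23) (m245 + m13))"
    using r2_345 r3_145 r4_235 r5_134 r5_234 by (smt (verit, best))
  have g11: "m235 + m14 \<ge> min (min (m134 + m25) (m234 + m15)) (min (m145 + m23) (m245 + m13))"
    using r2_345 r4_123 r4_135 r4_235 by (smt (verit, best))
  have g12: "m134 + m25 \<ge> min (m135 + m24) (m235 + m14)"
    using r2_345 r3_145 r4_235 r5_234 by (smt (verit, best))
  have g13: "m234 + m15 \<ge> min (m135 + m24) (m235 + m14)"
    using r2_345 r5_123 by (smt (verit, best))
  have g14: "m145 + m23 \<ge> min (m135 + m24) (m235 + m14)"
    using r2_345 r5_123 r5_134 r5_234 by (smt (verit, best))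
  have g15: "m245 + m13 \<ge> min (m135 + m24) (m235 + m14)"
    using r2_345 r3_125 by (smt (verit, best))
  show "min (m135 + m24) (m235 + m14) =
      min (min (m134 + m25) (m234 + m15)) (min (m145 + m23) (m245 + m13))"
    using g10 g11 g12 g13 g14 g15 by (smt (verit, best))
  have g20: "m125 + m34 \<ge> min (min (m124 + m35) (m134 + m25)) (min (m245 + m13) (m345 + m12))"
    using r3_145 r5_123 r5_234 by (smt (verit, best))
  have g21: "m135 + m24 \<ge> min (min (m124 + m35) (m134 + m25)) (min (m245 + m13) (m345 + m12))"
    using r2_134 r2_345 r3_125 r3_145 r4_235 r5_234 by (smt (verit, best))
  have g22: "m124 + m35 \<ge> min (m125 + m34) (m135 + m24)"
    using r3_145 r4_123 by (smt (verit, best))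
  have g23: "m134 + m25 \<ge> min (m125 + m34) (m135 + m24)"
    using r2_345 r3_145 r4_235 r5_234 by (smt (verit, best))
  have g24: "m245 + m13 \<ge> min (m125 + m34) (m135 + m24)"
    using r2_345 r3_125 by (smt (verit, best))
  have g25: "m345 + m12 \<ge> min (m125 + m34) (m135 + m24)"
    using r2_145 r5_123 r5_234 by (smt (verit, best))
  show "min (m125 + m34) (m135 + m24) =
      min (min (m124 + m35) (m134 + m25)) (min (m245 + m13) (m345 + m12))"
    using g20 g21 g22 g23 g24 g25 by (smt (verit, best))
  have g30: "m135 + m24 \<ge> min (min (m123 + m45) (m124 + m35)) (min (m235 + m14) (m245 + m13))"
    using r3_145 r3_245 r4_123 r4_235 by (smt (verit, best))
  have g31: "m145 + m23 \<ge> min (min (m123 + m45) (m124 + m35)) (min (m235 + m14) (m245 + m13))"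
    using r3_125 r3_245 r4_125 r4_235 r5_123 r5_134 r5_234 by (smt (verit, best))
  have g32: "m123 + m45 \<ge> min (m135 + m24) (m145 + m23)"
    using r3_125 r5_134 by (smt (verit, best))
  have g33: "m124 + m35 \<ge> min (m135 + m24) (m145 + m23)"
    using r3_145 r4_123 by (smt (verit, best))
  have g34: "m235 + m14 \<ge> min (m135 + m24) (m145 + m23)"
    using r4_125 r5_123 r5_134 r5_234 by (smt (verit, best))
  have g35: "m245 + m13 \<ge> min (m135 + m24) (m145 + m23)"
    using r3_125 r3_245 r4_235 r5_134 by (smt (verit, best))
  show "min (m135 + m24) (m145 + m23) =
      min (min (m123 + m45) (m124 + m35)) (min (m235 + m14) (m245 + m13))"
    using g30 g31 g32 g33 g34 g35 by (smt (verit, best))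
  have g40: "m134 + m25 \<ge> min (min (m124 + m35) (m125 + m34)) (min (m234 + m15) (m235 + m14))"
    using r4_123 r4_135 r4_235 r5_124 r5_234 by (smt (verit, best))
  have g41: "m135 + m24 \<ge> min (min (m124 + m35) (m125 + m34)) (min (m234 + m15) (m235 + m14))"
    using r4_125 r4_235 r5_123 r5_134 r5_234 by (smt (verit, best))
  have g42: "m124 + m35 \<ge> min (m134 + m25) (m135 + m24)"
    using r4_123 r4_135 r4_235 r5_124 r5_134 by (smt (verit, best))
  have g43: "m125 + m34 \<ge> min (m134 + m25) (m135 + m24)"
    using r4_125 r4_135 r5_123 r5_134 r5_234 by (smt (verit, best))
  have g44: "m234 + m15 \<ge> min (m134 + m25) (m135 + m24)"
    using r4_123 r4_135 r4_235 r5_124 by (smt (verit, best))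
  have g45: "m235 + m14 \<ge> min (m134 + m25) (m135 + m24)"
    using r4_125 r5_123 r5_134 r5_234 by (smt (verit, best))
  show "min (m134 + m25) (m135 + m24) =
      min (min (m124 + m35) (m125 + m34)) (min (m234 + m15) (m235 + m14))"
    using g40 g41 g42 g43 g44 g45 by (smt (verit, best))
qed

section \<open>The BZ conditions as predicates, and their polarized forms\<close>

definition bz1 :: "int set \<Rightarrow> family \<Rightarrow> bool" where
  "bz1 T M \<longleftrightarrow> (\<forall>k i j. k \<subseteq> T \<longrightarrow> i \<in> T - k \<longrightarrow> j \<in> T - k \<longrightarrow> i \<noteq> j \<longrightarrow>
     M (insert i k) + M (insert j k) \<le> M (insert i (insert j k)) + M k)"

definition bz2 :: "int set \<Rightarrow> family \<Rightarrow> bool" where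
  "bz2 T M \<longleftrightarrow> (\<forall>k h i j. k \<subseteq> T \<longrightarrow> h \<in> T - k \<longrightarrow> i \<in> T - k \<longrightarrow> j \<in> T - k \<longrightarrow> h < i \<longrightarrow> i < j \<longrightarrow>
     M (insert h (insert j k)) + M (insert i k) =
       min (M (insert h (insert i k)) + M (insert j k)) (M (insert i (insert j k)) + M (insert h k)))"

lemma bz1D:
  "bz1 T M \<Longrightarrow> k \<subseteq> T \<Longrightarrow> i \<in> T - k \<Longrightarrow> j \<in> T - k \<Longrightarrow> i \<noteq> j \<Longrightarrow>
     M (insert i k) + M (insert j k) \<le> M (insert i (insert j k)) + M k"
  by (simp add: bz1_def)

lemma bz2D:
  "bz2 T M \<Longrightarrow> k \<subseteq> T \<Longrightarrow> h \<in> T - k \<Longrightarrow> i \<in> T - k \<Longrightarrow> j \<in> T - k \<Longrightarrow> h < i \<Longrightarrow> i < j \<Longrightarrow>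
     M (insert h (insert j k)) + M (insert i k) =
       min (M (insert h (insert i k)) + M (insert j k)) (M (insert i (insert j k)) + M (insert h k))"
  unfolding bz2_def by blast

lemma bz_data_iff:
  "M \<in> bz_data I \<longleftrightarrow> M \<in> families (M_fin_x I) \<and> bz1 (tilde I) M \<and> bz2 (tilde I) M"
proof -
  have 1: "(\<forall>i\<in>T. \<forall>j\<in>T. \<forall>k\<in>Pow T. i \<noteq> j \<and> k \<inter> {i, j} = {} \<longrightarrow>
        M (k \<union> {i}) + M (k \<union> {j}) \<le> M (k \<union> {i, j}) + M k) \<longleftrightarrow> bz1 T M" for T
    unfolding bz1_def by (simp add: Un_insert_right) blast
  have 2: "(\<forall>h\<in>T. \<forall>i\<in>T. \<forall>j\<in>T. \<forall>k\<in>Pow T.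
        h < i \<and> i < j \<and> k \<inter> {h, i, j} = {} \<longrightarrow>
        M (k \<union> {h, j}) + M (k \<union> {i}) =
          min (M (k \<union> {h, i}) + M (k \<union> {j})) (M (k \<union> {i, j}) + M (k \<union> {h}))) \<longleftrightarrow> bz2 T M" for T
    unfolding bz2_def by (simp add: Un_insert_right) blast
  show ?thesis unfolding bz_data_def M_fin_def by (simp only: mem_Collect_eq 1 2)
qed

text \<open>These are the mixed terms of BZ-1 for the min-formula: in each sum one set contains p
  and the other p + 1. They come from chaining BZ-1 with three-term relations; which ones depends on
  where h and j lie relative to the pair p, p + 1.\<close>

lemma bz1_polarized:
  assumes bz: "bz1 T M" "bz2 T M" and sub: "{p, p + 1, h, j} \<union> K \<subseteq> T"
    and dj: "K \<inter> {p, p + 1, h, j} = {}" and o: "h < j" "h \<notin> {p, p + 1}" "j \<notin> {p, p + 1}"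
  shows "min (M (insert p (insert h K)) + M (insert (p + 1) (insert j K)))
             (M (insert (p + 1) (insert h K)) + M (insert p (insert j K)))
         \<le> min (M (insert p (insert h (insert j K))) + M (insert (p + 1) K))
               (M (insert (p + 1) (insert h (insert j K))) + M (insert p K))"
proof -
  have R: "M (insert x (insert u (insert w K))) + M (insert x (insert v K)) =
      min (M (insert x (insert u (insert v K))) + M (insert x (insert w K)))
          (M (insert x (insert v (insert w K))) + M (insert x (insert u K)))"
    if "{x, u, v, w} \<subseteq> {p, p + 1, h, j}" "u < v" "v < w" "x \<notin> {u, v, w}" for x u v w
    using bz2D[OF bz(2), of "insert x K" u v w] sub dj that by (auto simp: insert_commute)
  have S: "M (insert x (insert u K)) + M (insert x (insert v K)) \<le>
      M (insert x (insert u (insert v K))) + M (insert x K)"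
    if "{x, u, v} \<subseteq> {p, p + 1, h, j}" "u < v" "x \<notin> {u, v}" for x u v
    using bz1D[OF bz(1), of "insert x K" u v] sub dj that by (auto simp: insert_commute)
  consider "p + 1 < h" | "h < p" "p + 1 < j" | "j < p" using o by fastforce
  then show ?thesis
  proof cases
    case 1
    then show ?thesis
      using R[of p "p + 1" h j] S[of "p + 1" p j] S[of p h j] R[of j p "p + 1" h] o
      apply (simp add: insert_commute) by (smt (verit, best))
  next
    case 2
    then show ?thesis
      using S[of "p + 1" h j] R[of j h p "p + 1"] S[of p h "p + 1"] S[of p "p + 1" j] R[of "p + 1" h p j] o
      apply (simp add: insert_commute) by (smt (verit, best))
  next
    case 3
    then show ?thesis
      using R[of p h j "p + 1"] S[of "p + 1" h p] S[of p h "p + 1"] R[of "p + 1" h j p] o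
      apply (simp add: insert_commute) by (smt (verit, best))
  qed
qed

text \<open>The mixed terms of the three-term relation when p is exchanged for p + 1 in some of the
  sets. The four equations are the four positions of an adjacent pair among the five indices; the
  other three indices carry the relation.\<close>

lemma bz2_polarized:
  assumes bz2: "bz2 T M" and sub: "{x1, x2, x3, x4, x5} \<union> K \<subseteq> T"
    and dj: "K \<inter> {x1, x2, x3, x4, x5} = {}"
    and o: "x1 < x2" "x2 < x3" "x3 < x4" "x4 < x5"
  shows "min (M (insert x1 (insert x3 (insert x5 (K)))) + M (insert x2 (insert x4 (K)))) (M (insert x2 (insert x3 (insert x5 (K)))) + M (insert x1 (insert x4 (K)))) =
      min (min (M (insert x1 (insert x3 (insert x4 (K)))) + M (insert x2 (insert x5 (K)))) (M (insert x2 (insert x3 (insert x4 (K)))) + M (insert x1 (insert x5 (K))))) (min (M (insert x1 (insert x4 (insert x5 (K)))) + M (insert x2 (insert x3 (K)))) (M (insert x2 (insert x4 (insert x5 (K)))) + M (insert x1 (insert x3 (K)))))"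
    and "min (M (insert x1 (insert x2 (insert x5 (K)))) + M (insert x3 (insert x4 (K)))) (M (insert x1 (insert x3 (insert x5 (K)))) + M (insert x2 (insert x4 (K)))) =
      min (min (M (insert x1 (insert x2 (insert x4 (K)))) + M (insert x3 (insert x5 (K)))) (M (insert x1 (insert x3 (insert x4 (K)))) + M (insert x2 (insert x5 (K))))) (min (M (insert x2 (insert x4 (insert x5 (K)))) + M (insert x1 (insert x3 (K)))) (M (insert x3 (insert x4 (insert x5 (K)))) + M (insert x1 (insert x2 (K)))))"
    and "min (M (insert x1 (insert x3 (insert x5 (K)))) + M (insert x2 (insert x4 (K)))) (M (insert x1 (insert x4 (insert x5 (K)))) + M (insert x2 (insert x3 (K)))) =
      min (min (M (insert x1 (insert x2 (insert x3 (K)))) + M (insert x4 (insert x5 (K)))) (M (insert x1 (insert x2 (insert x4 (K)))) + M (insert x3 (insert x5 (K))))) (min (M (insert x2 (insert x3 (insert x5 (K)))) + M (insert x1 (insert x4 (K)))) (M (insert x2 (insert x4 (insert x5 (K)))) + M (insert x1 (insert x3 (K)))))"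
    and "min (M (insert x1 (insert x3 (insert x4 (K)))) + M (insert x2 (insert x5 (K)))) (M (insert x1 (insert x3 (insert x5 (K)))) + M (insert x2 (insert x4 (K)))) =
      min (min (M (insert x1 (insert x2 (insert x4 (K)))) + M (insert x3 (insert x5 (K)))) (M (insert x1 (insert x2 (insert x5 (K)))) + M (insert x3 (insert x4 (K))))) (min (M (insert x2 (insert x3 (insert x4 (K)))) + M (insert x1 (insert x5 (K)))) (M (insert x2 (insert x3 (insert x5 (K)))) + M (insert x1 (insert x4 (K)))))"
proof -
  have R: "M (insert x (insert u (insert w K))) + M (insert x (insert v K)) =
      min (M (insert x (insert u (insert v K))) + M (insert x (insert w K)))
          (M (insert x (insert v (insert w K))) + M (insert x (insert u K)))"
    if "{x, u, v, w} \<subseteq> {x1, x2, x3, x4, x5}" "u < v" "v < w" "x \<notin> {u, v, w}" for x u v w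
    using bz2D[OF bz2, of "insert x K" u v w] sub dj that by (auto simp: insert_commute)
  have r1_234: "M (insert x1 (insert x2 (insert x4 (K)))) + M (insert x1 (insert x3 (K))) =
      min (M (insert x1 (insert x2 (insert x3 (K)))) + M (insert x1 (insert x4 (K)))) (M (insert x1 (insert x3 (insert x4 (K)))) + M (insert x1 (insert x2 (K))))"
    using R[of x1 x2 x3 x4] o by (simp add: insert_commute)
  have r1_235: "M (insert x1 (insert x2 (insert x5 (K)))) + M (insert x1 (insert x3 (K))) =
      min (M (insert x1 (insert x2 (insert x3 (K)))) + M (insert x1 (insert x5 (K)))) (M (insert x1 (insert x3 (insert x5 (K)))) + M (insert x1 (insert x2 (K))))"
    using R[of x1 x2 x3 x5] o by (simp add: insert_commute)
  have r1_245: "M (insert x1 (insert x2 (insert x5 (K)))) + M (insert x1 (insert x4 (K))) =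
      min (M (insert x1 (insert x2 (insert x4 (K)))) + M (insert x1 (insert x5 (K)))) (M (insert x1 (insert x4 (insert x5 (K)))) + M (insert x1 (insert x2 (K))))"
    using R[of x1 x2 x4 x5] o by (simp add: insert_commute)
  have r1_345: "M (insert x1 (insert x3 (insert x5 (K)))) + M (insert x1 (insert x4 (K))) =
      min (M (insert x1 (insert x3 (insert x4 (K)))) + M (insert x1 (insert x5 (K)))) (M (insert x1 (insert x4 (insert x5 (K)))) + M (insert x1 (insert x3 (K))))"
    using R[of x1 x3 x4 x5] o by (simp add: insert_commute)
  have r2_134: "M (insert x1 (insert x2 (insert x4 (K)))) + M (insert x2 (insert x3 (K))) =
      min (M (insert x1 (insert x2 (insert x3 (K)))) + M (insert x2 (insert x4 (K)))) (M (insert x2 (insert x3 (insert x4 (K)))) + M (insert x1 (insert x2 (K))))"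
    using R[of x2 x1 x3 x4] o by (simp add: insert_commute)
  have r2_135: "M (insert x1 (insert x2 (insert x5 (K)))) + M (insert x2 (insert x3 (K))) =
      min (M (insert x1 (insert x2 (insert x3 (K)))) + M (insert x2 (insert x5 (K)))) (M (insert x2 (insert x3 (insert x5 (K)))) + M (insert x1 (insert x2 (K))))"
    using R[of x2 x1 x3 x5] o by (simp add: insert_commute)
  have r2_145: "M (insert x1 (insert x2 (insert x5 (K)))) + M (insert x2 (insert x4 (K))) =
      min (M (insert x1 (insert x2 (insert x4 (K)))) + M (insert x2 (insert x5 (K)))) (M (insert x2 (insert x4 (insert x5 (K)))) + M (insert x1 (insert x2 (K))))"
    using R[of x2 x1 x4 x5] o by (simp add: insert_commute)
  have r2_345: "M (insert x2 (insert x3 (insert x5 (K)))) + M (insert x2 (insert x4 (K))) =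
      min (M (insert x2 (insert x3 (insert x4 (K)))) + M (insert x2 (insert x5 (K)))) (M (insert x2 (insert x4 (insert x5 (K)))) + M (insert x2 (insert x3 (K))))"
    using R[of x2 x3 x4 x5] o by (simp add: insert_commute)
  have r3_124: "M (insert x1 (insert x3 (insert x4 (K)))) + M (insert x2 (insert x3 (K))) =
      min (M (insert x1 (insert x2 (insert x3 (K)))) + M (insert x3 (insert x4 (K)))) (M (insert x2 (insert x3 (insert x4 (K)))) + M (insert x1 (insert x3 (K))))"
    using R[of x3 x1 x2 x4] o by (simp add: insert_commute)
  have r3_125: "M (insert x1 (insert x3 (insert x5 (K)))) + M (insert x2 (insert x3 (K))) =
      min (M (insert x1 (insert x2 (insert x3 (K)))) + M (insert x3 (insert x5 (K)))) (M (insert x2 (insert x3 (insert x5 (K)))) + M (insert x1 (insert x3 (K))))"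
    using R[of x3 x1 x2 x5] o by (simp add: insert_commute)
  have r3_145: "M (insert x1 (insert x3 (insert x5 (K)))) + M (insert x3 (insert x4 (K))) =
      min (M (insert x1 (insert x3 (insert x4 (K)))) + M (insert x3 (insert x5 (K)))) (M (insert x3 (insert x4 (insert x5 (K)))) + M (insert x1 (insert x3 (K))))"
    using R[of x3 x1 x4 x5] o by (simp add: insert_commute)
  have r3_245: "M (insert x2 (insert x3 (insert x5 (K)))) + M (insert x3 (insert x4 (K))) =
      min (M (insert x2 (insert x3 (insert x4 (K)))) + M (insert x3 (insert x5 (K)))) (M (insert x3 (insert x4 (insert x5 (K)))) + M (insert x2 (insert x3 (K))))"
    using R[of x3 x2 x4 x5] o by (simp add: insert_commute)
  have r4_123: "M (insert x1 (insert x3 (insert x4 (K)))) + M (insert x2 (insert x4 (K))) =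
      min (M (insert x1 (insert x2 (insert x4 (K)))) + M (insert x3 (insert x4 (K)))) (M (insert x2 (insert x3 (insert x4 (K)))) + M (insert x1 (insert x4 (K))))"
    using R[of x4 x1 x2 x3] o by (simp add: insert_commute)
  have r4_125: "M (insert x1 (insert x4 (insert x5 (K)))) + M (insert x2 (insert x4 (K))) =
      min (M (insert x1 (insert x2 (insert x4 (K)))) + M (insert x4 (insert x5 (K)))) (M (insert x2 (insert x4 (insert x5 (K)))) + M (insert x1 (insert x4 (K))))"
    using R[of x4 x1 x2 x5] o by (simp add: insert_commute)
  have r4_135: "M (insert x1 (insert x4 (insert x5 (K)))) + M (insert x3 (insert x4 (K))) =
      min (M (insert x1 (insert x3 (insert x4 (K)))) + M (insert x4 (insert x5 (K)))) (M (insert x3 (insert x4 (insert x5 (K)))) + M (insert x1 (insert x4 (K))))"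
    using R[of x4 x1 x3 x5] o by (simp add: insert_commute)
  have r4_235: "M (insert x2 (insert x4 (insert x5 (K)))) + M (insert x3 (insert x4 (K))) =
      min (M (insert x2 (insert x3 (insert x4 (K)))) + M (insert x4 (insert x5 (K)))) (M (insert x3 (insert x4 (insert x5 (K)))) + M (insert x2 (insert x4 (K))))"
    using R[of x4 x2 x3 x5] o by (simp add: insert_commute)
  have r5_123: "M (insert x1 (insert x3 (insert x5 (K)))) + M (insert x2 (insert x5 (K))) =
      min (M (insert x1 (insert x2 (insert x5 (K)))) + M (insert x3 (insert x5 (K)))) (M (insert x2 (insert x3 (insert x5 (K)))) + M (insert x1 (insert x5 (K))))"
    using R[of x5 x1 x2 x3] o by (simp add: insert_commute)
  have r5_124: "M (insert x1 (insert x4 (insert x5 (K)))) + M (insert x2 (insert x5 (K))) =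
      min (M (insert x1 (insert x2 (insert x5 (K)))) + M (insert x4 (insert x5 (K)))) (M (insert x2 (insert x4 (insert x5 (K)))) + M (insert x1 (insert x5 (K))))"
    using R[of x5 x1 x2 x4] o by (simp add: insert_commute)
  have r5_134: "M (insert x1 (insert x4 (insert x5 (K)))) + M (insert x3 (insert x5 (K))) =
      min (M (insert x1 (insert x3 (insert x5 (K)))) + M (insert x4 (insert x5 (K)))) (M (insert x3 (insert x4 (insert x5 (K)))) + M (insert x1 (insert x5 (K))))"
    using R[of x5 x1 x3 x4] o by (simp add: insert_commute)
  have r5_234: "M (insert x2 (insert x4 (insert x5 (K)))) + M (insert x3 (insert x5 (K))) =
      min (M (insert x2 (insert x3 (insert x5 (K)))) + M (insert x4 (insert x5 (K)))) (M (insert x3 (insert x4 (insert x5 (K)))) + M (insert x2 (insert x5 (K))))"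
    using R[of x5 x2 x3 x4] o by (simp add: insert_commute)
  note r = r1_234 r1_235 r1_245 r1_345 r2_134 r2_135 r2_145 r2_345 r3_124 r3_125 r3_145 r3_245 r4_123 r4_125 r4_135 r4_235 r5_123 r5_124 r5_134 r5_234
  show "min (M (insert x1 (insert x3 (insert x5 (K)))) + M (insert x2 (insert x4 (K)))) (M (insert x2 (insert x3 (insert x5 (K)))) + M (insert x1 (insert x4 (K)))) =
      min (min (M (insert x1 (insert x3 (insert x4 (K)))) + M (insert x2 (insert x5 (K)))) (M (insert x2 (insert x3 (insert x4 (K)))) + M (insert x1 (insert x5 (K))))) (min (M (insert x1 (insert x4 (insert x5 (K)))) + M (insert x2 (insert x3 (K)))) (M (insert x2 (insert x4 (insert x5 (K)))) + M (insert x1 (insert x3 (K)))))"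
    by (rule five_index_polarization(1)[OF r])
  show "min (M (insert x1 (insert x2 (insert x5 (K)))) + M (insert x3 (insert x4 (K)))) (M (insert x1 (insert x3 (insert x5 (K)))) + M (insert x2 (insert x4 (K)))) =
      min (min (M (insert x1 (insert x2 (insert x4 (K)))) + M (insert x3 (insert x5 (K)))) (M (insert x1 (insert x3 (insert x4 (K)))) + M (insert x2 (insert x5 (K))))) (min (M (insert x2 (insert x4 (insert x5 (K)))) + M (insert x1 (insert x3 (K)))) (M (insert x3 (insert x4 (insert x5 (K)))) + M (insert x1 (insert x2 (K)))))"
    by (rule five_index_polarization(2)[OF r])
  show "min (M (insert x1 (insert x3 (insert x5 (K)))) + M (insert x2 (insert x4 (K)))) (M (insert x1 (insert x4 (insert x5 (K)))) + M (insert x2 (insert x3 (K)))) =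
      min (min (M (insert x1 (insert x2 (insert x3 (K)))) + M (insert x4 (insert x5 (K)))) (M (insert x1 (insert x2 (insert x4 (K)))) + M (insert x3 (insert x5 (K))))) (min (M (insert x2 (insert x3 (insert x5 (K)))) + M (insert x1 (insert x4 (K)))) (M (insert x2 (insert x4 (insert x5 (K)))) + M (insert x1 (insert x3 (K)))))"
    by (rule five_index_polarization(3)[OF r])
  show "min (M (insert x1 (insert x3 (insert x4 (K)))) + M (insert x2 (insert x5 (K)))) (M (insert x1 (insert x3 (insert x5 (K)))) + M (insert x2 (insert x4 (K)))) =
      min (min (M (insert x1 (insert x2 (insert x4 (K)))) + M (insert x3 (insert x5 (K)))) (M (insert x1 (insert x2 (insert x5 (K)))) + M (insert x3 (insert x4 (K))))) (min (M (insert x2 (insert x3 (insert x4 (K)))) + M (insert x1 (insert x5 (K)))) (M (insert x2 (insert x3 (insert x5 (K)))) + M (insert x1 (insert x4 (K)))))"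
    by (rule five_index_polarization(4)[OF r])
qed

text \<open>\<open>min x (y + c)\<close> is a tropical linear polynomial in c, so the claim is
  quadratic in c. Its coefficients of degree 0 and 2 agree by the first two hypotheses, the
  coefficient of degree 1 by the third.\<close>

lemma min_polarize:
  fixes A1 :: int
  assumes 1: "A1 + B1 = min (C1 + D1) (E1 + F1)" and 2: "A2 + B2 = min (C2 + D2) (E2 + F2)"
    and 3: "min (A1 + B2) (A2 + B1) = min (min (C1 + D2) (C2 + D1)) (min (E1 + F2) (E2 + F1))"
  shows "min A1 (A2 + c) + min B1 (B2 + c) =
    min (min C1 (C2 + c) + min D1 (D2 + c)) (min E1 (E2 + c) + min F1 (F2 + c))"
proof -
  have d: "min x (y + c) + min z (w + c) = min (min (x + z) (y + w + 2 * c)) (min (x + w) (y + z) + c)"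
    for x y z w :: int by (smt (verit, best))
  have e: "min (min (min x y) (min z w)) (min u v) = min (min (min x z) u) (min (min y w) v)"
    for x y z w u v :: int
    by (auto intro!: antisym min.boundedI intro: min.coboundedI1 min.coboundedI2)
  show ?thesis
    unfolding d[of A1] d[of C1] d[of E1] 1 2 3
    unfolding min_add_distrib_left[of "C2 + D2"] min_add_distrib_left[of "min (C1 + D2) (C2 + D1)"]
    by (rule e)
qed

text \<open>The Anderson-Mirkovic formula for the lowering operator.\<close>

definition am :: "int \<Rightarrow> int \<Rightarrow> family \<Rightarrow> family" where
  "am p c M = (\<lambda>k. if p \<in> k \<and> p + 1 \<notin> k then min (M k) (M (insert (p + 1) (k - {p})) + c) else M k)"

lemma am_unbad: "\<not> (p \<in> k \<and> p + 1 \<notin> k) \<Longrightarrow> am p c M k = M k"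
  by (auto simp: am_def)

lemma am_insert:
  assumes "p \<notin> k"
  shows "am p c M (insert p k) = (if p + 1 \<in> k then M (insert p k)
           else min (M (insert p k)) (M (insert (p + 1) k) + c))"
  using assms by (simp add: am_def)

text \<open>The cases follow how the pair p, p + 1 meets h, i, j. If it misses the triple, either no
  set changes or all six do, and then the polarized relation is needed. If one member lies in the
  triple, a second three-term relation with the other member in its place is added; its order is the
  same because nothing lies between p and p + 1. If both lie in it, the relation itself
  suffices.\<close>

lemma bz2_am:
  assumes bz: "bz2 T M" and p: "p \<in> T" "p + 1 \<in> T"
  shows "bz2 T (am p c M)"
  unfolding bz2_def
proof (intro allI impI)
  fix k h i j
  assume k: "k \<subseteq> T" and m: "h \<in> T - k" "i \<in> T - k" "j \<in> T - k" and o: "h < i" "i < j"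
  note B = bz2D[OF bz, of _ h i j]
  let ?goal = "am p c M (insert h (insert j k)) + am p c M (insert i k) =
       min (am p c M (insert h (insert i k)) + am p c M (insert j k))
           (am p c M (insert i (insert j k)) + am p c M (insert h k))"
  consider (none) "p \<notin> {h, i, j}" "p + 1 \<notin> {h, i, j}" "\<not> (p \<in> k \<and> p + 1 \<notin> k)"
    | (quad) "p \<notin> {h, i, j}" "p + 1 \<notin> {h, i, j}" "p \<in> k" "p + 1 \<notin> k"
    | (fst) "p \<in> {h, i, j}" "p + 1 \<notin> {h, i, j}"
    | (snd) "p \<notin> {h, i, j}" "p + 1 \<in> {h, i, j}"
    | (lo) "p = h" "p + 1 = i" | (hi) "p = i" "p + 1 = j"
    using o by fastforce
  then show ?goal
  proof cases
    case none
    then have "am p c M (S \<union> k) = M (S \<union> k)" if "S \<subseteq> {h, i, j}" for S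
      using that by (intro am_unbad) auto
    from this[of "{h, j}"] this[of "{i}"] this[of "{h, i}"] this[of "{j}"] this[of "{i, j}"] this[of "{h}"]
    show ?thesis using B[of k] k m o by simp
  next
    case quad
    define K where "K = k - {p}"
    have kK: "k = insert p K" "p \<notin> K" "p + 1 \<notin> K" using quad by (auto simp: K_def)
    have am1: "am p c M (insert x k) = min (M (insert p (insert x K))) (M (insert (p + 1) (insert x K)) + c)"
      if "x \<in> {h, i, j}" for x
      using that quad kK am_insert[of p "insert x K" c M] by (auto simp: insert_commute)
    have am2: "am p c M (insert x (insert y k)) =
        min (M (insert p (insert x (insert y K)))) (M (insert (p + 1) (insert x (insert y K))) + c)"
      if "x \<in> {h, i, j}" "y \<in> {h, i, j}" for x y
      using that quad kK am_insert[of p "insert x (insert y K)" c M] by (auto simp: insert_commute)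
    have B1: "M (insert p (insert h (insert j K))) + M (insert p (insert i K)) =
       min (M (insert p (insert h (insert i K))) + M (insert p (insert j K)))
           (M (insert p (insert i (insert j K))) + M (insert p (insert h K)))"
      using B[of k] k m o kK by (simp add: insert_commute)
    have B2: "M (insert (p + 1) (insert h (insert j K))) + M (insert (p + 1) (insert i K)) =
       min (M (insert (p + 1) (insert h (insert i K))) + M (insert (p + 1) (insert j K)))
           (M (insert (p + 1) (insert i (insert j K))) + M (insert (p + 1) (insert h K)))"
      using B[of "insert (p + 1) K"] k m o kK quad p by (simp add: insert_commute)
    have sub: "{p, p + 1, h, i, j} \<union> K \<subseteq> T" "K \<inter> {p, p + 1, h, i, j} = {}"
      using k m p kK quad by auto
    have P: "min (M (insert p (insert h (insert j K))) + M (insert (p + 1) (insert i K)))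
                 (M (insert (p + 1) (insert h (insert j K))) + M (insert p (insert i K))) =
       min (min (M (insert p (insert h (insert i K))) + M (insert (p + 1) (insert j K)))
                (M (insert (p + 1) (insert h (insert i K))) + M (insert p (insert j K))))
           (min (M (insert p (insert i (insert j K))) + M (insert (p + 1) (insert h K)))
                (M (insert (p + 1) (insert i (insert j K))) + M (insert p (insert h K))))"
    proof -
      consider "p + 1 < h" | "h < p" "p + 1 < i" | "i < p" "p + 1 < j" | "j < p"
        using quad o by fastforce
      then show ?thesis
      proof cases
        case 1
        then show ?thesis using bz2_polarized(1)[OF bz, of p "p + 1" h i j K] sub o
          by (simp add: insert_commute)
      next
        case 2
        then show ?thesis using bz2_polarized(2)[OF bz, of h p "p + 1" i j K] sub o
          by (simp add: insert_commute)
      next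
        case 3
        then show ?thesis using bz2_polarized(3)[OF bz, of h i p "p + 1" j K] sub o
          by (simp add: insert_commute)
      next
        case 4
        then show ?thesis using bz2_polarized(4)[OF bz, of h i j p "p + 1" K] sub o
          by (simp add: insert_commute)
      qed
    qed
    show ?thesis
      using min_polarize[OF B1 B2 P, of c] by (simp add: am1 am2)
  next
    case fst
    show ?thesis
    proof (cases "p + 1 \<in> k")
      case True
      then have "am p c M (S \<union> k) = M (S \<union> k)" for S
        by (intro am_unbad) auto
      from this[of "{h, j}"] this[of "{i}"] this[of "{h, i}"] this[of "{j}"] this[of "{i, j}"] this[of "{h}"]
      show ?thesis using B[of k] k m o by simp
    next
      case False
      consider "p = h" "p + 1 < i" | "p = i" "h < p + 1" "p + 1 < j" | "p = j" "i < p + 1" using fst o by (smt (verit) insert_iff empty_iff)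
      then show ?thesis
      proof cases
        case 1
        have e0: "am p c M (insert h (insert j k)) = min (M (insert h (insert j k))) (M (insert (p + 1) (insert j k)) + c)"
          using 1 k m o fst False by (auto simp: am_def insert_commute insert_Diff_if)
        have e1: "am p c M (insert i k) = M (insert i k)"
          using 1 k m o fst False by (auto simp: am_def insert_commute insert_Diff_if)
        have e2: "am p c M (insert h (insert i k)) = min (M (insert h (insert i k))) (M (insert (p + 1) (insert i k)) + c)"
          using 1 k m o fst False by (auto simp: am_def insert_commute insert_Diff_if)
        have e3: "am p c M (insert j k) = M (insert j k)"
          using 1 k m o fst False by (auto simp: am_def insert_commute insert_Diff_if)
        have e4: "am p c M (insert i (insert j k)) = M (insert i (insert j k))"
          using 1 k m o fst False by (auto simp: am_def insert_commute insert_Diff_if)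
        have e5: "am p c M (insert h k) = min (M (insert h k)) (M (insert (p + 1) k) + c)"
          using 1 k m o fst False by (auto simp: am_def insert_commute insert_Diff_if)
        \<comment> \<open>The given relation with p + 1 in the place of h = p. The claim is the
          minimum of the given relation and this one shifted by c.\<close>
        have r: "M (insert (p + 1) (insert j k)) + M (insert i k) =
            min (M (insert (p + 1) (insert i k)) + M (insert j k))
              (M (insert i (insert j k)) + M (insert (p + 1) k))"
          using bz2D[OF bz, of k "p + 1" i j] 1 k m o p fst False by simp
        have "M (insert h (insert j k)) + M (insert i k) = min (M (insert h (insert i k)) + M (insert j k)) (M (insert i (insert j k)) + M (insert h k))"
          using B[of k] k m o by blast
        with r show ?thesis unfolding e0 e1 e2 e3 e4 e5 by linarith
      next
        case 2
        have e0: "am p c M (insert h (insert j k)) = M (insert h (insert j k))"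
          using 2 k m o fst False by (auto simp: am_def insert_commute insert_Diff_if)
        have e1: "am p c M (insert i k) = min (M (insert i k)) (M (insert (p + 1) k) + c)"
          using 2 k m o fst False by (auto simp: am_def insert_commute insert_Diff_if)
        have e2: "am p c M (insert h (insert i k)) = min (M (insert h (insert i k))) (M (insert h (insert (p + 1) k)) + c)"
          using 2 k m o fst False by (auto simp: am_def insert_commute insert_Diff_if)
        have e3: "am p c M (insert j k) = M (insert j k)"
          using 2 k m o fst False by (auto simp: am_def insert_commute insert_Diff_if)
        have e4: "am p c M (insert i (insert j k)) = min (M (insert i (insert j k))) (M (insert (p + 1) (insert j k)) + c)"
          using 2 k m o fst False by (auto simp: am_def insert_commute insert_Diff_if)
        have e5: "am p c M (insert h k) = M (insert h k)"
          using 2 k m o fst False by (auto simp: am_def insert_commute insert_Diff_if)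
        have r: "M (insert h (insert j k)) + M (insert (p + 1) k) =
            min (M (insert h (insert (p + 1) k)) + M (insert j k))
              (M (insert (p + 1) (insert j k)) + M (insert h k))"
          using bz2D[OF bz, of k h "p + 1" j] 2 k m o p fst False by simp
        have "M (insert h (insert j k)) + M (insert i k) = min (M (insert h (insert i k)) + M (insert j k)) (M (insert i (insert j k)) + M (insert h k))"
          using B[of k] k m o by blast
        with r show ?thesis unfolding e0 e1 e2 e3 e4 e5 by linarith
      next
        case 3
        have e0: "am p c M (insert h (insert j k)) = min (M (insert h (insert j k))) (M (insert h (insert (p + 1) k)) + c)"
          using 3 k m o fst False by (auto simp: am_def insert_commute insert_Diff_if)
        have e1: "am p c M (insert i k) = M (insert i k)"
          using 3 k m o fst False by (auto simp: am_def insert_commute insert_Diff_if)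
        have e2: "am p c M (insert h (insert i k)) = M (insert h (insert i k))"
          using 3 k m o fst False by (auto simp: am_def insert_commute insert_Diff_if)
        have e3: "am p c M (insert j k) = min (M (insert j k)) (M (insert (p + 1) k) + c)"
          using 3 k m o fst False by (auto simp: am_def insert_commute insert_Diff_if)
        have e4: "am p c M (insert i (insert j k)) = min (M (insert i (insert j k))) (M (insert i (insert (p + 1) k)) + c)"
          using 3 k m o fst False by (auto simp: am_def insert_commute insert_Diff_if)
        have e5: "am p c M (insert h k) = M (insert h k)"
          using 3 k m o fst False by (auto simp: am_def insert_commute insert_Diff_if)
        have r: "M (insert h (insert (p + 1) k)) + M (insert i k) =
            min (M (insert h (insert i k)) + M (insert (p + 1) k))
              (M (insert i (insert (p + 1) k)) + M (insert h k))"
          using bz2D[OF bz, of k h i "p + 1"] 3 k m o p fst False by simp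
        have "M (insert h (insert j k)) + M (insert i k) = min (M (insert h (insert i k)) + M (insert j k)) (M (insert i (insert j k)) + M (insert h k))"
          using B[of k] k m o by blast
        with r show ?thesis unfolding e0 e1 e2 e3 e4 e5 by linarith
      qed
    qed
  next
    case snd
    show ?thesis
    proof (cases "p \<in> k")
      case False
      then have "am p c M (S \<union> k) = M (S \<union> k)" if "S \<subseteq> {h, i, j}" for S
        using that snd by (intro am_unbad) auto
      from this[of "{h, j}"] this[of "{i}"] this[of "{h, i}"] this[of "{j}"] this[of "{i, j}"] this[of "{h}"]
      show ?thesis using B[of k] k m o by simp
    next
      case True
      \<comment> \<open>k with p moved to p + 1. Inserting p into it gives back the sets that
        contain both, so the second relation is the one over \<open>K\<close>.\<close>
      define K where "K = insert (p + 1) (k - {p})"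
      have K: "K \<subseteq> T" using k p by (auto simp: K_def)
      have pK: "insert p K = insert (p + 1) k" "insert p (insert x K) = insert (p + 1) (insert x k)"
        "insert x (insert p K) = insert x (insert (p + 1) k)" for x
        using True by (auto simp: K_def)
      have m': "h \<noteq> p + 1 \<Longrightarrow> h \<notin> K" "i \<noteq> p + 1 \<Longrightarrow> i \<notin> K" "j \<noteq> p + 1 \<Longrightarrow> j \<notin> K" "p \<notin> K"
        using m by (auto simp: K_def)
      consider "p + 1 = h" | "p + 1 = i" "h < p" | "p + 1 = j" "i < p" using snd o by (smt (verit) insert_iff empty_iff)
      then show ?thesis
      proof cases
        case 1
        have e0: "am p c M (insert h (insert j k)) = M (insert h (insert j k))"
          using 1 k m o snd True by (auto simp: am_def K_def insert_commute insert_Diff_if)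
        have e1: "am p c M (insert i k) = min (M (insert i k)) (M (insert i K) + c)"
          using 1 k m o snd True by (auto simp: am_def K_def insert_commute insert_Diff_if)
        have e2: "am p c M (insert h (insert i k)) = M (insert h (insert i k))"
          using 1 k m o snd True by (auto simp: am_def K_def insert_commute insert_Diff_if)
        have e3: "am p c M (insert j k) = min (M (insert j k)) (M (insert j K) + c)"
          using 1 k m o snd True by (auto simp: am_def K_def insert_commute insert_Diff_if)
        have e4: "am p c M (insert i (insert j k)) = min (M (insert i (insert j k))) (M (insert i (insert j K)) + c)"
          using 1 k m o snd True by (auto simp: am_def K_def insert_commute insert_Diff_if)
        have e5: "am p c M (insert h k) = M (insert h k)"
          using 1 k m o snd True by (auto simp: am_def K_def insert_commute insert_Diff_if)
        have r: "M (insert h (insert j k)) + M (insert i K) = min (M (insert h (insert i k)) + M (insert j K)) (M (insert i (insert j K)) + M (insert h k))"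
          using bz2D[OF bz K, of p i j] 1 m m' o p unfolding pK by simp
        have "M (insert h (insert j k)) + M (insert i k) = min (M (insert h (insert i k)) + M (insert j k)) (M (insert i (insert j k)) + M (insert h k))"
          using B[of k] k m o by blast
        with r show ?thesis unfolding e0 e1 e2 e3 e4 e5 by linarith
      next
        case 2
        have e0: "am p c M (insert h (insert j k)) = min (M (insert h (insert j k))) (M (insert h (insert j K)) + c)"
          using 2 k m o snd True by (auto simp: am_def K_def insert_commute insert_Diff_if)
        have e1: "am p c M (insert i k) = M (insert i k)"
          using 2 k m o snd True by (auto simp: am_def K_def insert_commute insert_Diff_if)
        have e2: "am p c M (insert h (insert i k)) = M (insert h (insert i k))"
          using 2 k m o snd True by (auto simp: am_def K_def insert_commute insert_Diff_if)
        have e3: "am p c M (insert j k) = min (M (insert j k)) (M (insert j K) + c)"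
          using 2 k m o snd True by (auto simp: am_def K_def insert_commute insert_Diff_if)
        have e4: "am p c M (insert i (insert j k)) = M (insert i (insert j k))"
          using 2 k m o snd True by (auto simp: am_def K_def insert_commute insert_Diff_if)
        have e5: "am p c M (insert h k) = min (M (insert h k)) (M (insert h K) + c)"
          using 2 k m o snd True by (auto simp: am_def K_def insert_commute insert_Diff_if)
        have r: "M (insert h (insert j K)) + M (insert i k) = min (M (insert h (insert i k)) + M (insert j K)) (M (insert i (insert j k)) + M (insert h K))"
          using bz2D[OF bz K, of h p j] 2 m m' o p unfolding pK by simp
        have "M (insert h (insert j k)) + M (insert i k) = min (M (insert h (insert i k)) + M (insert j k)) (M (insert i (insert j k)) + M (insert h k))"
          using B[of k] k m o by blast
        with r show ?thesis unfolding e0 e1 e2 e3 e4 e5 by linarith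
      next
        case 3
        have e0: "am p c M (insert h (insert j k)) = M (insert h (insert j k))"
          using 3 k m o snd True by (auto simp: am_def K_def insert_commute insert_Diff_if)
        have e1: "am p c M (insert i k) = min (M (insert i k)) (M (insert i K) + c)"
          using 3 k m o snd True by (auto simp: am_def K_def insert_commute insert_Diff_if)
        have e2: "am p c M (insert h (insert i k)) = min (M (insert h (insert i k))) (M (insert h (insert i K)) + c)"
          using 3 k m o snd True by (auto simp: am_def K_def insert_commute insert_Diff_if)
        have e3: "am p c M (insert j k) = M (insert j k)"
          using 3 k m o snd True by (auto simp: am_def K_def insert_commute insert_Diff_if)
        have e4: "am p c M (insert i (insert j k)) = M (insert i (insert j k))"
          using 3 k m o snd True by (auto simp: am_def K_def insert_commute insert_Diff_if)
        have e5: "am p c M (insert h k) = min (M (insert h k)) (M (insert h K) + c)"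
          using 3 k m o snd True by (auto simp: am_def K_def insert_commute insert_Diff_if)
        have r: "M (insert h (insert j k)) + M (insert i K) = min (M (insert h (insert i K)) + M (insert j k)) (M (insert i (insert j k)) + M (insert h K))"
          using bz2D[OF bz K, of h i p] 3 m m' o p unfolding pK by simp
        have "M (insert h (insert j k)) + M (insert i k) = min (M (insert h (insert i k)) + M (insert j k)) (M (insert i (insert j k)) + M (insert h k))"
          using B[of k] k m o by blast
        with r show ?thesis unfolding e0 e1 e2 e3 e4 e5 by linarith
      qed
    qed
  next
    case lo
    have e0: "am p c M (insert h (insert j k)) = min (M (insert h (insert j k))) (M (insert i (insert j k)) + c)"
      using lo k m o by (auto simp: am_def insert_commute insert_Diff_if)
    have e1: "am p c M (insert i k) = M (insert i k)"
      using lo k m o by (auto simp: am_def insert_commute insert_Diff_if)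
    have e2: "am p c M (insert h (insert i k)) = M (insert h (insert i k))"
      using lo k m o by (auto simp: am_def insert_commute insert_Diff_if)
    have e3: "am p c M (insert j k) = M (insert j k)"
      using lo k m o by (auto simp: am_def insert_commute insert_Diff_if)
    have e4: "am p c M (insert i (insert j k)) = M (insert i (insert j k))"
      using lo k m o by (auto simp: am_def insert_commute insert_Diff_if)
    have e5: "am p c M (insert h k) = min (M (insert h k)) (M (insert i k) + c)"
      using lo k m o by (auto simp: am_def insert_commute insert_Diff_if)
    have "M (insert h (insert j k)) + M (insert i k) = min (M (insert h (insert i k)) + M (insert j k)) (M (insert i (insert j k)) + M (insert h k))"
      using B[of k] k m o by blast
    then show ?thesis unfolding e0 e1 e2 e3 e4 e5 by linarith
  next
    case hi
    have e0: "am p c M (insert h (insert j k)) = M (insert h (insert j k))"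
      using hi k m o by (auto simp: am_def insert_commute insert_Diff_if)
    have e1: "am p c M (insert i k) = min (M (insert i k)) (M (insert j k) + c)"
      using hi k m o by (auto simp: am_def insert_commute insert_Diff_if)
    have e2: "am p c M (insert h (insert i k)) = min (M (insert h (insert i k))) (M (insert h (insert j k)) + c)"
      using hi k m o by (auto simp: am_def insert_commute insert_Diff_if)
    have e3: "am p c M (insert j k) = M (insert j k)"
      using hi k m o by (auto simp: am_def insert_commute insert_Diff_if)
    have e4: "am p c M (insert i (insert j k)) = M (insert i (insert j k))"
      using hi k m o by (auto simp: am_def insert_commute insert_Diff_if)
    have e5: "am p c M (insert h k) = M (insert h k)"
      using hi k m o by (auto simp: am_def insert_commute insert_Diff_if)
    have "M (insert h (insert j k)) + M (insert i k) = min (M (insert h (insert i k)) + M (insert j k)) (M (insert i (insert j k)) + M (insert h k))"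
      using B[of k] k m o by blast
    then show ?thesis unfolding e0 e1 e2 e3 e4 e5 by linarith
  qed
qed

text \<open>Same case distinction as for the three-term relation. BZ-2 enters only when neither i
  nor j lies in the pair p, p + 1, through the polarized inequality.\<close>

lemma bz1_am:
  assumes bz: "bz1 T M" "bz2 T M" and p: "p \<in> T" "p + 1 \<in> T"
  shows "bz1 T (am p c M)"
proof -
  have main: "am p c M (insert i k) + am p c M (insert j k) \<le> am p c M (insert i (insert j k)) + am p c M k"
    if k: "k \<subseteq> T" and m: "i \<in> T - k" "j \<in> T - k" and o: "i < j" for k i j
  proof -
    have B: "M (insert i K) + M (insert j K) \<le> M (insert i (insert j K)) + M K"
      if "K \<subseteq> T" "i \<in> T - K" "j \<in> T - K" "i < j" for K i j
      using bz1D[OF bz(1)] that by simp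
    consider (both) "i = p" "j = p + 1" | (p) "p \<in> {i, j}" "p + 1 \<notin> {i, j}" | (q) "p \<notin> {i, j}" "p + 1 \<in> {i, j}"
      | (none) "p \<notin> {i, j}" "p + 1 \<notin> {i, j}" using o by force
    then show ?thesis
    proof cases
      case both
      then show ?thesis using B[OF k m o] m am_insert[of p k c M] am_unbad[of p "insert (p + 1) k" c M]
          am_unbad[of p k c M] am_unbad[of p "insert p (insert (p + 1) k)" c M] by simp
    next
      case p
      define q where "q = (if p = i then j else i)"
      have q: "{i, j} = {p, q}" "q \<noteq> p" "q \<noteq> p + 1" "q \<in> T - k" "p \<in> T - k" using p m o by (auto simp: q_def)
      have "am p c M (insert p k) + am p c M (insert q k) \<le> am p c M (insert p (insert q k)) + am p c M k"
        using bz1D[OF bz(1) k, of p q] bz1D[OF bz(1) k, of "p + 1" q] q assms(3,4)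
          am_insert[of p k c M] am_insert[of p "insert q k" c M] am_unbad[of p k c M] am_unbad[of p "insert q k" c M]
        by (cases "p + 1 \<in> k") auto
      then show ?thesis using p o by (auto simp: q_def insert_commute add.commute split: if_splits)
    next
      case q
      define r where "r = (if p + 1 = i then j else i)"
      define K where "K = k - {p}"
      have r: "{i, j} = {p + 1, r}" "r \<noteq> p" "r \<noteq> p + 1" "r \<in> T - k" "p + 1 \<in> T - k" using q m o by (auto simp: r_def)
      have "am p c M (insert (p + 1) k) + am p c M (insert r k) \<le> am p c M (insert (p + 1) (insert r k)) + am p c M k"
      proof (cases "p \<in> k")
        case False
        then show ?thesis using bz1D[OF bz(1) k, of "p + 1" r] r by (simp add: am_unbad)
      next
        case True
        then have k': "k = insert p K" "p \<notin> K" by (auto simp: K_def)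
        show ?thesis
          using bz1D[OF bz(1) k, of "p + 1" r] bz1D[OF bz(1), of "insert (p + 1) K" p r] r assms(3,4) k k'
            am_insert[of p K c M] am_insert[of p "insert r K" c M] am_unbad[of p "insert (p + 1) k" c M]
            am_unbad[of p "insert (p + 1) (insert r k)" c M]
          by (auto simp: insert_commute)
      qed
      then show ?thesis using q o by (auto simp: r_def insert_commute add.commute split: if_splits)
    next
      case none
      show ?thesis
      proof (cases "p \<in> k \<and> p + 1 \<notin> k")
        case False
        then show ?thesis using B[OF k m o] none by (simp add: am_unbad)
      next
        case True
        define K where "K = k - {p}"
        have kK: "k = insert p K" "p \<notin> K" "p + 1 \<notin> K" using True by (auto simp: K_def)
        show ?thesis
          using bz1_polarized[OF bz, of p i j K] B[OF k m o] B[of "insert (p + 1) K" i j] True kK k m o none p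
            am_insert[of p K c M] am_insert[of p "insert i K" c M] am_insert[of p "insert j K" c M]
            am_insert[of p "insert i (insert j K)" c M]
          by (simp add: insert_commute) linarith
      qed
    qed
  qed
  show ?thesis
    unfolding bz1_def
  proof (intro allI impI)
    fix k i j assume "k \<subseteq> T" "i \<in> T - k" "j \<in> T - k" "i \<noteq> j"
    then show "am p c M (insert i k) + am p c M (insert j k) \<le> am p c M (insert i (insert j k)) + am p c M k"
      using main[of k i j] main[of k j i] by (cases "i < j") (auto simp: insert_commute)
  qed
qed

text \<open>A three-term relation on h, q, q + 1 or on q, q + 1, j can be solved for the component
  at k: every other term either has fewer bad positions in Q or is closer to the initial segment
  \<open>{A..q}\<close>. A singleton Q gives Kamnitzer's uniqueness; a residue class is what
  injectivity of the affine f requires.\<close>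

lemma bz2_determined:
  assumes bz: "bz2 {A..B} M" "bz2 {A..B} M'"
    and Q: "Q \<subseteq> {A..<B}" "\<And>q. q \<in> Q \<Longrightarrow> q + 1 \<notin> Q"
    and good: "\<And>k. k \<subseteq> {A..B} \<Longrightarrow> {q \<in> Q. q \<in> k \<and> q + 1 \<notin> k} = {} \<Longrightarrow> M k = M' k"
    and base: "\<And>q. q \<in> Q0 \<Longrightarrow> M {A..q} = M' {A..q}"
    and k: "k \<subseteq> {A..B}" "{q \<in> Q. q \<in> k \<and> q + 1 \<notin> k} \<subseteq> Q0"
  shows "M k = M' k"
proof -
  define Bd where "Bd k = {q \<in> Q. q \<in> k \<and> q + 1 \<notin> k}" for k
  have finBd: "finite (Bd k)" for k
    using finite_subset[OF Q(1)] by (simp add: Bd_def)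
  \<comment> \<open>The places where k differs from \<open>{A..q}\<close> for its least bad position
    q. Their number is the second component of the termination measure.\<close>
  define ds where "ds k = {x \<in> {A..<Min (Bd k)}. x \<notin> k} \<union> {x \<in> {Min (Bd k) + 2..B}. x \<in> k}" for k
  define d where "d k = card (ds k)" for k
  have findS: "finite (ds k)" for k
    by (rule finite_subset[of _ "{A..<Min (Bd k)} \<union> {Min (Bd k) + 2..B}"]) (auto simp: ds_def)
  have "\<lbrakk>k \<subseteq> {A..B}; Bd k \<subseteq> Q0\<rbrakk> \<Longrightarrow> M k = M' k"
  proof (induction k rule: wf_induct_rule[OF wf_measures[of "[\<lambda>k. card (Bd k), d]"]])
    case (1 k)
    show ?case
    proof (cases "Bd k = {}")
      case True
      then show ?thesis using good[OF 1(2)] by (simp add: Bd_def)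
    next
      case False
      define q where "q = Min (Bd k)"
      have qB: "q \<in> Bd k" using Min_in[OF finBd False] by (simp add: q_def)
      then have q: "q \<in> Q" "q \<in> k" "q + 1 \<notin> k" "A \<le> q" "q < B" "q \<in> Q0"
        using Q 1(3) by (auto simp: Bd_def)
      have adj: "q + 1 \<notin> Q" "q - 1 \<notin> Q" using Q(2)[of q] Q(2)[of "q - 1"] q by auto
      have outer: "M k' = M' k'" if "k' \<subseteq> {A..B}" "Bd k' \<subseteq> Bd k - {q}" for k'
      proof (rule 1(1))
        have "Bd k' \<subset> Bd k" using that qB by auto
        then have "card (Bd k') < card (Bd k)" using finBd psubset_card_mono by blast
        then show "(k', k) \<in> measures [\<lambda>k. card (Bd k), d]" by simp
        show "k' \<subseteq> {A..B}" "Bd k' \<subseteq> Q0" using that 1(3) by auto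
      qed
      have inner: "M k' = M' k'" if "k' \<subseteq> {A..B}" "Bd k' \<subseteq> Bd k" "Min (Bd k') = q" "ds k' \<subset> ds k" for k'
      proof (rule 1(1))
        have "d k' < d k" unfolding d_def using that findS psubset_card_mono by blast
        moreover have "card (Bd k') \<le> card (Bd k)" using that finBd card_mono by blast
        ultimately show "(k', k) \<in> measures [\<lambda>k. card (Bd k), d]" by auto
        show "k' \<subseteq> {A..B}" "Bd k' \<subseteq> Q0" using that 1(3) by auto
      qed
      have minq: "Min (Bd k') = q" if "Bd k' \<subseteq> Bd k" "q \<in> Bd k'" for k'
        using that Min_antimono[of "Bd k'" "Bd k"] finBd Min_le[of "Bd k'" q] unfolding q_def
        by (metis emptyE order_antisym)
      consider (h) "\<exists>h\<in>{A..<q}. h \<notin> k" | (j) "\<exists>j\<in>{q + 2..B}. j \<in> k"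
        | (b) "{A..<q} \<subseteq> k" "k \<inter> {q + 2..B} = {}" by auto
      then show ?thesis
      proof cases
        case b
        have "k = {A..q}"
        proof
          show "k \<subseteq> {A..q}"
          proof
            fix x assume x: "x \<in> k"
            then have "x \<noteq> q + 1" "x \<notin> {q + 2..B}" "x \<in> {A..B}" using b q 1(2) by auto
            then show "x \<in> {A..q}" by auto
          qed
          show "{A..q} \<subseteq> k"
          proof
            fix x assume "x \<in> {A..q}"
            then show "x \<in> k" using b(1) q by (cases "x = q") auto
          qed
        qed
        then show ?thesis using base q by simp
      next
        case h
        \<comment> \<open>The highest gap below q. Since h + 1 is in k, filling it creates no bad
          position; if h + 1 = q, the sets from which q is removed are safe because Q contains no
          two neighbours.\<close>
        define h where "h = Max {x \<in> {A..<q}. x \<notin> k}"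
        have fh: "finite {x \<in> {A..<q}. x \<notin> k}" by (rule finite_subset[of _ "{A..<q}"]) auto
        have "h \<in> {x \<in> {A..<q}. x \<notin> k}" unfolding h_def by (rule Max_in[OF fh]) (use h in auto)
        then have h1: "A \<le> h" "h < q" "h \<notin> k" by auto
        have h2: "x \<in> k" if "h < x" "x < q" for x
        proof (rule ccontr)
          assume "x \<notin> k"
          then have "x \<le> h" unfolding h_def by (intro Max_ge[OF fh]) (use that h1 in auto)
          then show False using that by simp
        qed
        have h3: "h + 1 \<in> k" using h2[of "h + 1"] h1 q by (cases "h + 1 = q") auto
        have hQ: "h + 1 \<noteq> q \<or> h \<notin> Q" using adj by auto
        define K where "K = k - {q}"
        have kK: "k = insert q K" using q by (auto simp: K_def)
        have rel: "N (insert h (insert (q + 1) K)) + N k =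
            min (N (insert h k) + N (insert (q + 1) K)) (N (insert (q + 1) k) + N (insert h K))"
          if "bz2 {A..B} N" for N
        proof -
          have "K \<subseteq> {A..B}" "h \<notin> K" "q \<notin> K" "q + 1 \<notin> K" using 1(2) h1 q by (auto simp: K_def)
          then show ?thesis unfolding kK
            using bz2D[OF that, of K h q "q + 1"] h1 q by (simp add: insert_commute)
        qed
        have sub: "insert h (insert (q + 1) k) \<subseteq> {A..B}" "K \<subseteq> k" using 1(2) h1 q by (auto simp: K_def)
        have e: "M (insert h (insert (q + 1) K)) = M' (insert h (insert (q + 1) K))"
          "M (insert (q + 1) K) = M' (insert (q + 1) K)" "M (insert (q + 1) k) = M' (insert (q + 1) k)"
          "M (insert h K) = M' (insert h K)"
          using h3 hQ adj sub by (intro outer; auto simp: Bd_def K_def)+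
        have B': "Bd (insert h k) \<subseteq> Bd k" "q \<in> Bd (insert h k)" using h3 q h1 by (auto simp: Bd_def)
        have "ds (insert h k) \<subset> ds k"
        proof
          show "ds (insert h k) \<subseteq> ds k" unfolding ds_def minq[OF B'] using h1 by (auto simp: q_def)
          have "h \<in> ds k" "h \<notin> ds (insert h k)" unfolding ds_def minq[OF B'] using h1 by (auto simp: q_def)
          then show "ds (insert h k) \<noteq> ds k" by auto
        qed
        then have "M (insert h k) = M' (insert h k)"
          using B' minq[OF B'] sub by (intro inner) auto
        then show ?thesis using rel[OF bz(1)] rel[OF bz(2)] e by simp
      next
        case j
        \<comment> \<open>The least element above q + 1. Its left neighbour is not in k, so removing
          it creates no bad position.\<close>
        define j where "j = Min {x \<in> {q + 2..B}. x \<in> k}"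
        have fj: "finite {x \<in> {q + 2..B}. x \<in> k}" by (rule finite_subset[of _ "{q + 2..B}"]) auto
        have "j \<in> {x \<in> {q + 2..B}. x \<in> k}" unfolding j_def by (rule Min_in[OF fj]) (use j in auto)
        then have j1: "j \<le> B" "q + 2 \<le> j" "j \<in> k" by auto
        have j2: "x \<notin> k" if "q < x" "x < j" for x
        proof
          assume "x \<in> k"
          moreover have "x \<noteq> q + 1" using \<open>x \<in> k\<close> q by auto
          ultimately have "j \<le> x" unfolding j_def by (intro Min_le[OF fj]) (use that j1 in auto)
          then show False using that by simp
        qed
        have j3: "j - 1 \<notin> k" using j2[of "j - 1"] j1 by auto
        define K where "K = k - {q, j}"
        have kK: "k = insert q (insert j K)" "k - {j} = insert q K" "k - {q} = insert j K" using q j1 by (auto simp: K_def)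
        have rel: "N k + N (insert (q + 1) K) =
            min (N (insert q (insert (q + 1) K)) + N (k - {q})) (N (insert (q + 1) (insert j K)) + N (k - {j}))"
          if "bz2 {A..B} N" for N
        proof -
          have "K \<subseteq> {A..B}" "j \<notin> K" "q \<notin> K" "q + 1 \<notin> K" using 1(2) j1 q by (auto simp: K_def)
          then show ?thesis unfolding kK(2,3) unfolding kK(1)
            using bz2D[OF that, of K q "q + 1" j] j1 q by simp
        qed
        have sub: "insert (q + 1) k \<subseteq> {A..B}" "K \<subseteq> k" using 1(2) q by (auto simp: K_def)
        have jj: "x \<noteq> j - 1" if "x \<in> k" for x using that j3 by auto
        have e: "M (insert (q + 1) K) = M' (insert (q + 1) K)"
          "M (insert q (insert (q + 1) K)) = M' (insert q (insert (q + 1) K))" "M (k - {q}) = M' (k - {q})"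
          "M (insert (q + 1) (insert j K)) = M' (insert (q + 1) (insert j K))"
          using adj sub j1 q by (intro outer; auto simp: Bd_def K_def dest: jj)+
        have B': "Bd (k - {j}) \<subseteq> Bd k" "q \<in> Bd (k - {j})" using q j1 by (auto simp: Bd_def dest: jj)
        have "ds (k - {j}) \<subset> ds k"
        proof
          show "ds (k - {j}) \<subseteq> ds k" unfolding ds_def minq[OF B'] using j1 by (auto simp: q_def)
          have "j \<in> ds k" "j \<notin> ds (k - {j})" unfolding ds_def minq[OF B'] using j1 by (auto simp: q_def)
          then show "ds (k - {j}) \<noteq> ds k" by auto
        qed
        then have "M (k - {j}) = M' (k - {j})"
          using B' minq[OF B'] sub by (intro inner) auto
        then show ?thesis using rel[OF bz(1)] rel[OF bz(2)] e by simp
      qed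
    qed
  qed
  then show ?thesis using k by (simp add: Bd_def)
qed

section \<open>Kamnitzer's operators on a finite interval\<close>

lemma fin_intervalsE:
  assumes "I \<in> fin_intervals"
  obtains a b where "I = {a..b}" "a \<le> b" "Min I = a" "Max I = b" "tilde I = {a..b + 1}"
proof -
  obtain a b where "I = {a..b}" "a \<le> b" using assms by (auto simp: fin_intervals_def)
  moreover from this have "Min I = a" "Max I = b" by (auto intro: Min_eqI Max_eqI)
  ultimately show ?thesis using that by (simp add: tilde_def)
qed

text \<open>Families vanish off their index set, but for negative c the formula \<open>am\<close>
  can produce nonzero values there; hence the restriction to D.\<close>

definition am_on :: "int set set \<Rightarrow> int \<Rightarrow> int \<Rightarrow> family \<Rightarrow> family" where
  "am_on D p c M = (\<lambda>k. if k \<in> D then am p c M k else M k)"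

lemma am_on_unbad: "\<not> (p \<in> k \<and> p + 1 \<notin> k) \<Longrightarrow> am_on D p c M k = M k"
  by (simp add: am_on_def am_unbad)

lemma bz1_cong: "(\<And>k. k \<subseteq> T \<Longrightarrow> M k = M' k) \<Longrightarrow> bz1 T M = bz1 T M'"
  by (auto simp: bz1_def)

lemma bz2_cong: "(\<And>k. k \<subseteq> T \<Longrightarrow> M k = M' k) \<Longrightarrow> bz2 T M = bz2 T M'"
  by (auto simp: bz2_def)

lemma BZ_fin_am:
  assumes I: "I \<in> fin_intervals" and p: "p \<in> I" and M: "M \<in> BZ_fin I"
  shows "am_on (M_fin_x I) p c M \<in> BZ_fin I"
proof -
  obtain a b where ab: "I = {a..b}" "a \<le> b" "Min I = a" "Max I = b" "tilde I = {a..b + 1}"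
    using fin_intervalsE[OF I] .
  have bz: "M \<in> families (M_fin_x I)" "bz1 (tilde I) M" "bz2 (tilde I) M" "\<forall>i\<in>I. M {i + 1..Max I + 1} = 0"
    using M by (auto simp: BZ_fin_def bz_data_iff)
  have e: "am_on (M_fin_x I) p c M k = am p c M k" if "k \<subseteq> tilde I" for k
    using that p ab by (auto simp: am_on_def am_def M_fin_x_def M_fin_def)
  have "am_on (M_fin_x I) p c M \<in> families (M_fin_x I)"
    using bz(1) by (auto simp: families_def am_on_def)
  moreover have pt: "p \<in> tilde I" "p + 1 \<in> tilde I" using ab p by auto
  moreover have "am_on (M_fin_x I) p c M {i + 1..Max I + 1} = 0" if "i \<in> I" for i
    using bz(4) that p ab by (subst am_on_unbad) auto
  ultimately show ?thesis
    using bz1_am[OF bz(2,3) pt] bz2_am[OF bz(3) pt] bz1_cong[OF e] bz2_cong[OF e]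
    by (auto simp: BZ_fin_def bz_data_iff)
qed

lemma BZ_fin_unique:
  assumes I: "I \<in> fin_intervals" and p: "p \<in> I" and M: "M \<in> BZ_fin I" "M' \<in> BZ_fin I"
    and top: "M {Min I..p} = M' {Min I..p}"
    and good: "\<And>k. k \<in> M_fin_x I \<Longrightarrow> \<not> (p \<in> k \<and> p + 1 \<notin> k) \<Longrightarrow> M k = M' k"
  shows "M = M'"
proof
  fix k
  obtain a b where ab: "I = {a..b}" "a \<le> b" "Min I = a" "Max I = b" "tilde I = {a..b + 1}"
    using fin_intervalsE[OF I] .
  have bz: "M \<in> families (M_fin_x I)" "bz2 {a..b + 1} M" "M' \<in> families (M_fin_x I)" "bz2 {a..b + 1} M'"
    using M unfolding ab(5)[symmetric] by (auto simp: BZ_fin_def bz_data_iff)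
  have out: "M k = M' k" if "k \<notin> M_fin_x I" for k using bz that by (simp add: families_def)
  show "M k = M' k"
  proof (cases "k \<in> M_fin_x I")
    case True
    have "M k = M' k" if "\<not> (p \<in> k \<and> p + 1 \<notin> k)" for k
      using good out that by (cases "k \<in> M_fin_x I") auto
    then show ?thesis
      using bz2_determined[OF bz(2,4), of "{p}" "{p}" k] top True ab p
      by (auto simp: M_fin_x_def M_fin_def)
  qed (rule out)
qed

text \<open>The constant is forced: it makes the minimum at the initial segment ending in p equal to
  the old value minus one. Uniqueness does the rest.\<close>

lemma f_fin_eq:
  assumes I: "I \<in> fin_intervals" and p: "p \<in> I" and M: "M \<in> BZ_fin I"
  shows "f_fin I p M = am_on (M_fin_x I) p (M {Min I..p} - M ({Min I..p - 1} \<union> {p + 1}) - 1) M"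
    (is "_ = am_on ?D p ?c M")
proof -
  obtain a b where ab: "I = {a..b}" "a \<le> b" "Min I = a" "Max I = b" "tilde I = {a..b + 1}"
    using fin_intervalsE[OF I] .
  have s: "insert (p + 1) ({a..p} - {p}) = {a..p - 1} \<union> {p + 1}" using p ab by auto
  have top: "am_on ?D p ?c M {Min I..p} = M {Min I..p} - 1"
    using p ab s by (auto simp: am_on_def am_def M_fin_x_def M_fin_def)
  show ?thesis
    unfolding f_fin_def
  proof (rule the_equality)
    show "am_on ?D p ?c M \<in> BZ_fin I \<and> am_on ?D p ?c M {Min I..p} = M {Min I..p} - 1 \<and>
      (\<forall>k\<in>M_fin_x I. \<not> (p \<in> k \<and> p + 1 \<notin> k) \<longrightarrow> am_on ?D p ?c M k = M k)"
      using BZ_fin_am[OF assms] top am_on_unbad by blast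
    fix M' assume "M' \<in> BZ_fin I \<and> M' {Min I..p} = M {Min I..p} - 1 \<and>
      (\<forall>k\<in>M_fin_x I. \<not> (p \<in> k \<and> p + 1 \<notin> k) \<longrightarrow> M' k = M k)"
    then show "M' = am_on ?D p ?c M"
      using BZ_fin_unique[OF I p _ BZ_fin_am[OF assms, of ?c]] top am_on_unbad by metis
  qed
qed

text \<open>M meets the definite description in \<open>e_fin\<close>, so raising is obtained as the
  inverse of lowering, without a closed formula of its own.\<close>

lemma e_fin_eq:
  assumes I: "I \<in> fin_intervals" and p: "p \<in> I" and M: "M \<in> BZ_fin I" and eps: "eps_fin I p (f_fin I p M) \<noteq> 0"
  shows "e_fin I p (f_fin I p M) = Some M"
proof -
  obtain a b where ab: "I = {a..b}" "a \<le> b" "Min I = a" "Max I = b" "tilde I = {a..b + 1}"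
    using fin_intervalsE[OF I] .
  have s: "insert (p + 1) ({a..p} - {p}) = {a..p - 1} \<union> {p + 1}" using p ab by auto
  have top: "f_fin I p M {Min I..p} = M {Min I..p} - 1"
    unfolding f_fin_eq[OF I p M] using p ab s by (auto simp: am_on_def am_def M_fin_x_def M_fin_def)
  have "(THE M'. M' \<in> BZ_fin I \<and>
     M' {Min I..p} = f_fin I p M {Min I..p} + 1 \<and>
     (\<forall>k\<in>M_fin_x I. \<not> (p \<in> k \<and> p + 1 \<notin> k) \<longrightarrow> M' k = f_fin I p M k)) = M"
  proof (rule the_equality)
    show "M \<in> BZ_fin I \<and> M {Min I..p} = f_fin I p M {Min I..p} + 1 \<and>
     (\<forall>k\<in>M_fin_x I. \<not> (p \<in> k \<and> p + 1 \<notin> k) \<longrightarrow> M k = f_fin I p M k)"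
      using M top am_on_unbad f_fin_eq[OF I p M] by auto
    fix M' assume "M' \<in> BZ_fin I \<and> M' {Min I..p} = f_fin I p M {Min I..p} + 1 \<and>
     (\<forall>k\<in>M_fin_x I. \<not> (p \<in> k \<and> p + 1 \<notin> k) \<longrightarrow> M' k = f_fin I p M k)"
    then show "M' = M"
      using BZ_fin_unique[OF I p _ M] top am_on_unbad f_fin_eq[OF I p M] by auto
  qed
  then show ?thesis using eps by (simp add: e_fin_def)
qed

section \<open>Tableaux as particle systems\<close>

text \<open>Arrays of Gelfand-Tsetlin type with an abstract diagonal e, so that a half-infinite Maya
  diagram and all its truncations can share one enumeration.\<close>

definition gt_patterns :: "int \<Rightarrow> int \<Rightarrow> (int \<Rightarrow> int) \<Rightarrow> (int \<Rightarrow> int \<Rightarrow> int) set" where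
  "gt_patterns lo hi e = {C.
     (\<forall>p\<in>{lo..hi}. C p p = e p) \<and>
     (\<forall>p\<in>{lo..hi}. \<forall>q. p \<le> q \<and> q + 1 \<in> {lo..hi} \<longrightarrow> C p q \<le> C p (q + 1)) \<and>
     (\<forall>p\<in>{lo..hi}. \<forall>q\<in>{lo..hi}. p < q \<longrightarrow> C p q < C (p + 1) q)}"

text \<open>Row p is the trajectory of one particle and t = q - p its time. Including time 0 lets
  the linear part of \<open>M_of_fin\<close> be absorbed as a price.\<close>

definition gt_cost :: "(int \<Rightarrow> int \<Rightarrow> int) \<Rightarrow> int \<Rightarrow> int \<Rightarrow> (int \<Rightarrow> int \<Rightarrow> int) \<Rightarrow> int" where
  "gt_cost w lo hi C = (\<Sum>p\<in>{lo..hi}. \<Sum>t\<in>{0..hi - p}. w (C p (p + t)) t)"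

definition gt_min :: "(int \<Rightarrow> int \<Rightarrow> int) \<Rightarrow> int \<Rightarrow> int \<Rightarrow> (int \<Rightarrow> int) \<Rightarrow> int" where
  "gt_min w lo hi e = Min (gt_cost w lo hi ` gt_patterns lo hi e)"

lemma gt_diag: "C \<in> gt_patterns lo hi e \<Longrightarrow> p \<in> {lo..hi} \<Longrightarrow> C p p = e p"
  by (simp add: gt_patterns_def)

lemma gt_row:
  assumes "C \<in> gt_patterns lo hi e" "lo \<le> p" "p \<le> q" "q \<le> q'" "q' \<le> hi"
  shows "C p q \<le> C p q'"
proof -
  have "q' \<le> hi \<longrightarrow> C p q \<le> C p q'"
    using assms(4)
  proof (induction q' rule: int_ge_induct)
    case (step i)
    have "i + 1 \<le> hi \<longrightarrow> C p i \<le> C p (i + 1)" using assms(1-3) step by (auto simp: gt_patterns_def)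
    then show ?case using step by auto
  qed simp
  then show ?thesis using assms by simp
qed

lemma gt_col:
  assumes "C \<in> gt_patterns lo hi e" "lo \<le> p" "p \<le> p'" "p' \<le> q" "q \<le> hi"
  shows "C p q + (p' - p) \<le> C p' q"
proof -
  have "p' \<le> q \<longrightarrow> C p q + (p' - p) \<le> C p' q"
    using assms(3)
  proof (induction p' rule: int_ge_induct)
    case (step i)
    have "i + 1 \<le> q \<longrightarrow> C i q < C (i + 1) q" using assms(1,2,5) step by (auto simp: gt_patterns_def)
    then show ?case using step by auto
  qed simp
  then show ?thesis using assms by simp
qed

text \<open>Row steps followed by column steps compare two particles at the same time. Hence a site
  holds at most one particle at a time.\<close>

lemma gt_time:
  assumes "C \<in> gt_patterns lo hi e" "lo \<le> p" "p < p'" "0 \<le> t" "p' + t \<le> hi"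
  shows "C p (p + t) < C p' (p' + t)"
  using gt_col[OF assms(1,2), of p' "p' + t"] gt_row[OF assms(1,2), of "p + t" "p' + t"] assms by auto

lemma gt_bounds:
  assumes "C \<in> gt_patterns lo hi e" "lo \<le> p" "p \<le> q" "q \<le> hi"
  shows "e p \<le> C p q" "C p q + (q - p) \<le> e q"
  using gt_row[OF assms(1,2), of p q] gt_col[OF assms(1,2), of q q] gt_diag[OF assms(1)] assms by auto

text \<open>Entries off the triangle are free, so there are infinitely many patterns and only their
  costs form a finite set. The entries that matter lie in the finite set \<open>S\<close>, which
  bounds every cost.\<close>

lemma finite_gt_costs: "finite (gt_cost w lo hi ` gt_patterns lo hi e)"
proof -
  define S where "S = (\<Union>p\<in>{lo..hi}. \<Union>q\<in>{lo..hi}. {e p..e q})"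
  define f where "f x = (\<Sum>t\<in>{0..hi - lo}. \<bar>w x t\<bar>)" for x
  define B where "B = sum f S"
  define N where "N = (\<Sum>p\<in>{lo..hi}. \<Sum>t\<in>{0..hi - p}. B)"
  have fS: "finite S" by (simp add: S_def)
  have f0: "0 \<le> f x" for x by (simp add: f_def sum_nonneg)
  have "\<bar>gt_cost w lo hi C\<bar> \<le> N" if C: "C \<in> gt_patterns lo hi e" for C
  proof -
    have "\<bar>w (C p (p + t)) t\<bar> \<le> B" if "p \<in> {lo..hi}" "t \<in> {0..hi - p}" for p t
    proof -
      have "C p (p + t) \<in> S"
        using gt_bounds[OF C, of p "p + t"] that unfolding S_def
        by (intro UN_I[of p] UN_I[of "p + t"]) auto
      then have "f (C p (p + t)) \<le> B"
        unfolding B_def using f0 fS by (simp add: member_le_sum)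
      moreover have "\<bar>w (C p (p + t)) t\<bar> \<le> f (C p (p + t))" unfolding f_def
        by (rule member_le_sum[where f = "\<lambda>t'. \<bar>w (C p (p + t)) t'\<bar>"]) (use that in auto)
      ultimately show ?thesis by simp
    qed
    then show ?thesis
      unfolding gt_cost_def N_def
      by (intro order_trans[OF sum_abs] sum_mono) auto
  qed
  then have "gt_cost w lo hi ` gt_patterns lo hi e \<subseteq> {- N..N}" by (auto simp: abs_le_iff minus_le_iff)
  then show ?thesis by (rule finite_subset) simp
qed

lemma const_gt_pattern:
  assumes "strict_mono_on {lo..hi} e"
  shows "(\<lambda>p q. e p) \<in> gt_patterns lo hi e"
  using assms by (auto simp: gt_patterns_def strict_mono_on_def)

lemma gt_min_le: "C \<in> gt_patterns lo hi e \<Longrightarrow> gt_min w lo hi e \<le> gt_cost w lo hi C"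
  unfolding gt_min_def using finite_gt_costs by (intro Min_le) auto

lemma gt_min_attained:
  assumes "strict_mono_on {lo..hi} e"
  obtains C where "C \<in> gt_patterns lo hi e" "gt_cost w lo hi C = gt_min w lo hi e"
proof -
  have "gt_min w lo hi e \<in> gt_cost w lo hi ` gt_patterns lo hi e"
    unfolding gt_min_def using const_gt_pattern[OF assms] by (intro Min_in finite_gt_costs) auto
  then show ?thesis using that by auto
qed

section \<open>Rerouting one particle when two prices change\<close>

definition gt_upd :: "(int \<Rightarrow> int \<Rightarrow> int) \<Rightarrow> int \<Rightarrow> int \<Rightarrow> int \<Rightarrow> int \<Rightarrow> (int \<Rightarrow> int \<Rightarrow> int)" where
  "gt_upd C i u s v = (\<lambda>p q. if p = i \<and> i + u \<le> q \<and> q < i + s then v else C p q)"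

lemma gt_cost_upd:
  assumes "lo \<le> i" "0 \<le> u" "u < s" "i + s \<le> hi + 1" "\<And>t. u \<le> t \<Longrightarrow> t < s \<Longrightarrow> C i (i + t) = v0"
  shows "gt_cost w lo hi (gt_upd C i u s v) = gt_cost w lo hi C + (\<Sum>t\<in>{u..<s}. w v t - w v0 t)"
proof -
  have "gt_cost w lo hi (gt_upd C i u s v) - gt_cost w lo hi C =
    (\<Sum>p\<in>{lo..hi}. if p = i then \<Sum>t\<in>{0..hi - i}. w (gt_upd C i u s v i (i + t)) t - w (C i (i + t)) t else 0)"
    unfolding gt_cost_def sum_subtractf[symmetric]
    by (intro sum.cong refl) (auto simp: gt_upd_def intro!: sum.neutral)
  also have "\<dots> = (\<Sum>t\<in>{0..hi - i}. w (gt_upd C i u s v i (i + t)) t - w (C i (i + t)) t)"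
    using assms by simp
  also have "\<dots> = (\<Sum>t\<in>{u..<s}. w v t - w v0 t)"
    using assms by (intro sum.mono_neutral_cong_right) (auto simp: gt_upd_def)
  finally show ?thesis by simp
qed

text \<open>Let S(s) be the sum of w (b + 1) t - w b t over 0 <= t < s. The conditions
  \<open>before\<close> and \<open>after\<close> say that s0 is the first s >= 1 at which S is
  maximal, and c is this maximum minus one. The new prices put a surcharge on b at time s0 and give
  a discount on b + 1 at time s0 - 1.\<close>

locale gt_move =
  fixes w w' :: "int \<Rightarrow> int \<Rightarrow> int" and b s0 c lo hi :: int
  assumes s0: "1 \<le> s0"
    and before: "\<And>u. 1 \<le> u \<Longrightarrow> u < s0 \<Longrightarrow> (\<Sum>t\<in>{u..<s0}. w (b + 1) t - w b t) \<ge> 1"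
    and after: "\<And>s. s0 \<le> s \<Longrightarrow> (\<Sum>t\<in>{s0..<s}. w (b + 1) t - w b t) \<le> 0"
    and w': "\<And>x t. w' x t = w x t + (if x = b \<and> t = s0 then 1 else 0) - (if x = b + 1 \<and> t = s0 - 1 then 1 else 0)"
    and c: "c = (\<Sum>t\<in>{0..<s0}. w (b + 1) t - w b t) - 1"
begin

definition occ :: "(int \<Rightarrow> int \<Rightarrow> int) \<Rightarrow> int \<Rightarrow> int \<Rightarrow> bool" where
  "occ C x t \<longleftrightarrow> (\<exists>i. lo \<le> i \<and> i + t \<le> hi \<and> C i (i + t) = x)"

lemma sum_occ:
  assumes "C \<in> gt_patterns lo hi e" "0 \<le> t0"
  shows "(\<Sum>p\<in>{lo..hi}. \<Sum>t\<in>{0..hi - p}. if C p (p + t) = x \<and> t = t0 then 1 else 0 :: int) = (if occ C x t0 then 1 else 0)"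
proof -
  have "(\<Sum>t\<in>{0..hi - p}. if C p (p + t) = x \<and> t = t0 then 1 else 0 :: int) =
      (if p + t0 \<le> hi \<and> C p (p + t0) = x then 1 else 0)" for p
  proof -
    have "(\<Sum>t\<in>{0..hi - p}. if C p (p + t) = x \<and> t = t0 then 1 else 0 :: int) =
      (\<Sum>t\<in>{0..hi - p}. if t = t0 then (if C p (p + t0) = x then 1 else 0) else 0)"
      by (intro sum.cong) auto
    then show ?thesis using assms(2) by auto
  qed
  then have *: "(\<Sum>p\<in>{lo..hi}. \<Sum>t\<in>{0..hi - p}. if C p (p + t) = x \<and> t = t0 then 1 else 0 :: int) =
    (\<Sum>p\<in>{lo..hi}. if p + t0 \<le> hi \<and> C p (p + t0) = x then 1 else 0)" by simp
  show ?thesis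
  proof (cases "occ C x t0")
    case False
    then show ?thesis unfolding * by (auto simp: occ_def intro!: sum.neutral)
  next
    case True
    then obtain i where i: "lo \<le> i" "i + t0 \<le> hi" "C i (i + t0) = x" by (auto simp: occ_def)
    have uniq: "p = i" if "lo \<le> p" "p + t0 \<le> hi" "C p (p + t0) = x" for p
    proof (rule ccontr)
      assume "p \<noteq> i"
      then consider "p < i" | "i < p" by linarith
      then show False
      proof cases
        case 1
        then show ?thesis using gt_time[OF assms(1) that(1) 1 assms(2) i(2)] that i by linarith
      next
        case 2
        then show ?thesis using gt_time[OF assms(1) i(1) 2 assms(2) that(2)] that i by linarith
      qed
    qed
    have eq: "(if p + t0 \<le> hi \<and> C p (p + t0) = x then 1 else 0 :: int) = (if p = i then 1 else 0)"
      if "p \<in> {lo..hi}" for p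
    proof (cases "p = i")
      case True
      then show ?thesis using i by (simp add: add.commute)
    next
      case False
      then have "\<not> (p + t0 \<le> hi \<and> C p (p + t0) = x)" using uniq[of p] that by auto
      then show ?thesis using False by simp
    qed
    have "(\<Sum>p\<in>{lo..hi}. if p + t0 \<le> hi \<and> C p (p + t0) = x then 1 else 0 :: int) =
       (\<Sum>p\<in>{lo..hi}. if p = i then 1 else 0)"
      by (rule sum.cong[OF refl eq])
    then show ?thesis unfolding * using True i assms(2) by simp
  qed
qed

lemma cost':
  assumes "C \<in> gt_patterns lo hi e"
  shows "gt_cost w' lo hi C = gt_cost w lo hi C + (if occ C b s0 then 1 else 0) - (if occ C (b + 1) (s0 - 1) then 1 else 0)"
  unfolding gt_cost_def w' sum.distrib sum_subtractf
  using sum_occ[OF assms, of s0 b] sum_occ[OF assms, of "s0 - 1" "b + 1"] s0 by simp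

text \<open>\<open>ent\<close> keeps the row weakly increasing where the altered stay begins.
  \<open>low\<close> keeps the columns strict: a column compares a particle with its lower neighbour
  one time step later, hence the entry at row i - 1 and index i + s - 1.\<close>

lemma delay:
  assumes C: "C \<in> gt_patterns lo hi e" and i: "lo \<le> i" "0 \<le> u" "u < s" "i + s \<le> hi + 1"
    and on: "\<And>t. u \<le> t \<Longrightarrow> t < s \<Longrightarrow> C i (i + t) = b + 1"
    and ent: "0 < u \<Longrightarrow> C i (i + u - 1) \<le> b" and low: "lo \<le> i - 1 \<Longrightarrow> C (i - 1) (i + s - 1) < b"
  shows "gt_upd C i u s b \<in> gt_patterns lo hi (if u = 0 then e(i := b) else e)"
proof -
  let ?C = "gt_upd C i u s b"
  have on': "C i q = b + 1" if "i + u \<le> q" "q < i + s" for q using on[of "q - i"] that by simp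
  have d: "?C p p = (if u = 0 then e(i := b) else e) p" if "p \<in> {lo..hi}" for p
    using gt_diag[OF C that] i by (auto simp: gt_upd_def)
  have r: "?C p q \<le> ?C p (q + 1)" if "p \<in> {lo..hi}" "p \<le> q" "q + 1 \<in> {lo..hi}" for p q
  proof (cases "p = i")
    case False
    then show ?thesis using gt_row[OF C, of p q "q + 1"] that by (simp add: gt_upd_def)
  next
    case True
    have 1: "C i q \<le> C i (q + 1)" using gt_row[OF C, of p q "q + 1"] that True by simp
    consider "i + u \<le> q" "q + 1 < i + s" | "q + 1 = i + u" | "q + 1 = i + s" "i + u \<le> q" | "q + 1 < i + u" | "i + s \<le> q" by linarith
    then show ?thesis
    proof cases
      case 2
      then have q: "i + u - 1 = q" by simp
      moreover from 2 True that have "0 < u" by simp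
      ultimately have "C i q \<le> b" using ent by simp
      then show ?thesis using 2 True i by (auto simp: gt_upd_def)
    next
      case 3
      then show ?thesis using 1 on'[of q] True by (auto simp: gt_upd_def)
    qed (use 1 True in \<open>auto simp: gt_upd_def\<close>)
  qed
  have cl: "?C p q < ?C (p + 1) q" if "p \<in> {lo..hi}" "q \<in> {lo..hi}" "p < q" for p q
  proof -
    have 1: "C p q < C (p + 1) q" using gt_col[OF C, of p "p + 1" q] that by simp
    consider "p = i" | "p = i - 1" | "p \<noteq> i" "p + 1 \<noteq> i" by fastforce
    then show ?thesis
    proof cases
      case 1
      then show ?thesis using \<open>C p q < C (p + 1) q\<close> on'[of q] by (auto simp: gt_upd_def)
    next
      case 2
      show ?thesis
      proof (cases "i + u \<le> q \<and> q < i + s")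
        case True
        have "C (i - 1) q \<le> C (i - 1) (i + s - 1)"
          using gt_row[OF C, of "i - 1" q "i + s - 1"] that 2 True i by simp
        then show ?thesis using low that 2 True by (simp add: gt_upd_def)
      qed (use 2 1 in \<open>auto simp: gt_upd_def\<close>)
    qed (use 1 in \<open>auto simp: gt_upd_def\<close>)
  qed
  show ?thesis using d r cl unfolding gt_patterns_def by blast
qed

text \<open>Mirror image of \<open>delay\<close>. The upper neighbour, compared one time step
  earlier, must already be beyond b + 1; at time 0 there is nothing to compare with.\<close>

lemma advance:
  assumes C: "C \<in> gt_patterns lo hi e" and i: "lo \<le> i" "0 \<le> u" "u < s" "i + s \<le> hi + 1"
    and on: "\<And>t. u \<le> t \<Longrightarrow> t < s \<Longrightarrow> C i (i + t) = b"
    and ex: "i + s \<le> hi \<Longrightarrow> C i (i + s) \<noteq> b"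
    and up: "\<And>t. u \<le> t \<Longrightarrow> t < s \<Longrightarrow> 1 \<le> t \<Longrightarrow> C (i + 1) (i + t) > b + 1"
  shows "gt_upd C i u s (b + 1) \<in> gt_patterns lo hi (if u = 0 then e(i := b + 1) else e)"
proof -
  let ?C = "gt_upd C i u s (b + 1)"
  have on': "C i q = b" if "i + u \<le> q" "q < i + s" for q using on[of "q - i"] that by simp
  have up': "C (i + 1) q > b + 1" if "i + u \<le> q" "q < i + s" "i < q" for q using up[of "q - i"] that by simp
  have d: "?C p p = (if u = 0 then e(i := b + 1) else e) p" if "p \<in> {lo..hi}" for p
    using gt_diag[OF C that] i by (auto simp: gt_upd_def)
  have r: "?C p q \<le> ?C p (q + 1)" if "p \<in> {lo..hi}" "p \<le> q" "q + 1 \<in> {lo..hi}" for p q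
  proof (cases "p = i")
    case False
    then show ?thesis using gt_row[OF C, of p q "q + 1"] that by (simp add: gt_upd_def)
  next
    case True
    have 1: "C i q \<le> C i (q + 1)" using gt_row[OF C, of p q "q + 1"] that True by simp
    consider "i + u \<le> q" "q + 1 < i + s" | "q + 1 = i + u" | "q + 1 = i + s" "i + u \<le> q" | "q + 1 < i + u" | "i + s \<le> q" by linarith
    then show ?thesis
    proof cases
      case 2
      then show ?thesis using 1 on'[of "q + 1"] True i by (auto simp: gt_upd_def)
    next
      case 3
      then have "C i (q + 1) \<noteq> b" using ex that by simp
      then show ?thesis using 1 3 on'[of q] True by (auto simp: gt_upd_def)
    qed (use 1 True in \<open>auto simp: gt_upd_def\<close>)
  qed
  have cl: "?C p q < ?C (p + 1) q" if "p \<in> {lo..hi}" "q \<in> {lo..hi}" "p < q" for p q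
  proof -
    have 1: "C p q < C (p + 1) q" using gt_col[OF C, of p "p + 1" q] that by simp
    consider "p = i" | "p = i - 1" | "p \<noteq> i" "p + 1 \<noteq> i" by fastforce
    then show ?thesis
    proof cases
      case 1
      then show ?thesis using \<open>C p q < C (p + 1) q\<close> up'[of q] that by (auto simp: gt_upd_def)
    next
      case 2
      then show ?thesis using 1 on'[of q] by (auto simp: gt_upd_def)
    qed (use 1 in \<open>auto simp: gt_upd_def\<close>)
  qed
  show ?thesis using d r cl unfolding gt_patterns_def by blast
qed

text \<open>Only a pattern that takes the discount without paying the surcharge can beat the old
  minimum. Keeping its particle at b from the time u of its arrival at b + 1 until s0 saves at least
  the discount if u > 0. If u = 0, the starting set changes instead, and the difference is accounted
  for by c.\<close>

lemma lower:
  assumes e: "strict_mono_on {lo..hi} e" and C: "C \<in> gt_patterns lo hi e"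
  shows "gt_min w lo hi e \<le> gt_cost w' lo hi C \<or>
    (\<exists>i\<in>{lo..hi}. e i = b + 1 \<and> b \<notin> e ` {lo..hi} \<and> gt_min w lo hi (e(i := b)) + c \<le> gt_cost w' lo hi C)"
proof (cases "occ C (b + 1) (s0 - 1) \<and> \<not> occ C b s0")
  case False
  then have "gt_cost w lo hi C \<le> gt_cost w' lo hi C" using cost'[OF C] by auto
  then show ?thesis using gt_min_le[OF C, of w] by simp
next
  case True
  then obtain i where i: "lo \<le> i" "i + s0 - 1 \<le> hi" "C i (i + s0 - 1) = b + 1"
    by (auto simp: occ_def algebra_simps)
  have cC: "gt_cost w' lo hi C = gt_cost w lo hi C - 1" using cost'[OF C] True by simp
  define U where "U = {t \<in> {0..s0 - 1}. C i (i + t) = b + 1}"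
  have U: "finite U" "s0 - 1 \<in> U" using i s0 by (auto simp: U_def algebra_simps intro: finite_subset[of _ "{0..s0 - 1}"])
  define u where "u = Min U"
  have "u \<in> U" unfolding u_def using U by (intro Min_in) auto
  then have u: "0 \<le> u" "u < s0" "C i (i + u) = b + 1" by (auto simp: U_def)
  have on: "C i (i + t) = b + 1" if "u \<le> t" "t < s0" for t
    using gt_row[OF C, of i "i + u" "i + t"] gt_row[OF C, of i "i + t" "i + s0 - 1"] i u that by simp
  have ent: "C i (i + u - 1) \<le> b" if "0 < u"
  proof -
    have "u - 1 \<notin> U" using Min_le[OF U(1), of "u - 1"] unfolding u_def by auto
    then have "C i (i + (u - 1)) \<noteq> b + 1" using u that by (simp add: U_def)
    moreover have "C i (i + u - 1) \<le> C i (i + u)" using gt_row[OF C, of i "i + u - 1" "i + u"] i u that by simp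
    ultimately show ?thesis using u(3) by (simp add: algebra_simps)
  qed
  \<comment> \<open>Since no surcharge is paid, b is free at time s0, and this is the site where the
    lower neighbour could obstruct the delay.\<close>
  have low: "C (i - 1) (i + s0 - 1) < b" if "lo \<le> i - 1"
  proof -
    have "C (i - 1) (i + s0 - 1) < b + 1" using gt_col[OF C, of "i - 1" i "i + s0 - 1"] that i s0 by simp
    moreover have "C (i - 1) (i - 1 + s0) \<noteq> b" using True that i by (auto simp: occ_def)
    ultimately show ?thesis by (simp add: algebra_simps)
  qed
  have hi': "i + s0 \<le> hi + 1" using i by simp
  have D: "gt_upd C i u s0 b \<in> gt_patterns lo hi (if u = 0 then e(i := b) else e)"
    using on ent low by (intro delay[OF C i(1) u(1,2) hi']) auto
  have DC: "gt_cost w lo hi (gt_upd C i u s0 b) = gt_cost w lo hi C + (\<Sum>t\<in>{u..<s0}. w b t - w (b + 1) t)"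
    using on by (intro gt_cost_upd[OF i(1) u(1,2) hi']) auto
  have neg: "(\<Sum>t\<in>{u..<s0}. w b t - w (b + 1) t) = - (\<Sum>t\<in>{u..<s0}. w (b + 1) t - w b t)"
    by (simp add: sum_negf[symmetric])
  show ?thesis
  proof (cases "u = 0")
    case False
    then have "gt_min w lo hi e \<le> gt_cost w lo hi C + (\<Sum>t\<in>{u..<s0}. w b t - w (b + 1) t)"
      using gt_min_le[of "gt_upd C i u s0 b" lo hi e w] D DC i by simp
    then show ?thesis unfolding neg using before[of u] False u cC by simp
  next
    case True
    have ei: "e i = b + 1" using u(3) True gt_diag[OF C, of i] i s0 by simp
    have "gt_min w lo hi (e(i := b)) \<le> gt_cost w lo hi C + (\<Sum>t\<in>{u..<s0}. w b t - w (b + 1) t)"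
      using gt_min_le[of "gt_upd C i u s0 b" lo hi "e(i := b)" w] D DC i True by simp
    then have 1: "gt_min w lo hi (e(i := b)) + c \<le> gt_cost w' lo hi C" unfolding neg using c True cC by simp
    have "e p \<noteq> b" if "p \<in> {lo..hi}" for p
    proof
      assume ep: "e p = b"
      have "p < i"
      proof (rule ccontr)
        assume "\<not> p < i"
        then have "p = i \<or> e i < e p" using e that i s0 by (cases "p = i") (auto simp: strict_mono_on_def)
        then show False using ep ei by auto
      qed
      then have "lo \<le> i - 1" using that by simp
      have "e p \<le> e (i - 1)"
        using strict_mono_onD[OF e, of p "i - 1"] \<open>p < i\<close> that i s0 by (cases "p = i - 1") auto
      moreover have "e (i - 1) \<le> C (i - 1) (i + s0 - 1)" using gt_bounds(1)[OF C, of "i - 1" "i + s0 - 1"] \<open>lo \<le> i - 1\<close> i s0 by simp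
      ultimately show False using low[OF \<open>lo \<le> i - 1\<close>] ep by simp
    qed
    then have "b \<notin> e ` {lo..hi}" by blast
    moreover have "i \<in> {lo..hi}" using i s0 by simp
    ultimately show ?thesis using 1 ei by blast
  qed
qed

text \<open>If the surcharge is paid without the discount, the particle at b moves to b + 1 from
  time s0 on, for as long as it would have stayed at b. By maximality of S at s0 this is no dearer
  at the old prices, and the surcharge disappears.\<close>

lemma upper:
  assumes C: "C \<in> gt_patterns lo hi e"
  obtains C' where "C' \<in> gt_patterns lo hi e" "gt_cost w' lo hi C' \<le> gt_cost w lo hi C"
proof (cases "occ C b s0 \<and> \<not> occ C (b + 1) (s0 - 1)")
  case False
  then have "gt_cost w' lo hi C \<le> gt_cost w lo hi C" using cost'[OF C] by auto
  then show ?thesis using that C by blast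
next
  case True
  then obtain i where i: "lo \<le> i" "i + s0 \<le> hi" "C i (i + s0) = b" by (auto simp: occ_def)
  define U where "U = {t \<in> {s0..hi - i}. C i (i + t) = b}"
  have U: "finite U" "s0 \<in> U" using i s0 by (auto simp: U_def intro: finite_subset[of _ "{s0..hi - i}"])
  define s where "s = Max U + 1"
  have "s - 1 \<in> U" unfolding s_def using U Max_in[of U] by (cases "U = {}") auto
  then have s: "s0 < s" "i + s \<le> hi + 1" "C i (i + s - 1) = b" by (auto simp: U_def algebra_simps)
  have on: "C i (i + t) = b" if "s0 \<le> t" "t < s" for t
    using gt_row[OF C, of i "i + s0" "i + t"] gt_row[OF C, of i "i + t" "i + s - 1"] i s s0 that by simp
  have ex: "C i (i + s) \<noteq> b" if "i + s \<le> hi"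
    using Max_ge[OF U(1), of s] s that unfolding s_def by (auto simp: U_def)
  have up: "C (i + 1) (i + t) > b + 1" if "s0 \<le> t" "t < s" for t
  proof -
    have "C (i + 1) (i + s0) > b" using gt_col[OF C, of i "i + 1" "i + s0"] i s0 by simp
    moreover have "C (i + 1) (i + 1 + (s0 - 1)) \<noteq> b + 1" 
    proof -
      have "\<not> (lo \<le> i + 1 \<and> i + 1 + (s0 - 1) \<le> hi \<and> C (i + 1) (i + 1 + (s0 - 1)) = b + 1)"
        using True unfolding occ_def by blast
      then show ?thesis using i by simp
    qed
    moreover have "C (i + 1) (i + s0) \<le> C (i + 1) (i + t)"
      using gt_row[OF C, of "i + 1" "i + s0" "i + t"] i s s0 that by simp
    ultimately show ?thesis by (simp add: algebra_simps)
  qed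
  let ?C = "gt_upd C i s0 s (b + 1)"
  have P: "?C \<in> gt_patterns lo hi e" using advance[where C = C and e = e, OF C i(1) _ s(1,2)] on ex up s0 by auto
  have c1: "gt_cost w lo hi ?C \<le> gt_cost w lo hi C"
  proof -
    have "gt_cost w lo hi ?C = gt_cost w lo hi C + (\<Sum>t\<in>{s0..<s}. w (b + 1) t - w b t)"
      using on s0 by (intro gt_cost_upd[OF i(1) _ s(1,2)]) auto
    then show ?thesis using after[of s] s by simp
  qed
  have "\<not> occ ?C b s0"
  proof
    assume "occ ?C b s0"
    then obtain p where p: "lo \<le> p" "p + s0 \<le> hi" "?C p (p + s0) = b" by (auto simp: occ_def)
    then have "p \<noteq> i" using s by (auto simp: gt_upd_def)
    then have "C p (p + s0) = b" using p by (simp add: gt_upd_def)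
    then show False
      using gt_time[OF C, of p i s0] gt_time[OF C, of i p s0] i p s0 \<open>p \<noteq> i\<close>
      by (cases p i rule: linorder_cases) auto
  qed
  moreover have "\<not> occ ?C (b + 1) (s0 - 1)" using True by (auto simp: occ_def gt_upd_def)
  ultimately have "gt_cost w' lo hi ?C \<le> gt_cost w lo hi C" using cost'[OF P] c1 by simp
  then show ?thesis using that P by blast
qed

text \<open>The particle that starts at b is put on b + 1 for its whole stay [0, s), at the price
  S(s). If s < s0, then S(s) <= c because s0 is the first maximum. Otherwise S(s) may equal c + 1,
  but the particle is at b + 1 at time s0 - 1 and collects the discount, while b is free at time
  s0.\<close>

lemma upper_bad:
  assumes e: "strict_mono_on {lo..hi} e" and i: "i \<in> {lo..hi}" "e i = b + 1"
    and C: "C \<in> gt_patterns lo hi (e(i := b))"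
  obtains C' where "C' \<in> gt_patterns lo hi e" "gt_cost w' lo hi C' \<le> gt_cost w lo hi C + c"
proof -
  define U where "U = {t \<in> {0..hi - i}. C i (i + t) = b}"
  have U: "finite U" "0 \<in> U" using i gt_diag[OF C i(1)] by (auto simp: U_def intro: finite_subset[of _ "{0..hi - i}"])
  define s where "s = Max U + 1"
  have "s - 1 \<in> U" unfolding s_def using U Max_in[of U] by (cases "U = {}") auto
  then have s: "0 < s" "i + s \<le> hi + 1" "C i (i + s - 1) = b" by (auto simp: U_def algebra_simps)
  have i': "lo \<le> i" using i by simp
  have on: "C i (i + t) = b" if "0 \<le> t" "t < s" for t
    using gt_row[OF C, of i "i" "i + t"] gt_row[OF C, of i "i + t" "i + s - 1"] i s that gt_diag[OF C i(1)] by simp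
  have ex: "C i (i + s) \<noteq> b" if "i + s \<le> hi"
    using Max_ge[OF U(1), of s] s that unfolding s_def by (auto simp: U_def)
  have up: "C (i + 1) (i + t) > b + 1" if "0 \<le> t" "t < s" "1 \<le> t" for t
  proof -
    have "e i < e (i + 1)" using strict_mono_onD[OF e, of i "i + 1"] i s that by simp
    then show ?thesis using gt_bounds(1)[OF C, of "i + 1" "i + t"] i s that by simp
  qed
  let ?C = "gt_upd C i 0 s (b + 1)"
  have ee: "(e(i := b))(i := b + 1) = e" using i by auto
  have P: "?C \<in> gt_patterns lo hi e" using advance[where C = C, OF C i' _ s(1,2)] on ex up ee by simp
  have c1: "gt_cost w lo hi ?C = gt_cost w lo hi C + (\<Sum>t\<in>{0..<s}. w (b + 1) t - w b t)"
    using on by (intro gt_cost_upd[OF i' _ s(1,2)]) auto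
  show ?thesis
  proof (cases "s < s0")
    case True
    have "(\<Sum>t\<in>{0..<s0}. w (b + 1) t - w b t) = (\<Sum>t\<in>{0..<s}. w (b + 1) t - w b t) + (\<Sum>t\<in>{s..<s0}. w (b + 1) t - w b t)"
      using True s by (subst sum.union_disjoint[symmetric]) (auto intro: sum.cong)
    then have "gt_cost w lo hi ?C \<le> gt_cost w lo hi C + c" using c1 c before[of s] s True by simp
    then show ?thesis using upper[OF P] that by (metis order.trans)
  next
    case False
    have "(\<Sum>t\<in>{0..<s}. w (b + 1) t - w b t) = (\<Sum>t\<in>{0..<s0}. w (b + 1) t - w b t) + (\<Sum>t\<in>{s0..<s}. w (b + 1) t - w b t)"
      using False s0 by (subst sum.union_disjoint[symmetric]) (auto intro: sum.cong)
    then have c2: "gt_cost w lo hi ?C \<le> gt_cost w lo hi C + c + 1" using c1 c after[of s] False by simp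
    have "?C i (i + (s0 - 1)) = b + 1" using False s0 by (simp add: gt_upd_def)
    then have o1: "occ ?C (b + 1) (s0 - 1)" using i s False unfolding occ_def by (intro exI[of _ i]) auto
    have o2: "\<not> occ ?C b s0"
    proof
      assume "occ ?C b s0"
      then obtain p where p: "lo \<le> p" "p + s0 \<le> hi" "?C p (p + s0) = b" by (auto simp: occ_def)
      consider "p = i" | "p < i" | "i < p" by linarith
      then show False
      proof cases
        case 1
        then show ?thesis using p False ex s0 by (cases "s = s0") (auto simp: gt_upd_def)
      next
        case 2
        then have "C p (p + s0) = b" using p by (simp add: gt_upd_def)
        moreover have "C (i - 1) (i - 1 + s0) < C i (i + (s0 - 1))"
          using gt_col[OF C, of "i - 1" i "i - 1 + s0"] p 2 i s False s0 by (simp add: algebra_simps)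
        moreover have "C i (i + (s0 - 1)) = b" using on[of "s0 - 1"] False s0 by simp
        moreover have "C p (p + s0) \<le> C (i - 1) (i - 1 + s0)"
          using gt_time[OF C, of p "i - 1" s0] p 2 i s False s0 by (cases "p = i - 1") auto
        ultimately show ?thesis by simp
      next
        case 3
        then have "C p (p + s0) = b" using p by (simp add: gt_upd_def)
        moreover have "C i (i + s0) < C p (p + s0)" using gt_time[OF C, of i p s0] 3 i p s0 by simp
        moreover have "b \<le> C i (i + s0)" using gt_bounds(1)[OF C, of i "i + s0"] i p 3 s0 by simp
        ultimately show ?thesis by simp
      qed
    qed
    have "gt_cost w' lo hi ?C \<le> gt_cost w lo hi C + c" using cost'[OF P] o1 o2 c2 by simp
    then show ?thesis using that P by blast
  qed
qed

lemma gt_min_move: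
  assumes e: "strict_mono_on {lo..hi} e"
  shows "\<not> (b + 1 \<in> e ` {lo..hi} \<and> b \<notin> e ` {lo..hi}) \<Longrightarrow> gt_min w' lo hi e = gt_min w lo hi e"
    and "i \<in> {lo..hi} \<Longrightarrow> e i = b + 1 \<Longrightarrow> b \<notin> e ` {lo..hi} \<Longrightarrow>
      gt_min w' lo hi e = min (gt_min w lo hi e) (gt_min w lo hi (e(i := b)) + c)"
proof -
  obtain C where C: "C \<in> gt_patterns lo hi e" "gt_cost w' lo hi C = gt_min w' lo hi e"
    using gt_min_attained[OF e] .
  obtain D where D: "D \<in> gt_patterns lo hi e" "gt_cost w lo hi D = gt_min w lo hi e"
    using gt_min_attained[OF e] .
  obtain D' where "D' \<in> gt_patterns lo hi e" "gt_cost w' lo hi D' \<le> gt_cost w lo hi D"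
    using upper[OF D(1)] .
  then have 1: "gt_min w' lo hi e \<le> gt_min w lo hi e" using D(2) gt_min_le[of D' lo hi e w'] by simp
  {
    assume "\<not> (b + 1 \<in> e ` {lo..hi} \<and> b \<notin> e ` {lo..hi})"
    then have "gt_min w lo hi e \<le> gt_min w' lo hi e" using lower[OF e C(1)] C(2) by (metis image_eqI)
    then show "gt_min w' lo hi e = gt_min w lo hi e" using 1 by simp
  }
  {
    assume i: "i \<in> {lo..hi}" "e i = b + 1" and b: "b \<notin> e ` {lo..hi}"
    have inj: "inj_on e {lo..hi}" using e strict_mono_on_imp_inj_on by blast
    have "strict_mono_on {lo..hi} (e(i := b))"
      unfolding strict_mono_on_def
    proof (intro allI impI)
      fix x y assume xy: "x \<in> {lo..hi} \<and> y \<in> {lo..hi} \<and> x < y"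
      then have "e x < e y" "e x \<noteq> b" "e y \<noteq> b" using e b by (auto simp: strict_mono_on_def)
      then show "(e(i := b)) x < (e(i := b)) y" using i xy by auto
    qed
    then obtain E where E: "E \<in> gt_patterns lo hi (e(i := b))" "gt_cost w lo hi E = gt_min w lo hi (e(i := b))"
      using gt_min_attained by blast
    obtain E' where "E' \<in> gt_patterns lo hi e" "gt_cost w' lo hi E' \<le> gt_cost w lo hi E + c"
      using upper_bad[OF e i E(1)] .
    then have "gt_min w' lo hi e \<le> gt_min w lo hi (e(i := b)) + c"
      using E(2) gt_min_le[of E' lo hi e w'] by simp
    moreover have "gt_min w lo hi e \<le> gt_min w' lo hi e \<or> gt_min w lo hi (e(i := b)) + c \<le> gt_min w' lo hi e"
    proof -
      show ?thesis using lower[OF e C(1)] unfolding C(2)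
      proof
        assume "\<exists>j\<in>{lo..hi}. e j = b + 1 \<and> b \<notin> e ` {lo..hi} \<and> gt_min w lo hi (e(j := b)) + c \<le> gt_min w' lo hi e"
        then obtain j where j: "j \<in> {lo..hi}" "e j = b + 1" "gt_min w lo hi (e(j := b)) + c \<le> gt_min w' lo hi e" by blast
        have "j = i" using inj_onD[OF inj, of j i] i j by simp
        then show ?thesis using j by simp
      qed simp
    qed
    ultimately show "gt_min w' lo hi e = min (gt_min w lo hi e) (gt_min w lo hi (e(i := b)) + c)"
      using 1 by linarith
  }
qed

end

section \<open>Stabilization\<close>

text \<open>The price at time 0 is minus a column sum cut off at the left end A of the window: the
  first sum of \<open>M_of_fin\<close>.\<close>

definition gt_weight :: "lusztig \<Rightarrow> int \<Rightarrow> int \<Rightarrow> int \<Rightarrow> int" where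
  "gt_weight a A x t = (if t = 0 then - (\<Sum>i\<in>{A..x - 1}. int (a i x)) else int (a x (x + t)))"

definition list_enum :: "int \<Rightarrow> int set \<Rightarrow> int \<Rightarrow> int" where
  "list_enum lo S j = sorted_list_of_set S ! nat (j - lo)"

lemma list_enum_mono: "finite S \<Longrightarrow> strict_mono_on {lo..lo + int (card S) - 1} (list_enum lo S)"
  unfolding strict_mono_on_def list_enum_def
  by (auto intro!: sorted_wrt_nth_less[OF strict_sorted_list_of_set])

lemma list_enum_image:
  assumes "finite S"
  shows "list_enum lo S ` {lo..lo + int (card S) - 1} = S"
proof -
  have "(\<lambda>j. nat (j - lo)) ` {lo..lo + int (card S) - 1} = {0..<card S}"
  proof (intro set_eqI iffI)
    fix n assume "n \<in> {0..<card S}"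
    then show "n \<in> (\<lambda>j. nat (j - lo)) ` {lo..lo + int (card S) - 1}"
      by (intro image_eqI[of _ _ "lo + int n"]) auto
  qed auto
  then have "list_enum lo S ` {lo..lo + int (card S) - 1} = (!) (sorted_list_of_set S) ` {0..<card S}"
    unfolding list_enum_def by (metis (no_types, lifting) image_cong image_image)
  also have "\<dots> = S" using assms
    by (metis atLeast0LessThan length_sorted_list_of_set list.set_map map_nth set_sorted_list_of_set set_upt)
  finally show ?thesis .
qed

lemma gt_patterns_cong:
  assumes "\<And>p. p \<in> {lo..hi} \<Longrightarrow> e p = e' p"
  shows "gt_patterns lo hi e = gt_patterns lo hi e'"
  using assms by (auto simp: gt_patterns_def)

lemma gt_min_cong:
  assumes "\<And>p. p \<in> {lo..hi} \<Longrightarrow> e p = e' p"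
  shows "gt_min w lo hi e = gt_min w lo hi e'"
  using gt_patterns_cong[of lo hi e e'] assms by (simp add: gt_min_def)

lemma gt_min_eqI:
  assumes "strict_mono_on {lo..hi} e"
    and "\<And>C. C \<in> gt_patterns lo hi e \<Longrightarrow> v \<le> gt_cost w lo hi C"
    and "C \<in> gt_patterns lo hi e" "gt_cost w lo hi C \<le> v"
  shows "gt_min w lo hi e = v"
proof -
  obtain D where "D \<in> gt_patterns lo hi e" "gt_cost w lo hi D = gt_min w lo hi e"
    using gt_min_attained[OF assms(1)] .
  then show ?thesis using assms gt_min_le[OF assms(3), of w] by force
qed

lemma tableaux_eq: "tableaux I k = gt_patterns (Min I) (Min I + int (card k) - 1) (entry I k)"
  by (simp add: tableaux_def gt_patterns_def idx_range_def)

lemma entry_eq: "entry I k = list_enum (Min I) k"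
  by (simp add: entry_def list_enum_def fun_eq_iff)

lemma gt_cost_split:
  assumes C: "C \<in> gt_patterns lo hi e"
  shows "gt_cost (gt_weight a A) lo hi C = - (\<Sum>j\<in>{lo..hi}. \<Sum>i\<in>{A..e j - 1}. int (a i (e j))) +
    (\<Sum>(p, q)\<in>{(p, q). p \<in> {lo..hi} \<and> q \<in> {lo..hi} \<and> p < q}. int (a (C p q) (C p q + (q - p))))"
proof -
  have 1: "(\<Sum>t\<in>{0..hi - p}. gt_weight a A (C p (p + t)) t) =
     - (\<Sum>i\<in>{A..e p - 1}. int (a i (e p))) + (\<Sum>q\<in>{p<..hi}. int (a (C p q) (C p q + (q - p))))"
    if p: "p \<in> {lo..hi}" for p
  proof -
    have "{0..hi - p} = insert 0 {0<..hi - p}" using p by auto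
    then have "(\<Sum>t\<in>{0..hi - p}. gt_weight a A (C p (p + t)) t) =
      gt_weight a A (C p p) 0 + (\<Sum>t\<in>{0<..hi - p}. gt_weight a A (C p (p + t)) t)" by simp
    also have "gt_weight a A (C p p) 0 = - (\<Sum>i\<in>{A..e p - 1}. int (a i (e p)))"
      using gt_diag[OF C p] by (simp add: gt_weight_def)
    also have "(\<Sum>t\<in>{0<..hi - p}. gt_weight a A (C p (p + t)) t) =
      (\<Sum>q\<in>{p<..hi}. int (a (C p q) (C p q + (q - p))))"
      by (rule sum.reindex_bij_witness[of _ "\<lambda>q. q - p" "\<lambda>t. p + t"]) (auto simp: gt_weight_def)
    finally show ?thesis .
  qed
  have "(\<Sum>p\<in>{lo..hi}. \<Sum>q\<in>{p<..hi}. int (a (C p q) (C p q + (q - p)))) =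
    (\<Sum>(p, q)\<in>(SIGMA p:{lo..hi}. {p<..hi}). int (a (C p q) (C p q + (q - p))))"
    by (rule sum.Sigma) auto
  moreover have "(SIGMA p:{lo..hi}. {p<..hi}) = {(p, q). p \<in> {lo..hi} \<and> q \<in> {lo..hi} \<and> p < q}" by auto
  ultimately show ?thesis
    unfolding gt_cost_def using 1 by (simp add: sum_subtractf)
qed

lemma M_of_fin_eq:
  assumes I: "I \<in> fin_intervals" and k: "k \<subseteq> tilde I"
  shows "M_of_fin I (lusztig_restr I a) k =
    gt_min (gt_weight a (Min I)) (Min I) (Min I + int (card k) - 1) (list_enum (Min I) k)"
proof -
  define lo where "lo = Min I"
  define hi where "hi = lo + int (card k) - 1"
  define e where "e = list_enum lo k"
  define d where "d = - (\<Sum>j\<in>{lo..hi}. \<Sum>i\<in>{lo..e j - 1}. int (lusztig_restr I a i (e j)))"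
  define f where "f C = (\<Sum>(p, q)\<in>{(p, q). p \<in> {lo..hi} \<and> q \<in> {lo..hi} \<and> p < q}.
    int (lusztig_restr I a (C p q) (C p q + (q - p))))" for C :: "int \<Rightarrow> int \<Rightarrow> int"
  have fk: "finite k" using k unfolding tilde_def by (rule finite_subset) simp
  have em: "strict_mono_on {lo..hi} e" "e ` {lo..hi} = k"
    unfolding e_def hi_def using list_enum_mono[OF fk] list_enum_image[OF fk] by auto
  have et: "e j \<in> tilde I" if "j \<in> {lo..hi}" for j using em that k by auto
  have cost: "gt_cost (gt_weight a lo) lo hi C = d + f C" if C: "C \<in> gt_patterns lo hi e" for C
  proof -
    have "(\<Sum>i\<in>{lo..e j - 1}. int (lusztig_restr I a i (e j))) = (\<Sum>i\<in>{lo..e j - 1}. int (a i (e j)))"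
      if "j \<in> {lo..hi}" for j
      using et[OF that] by (intro sum.cong) (auto simp: lusztig_restr_def tilde_def lo_def)
    moreover have "lusztig_restr I a (C p q) (C p q + (q - p)) = a (C p q) (C p q + (q - p))"
      if "p \<in> {lo..hi}" "q \<in> {lo..hi}" "p < q" for p q
      using gt_bounds[OF C, of p q] et[OF that(1)] et[OF that(2)] that by (auto simp: lusztig_restr_def tilde_def)
    then have "f C = (\<Sum>(p, q)\<in>{(p, q). p \<in> {lo..hi} \<and> q \<in> {lo..hi} \<and> p < q}.
      int (a (C p q) (C p q + (q - p))))" unfolding f_def by (intro sum.cong) auto
    ultimately show ?thesis unfolding gt_cost_split[OF C] d_def by simp
  qed
  let ?S = "gt_patterns lo hi e"
  have ne: "?S \<noteq> {}" using const_gt_pattern[OF em(1)] by auto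
  have "f ` ?S = (\<lambda>x. x - d) ` gt_cost (gt_weight a lo) lo hi ` ?S"
    using cost by (auto simp: image_image)
  then have fin: "finite (f ` ?S)" using finite_gt_costs by simp
  have "M_of_fin I (lusztig_restr I a) k = d + Min (f ` ?S)"
    unfolding M_of_fin_def tableaux_eq idx_range_def entry_eq d_def f_def lo_def[symmetric] e_def[symmetric] hi_def[symmetric] ..
  also have "\<dots> = Min ((\<lambda>x. d + x) ` f ` ?S)"
    using ne fin by (intro mono_Min_commute) (auto simp: mono_def)
  also have "(\<lambda>x. d + x) ` f ` ?S = gt_cost (gt_weight a lo) lo hi ` ?S"
    using cost by (simp add: image_image)
  finally show ?thesis by (simp add: gt_min_def lo_def hi_def e_def)
qed

definition band :: "int \<Rightarrow> lusztig \<Rightarrow> bool" where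
  "band N a \<longleftrightarrow> N > 0 \<and> (\<forall>i j. \<not> i < j \<or> N \<le> j - i \<longrightarrow> a i j = 0)"

lemma lusztig_Z_band: "a \<in> lusztig_Z \<longleftrightarrow> (\<exists>N. band N a)"
  unfolding lusztig_Z_def band_def by blast

lemma band_mono: "band N a \<Longrightarrow> N \<le> N' \<Longrightarrow> band N' a"
  unfolding band_def by auto

text \<open>A new particle at A - 1 is held in place as long as e j = j, and beyond that the entries
  of row A - 1 met by resting vanish by the band condition. What it pays is what the other particles
  gain at time 0 when their column sums are extended by row A - 1.\<close>

lemma gt_min_stable_step:
  assumes a: "band N a" and e: "strict_mono_on {A - 1..r} e" and low: "\<And>j. A - 1 \<le> j \<Longrightarrow> j \<le> m \<Longrightarrow> e j = j"
    and A: "A + N \<le> m" "m \<le> r"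
  shows "gt_min (gt_weight a (A - 1)) (A - 1) r e = gt_min (gt_weight a A) A r e"
proof -
  have N: "0 < N" and z: "a i j = 0" if "N \<le> j - i" for i j using a that by (auto simp: band_def)
  have N: "0 < N" using a by (simp add: band_def)
  have eA: "strict_mono_on {A..r} e" using e by (rule monotone_on_subset) auto
  have esum: "(\<Sum>p\<in>{A..r}. int (a (A - 1) (e p))) = (\<Sum>p\<in>{A..r}. int (a (A - 1) p))"
  proof (rule sum.cong)
    fix p assume p: "p \<in> {A..r}"
    show "int (a (A - 1) (e p)) = int (a (A - 1) p)"
    proof (cases "p \<le> m")
      case False
      then have "e m < e p" using p A N strict_mono_onD[OF e, of m p] by simp
      then have "m < e p" using low[of m] A N by simp
      then show ?thesis using z[of "e p" "A - 1"] z[of p "A - 1"] False A by simp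
    qed (use p low in simp)
  qed simp
  have esum2: "(\<Sum>p\<in>{A..r}. int (a (A - 1) p)) = (\<Sum>p\<in>{A..m}. int (a (A - 1) p))"
    using A z by (intro sum.mono_neutral_right) auto
  have shift: "gt_cost (gt_weight a (A - 1)) A r C = gt_cost (gt_weight a A) A r C - (\<Sum>p\<in>{A..r}. int (a (A - 1) (e p)))"
    if C: "C \<in> gt_patterns A r e" for C
  proof -
    have "(\<Sum>i\<in>{A - 1..e p - 1}. int (a i (e p))) = int (a (A - 1) (e p)) + (\<Sum>i\<in>{A..e p - 1}. int (a i (e p)))"
      if "p \<in> {A..r}" for p
    proof -
      have "A \<le> e p"
      proof -
        have "A \<le> m" using A N by simp
        then have "e A = A" using low by simp
        then show ?thesis using strict_mono_onD[OF e, of A p] that by (cases "p = A") auto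
      qed
      then have "{A - 1..e p - 1} = insert (A - 1) {A..e p - 1}" by auto
      then show ?thesis by simp
    qed
    then show ?thesis unfolding gt_cost_split[OF C] by (simp add: sum.distrib)
  qed
  have rowsplit: "gt_cost w (A - 1) r C = (\<Sum>t\<in>{0..r - (A - 1)}. w (C (A - 1) (A - 1 + t)) t) + gt_cost w A r C" for w C
  proof -
    have "{A - 1..r} = insert (A - 1) {A..r}" using A N by auto
    then show ?thesis by (simp add: gt_cost_def)
  qed
  have row0: "(\<Sum>t\<in>{0..r - (A - 1)}. gt_weight a (A - 1) (C (A - 1) (A - 1 + t)) t) =
      (\<Sum>q\<in>{A..r}. int (a (C (A - 1) q) (C (A - 1) q + (q - (A - 1)))))"
    if "C (A - 1) (A - 1) = A - 1" for C :: "int \<Rightarrow> int \<Rightarrow> int"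
  proof -
    have "{0..r - (A - 1)} = insert 0 {0<..r - (A - 1)}" using A N by auto
    then have "(\<Sum>t\<in>{0..r - (A - 1)}. gt_weight a (A - 1) (C (A - 1) (A - 1 + t)) t) =
      (\<Sum>t\<in>{0<..r - (A - 1)}. gt_weight a (A - 1) (C (A - 1) (A - 1 + t)) t)"
      using that by (simp add: gt_weight_def)
    also have "\<dots> = (\<Sum>q\<in>{A..r}. int (a (C (A - 1) q) (C (A - 1) q + (q - (A - 1)))))"
      by (rule sum.reindex_bij_witness[of _ "\<lambda>q. q - (A - 1)" "\<lambda>t. A - 1 + t"]) (auto simp: gt_weight_def)
    finally show ?thesis .
  qed
  obtain C where C: "C \<in> gt_patterns A r e" "gt_cost (gt_weight a A) A r C = gt_min (gt_weight a A) A r e"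
    using gt_min_attained[OF eA] .
  \<comment> \<open>An old optimum with the new particle at rest.\<close>
  let ?C = "\<lambda>p q. if p = A - 1 then A - 1 else C p q"
  show ?thesis
  proof (rule gt_min_eqI[OF e])
    have eA': "e A = A" "e (A - 1) = A - 1" using low[of A] low[of "A - 1"] A N by auto
    show P: "?C \<in> gt_patterns (A - 1) r e"
      unfolding gt_patterns_def
    proof (intro CollectI conjI ballI allI impI)
      fix p assume "p \<in> {A - 1..r}"
      then show "?C p p = e p" using eA' gt_diag[OF C(1)] by auto
      fix q assume "p \<le> q \<and> q + 1 \<in> {A - 1..r}"
      then show "?C p q \<le> ?C p (q + 1)" using gt_row[OF C(1), of p q "q + 1"] \<open>p \<in> {A - 1..r}\<close> by auto
    next
      fix p q assume pq: "p \<in> {A - 1..r}" "q \<in> {A - 1..r}" "p < q"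
      then show "?C p q < ?C (p + 1) q"
        using gt_col[OF C(1), of p "p + 1" q] gt_bounds(1)[OF C(1), of A q] eA' by auto
    qed
    have "gt_cost (gt_weight a (A - 1)) A r ?C = gt_cost (gt_weight a (A - 1)) A r C"
      unfolding gt_cost_def by (intro sum.cong) auto
    then have "gt_cost (gt_weight a (A - 1)) (A - 1) r ?C =
        (\<Sum>q\<in>{A..r}. int (a (A - 1) q)) + gt_cost (gt_weight a (A - 1)) A r C"
      unfolding rowsplit using row0[of ?C] by simp
    then show "gt_cost (gt_weight a (A - 1)) (A - 1) r ?C \<le> gt_min (gt_weight a A) A r e"
      using shift[OF C(1)] esum C(2) by simp
  next
    fix D assume D: "D \<in> gt_patterns (A - 1) r e"
    have DA: "D \<in> gt_patterns A r e" using D by (auto simp: gt_patterns_def)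
    have d0: "D (A - 1) q = A - 1" if "A - 1 \<le> q" "q \<le> m" for q
      using gt_bounds[OF D, of "A - 1" q] low[of q] low[of "A - 1"] that A N by simp
    have "(\<Sum>p\<in>{A..m}. int (a (A - 1) p)) = (\<Sum>q\<in>{A..m}. int (a (D (A - 1) q) (D (A - 1) q + (q - (A - 1)))))"
      using d0 by (intro sum.cong) auto
    also have "\<dots> \<le> (\<Sum>q\<in>{A..r}. int (a (D (A - 1) q) (D (A - 1) q + (q - (A - 1)))))"
      using A by (intro sum_mono2) auto
    finally have "gt_cost (gt_weight a A) A r D \<le> gt_cost (gt_weight a (A - 1)) (A - 1) r D"
      unfolding rowsplit using row0[of D] d0[of "A - 1"] shift[OF DA] esum esum2 A N by simp
    then show "gt_min (gt_weight a A) A r e \<le> gt_cost (gt_weight a (A - 1)) (A - 1) r D"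
      using gt_min_le[OF DA, of "gt_weight a A"] by simp
  qed
qed

text \<open>The normalization \<open>e j = j\<close> for \<open>j \<le> m\<close> makes \<open>r\<close> the charge of \<open>k\<close>.\<close>

definition is_enum :: "int set \<Rightarrow> int \<Rightarrow> (int \<Rightarrow> int) \<Rightarrow> int \<Rightarrow> bool" where
  "is_enum k r e m \<longleftrightarrow> strict_mono_on {..r} e \<and> e ` {..r} = k \<and> m \<le> r \<and> (\<forall>j\<le>m. e j = j)"

lemma gt_min_stable:
  assumes a: "band N a" and e: "is_enum k r e m" and A: "A + N \<le> m" "A' \<le> A"
  shows "gt_min (gt_weight a A') A' r e = gt_min (gt_weight a A) A r e"
  using A(2)
proof (induction A' rule: int_le_induct)
  case (step i)
  have "strict_mono_on {i - 1..r} e" using e by (auto simp: is_enum_def intro: monotone_on_subset)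
  then show ?case using gt_min_stable_step[OF a, of i r e m] e A step by (auto simp: is_enum_def)
qed simp

lemma is_enum_mono:
  assumes "is_enum k r e m" "i \<le> r" "j \<le> r"
  shows "i < j \<Longrightarrow> e i < e j" "i \<le> j \<Longrightarrow> e i \<le> e j" "e i = e j \<Longrightarrow> i = j"
proof -
  have *: "x < y \<Longrightarrow> x \<le> r \<Longrightarrow> y \<le> r \<Longrightarrow> e x < e y" for x y
    using assms(1) by (auto simp: is_enum_def strict_mono_on_def)
  show "i < j \<Longrightarrow> e i < e j" using * assms by simp
  show "i \<le> j \<Longrightarrow> e i \<le> e j" using *[of i j] assms by (cases "i = j") auto
  show "e i = e j \<Longrightarrow> i = j" using *[of i j] *[of j i] assms by (cases i j rule: linorder_cases) auto
qed

lemma is_enum_low: "is_enum k r e m \<Longrightarrow> m' \<le> m \<Longrightarrow> is_enum k r e m'"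
  by (auto simp: is_enum_def)

text \<open>Counting the elements of k between m and e j recovers j, which makes the enumeration and
  the charge canonical.\<close>

lemma is_enum_rank:
  assumes e: "is_enum k r e m" and j: "m \<le> j" "j \<le> r"
  shows "int (card (k \<inter> {m<..e j})) = j - m"
proof -
  have m: "m \<le> r" "e m = m" using e by (auto simp: is_enum_def)
  have "k \<inter> {m<..e j} = e ` {m<..j}"
  proof (intro set_eqI iffI)
    fix x assume x: "x \<in> k \<inter> {m<..e j}"
    then obtain i where i: "i \<le> r" "x = e i" using e by (auto simp: is_enum_def)
    have "m < i" using is_enum_mono(2)[OF e, of i m] i m x by (cases "m < i") auto
    moreover have "i \<le> j" using is_enum_mono(1)[OF e, of j i] i j x by (cases "i \<le> j") auto
    ultimately show "x \<in> e ` {m<..j}" using i by auto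
  next
    fix x assume "x \<in> e ` {m<..j}"
    then obtain i where i: "m < i" "i \<le> j" "x = e i" by auto
    then show "x \<in> k \<inter> {m<..e j}"
      using is_enum_mono(1)[OF e, of m i] is_enum_mono(2)[OF e, of i j] j m e by (auto simp: is_enum_def)
  qed
  moreover have "inj_on e {m<..j}" using is_enum_mono(3)[OF e] j by (auto simp: inj_on_def)
  ultimately show ?thesis using j by (simp add: card_image)
qed

lemma is_enum_unique:
  assumes e: "is_enum k r e m" and f: "is_enum k r' f m'"
  shows "r = r'" "\<And>j. j \<le> r \<Longrightarrow> e j = f j"
proof -
  define n where "n = min m m'"
  have main: "j \<le> s' \<and> g' j = g j"
    if g: "is_enum k s g n" and g': "is_enum k s' g' n" and j: "j \<le> s" for s g s' g' j
  proof (cases "j < n")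
    case True
    then show ?thesis using g g' by (auto simp: is_enum_def)
  next
    case False
    have "g j \<in> k" using g j by (auto simp: is_enum_def)
    then obtain i where i: "i \<le> s'" "g j = g' i" using g' by (auto simp: is_enum_def)
    have "n \<le> i"
    proof (rule ccontr)
      assume "\<not> n \<le> i"
      then have "g' i < n" using g' by (auto simp: is_enum_def)
      moreover have "n \<le> g j" using is_enum_mono(2)[OF g, of n j] g j False by (auto simp: is_enum_def)
      ultimately show False using i by simp
    qed
    then have "j = i" using is_enum_rank[OF g, of j] is_enum_rank[OF g', of i] i j False by simp
    then show ?thesis using i by simp
  qed
  have E: "is_enum k r e n" "is_enum k r' f n" using is_enum_low e f by (auto simp: n_def)
  show "r = r'" using main[OF E, of r] main[OF E(2,1), of r'] by simp
  show "e j = f j" if "j \<le> r" for j using main[OF E that] by simp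
qed

lemma is_enum_list:
  assumes "finite S" "S \<subseteq> {lo..}"
  shows "is_enum ({..<lo} \<union> S) (lo + int (card S) - 1) (\<lambda>j. if j < lo then j else list_enum lo S j) (lo - 1)"
    (is "is_enum _ ?r ?e _")
proof -
  note L = list_enum_mono[OF assms(1), of lo] list_enum_image[OF assms(1), of lo]
  have "{..?r} = {..<lo} \<union> {lo..?r}" by auto
  then have "?e ` {..?r} = ?e ` {..<lo} \<union> ?e ` {lo..?r}" by (metis image_Un)
  also have "?e ` {lo..?r} = list_enum lo S ` {lo..?r}" by (intro image_cong) auto
  finally have "?e ` {..?r} = {..<lo} \<union> S" using L(2) by auto
  moreover have "strict_mono_on {..?r} ?e"
    unfolding strict_mono_on_def
  proof (intro allI impI)
    fix x y assume xy: "x \<in> {..?r} \<and> y \<in> {..?r} \<and> x < y"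
    consider "y < lo" | "x < lo" "lo \<le> y" | "lo \<le> x" using xy by linarith
    then show "?e x < ?e y"
    proof cases
      case 2
      then have "list_enum lo S y \<in> S" using L(2) xy by auto
      then show ?thesis using 2 assms(2) by auto
    next
      case 3
      then show ?thesis using strict_mono_onD[OF L(1), of x y] xy by auto
    qed (use xy in auto)
  qed
  ultimately show ?thesis by (auto simp: is_enum_def)
qed

section \<open>Maya diagrams and the evaluation of the stabilized components\<close>

lemma maya_iff_enum: "k \<in> maya \<longleftrightarrow> (\<exists>r e m. is_enum k r e m)"
proof
  assume "k \<in> maya"
  then obtain r p q where k: "{..r - int p} \<subseteq> k" "finite (k \<inter> {r - int p<..})"
    unfolding maya_def by blast
  have "k = {..<r - int p + 1} \<union> (k \<inter> {r - int p<..})" using k(1) by auto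
  moreover have "k \<inter> {r - int p<..} \<subseteq> {r - int p + 1..}" by auto
  ultimately show "\<exists>r e m. is_enum k r e m"
    using is_enum_list[OF k(2), of "r - int p + 1"] by metis
next
  assume "\<exists>r e m. is_enum k r e m"
  then obtain r e m where e: "is_enum k r e m" by blast
  then have m: "m \<le> r" "e m = m" by (auto simp: is_enum_def)
  define p where "p = nat (r - m)"
  define q where "q = nat (e r - r)"
  have "{..r - int p} \<subseteq> k"
  proof
    fix x assume "x \<in> {..r - int p}"
    then have "e x = x" "x \<le> r" using e m by (auto simp: is_enum_def p_def)
    then show "x \<in> k" using e unfolding is_enum_def by force
  qed
  moreover have er: "x \<le> e r" if "x \<in> k" for x
    using that e is_enum_mono(2)[OF e, of _ r] by (auto simp: is_enum_def)
  then have "k \<subseteq> {..r + int q}" by (fastforce simp: q_def)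
  moreover have "k \<inter> {r - int p<..} = k \<inter> {m<..e r}" using er m by (auto simp: p_def)
  then have "finite (k \<inter> {r - int p<..})" "card (k \<inter> {r - int p<..}) = p"
    using is_enum_rank[OF e, of r] m by (auto simp: p_def)
  ultimately show "k \<in> maya" unfolding maya_def by blast
qed

lemma maya_on_iff:
  assumes "I \<in> fin_intervals"
  shows "k \<in> maya_on I \<longleftrightarrow> {..<Min I} \<subseteq> k \<and> k \<subseteq> {..Max I + 1} \<and> k \<inter> tilde I \<noteq> {} \<and> \<not> tilde I \<subseteq> k"
proof
  assume "k \<in> maya_on I"
  then obtain S where S: "k = {..<Min I} \<union> S" "S \<subseteq> tilde I" "S \<noteq> {}" "S \<noteq> tilde I"
    by (auto simp: maya_on_def M_fin_x_def M_fin_def)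
  then show "{..<Min I} \<subseteq> k \<and> k \<subseteq> {..Max I + 1} \<and> k \<inter> tilde I \<noteq> {} \<and> \<not> tilde I \<subseteq> k"
    using fin_intervalsE[OF assms] by (fastforce simp: tilde_def)
next
  assume k: "{..<Min I} \<subseteq> k \<and> k \<subseteq> {..Max I + 1} \<and> k \<inter> tilde I \<noteq> {} \<and> \<not> tilde I \<subseteq> k"
  then have "k = {..<Min I} \<union> (k \<inter> tilde I)" by (auto simp: tilde_def)
  moreover have "k \<inter> tilde I \<in> M_fin_x I" using k by (auto simp: M_fin_x_def M_fin_def)
  ultimately show "k \<in> maya_on I" unfolding maya_on_def by blast
qed

lemma res_Un: "I \<in> fin_intervals \<Longrightarrow> k \<in> maya_on I \<Longrightarrow> {..<Min I} \<union> res I k = k"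
  unfolding maya_on_iff by (auto simp: res_def tilde_def)

lemma M_of_fin_enum:
  assumes I: "I \<in> fin_intervals" and k: "k \<in> maya_on I" and e: "is_enum k r e m"
  shows "M_of_fin I (lusztig_restr I a) (res I k) = gt_min (gt_weight a (Min I)) (Min I) r e"
proof -
  let ?S = "res I k"
  have S: "?S \<subseteq> tilde I" "finite ?S" "?S \<subseteq> {Min I..}" by (auto simp: res_def tilde_def)
  have E: "is_enum k (Min I + int (card ?S) - 1) (\<lambda>j. if j < Min I then j else list_enum (Min I) ?S j) (Min I - 1)"
    using is_enum_list[OF S(2,3)] res_Un[OF I k] by simp
  have r: "r = Min I + int (card ?S) - 1" using is_enum_unique(1)[OF e E] .
  have "e j = list_enum (Min I) ?S j" if "j \<in> {Min I..r}" for j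
    using is_enum_unique(2)[OF e E, of j] that by auto
  then show ?thesis
    unfolding M_of_fin_eq[OF I S(1)] r[symmetric] by (intro gt_min_cong) auto
qed

lemma fin_interval_hull:
  assumes "I \<in> fin_intervals" "J \<in> fin_intervals"
  obtains K where "K \<in> fin_intervals" "I \<subseteq> K" "J \<subseteq> K"
proof -
  obtain a b where 1: "I = {a..b}" "a \<le> b" using assms(1) by (auto simp: fin_intervals_def)
  obtain c d where 2: "J = {c..d}" "c \<le> d" using assms(2) by (auto simp: fin_intervals_def)
  have "min a c \<le> max b d" using 1 by simp
  then have "{min a c..max b d} \<in> fin_intervals" unfolding fin_intervals_def by blast
  then show ?thesis using that[of "{min a c..max b d}"] 1 2 by auto
qed

lemma fin_intervals_subset:
  assumes "I \<in> fin_intervals" "J \<in> fin_intervals" "I \<subseteq> J"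
  shows "Min J \<le> Min I" "Max I \<le> Max J" "tilde I \<subseteq> tilde J"
proof -
  have f: "finite I" "finite J" "I \<noteq> {}" "J \<noteq> {}" using assms by (auto simp: fin_intervals_def)
  show 1: "Min J \<le> Min I" "Max I \<le> Max J" using f assms(3) by (auto intro: Min_antimono Max_mono)
  then show "tilde I \<subseteq> tilde J" by (auto simp: tilde_def)
qed

lemma maya_on_mono:
  assumes "I \<in> fin_intervals" "J \<in> fin_intervals" "I \<subseteq> J" "k \<in> maya_on I"
  shows "k \<in> maya_on J"
  using assms(4) fin_intervals_subset[OF assms(1-3)]
  unfolding maya_on_iff[OF assms(1)] maya_on_iff[OF assms(2)] by fastforce

text \<open>All sufficiently large windows give the same minimum, and two candidates for the limit
  are compared on a common larger interval. Stabilization survives in later arguments only as the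
  inequality A + N <= m.\<close>

lemma Phi_Z_eq:
  assumes a: "band N a" and e: "is_enum k r e m" and A: "A + N \<le> m"
  shows "Phi_Z a k = gt_min (gt_weight a A) A r e"
proof -
  let ?v = "gt_min (gt_weight a A) A r e"
  define P where "P v \<longleftrightarrow> (\<exists>I\<^sub>0\<in>fin_intervals. \<forall>I\<in>fin_intervals. I\<^sub>0 \<subseteq> I \<longrightarrow>
             k \<in> maya_on I \<and> M_of_fin I (lusztig_restr I a) (res I k) = v)" for v
  have k: "k \<in> maya" using e maya_iff_enum by blast
  have N: "0 < N" using a by (simp add: band_def)
  have m: "m \<le> r" "e m = m" using e by (auto simp: is_enum_def)
  have kb: "x \<le> e r" if "x \<in> k" for x
    using that e is_enum_mono(2)[OF e, of _ r] by (auto simp: is_enum_def)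
  have kl: "x \<in> k" if "x \<le> m" for x
  proof -
    have "e x = x" "x \<le> r" using e that by (auto simp: is_enum_def)
    then show ?thesis using e unfolding is_enum_def by force
  qed
  define I0 where "I0 = {A..max A (e r)}"
  have I0: "I0 \<in> fin_intervals" "Min I0 = A" "Max I0 = max A (e r)"
    by (auto simp: I0_def fin_intervals_def intro: Min_eqI Max_eqI)
  have "k \<in> maya_on I0"
    unfolding maya_on_iff[OF I0(1)] tilde_def I0
  proof (intro conjI)
    show "{..<A} \<subseteq> k" using kl A N by auto
    show "k \<subseteq> {..max A (e r) + 1}" using kb by fastforce
    have "A \<in> k" using kl A N by auto
    then show "k \<inter> {A..max A (e r) + 1} \<noteq> {}" by auto
    have "max A (e r) + 1 \<notin> k" using kb by fastforce
    moreover have "max A (e r) + 1 \<in> {A..max A (e r) + 1}" by simp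
    ultimately show "\<not> {A..max A (e r) + 1} \<subseteq> k" by blast
  qed
  then have *: "k \<in> maya_on I \<and> M_of_fin I (lusztig_restr I a) (res I k) = ?v"
    if "I \<in> fin_intervals" "I0 \<subseteq> I" for I
    using maya_on_mono[OF I0(1) that] M_of_fin_enum[OF that(1) _ e]
      gt_min_stable[OF a e A, of "Min I"] fin_intervals_subset(1)[OF I0(1) that] I0(2) by simp
  then have Pv: "P ?v" unfolding P_def using I0(1) by blast
  have "v = ?v" if v: "P v" for v
  proof -
    obtain I1 where I1: "I1 \<in> fin_intervals" "\<forall>I\<in>fin_intervals. I1 \<subseteq> I \<longrightarrow>
      k \<in> maya_on I \<and> M_of_fin I (lusztig_restr I a) (res I k) = v" using v unfolding P_def by blast
    obtain K where K: "K \<in> fin_intervals" "I0 \<subseteq> K" "I1 \<subseteq> K" using fin_interval_hull[OF I0(1) I1(1)] .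
    then have "M_of_fin K (lusztig_restr K a) (res K k) = v" using I1(2) by blast
    then show ?thesis using *[OF K(1,2)] by simp
  qed
  then have "(THE v. P v) = ?v" using Pv by (intro the_equality) blast+
  moreover have "Phi_Z a k = (THE v. P v)" using k by (simp only: Phi_Z_def P_def if_True)
  ultimately show ?thesis by simp
qed

section \<open>Lusztig data and the components of Phi\<close>

lemma bandD: "band N a \<Longrightarrow> a i j \<noteq> 0 \<Longrightarrow> i < j \<and> j - i < N"
  unfolding band_def by (meson not_less)

lemma A_star_sum:
  assumes a: "band N a" and T: "p + N \<le> T + 1"
  shows "A_star p a k = (\<Sum>t\<in>{k + 1..T}. int (a p t) - int (a (p + 1) (t + 1)))"
  unfolding A_star_def
proof (rule sum.mono_neutral_cong_left)
  show "{t. k + 1 \<le> t \<and> (a p t \<noteq> 0 \<or> a (p + 1) (t + 1) \<noteq> 0)} \<subseteq> {k + 1..T}"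
  proof
    fix t assume t: "t \<in> {t. k + 1 \<le> t \<and> (a p t \<noteq> 0 \<or> a (p + 1) (t + 1) \<noteq> 0)}"
    then have "t - p < N" using bandD[OF a, of p t] bandD[OF a, of "p + 1" "t + 1"] by auto
    then show "t \<in> {k + 1..T}" using t T by simp
  qed
qed auto

lemma A_star_step:
  assumes "band N a"
  shows "A_star p a k = int (a p (k + 1)) - int (a (p + 1) (k + 2)) + A_star p a (k + 1)"
proof -
  define T where "T = max (p + N) (k + 1)"
  have "{k + 1..T} = insert (k + 1) {k + 2..T}" by (auto simp: T_def)
  then show ?thesis
    unfolding A_star_sum[OF assms, of p T, simplified T_def, simplified]
    using A_star_sum[OF assms, of p T k] A_star_sum[OF assms, of p T "k + 1"]
    by (simp add: T_def algebra_simps)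
qed

lemma A_star_diff:
  assumes "band N a" "k \<le> k'"
  shows "A_star p a k = A_star p a k' + (\<Sum>t\<in>{k..<k'}. int (a p (t + 1)) - int (a (p + 1) (t + 2)))"
  using assms(2)
proof (induction k' rule: int_ge_induct)
  case (step i)
  have "{k..<i + 1} = insert i {k..<i}" using step by auto
  then show ?case using step A_star_step[OF assms(1), of p i] by simp
qed simp

lemma A_star_zero: "band N a \<Longrightarrow> p + N \<le> k + 1 \<Longrightarrow> A_star p a k = 0"
  using A_star_sum[of N a p k k] by simp

lemma finite_A_star: "band N a \<Longrightarrow> finite (A_star p a ` {p..})"
proof (rule finite_subset)
  assume "band N a"
  then show "A_star p a ` {p..} \<subseteq> A_star p a ` {p..p + N} \<union> {0}"
    using A_star_zero[of N a p] by force
qed simp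

lemma eps_star_ge: "band N a \<Longrightarrow> p \<le> k \<Longrightarrow> A_star p a k \<le> eps_star p a"
  unfolding eps_star_def using finite_A_star by (intro Max_ge) auto

lemma eps_star_attained: "band N a \<Longrightarrow> \<exists>k\<ge>p. A_star p a k = eps_star p a"
  using Max_in[OF finite_A_star, of N a p] unfolding eps_star_def by fastforce

lemma eps_star_nonneg: "band N a \<Longrightarrow> 0 \<le> eps_star p a"
  using eps_star_ge[of N a p "p + N"] A_star_zero[of N a p "p + N"] by (simp add: band_def)

lemma eps_starI:
  assumes "band N a" "\<And>k. p \<le> k \<Longrightarrow> A_star p a k \<le> v" "p \<le> k0" "A_star p a k0 = v"
  shows "eps_star p a = v"
  using eps_star_attained[OF assms(1), of p] eps_star_ge[OF assms(1,3)] assms(2,4) by force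

text \<open>On the integers \<open>Least\<close> is meaningful only for predicates bounded below;
  the principle for natural numbers is shifted by the bound p.\<close>

lemma int_Least:
  fixes P :: "int \<Rightarrow> bool"
  assumes "\<exists>k. P k" "\<And>k. P k \<Longrightarrow> p \<le> k"
  shows "P (Least P)" "\<And>k. P k \<Longrightarrow> Least P \<le> k"
proof -
  obtain k where k: "P k" using assms(1) by blast
  define n where "n = (LEAST n. P (p + int n))"
  have "P (p + int (nat (k - p)))" using k assms(2)[OF k] by simp
  then have n: "P (p + int n)" unfolding n_def by (rule LeastI)
  have "p + int n \<le> j" if "P j" for j
  proof -
    have "P (p + int (nat (j - p)))" using that assms(2)[OF that] by simp
    then have "n \<le> nat (j - p)" unfolding n_def by (rule Least_le)
    then show ?thesis using assms(2)[OF that] by simp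
  qed
  then have "Least P = p + int n" using n by (intro Least_equality)
  then show "P (Least P)" "\<And>k. P k \<Longrightarrow> Least P \<le> k" using n \<open>\<And>j. P j \<Longrightarrow> p + int n \<le> j\<close> by auto
qed

lemma k_f_props:
  assumes "band N a"
  shows "p \<le> k_f p a" "A_star p a (k_f p a) = eps_star p a"
    "\<And>k. p \<le> k \<Longrightarrow> k < k_f p a \<Longrightarrow> A_star p a k < eps_star p a"
proof -
  let ?P = "\<lambda>k. p \<le> k \<and> A_star p a k = eps_star p a"
  have ex: "\<exists>k. ?P k" using eps_star_attained[OF assms] by blast
  note L = int_Least[of ?P p, OF ex]
  show "p \<le> k_f p a" "A_star p a (k_f p a) = eps_star p a" using L(1) unfolding k_f_def by auto
  show "A_star p a k < eps_star p a" if "p \<le> k" "k < k_f p a" for k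
    using L(2)[of k] that eps_star_ge[OF assms that(1)] unfolding k_f_def by force
qed

lemma k_fI:
  assumes "p \<le> k" "A_star p a k = eps_star p a" "\<And>k'. p \<le> k' \<Longrightarrow> k' < k \<Longrightarrow> A_star p a k' < eps_star p a"
  shows "k_f p a = k"
  unfolding k_f_def
proof (rule Least_equality)
  show "k \<le> y" if "p \<le> y \<and> A_star p a y = eps_star p a" for y
    using that assms(3)[of y] by (cases "k \<le> y") auto
qed (use assms in auto)

lemma k_eI:
  assumes "p \<le> k" "A_star p a k = eps_star p a" "\<And>k'. k < k' \<Longrightarrow> A_star p a k' < eps_star p a"
  shows "k_e p a = k"
  unfolding k_e_def
proof (rule Greatest_equality)
  show "y \<le> k" if "p \<le> y \<and> A_star p a y = eps_star p a" for y
    using that assms(3)[of y] by (cases "y \<le> k") auto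
qed (use assms in auto)

text \<open>The partial sums vanish far out, so a positive maximum is attained on a bounded set
  only. If the maximum is 0, it is attained arbitrarily far out and there is no greatest
  place.\<close>

lemma k_e_props:
  assumes a: "band N a" and eps: "0 < eps_star p a"
  shows "p \<le> k_e p a" "A_star p a (k_e p a) = eps_star p a" "k_e p a < p + N"
    "\<And>k. k_e p a < k \<Longrightarrow> A_star p a k < eps_star p a"
proof -
  let ?S = "{k. p \<le> k \<and> A_star p a k = eps_star p a}"
  have sub: "?S \<subseteq> {p..p + N}"
  proof
    fix k assume "k \<in> ?S"
    then show "k \<in> {p..p + N}" using A_star_zero[OF a, of p k] eps by (cases "k \<le> p + N") auto
  qed
  then have fin: "finite ?S" by (rule finite_subset) simp
  have ne: "?S \<noteq> {}" using eps_star_attained[OF a] by blast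
  have M: "Max ?S \<in> ?S" using Max_in[OF fin ne] .
  have G: "k_e p a = Max ?S"
  proof (rule k_eI)
    show "A_star p a k' < eps_star p a" if "Max ?S < k'" for k'
    proof -
      have "k' \<notin> ?S" using Max_ge[OF fin, of k'] that by auto
      then show ?thesis using eps_star_ge[OF a, of p k'] that M by force
    qed
  qed (use M in auto)
  show "p \<le> k_e p a" "A_star p a (k_e p a) = eps_star p a" using M G by auto
  then show "k_e p a < p + N" using A_star_zero[OF a, of p "k_e p a"] eps by (cases "k_e p a < p + N") auto
  show "A_star p a k < eps_star p a" if "k_e p a < k" for k
  proof -
    have "k \<notin> ?S" using Max_ge[OF fin, of k] that G by auto
    then show ?thesis using eps_star_ge[OF a, of p k] that M G by force
  qed
qed

lemma band_f_star:
  assumes a: "band N a" and N': "N \<le> N'" "k_f p a - p + 2 \<le> N'"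
  shows "band N' (f_star p a)"
proof -
  have "f_star p a i j = 0" if "\<not> i < j \<or> N' \<le> j - i" for i j
  proof -
    have "a i j = 0" "j \<noteq> k_f p a + 1 \<or> i \<noteq> p"
      using a that N' k_f_props(1)[OF a, of p] by (auto simp: band_def)
    then show ?thesis by (auto simp: f_star_def)
  qed
  then show ?thesis using a N' by (auto simp: band_def)
qed

text \<open>The partial sum rises strictly on reaching its first maximum. So the entry lowered by
  \<open>f_star\<close> is positive, and subtraction in nat is not truncated.\<close>

lemma f_star_pos:
  assumes a: "band N a" and k: "p < k_f p a"
  shows "0 < a (p + 1) (k_f p a + 1)"
  using A_star_step[OF a, of p "k_f p a - 1"] k_f_props(2)[OF a, of p]
    k_f_props(3)[OF a, of p "k_f p a - 1"] k by (simp add: algebra_simps)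

definition col_sum :: "lusztig \<Rightarrow> int \<Rightarrow> int" where
  "col_sum a x = (\<Sum>i\<in>{i. i < x \<and> a i x \<noteq> 0}. int (a i x))"

lemma col_sum_eq:
  assumes a: "band N a" and A: "A + N \<le> x"
  shows "(\<Sum>i\<in>{A..x - 1}. int (a i x)) = col_sum a x"
  unfolding col_sum_def
proof (rule sum.mono_neutral_cong_right)
  show "{i. i < x \<and> a i x \<noteq> 0} \<subseteq> {A..x - 1}"
  proof
    fix i assume i: "i \<in> {i. i < x \<and> a i x \<noteq> 0}"
    then have "x - i < N" using bandD[OF a, of i x] by auto
    then show "i \<in> {A..x - 1}" using i A by simp
  qed
qed auto

text \<open>The constant c of \<open>gt_move\<close> in terms of a:
  \<open>col_sum a p - col_sum a (p + 1)\<close> is the price difference at time 0,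
  \<open>eps_star p a - A_star p a p\<close> is the rise of the partial sums from there to their
  maximum, and one is subtracted.\<close>

definition f_const :: "int \<Rightarrow> lusztig \<Rightarrow> int" where
  "f_const p a = eps_star p a - A_star p a p - col_sum a (p + 1) + col_sum a p - 1"

lemma gt_move_f_star:
  assumes a: "band N a" and A: "A + N \<le> p"
  shows "gt_move (gt_weight a A) (gt_weight (f_star p a) A) p (k_f p a + 1 - p) (f_const p a)"
proof
  let ?w = "gt_weight a A" and ?k = "k_f p a" and ?s = "k_f p a + 1 - p"
  have N: "0 < N" using a by (simp add: band_def)
  note K = k_f_props[OF a, of p]
  show "1 \<le> ?s" using K(1) by simp
  \<comment> \<open>Sums of price differences become differences of \<open>A_star\<close>; the cut
    before time s corresponds to the index k = p + s - 1.\<close>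
  have S: "(\<Sum>t\<in>{u..<s}. ?w (p + 1) t - ?w p t) = A_star p a (p + s - 1) - A_star p a (p + u - 1)"
    if "1 \<le> u" "u \<le> s" for u s
  proof -
    have "(\<Sum>t\<in>{u..<s}. ?w (p + 1) t - ?w p t) =
      (\<Sum>t\<in>{p + u - 1..<p + s - 1}. int (a (p + 1) (t + 2)) - int (a p (t + 1)))"
      using that by (intro sum.reindex_bij_witness[of _ "\<lambda>t. t - p + 1" "\<lambda>t. p + t - 1"])
        (auto simp: gt_weight_def algebra_simps)
    also have "\<dots> = - (\<Sum>t\<in>{p + u - 1..<p + s - 1}. int (a p (t + 1)) - int (a (p + 1) (t + 2)))"
      by (simp add: sum_negf[symmetric])
    finally show ?thesis using A_star_diff[OF a, of "p + u - 1" "p + s - 1" p] that by simp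
  qed
  show "(\<Sum>t\<in>{u..<?s}. ?w (p + 1) t - ?w p t) \<ge> 1" if "1 \<le> u" "u < ?s" for u
    using S[of u ?s] K(2) K(3)[of "p + u - 1"] that by simp
  show "(\<Sum>t\<in>{?s..<s}. ?w (p + 1) t - ?w p t) \<le> 0" if "?s \<le> s" for s
    using S[of ?s s] K(1,2) eps_star_ge[OF a, of p "p + s - 1"] that by simp
  have "{0..<?s} = insert 0 {1..<?s}" using K(1) by auto
  then show "f_const p a = (\<Sum>t\<in>{0..<?s}. ?w (p + 1) t - ?w p t) - 1"
    using S[of 1 ?s] K(1,2) col_sum_eq[OF a, of A p] col_sum_eq[OF a, of A "p + 1"] A N
    by (simp add: f_const_def gt_weight_def)
  show "gt_weight (f_star p a) A x t = ?w x t + (if x = p \<and> t = ?s then 1 else 0) - (if x = p + 1 \<and> t = ?s - 1 then 1 else 0)"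
    for x t
  proof (cases "t = 0")
    case False
    then show ?thesis
      using K(1) f_star_pos[OF a, of p] a unfolding gt_weight_def f_star_def band_def
      by (auto simp: algebra_simps of_nat_diff)
  next
    \<comment> \<open>At time 0 the price is a column sum. The two changes made by
      \<open>f_star\<close> lie in one column and cancel, except when \<open>k_f p a = p\<close>:
      then the second entry does not exist, column p + 1 grows, and this is the discount at time s0
      - 1 = 0.\<close>
    case True
    have "(\<Sum>i\<in>{A..x - 1}. int (f_star p a i x)) = (\<Sum>i\<in>{A..x - 1}. int (a i x) +
      ((if i = p \<and> x = ?k + 1 then 1 else 0) - (if i = p + 1 \<and> x = ?k + 1 then 1 else 0)))"
    proof (rule sum.cong)
      fix i assume i: "i \<in> {A..x - 1}"
      show "int (f_star p a i x) = int (a i x) +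
        ((if i = p \<and> x = ?k + 1 then 1 else 0) - (if i = p + 1 \<and> x = ?k + 1 then 1 else 0))"
        using i f_star_pos[OF a, of p] unfolding f_star_def by (auto simp: of_nat_diff)
    qed simp
    also have "\<dots> = (\<Sum>i\<in>{A..x - 1}. int (a i x)) +
      ((\<Sum>i\<in>{A..x - 1}. if i = p \<and> x = ?k + 1 then 1 else 0) - (\<Sum>i\<in>{A..x - 1}. if i = p + 1 \<and> x = ?k + 1 then 1 else 0))"
      by (simp add: sum.distrib sum_subtractf)
    also have "(\<Sum>i\<in>{A..x - 1}. if i = p \<and> x = ?k + 1 then 1 else 0 :: int) = (if x = ?k + 1 then 1 else 0)"
      using K(1) A N by (cases "x = ?k + 1") auto
    also have "(\<Sum>i\<in>{A..x - 1}. if i = p + 1 \<and> x = ?k + 1 then 1 else 0 :: int) = (if x = ?k + 1 \<and> ?k \<noteq> p then 1 else 0)"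
      using K(1) A N by (cases "x = ?k + 1") auto
    finally show ?thesis using True K(1) by (auto simp: gt_weight_def)
  qed
qed

text \<open>The exchange on a Maya diagram which, on its complement, moves p to p + 1.\<close>

definition up_swap :: "int \<Rightarrow> int set \<Rightarrow> int set" where
  "up_swap p k = insert p (k - {p + 1})"

lemma is_enum_up_swap:
  assumes e: "is_enum k r e m" and i: "i \<le> r" "e i = p + 1" "p \<notin> k"
  shows "is_enum (up_swap p k) r (e(i := p)) m"
proof -
  have ek: "e j \<in> k" if "j \<le> r" for j using that e by (auto simp: is_enum_def)
  have im: "m < i"
  proof (rule ccontr)
    assume "\<not> m < i"
    then have "e i = i" "e (i - 1) = i - 1" using e by (auto simp: is_enum_def)
    then show False using i ek[of "i - 1"] by auto
  qed
  have "e(i := p) ` {..r} = up_swap p k"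
  proof -
    have "inj_on e {..r}" using is_enum_mono(3)[OF e] by (auto simp: inj_on_def)
    then have "e ` ({..r} - {i}) = e ` {..r} - e ` {i}" using i(1) by (intro inj_on_image_set_diff) auto
    then have "e ` ({..r} - {i}) = k - {p + 1}" using e i(2) by (simp add: is_enum_def)
    moreover have "e(i := p) ` ({..r} - {i}) = e ` ({..r} - {i})" by (intro image_cong) auto
    moreover have "{..r} = insert i ({..r} - {i})" using i(1) by auto
    then have "e(i := p) ` {..r} = insert p (e(i := p) ` ({..r} - {i}))" by (metis fun_upd_same image_insert)
    ultimately show ?thesis by (simp add: up_swap_def)
  qed
  moreover have "strict_mono_on {..r} (e(i := p))"
    unfolding strict_mono_on_def
  proof (intro allI impI)
    fix x y assume xy: "x \<in> {..r} \<and> y \<in> {..r} \<and> x < y"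
    then have "e x < e y" "e x \<noteq> p" "e y \<noteq> p" using is_enum_mono(1)[OF e, of x y] ek i by auto
    then show "(e(i := p)) x < (e(i := p)) y" using i xy by auto
  qed
  ultimately show ?thesis using e im by (auto simp: is_enum_def)
qed

lemma Phi_Z_f_star:
  assumes a: "a \<in> lusztig_Z" and k: "k \<in> maya"
  shows "Phi_Z (f_star p a) k = (if p \<notin> k \<and> p + 1 \<in> k
    then min (Phi_Z a k) (Phi_Z a (up_swap p k) + f_const p a) else Phi_Z a k)"
proof -
  obtain N0 where "band N0 a" using a lusztig_Z_band by blast
  then obtain N where N: "band N a" "band N (f_star p a)"
    using band_f_star[of N0 a "max N0 (k_f p a - p + 2)" p] band_mono by (metis max.cobounded1 max.cobounded2)
  obtain r e m0 where e0: "is_enum k r e m0" using k maya_iff_enum by blast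
  \<comment> \<open>Lowering m to at most p makes the window start far enough left both for
    stabilization and for the column sums at p and p + 1.\<close>
  define m where "m = min m0 p"
  have e: "is_enum k r e m" using is_enum_low[OF e0] by (simp add: m_def)
  define A where "A = m - N"
  have A: "A + N \<le> m" "A + N \<le> p" by (auto simp: A_def m_def)
  have N0: "0 < N" using N by (simp add: band_def)
  note P = Phi_Z_eq[OF N(1) e A(1)] Phi_Z_eq[OF N(2) e A(1)]
  interpret gt_move "gt_weight a A" "gt_weight (f_star p a) A" p "k_f p a + 1 - p" "f_const p a" A r
    by (rule gt_move_f_star[OF N(1) A(2)])
  have em: "strict_mono_on {A..r} e" using e by (auto simp: is_enum_def intro: monotone_on_subset)
  have im: "x \<in> e ` {A..r} \<longleftrightarrow> x \<in> k" if "p \<le> x" for x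
  proof
    assume "x \<in> k"
    then obtain j where j: "j \<le> r" "x = e j" using e by (auto simp: is_enum_def)
    have "A \<le> j"
    proof (rule ccontr)
      assume "\<not> A \<le> j"
      then have "e j = j" using e A N0 by (auto simp: is_enum_def)
      then show False using \<open>\<not> A \<le> j\<close> j that A N0 by simp
    qed
    then show "x \<in> e ` {A..r}" using j by auto
  qed (use e in \<open>auto simp: is_enum_def\<close>)
  show ?thesis
  proof (cases "p \<notin> k \<and> p + 1 \<in> k")
    case False
    have "gt_min (gt_weight (f_star p a) A) A r e = gt_min (gt_weight a A) A r e"
      by (rule gt_min_move(1)[OF em]) (use False im[of p] im[of "p + 1"] in auto)
    then show ?thesis using False P by auto
  next
    case True
    then obtain i where i: "i \<in> {A..r}" "e i = p + 1" using im[of "p + 1"] by auto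
    then have "Phi_Z a (up_swap p k) = gt_min (gt_weight a A) A r (e(i := p))"
      using is_enum_up_swap[OF e, of i p] True by (intro Phi_Z_eq[OF N(1) _ A(1)]) auto
    then show ?thesis using gt_min_move(2)[OF em i] im[of p] True P by simp
  qed
qed

section \<open>How f and e move the partial sums\<close>

lemma A_star_upd:
  assumes a: "band N a" and b: "band N' b"
    and p: "\<And>t. int (b p t) = int (a p t) + (if t = K + 1 then d else 0)"
    and q: "\<And>t. int (b (p + 1) t) = int (a (p + 1) t) - (if t = K + 1 \<and> p < K then d else 0)"
    and k: "p \<le> k" "p \<le> K"
  shows "A_star p b k = A_star p a k + (if k \<le> K then d else 0) + (if k < K then d else 0)"
proof -
  define T where "T = max (max (p + N) (p + N')) (K + 1)"
  have "A_star p b k = (\<Sum>t\<in>{k + 1..T}. int (b p t) - int (b (p + 1) (t + 1)))"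
    by (rule A_star_sum[OF b]) (simp add: T_def)
  also have "\<dots> = (\<Sum>t\<in>{k + 1..T}. (int (a p t) - int (a (p + 1) (t + 1))) +
      ((if t = K + 1 then d else 0) + (if t = K then (if p < K then d else 0) else 0)))"
    unfolding p q by (intro sum.cong) auto
  also have "\<dots> = A_star p a k + ((\<Sum>t\<in>{k + 1..T}. if t = K + 1 then d else 0) +
      (\<Sum>t\<in>{k + 1..T}. if t = K then (if p < K then d else 0) else 0))"
    using A_star_sum[OF a, of p T k] by (simp add: sum.distrib T_def)
  also have "(\<Sum>t\<in>{k + 1..T}. if t = K + 1 then d else 0) = (if k \<le> K then d else 0)"
    by (auto simp: T_def)
  also have "(\<Sum>t\<in>{k + 1..T}. if t = K then (if p < K then d else 0) else 0) = (if k < K then d else 0)"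
    using k by (auto simp: T_def)
  finally show ?thesis by simp
qed

lemma A_star_f_star:
  assumes a: "band N a" and k: "p \<le> k"
  shows "A_star p (f_star p a) k = A_star p a k + (if k \<le> k_f p a then 1 else 0) + (if k < k_f p a then 1 else 0)"
proof -
  note K = k_f_props[OF a, of p]
  have "band (max N (k_f p a - p + 2)) (f_star p a)" using band_f_star[OF a] by simp
  then show ?thesis
  proof (rule A_star_upd[OF a _ _ _ k K(1)])
    show "int (f_star p a (p + 1) t) = int (a (p + 1) t) - (if t = k_f p a + 1 \<and> p < k_f p a then 1 else 0)" for t
      using f_star_pos[OF a, of p] by (auto simp: f_star_def of_nat_diff)
  qed (simp add: f_star_def)
qed

text \<open>The first maximum rises by 1, the places before it by 2, the later ones not at all.
  Earlier places were strictly lower, so they can at most tie: the old first maximum becomes the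
  last one. Hence \<open>e_fun\<close> undoes \<open>f_star\<close>.\<close>

lemma eps_k_e_f_star:
  assumes a: "band N a"
  shows "eps_star p (f_star p a) = eps_star p a + 1" "k_e p (f_star p a) = k_f p a"
proof -
  note K = k_f_props[OF a, of p]
  have b: "band (max N (k_f p a - p + 2)) (f_star p a)" using band_f_star[OF a] by simp
  note A = A_star_f_star[OF a]
  show E: "eps_star p (f_star p a) = eps_star p a + 1"
  proof (rule eps_starI[OF b])
    show "p \<le> k_f p a" "A_star p (f_star p a) (k_f p a) = eps_star p a + 1" using A K by auto
    show "A_star p (f_star p a) k \<le> eps_star p a + 1" if "p \<le> k" for k
      using A[OF that] K(3)[OF that] eps_star_ge[OF a that] by (auto split: if_splits)
  qed
  show "k_e p (f_star p a) = k_f p a"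
  proof (rule k_eI)
    show "p \<le> k_f p a" "A_star p (f_star p a) (k_f p a) = eps_star p (f_star p a)" using A K E by auto
    show "A_star p (f_star p a) k < eps_star p (f_star p a)" if "k_f p a < k" for k
      using A[of p k] K(1) eps_star_ge[OF a, of p k] that E by auto
  qed
qed

definition e_fun :: "int \<Rightarrow> lusztig \<Rightarrow> lusztig" where
  "e_fun p a = (\<lambda>i j.
     if i = p \<and> j = k_e p a + 1 then a i j - 1
     else if i = p + 1 \<and> j = k_e p a + 1 \<and> i < j then a i j + 1
     else a i j)"

lemma e_star_eq: "e_star p a = (if eps_star p a = 0 then None else Some (e_fun p a))"
  by (simp add: e_star_def e_fun_def)

lemma e_fun_f_star: "band N a \<Longrightarrow> e_fun p (f_star p a) = a"
  using f_star_pos[of N a p] k_f_props(1)[of N a p] unfolding e_fun_def eps_k_e_f_star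
  by (auto simp: f_star_def fun_eq_iff)

lemma e_fun_pos:
  assumes a: "band N a" and eps: "0 < eps_star p a"
  shows "0 < a p (k_e p a + 1)"
  using A_star_step[OF a, of p "k_e p a"] k_e_props(2)[OF a eps] k_e_props(4)[OF a eps, of "k_e p a + 1"] by simp

lemma band_e_fun:
  assumes a: "band N a" and eps: "0 < eps_star p a"
  shows "band N (e_fun p a)"
  using a k_e_props(3)[OF a eps] by (auto simp: band_def e_fun_def)

lemma A_star_e_fun:
  assumes a: "band N a" and eps: "0 < eps_star p a" and k: "p \<le> k"
  shows "A_star p (e_fun p a) k = A_star p a k - (if k \<le> k_e p a then 1 else 0) - (if k < k_e p a then 1 else 0)"
proof -
  note K = k_e_props[OF a eps]
  have "A_star p (e_fun p a) k = A_star p a k + (if k \<le> k_e p a then -1 else 0) + (if k < k_e p a then -1 else 0)"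
  proof (rule A_star_upd[OF a band_e_fun[OF a eps] _ _ k K(1)])
    show "int (e_fun p a p t) = int (a p t) + (if t = k_e p a + 1 then - 1 else 0)" for t
      using e_fun_pos[OF a eps] by (auto simp: e_fun_def of_nat_diff)
  qed (simp add: e_fun_def)
  then show ?thesis by simp
qed

lemma eps_k_f_e_fun:
  assumes a: "band N a" and eps: "0 < eps_star p a"
  shows "eps_star p (e_fun p a) = eps_star p a - 1" "k_f p (e_fun p a) = k_e p a"
proof -
  note K = k_e_props[OF a eps]
  note b = band_e_fun[OF a eps]
  note A = A_star_e_fun[OF a eps]
  show E: "eps_star p (e_fun p a) = eps_star p a - 1"
  proof (rule eps_starI[OF b])
    show "p \<le> k_e p a" "A_star p (e_fun p a) (k_e p a) = eps_star p a - 1" using A K by auto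
    show "A_star p (e_fun p a) k \<le> eps_star p a - 1" if "p \<le> k" for k
      using A[OF that] K(4)[of k] eps_star_ge[OF a that] by (cases "k \<le> k_e p a") auto
  qed
  show "k_f p (e_fun p a) = k_e p a"
  proof (rule k_fI)
    show "p \<le> k_e p a" "A_star p (e_fun p a) (k_e p a) = eps_star p (e_fun p a)" using A K E by auto
    show "A_star p (e_fun p a) k < eps_star p (e_fun p a)" if "p \<le> k" "k < k_e p a" for k
      using A[of k] eps_star_ge[OF a, of p k] that E by auto
  qed
qed

lemma f_star_e_fun:
  assumes a: "band N a" and eps: "0 < eps_star p a"
  shows "f_star p (e_fun p a) = a"
  using e_fun_pos[OF a eps] k_e_props(1)[OF a eps] a
  unfolding f_star_def eps_k_f_e_fun[OF a eps] by (auto simp: fun_eq_iff e_fun_def)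

text \<open>Condition (a) of BZ data by itself: it is proved for all of \<open>lusztig_Z\<close>,
  whereas stabilization is proved for aperiodic data.\<close>

definition bz_Z :: "family \<Rightarrow> bool" where
  "bz_Z M \<longleftrightarrow> (\<forall>K\<in>fin_intervals. restr_c K M \<in> BZ_fin K)"

lemma maya_Un: "finite S \<Longrightarrow> S \<subseteq> {lo..} \<Longrightarrow> {..<lo} \<union> S \<in> maya"
  using is_enum_list maya_iff_enum by blast

lemma maya_c_iff: "k \<in> maya_c \<longleftrightarrow> - k \<in> maya"
  unfolding maya_c_def by (metis double_complement image_iff)

lemma compl_window:
  assumes "K \<in> fin_intervals" "k \<subseteq> tilde K"
  shows "- (k \<union> {Max K + 2..}) = {..<Min K} \<union> (tilde K - k)"
proof -
  obtain a b where ab: "K = {a..b}" "a \<le> b" "Min K = a" "Max K = b" "tilde K = {a..b + 1}"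
    using fin_intervalsE[OF assms(1)] .
  show ?thesis unfolding ab using assms(2) ab by auto
qed

lemma window_maya_c:
  assumes "K \<in> fin_intervals" "k \<subseteq> tilde K"
  shows "k \<union> {Max K + 2..} \<in> maya_c"
  unfolding maya_c_iff compl_window[OF assms] by (rule maya_Un) (auto simp: tilde_def)

text \<open>A window sees the exchange of p and p + 1 only if it contains p: to the left of the
  window p is absent from the set, to its right p + 1 belongs to the tail.\<close>

lemma restr_c_am_on:
  assumes K: "K \<in> fin_intervals"
  shows "restr_c K (am_on maya_c p c M) = (if p \<in> K then am_on (M_fin_x K) p c (restr_c K M) else restr_c K M)"
proof
  fix k
  obtain a b where ab: "K = {a..b}" "a \<le> b" "Min K = a" "Max K = b" "tilde K = {a..b + 1}"
    using fin_intervalsE[OF K] .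
  let ?E = "{Max K + 2..}"
  show "restr_c K (am_on maya_c p c M) k = (if p \<in> K then am_on (M_fin_x K) p c (restr_c K M) else restr_c K M) k"
  proof (cases "k \<in> M_fin_x K")
    case False
    then show ?thesis by (auto simp: restr_c_def am_on_def)
  next
    case True
    then have k: "k \<subseteq> tilde K" by (simp add: M_fin_x_def M_fin_def)
    have 1: "restr_c K (am_on maya_c p c M) k = am p c M (k \<union> ?E)"
      using True window_maya_c[OF K k] by (simp add: restr_c_def am_on_def)
    have pE: "p \<in> k \<union> ?E \<and> p + 1 \<notin> k \<union> ?E \<longleftrightarrow> p \<in> K \<and> p \<in> k \<and> p + 1 \<notin> k"
      using k ab by (fastforce simp del: Un_iff simp: Un_def)
    show ?thesis
    proof (cases "p \<in> K \<and> p \<in> k \<and> p + 1 \<notin> k")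
      case False
      then have "am p c M (k \<union> ?E) = M (k \<union> ?E)" using pE by (intro am_unbad) blast
      then show ?thesis using 1 True False by (auto simp: am_on_unbad restr_c_def)
    next
      case bad: True
      have "p \<in> tilde K" "p + 1 \<in> tilde K" using bad ab by auto
      moreover have "p \<notin> insert (p + 1) (k - {p})" by simp
      then have "insert (p + 1) (k - {p}) \<noteq> tilde K" using \<open>p \<in> tilde K\<close> by blast
      ultimately have "insert (p + 1) (k - {p}) \<in> M_fin_x K" using k by (auto simp: M_fin_x_def M_fin_def)
      moreover have "insert (p + 1) (k \<union> ?E - {p}) = insert (p + 1) (k - {p}) \<union> ?E" using bad ab by auto
      ultimately show ?thesis using 1 True bad pE by (simp add: am_on_def am_def restr_c_def)
    qed
  qed
qed

lemma bz_Z_am: "bz_Z M \<Longrightarrow> bz_Z (am_on maya_c p c M)"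
  unfolding bz_Z_def using restr_c_am_on BZ_fin_am by simp

lemma star_Phi_f_star:
  assumes "a \<in> lusztig_Z"
  shows "star (Phi_Z (f_star p a)) = am_on maya_c p (f_const p a) (star (Phi_Z a))"
proof
  fix k
  show "star (Phi_Z (f_star p a)) k = am_on maya_c p (f_const p a) (star (Phi_Z a)) k"
  proof (cases "k \<in> maya_c")
    case True
    then have k: "- k \<in> maya" by (simp add: maya_c_iff)
    have "up_swap p (- k) = - insert (p + 1) (k - {p})" by (auto simp: up_swap_def)
    then show ?thesis using Phi_Z_f_star[OF assms k, of p] True by (auto simp: star_def am_on_def am_def)
  next
    case False
    then show ?thesis by (simp add: star_def am_on_def Phi_Z_def maya_c_iff)
  qed
qed

lemma Phi_Z_zero: "Phi_Z (\<lambda>i j. 0) = (\<lambda>k. 0)"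
proof
  fix k
  show "Phi_Z (\<lambda>i j. 0) k = 0"
  proof (cases "k \<in> maya")
    case True
    then obtain r e m where e: "is_enum k r e m" using maya_iff_enum by blast
    have b: "band 1 (\<lambda>i j. 0)" by (simp add: band_def)
    have em: "strict_mono_on {m - 1..r} e" using e by (auto simp: is_enum_def intro: monotone_on_subset)
    have "gt_weight (\<lambda>i j. 0) (m - 1) = (\<lambda>x t. 0)" by (auto simp: gt_weight_def fun_eq_iff)
    moreover have "gt_min (\<lambda>x t. 0) (m - 1) r e = 0"
      using const_gt_pattern[OF em] by (intro gt_min_eqI[OF em]) (auto simp: gt_cost_def)
    ultimately show ?thesis using Phi_Z_eq[OF b e, of "m - 1"] by simp
  qed (simp add: Phi_Z_def)
qed

lemma bz_Z_zero: "bz_Z (\<lambda>k. 0)"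
proof -
  have "restr_c K (\<lambda>k. 0) = (\<lambda>k. 0)" for K by (simp add: restr_c_def fun_eq_iff)
  then show ?thesis by (simp add: bz_Z_def BZ_fin_def bz_data_def families_def)
qed

text \<open>The entry (i, j) stands for a root of height j - i, so this is the number of simple
  roots in the weight. Each \<open>f_star\<close> adds one; it is the induction measure for finite
  support.\<close>

definition lusztig_size :: "lusztig \<Rightarrow> nat" where
  "lusztig_size a = (\<Sum>(i, j)\<in>{(i, j). a i j \<noteq> 0}. a i j * nat (j - i))"

lemma lusztig_size_eq:
  assumes "finite S" "{(i, j). a i j \<noteq> 0} \<subseteq> S"
  shows "lusztig_size a = (\<Sum>(i, j)\<in>S. a i j * nat (j - i))"
  unfolding lusztig_size_def using assms by (intro sum.mono_neutral_left) auto

lemma lusztig_size_f_star: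
  assumes b: "band N b" and fin: "finite {(i, j). b i j \<noteq> 0}"
  shows "lusztig_size (f_star p b) = lusztig_size b + 1"
proof -
  let ?K = "k_f p b + 1"
  define S where "S = {(i, j). b i j \<noteq> 0} \<union> {(p, ?K), (p + 1, ?K)}"
  have fS: "finite S" using fin by (simp add: S_def)
  have K: "p < ?K" using k_f_props(1)[OF b, of p] by simp
  have "lusztig_size (f_star p b) = (\<Sum>(i, j)\<in>S. f_star p b i j * nat (j - i))"
    using fS by (rule lusztig_size_eq) (auto simp: S_def f_star_def split: if_splits)
  moreover have "lusztig_size b = (\<Sum>(i, j)\<in>S. b i j * nat (j - i))"
    using fS by (rule lusztig_size_eq) (auto simp: S_def)
  moreover have "int (\<Sum>(i, j)\<in>S. f_star p b i j * nat (j - i)) =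
     (\<Sum>x\<in>S. int (case x of (i, j) \<Rightarrow> b i j * nat (j - i)) +
       ((if x = (p, ?K) then ?K - p else 0) - (if x = (p + 1, ?K) then ?K - (p + 1) else 0)))"
    unfolding of_nat_sum
  proof (rule sum.cong)
    fix x assume "x \<in> S"
    obtain i j where x: "x = (i, j)" by (cases x)
    show "int (case x of (i, j) \<Rightarrow> f_star p b i j * nat (j - i)) =
       int (case x of (i, j) \<Rightarrow> b i j * nat (j - i)) +
       ((if x = (p, ?K) then ?K - p else 0) - (if x = (p + 1, ?K) then ?K - (p + 1) else 0))"
      using f_star_pos[OF b, of p] K unfolding x f_star_def
      by (auto simp: of_nat_diff algebra_simps)
  qed simp
  moreover have "(\<Sum>x\<in>S. int (case x of (i, j) \<Rightarrow> b i j * nat (j - i)) +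
       ((if x = (p, ?K) then ?K - p else 0) - (if x = (p + 1, ?K) then ?K - (p + 1) else 0))) =
       (\<Sum>x\<in>S. int (case x of (i, j) \<Rightarrow> b i j * nat (j - i))) + 1"
    using fS by (simp add: sum.distrib sum_subtractf sum.delta S_def)
  ultimately show ?thesis by (simp add: of_nat_sum split_def flip: of_nat_eq_iff[where 'a = int])
qed

lemma eps_star_top_row:
  assumes a: "band N a" and ij: "a i j \<noteq> 0" and top: "\<And>j'. a (i + 1) j' = 0"
  shows "0 < eps_star i a"
proof -
  have "i < j" "j - i < N" using bandD[OF a ij] by auto
  have "A_star i a (j - 1) = (\<Sum>t\<in>{j..i + N}. int (a i t))"
    using A_star_sum[OF a, of i "i + N" "j - 1"] top by simp
  also have "\<dots> \<ge> int (a i j)" using \<open>j - i < N\<close> by (intro member_le_sum) auto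
  finally show ?thesis using eps_star_ge[OF a, of i "j - 1"] ij \<open>i < j\<close> by linarith
qed

text \<open>Some \<open>e_fun\<close> applies to every nonzero datum of finite support: for the last
  nonzero row i, nothing is subtracted by row i + 1, so the partial sums become positive. Undoing
  these steps leads back from zero.\<close>

lemma bz_Z_finite_support:
  assumes "band N a" "finite {(i, j). a i j \<noteq> 0}"
  shows "bz_Z (star (Phi_Z a))"
  using assms
proof (induction "lusztig_size a" arbitrary: a rule: less_induct)
  case less
  show ?case
  proof (cases "a = (\<lambda>i j. 0)")
    case True
    then show ?thesis using bz_Z_zero by (simp add: Phi_Z_zero star_def)
  next
    case False
    define R where "R = fst ` {(i, j). a i j \<noteq> 0}"
    have R: "finite R" "R \<noteq> {}" using less(3) False by (auto simp: R_def fun_eq_iff)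
    define i where "i = Max R"
    have "i \<in> R" using R by (simp add: i_def)
    then obtain j where j: "a i j \<noteq> 0" by (auto simp: R_def)
    have "a (i + 1) j' = 0" for j'
    proof (rule ccontr)
      assume "a (i + 1) j' \<noteq> 0"
      then have "i + 1 \<in> R" by (force simp: R_def)
      then show False using Max_ge[OF R(1), of "i + 1"] by (simp add: i_def)
    qed
    then have eps: "0 < eps_star i a" using eps_star_top_row[OF less(2) j] by blast
    note b = band_e_fun[OF less(2) eps]
    have "{(x, y). e_fun i a x y \<noteq> 0} \<subseteq> {(x, y). a x y \<noteq> 0} \<union> {(i + 1, k_e i a + 1)}"
      by (auto simp: e_fun_def split: if_splits)
    then have fb: "finite {(x, y). e_fun i a x y \<noteq> 0}" by (rule finite_subset) (use less(3) in simp)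
    have "lusztig_size (e_fun i a) < lusztig_size a"
      using lusztig_size_f_star[OF b fb, of i] f_star_e_fun[OF less(2) eps] by simp
    then have "bz_Z (star (Phi_Z (e_fun i a)))" using less(1) b fb by blast
    moreover have "e_fun i a \<in> lusztig_Z" using b lusztig_Z_band by blast
    ultimately show ?thesis using star_Phi_f_star[of "e_fun i a" i] f_star_e_fun[OF less(2) eps] bz_Z_am by simp
  qed
qed

text \<open>A tableau entry \<open>C p q\<close> and its partner \<open>C p q + (q - p)\<close> both
  lie between e p and e q, and the column sums start at the left end of the window. Entries of a
  outside this range are never read.\<close>

lemma Phi_Z_local:
  assumes a: "band N a" and b: "band N b" and lo: "{..<lo} \<subseteq> k" and hi: "k \<subseteq> {..hi}" and k: "k \<in> maya"
    and ab: "\<And>i j. lo - 1 - N \<le> i \<Longrightarrow> j \<le> hi \<Longrightarrow> a i j = b i j"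
  shows "Phi_Z a k = Phi_Z b k"
proof -
  have kk: "k = {..<lo} \<union> (k \<inter> {lo..hi})" using lo hi by auto
  obtain r e where e: "is_enum k r e (lo - 1)"
  proof -
    have "k \<inter> {lo..hi} \<subseteq> {lo..}" by auto
    then show ?thesis using that is_enum_list[of "k \<inter> {lo..hi}" lo] kk by (metis finite_Int finite_atLeastAtMost_int)
  qed
  define A where "A = lo - 1 - N"
  have N: "0 < N" using a by (simp add: band_def)
  have ge: "A \<le> e p" if "A \<le> p" "p \<le> r" for p
    using is_enum_mono(2)[OF e, of A p] that e N by (auto simp: is_enum_def A_def)
  have le: "e p \<le> hi" if "p \<le> r" for p using e hi that by (auto simp: is_enum_def)
  have "gt_cost (gt_weight a A) A r C = gt_cost (gt_weight b A) A r C" if C: "C \<in> gt_patterns A r e" for C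
  proof -
    have "int (a i (e j)) = int (b i (e j))" if "j \<in> {A..r}" "i \<in> {A..e j - 1}" for i j
      using ab[of i "e j"] le[of j] that by (simp add: A_def)
    moreover have "a (C p q) (C p q + (q - p)) = b (C p q) (C p q + (q - p))"
      if "p \<in> {A..r}" "q \<in> {A..r}" "p < q" for p q
      using ab[of "C p q" "C p q + (q - p)"] gt_bounds[OF C, of p q] ge[of p] le[of q] that by (simp add: A_def)
    ultimately show ?thesis unfolding gt_cost_split[OF C] by (intro arg_cong2[of _ _ _ _ "(+)"] arg_cong[of _ _ uminus] sum.cong) auto
  qed
  then have "gt_min (gt_weight a A) A r e = gt_min (gt_weight b A) A r e"
    unfolding gt_min_def by (metis (no_types, lifting) image_cong)
  then show ?thesis using Phi_Z_eq[OF a e, of A] Phi_Z_eq[OF b e, of A] by (simp add: A_def)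
qed

text \<open>By locality the datum can be cut to finite support without changing any component of the
  window K.\<close>

lemma bz_Z_star_Phi:
  assumes "a \<in> lusztig_Z"
  shows "bz_Z (star (Phi_Z a))"
  unfolding bz_Z_def
proof
  fix K assume K: "K \<in> fin_intervals"
  obtain N where a: "band N a" using assms lusztig_Z_band by blast
  define b where "b = (\<lambda>i j. if Min K - 1 - N \<le> i \<and> j \<le> Max K + 1 then a i j else 0)"
  have b: "band N b" using a by (auto simp: band_def b_def)
  have "{(i, j). b i j \<noteq> 0} \<subseteq> {Min K - 1 - N..Max K + 1} \<times> {Min K - 1 - N..Max K + 1}"
  proof
    fix x assume "x \<in> {(i, j). b i j \<noteq> 0}"
    then obtain i j where x: "x = (i, j)" "b i j \<noteq> 0" by auto
    then have "Min K - 1 - N \<le> i" "j \<le> Max K + 1" "a i j \<noteq> 0" by (auto simp: b_def split: if_splits)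
    then show "x \<in> {Min K - 1 - N..Max K + 1} \<times> {Min K - 1 - N..Max K + 1}"
      using bandD[OF a, of i j] x by auto
  qed
  then have "finite {(i, j). b i j \<noteq> 0}" by (rule finite_subset) simp
  then have "restr_c K (star (Phi_Z b)) \<in> BZ_fin K"
    using bz_Z_finite_support[OF b] K by (simp add: bz_Z_def)
  moreover have "restr_c K (star (Phi_Z a)) = restr_c K (star (Phi_Z b))"
  proof
    fix k
    show "restr_c K (star (Phi_Z a)) k = restr_c K (star (Phi_Z b)) k"
    proof (cases "k \<in> M_fin_x K")
      case True
      then have k: "k \<subseteq> tilde K" by (simp add: M_fin_x_def M_fin_def)
      have "Phi_Z a (- (k \<union> {Max K + 2..})) = Phi_Z b (- (k \<union> {Max K + 2..}))"
      proof (rule Phi_Z_local[OF a b, of "Min K" _ "Max K + 1"])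
        show "- (k \<union> {Max K + 2..}) \<in> maya" using window_maya_c[OF K k] by (simp add: maya_c_iff)
        show "{..<Min K} \<subseteq> - (k \<union> {Max K + 2..})" unfolding compl_window[OF K k] by simp
      qed (auto simp: b_def)
      then show ?thesis using True by (simp add: restr_c_def star_def)
    qed (simp add: restr_c_def)
  qed
  ultimately show "restr_c K (star (Phi_Z a)) \<in> BZ_fin K" by simp
qed

section \<open>BZ data for the integers\<close>

declare Compl_atMost [simp del]

lemma atLeastAtMost_fin_intervals: "a \<le> b \<Longrightarrow> {a..b} \<in> fin_intervals"
  unfolding fin_intervals_def by blast

lemma fin_interval_mem: "I \<in> fin_intervals \<Longrightarrow> x \<in> I \<longleftrightarrow> Min I \<le> x \<and> x \<le> Max I"
  by (metis atLeastAtMost_iff fin_intervalsE)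

lemma maya_c_on_iff:
  assumes I: "I \<in> fin_intervals"
  shows "k \<in> maya_c_on I \<longleftrightarrow> - k \<in> maya_on I"
proof -
  have x: "tilde I - S \<in> M_fin_x I" if "S \<in> M_fin_x I" for S
    using that by (auto simp: M_fin_x_def M_fin_def)
  show ?thesis
  proof
    assume "k \<in> maya_c_on I"
    then obtain S where S: "S \<in> M_fin_x I" "k = S \<union> {Max I + 2..}" by (auto simp: maya_c_on_def)
    then have "- k = {..<Min I} \<union> (tilde I - S)"
      using compl_window[OF I, of S] by (auto simp: M_fin_x_def M_fin_def)
    then show "- k \<in> maya_on I" using x[OF S(1)] unfolding maya_on_def by blast
  next
    assume "- k \<in> maya_on I"
    then obtain S where S: "S \<in> M_fin_x I" "- k = {..<Min I} \<union> S" by (auto simp: maya_on_def)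
    then have "tilde I - (tilde I - S) = S" by (auto simp: M_fin_x_def M_fin_def)
    then have "- k = - ((tilde I - S) \<union> {Max I + 2..})"
      using compl_window[OF I, of "tilde I - S"] S by auto
    then have "k = (tilde I - S) \<union> {Max I + 2..}" by (metis double_complement)
    then show "k \<in> maya_c_on I" using x[OF S(1)] unfolding maya_c_on_def by blast
  qed
qed

lemma maya_c_on_mono:
  "I \<in> fin_intervals \<Longrightarrow> J \<in> fin_intervals \<Longrightarrow> I \<subseteq> J \<Longrightarrow> k \<in> maya_c_on I \<Longrightarrow> k \<in> maya_c_on J"
  using maya_on_mono maya_c_on_iff by blast

lemma res_Un_c:
  assumes "I \<in> fin_intervals" "k \<in> maya_c_on I"
  shows "res I k \<in> M_fin_x I" "res I k \<union> {Max I + 2..} = k"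
proof -
  obtain S where S: "S \<in> M_fin_x I" "k = S \<union> {Max I + 2..}" using assms by (auto simp: maya_c_on_def)
  then have "res I k = S" by (auto simp: res_def tilde_def M_fin_x_def M_fin_def)
  then show "res I k \<in> M_fin_x I" "res I k \<union> {Max I + 2..} = k" using S by auto
qed

lemma maya_on_exists:
  assumes "k \<in> maya"
  obtains I where "I \<in> fin_intervals" "k \<in> maya_on I"
proof -
  obtain r e m where e: "is_enum k r e m" using assms maya_iff_enum by blast
  have kb: "x \<le> e r" if "x \<in> k" for x
    using that e is_enum_mono(2)[OF e, of _ r] by (auto simp: is_enum_def)
  have kl: "x \<in> k" if "x \<le> m" for x
  proof -
    have "e x = x" "x \<le> r" using e that by (auto simp: is_enum_def)
    then show ?thesis using e unfolding is_enum_def by force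
  qed
  define I where "I = {m..max m (e r)}"
  have I: "I \<in> fin_intervals" "Min I = m" "Max I = max m (e r)"
    by (auto simp: I_def intro: Min_eqI Max_eqI atLeastAtMost_fin_intervals)
  have "k \<in> maya_on I"
    unfolding maya_on_iff[OF I(1)] tilde_def I
  proof (intro conjI)
    show "{..<m} \<subseteq> k" using kl by auto
    show "k \<subseteq> {..max m (e r) + 1}" using kb by fastforce
    show "k \<inter> {m..max m (e r) + 1} \<noteq> {}" using kl[of m] by auto
    have "max m (e r) + 1 \<notin> k" using kb by fastforce
    moreover have "max m (e r) + 1 \<in> {m..max m (e r) + 1}" by simp
    ultimately show "\<not> {m..max m (e r) + 1} \<subseteq> k" by blast
  qed
  then show ?thesis using that I(1) by blast
qed

lemma maya_on_maya: "I \<in> fin_intervals \<Longrightarrow> k \<in> maya_on I \<Longrightarrow> k \<in> maya"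
proof -
  assume "I \<in> fin_intervals" "k \<in> maya_on I"
  then obtain S where S: "k = {..<Min I} \<union> S" "S \<subseteq> tilde I"
    by (auto simp: maya_on_def M_fin_x_def M_fin_def)
  moreover have "finite S" using S(2) unfolding tilde_def by (rule finite_subset) simp
  moreover have "S \<subseteq> {Min I..}" using S(2) by (auto simp: tilde_def)
  ultimately show "k \<in> maya" using maya_Un by simp
qed

lemma Omega_c_compl: "Omega_c J (- k) = (tilde J \<inter> k) \<union> {Max J + 2..}"
  by (auto simp: Omega_c_def)

lemma Omega_c_maya_c: "J \<in> fin_intervals \<Longrightarrow> Omega_c J k \<in> maya_c"
  unfolding Omega_c_def by (rule window_maya_c) auto

lemma Int_c_iff: "I \<in> Int_c M k \<longleftrightarrow> I \<in> fin_intervals \<and> k \<in> maya_c_on I \<and>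
     (\<forall>J\<in>fin_intervals. I \<subseteq> J \<longrightarrow> M (Omega_c J k) = M (Omega_c I k))"
  by (simp add: Int_c_def)

lemma Int_c_mono:
  assumes "I \<in> Int_c M k" "J \<in> fin_intervals" "I \<subseteq> J"
  shows "J \<in> Int_c M k" "M (Omega_c J k) = M (Omega_c I k)"
proof -
  have I: "I \<in> fin_intervals" "k \<in> maya_c_on I"
    and st: "\<And>J. J \<in> fin_intervals \<Longrightarrow> I \<subseteq> J \<Longrightarrow> M (Omega_c J k) = M (Omega_c I k)"
    using assms(1) unfolding Int_c_iff by blast+
  show 1: "M (Omega_c J k) = M (Omega_c I k)" using st assms(2,3) .
  have "M (Omega_c J' k) = M (Omega_c J k)" if "J' \<in> fin_intervals" "J \<subseteq> J'" for J'
    using st[of J'] that assms(3) 1 by simp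
  then show "J \<in> Int_c M k" using assms(2) maya_c_on_mono[OF I(1) assms(2,3) I(2)] unfolding Int_c_iff by blast
qed

lemma Int_c_fin: "I \<in> Int_c M k \<Longrightarrow> I \<in> fin_intervals"
  by (simp add: Int_c_def)

lemma Int_c_agree:
  assumes "I \<in> Int_c M k" "I' \<in> Int_c M k"
  shows "M (Omega_c I k) = M (Omega_c I' k)"
proof -
  obtain J where J: "J \<in> fin_intervals" "I \<subseteq> J" "I' \<subseteq> J"
    using fin_interval_hull[OF Int_c_fin[OF assms(1)] Int_c_fin[OF assms(2)]] .
  show ?thesis using Int_c_mono(2)[OF assms(1) J(1,2)] Int_c_mono(2)[OF assms(2) J(1,3)] by simp
qed

lemma Theta_eq:
  assumes "I \<in> Int_c M (- k)"
  shows "Theta M k = M (Omega_c I (- k))"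
proof -
  have "(SOME I. I \<in> Int_c M (- k)) \<in> Int_c M (- k)" using assms by (rule someI)
  then have "M (Omega_c (SOME I. I \<in> Int_c M (- k)) (- k)) = M (Omega_c I (- k))"
    using Int_c_agree assms by blast
  moreover have "- k \<in> maya_c_on I" using assms by (simp add: Int_c_def)
  then have "k \<in> maya" using maya_on_maya[OF Int_c_fin[OF assms]] maya_c_on_iff[OF Int_c_fin[OF assms]] by simp
  ultimately show ?thesis by (simp add: Theta_def)
qed

text \<open>Stability passes to larger intervals, so finitely many stability conditions can be met
  at once.\<close>

lemma Int_c_common:
  assumes "finite X" "\<And>k. k \<in> X \<Longrightarrow> Int_c M k \<noteq> {}" "K \<in> fin_intervals"
  obtains I where "I \<in> fin_intervals" "K \<subseteq> I" "\<And>k. k \<in> X \<Longrightarrow> I \<in> Int_c M k"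
proof -
  have "\<exists>I\<in>fin_intervals. K \<subseteq> I \<and> (\<forall>k\<in>X. I \<in> Int_c M k)"
    using assms
  proof (induction X rule: finite_induct)
    case (insert x X)
    then obtain I where I: "I \<in> fin_intervals" "K \<subseteq> I" "\<forall>k\<in>X. I \<in> Int_c M k" by auto
    obtain I' where I': "I' \<in> Int_c M x" using insert by blast
    obtain J where J: "J \<in> fin_intervals" "I \<subseteq> J" "I' \<subseteq> J"
      using fin_interval_hull[OF I(1) Int_c_fin[OF I']] .
    then show ?case using I I' Int_c_mono(1) by (intro bexI[of _ J]) auto
  qed auto
  then show ?thesis using that by blast
qed

lemma BZ_Z_iff: "M \<in> BZ_Z \<longleftrightarrow> M \<in> families maya_c \<and> bz_Z M \<and> (\<forall>k\<in>maya. Int_c M (- k) \<noteq> {})"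
proof -
  have "(\<forall>k\<in>maya_c. Int_c M k \<noteq> {}) \<longleftrightarrow> (\<forall>k\<in>maya. Int_c M (- k) \<noteq> {})"
    using maya_c_iff by (metis double_complement)
  then show ?thesis by (auto simp: BZ_Z_def bz_Z_def)
qed

lemma Int_c_BZ: "M \<in> BZ_Z \<Longrightarrow> k \<in> maya \<Longrightarrow> Int_c M (- k) \<noteq> {}"
  by (simp add: BZ_Z_iff)

abbreviation down_swap :: "int \<Rightarrow> int set \<Rightarrow> int set" where
  "down_swap p k \<equiv> insert (p + 1) (k - {p})"

lemma down_swap_maya:
  assumes k: "k \<in> maya" and p: "p \<in> k" "p + 1 \<notin> k"
  shows "down_swap p k \<in> maya"
proof -
  obtain I0 where I0: "I0 \<in> fin_intervals" "k \<in> maya_on I0" using maya_on_exists[OF k] .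
  obtain I where I: "I \<in> fin_intervals" "I0 \<subseteq> I" "{p..p} \<subseteq> I"
    using fin_interval_hull[OF I0(1) atLeastAtMost_fin_intervals[of p p]] by auto
  have kI: "k \<in> maya_on I" using maya_on_mono[OF I0(1) I(1,2) I0(2)] .
  have pI: "Min I \<le> p" "p \<le> Max I" using I(3) fin_interval_mem[OF I(1), of p] by auto
  have eq: "down_swap p k = {..<Min I} \<union> (down_swap p k \<inter> tilde I)"
    using kI pI unfolding maya_on_iff[OF I(1)] by (auto simp: tilde_def)
  show ?thesis by (subst eq, rule maya_Un) (auto simp: tilde_def)
qed

lemma am_on_Omega_c:
  assumes J: "J \<in> fin_intervals" and p: "p \<in> J"
  shows "am_on maya_c p c M (Omega_c J (- k)) =
    (if p \<in> k \<and> p + 1 \<notin> k then min (M (Omega_c J (- k))) (M (Omega_c J (- down_swap p k)) + c)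
     else M (Omega_c J (- k)))"
proof -
  obtain a b where ab: "J = {a..b}" "a \<le> b" "Min J = a" "Max J = b" "tilde J = {a..b + 1}"
    using fin_intervalsE[OF J] .
  have "p \<in> Omega_c J (- k) \<and> p + 1 \<notin> Omega_c J (- k) \<longleftrightarrow> p \<in> k \<and> p + 1 \<notin> k"
    using p ab unfolding Omega_c_compl by auto
  moreover have "insert (p + 1) (Omega_c J (- k) - {p}) = Omega_c J (- down_swap p k)"
    using p ab unfolding Omega_c_compl by auto
  ultimately show ?thesis using Omega_c_maya_c[OF J, of "- k"] by (simp add: am_on_def am_def)
qed

text \<open>On a window containing p, the reflected set \<open>Omega_c J (- k)\<close> meets the
  pair p, p + 1 exactly as k does. So the min-formula acts on \<Theta> in the same form, and an
  interval containing p that is stable for k and, where needed, its exchange stays stable.\<close>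

lemma Theta_am_on:
  assumes st: "\<And>k. k \<in> maya \<Longrightarrow> Int_c M (- k) \<noteq> {}" and k: "k \<in> maya"
  shows "Int_c (am_on maya_c p c M) (- k) \<noteq> {}"
    and "Theta (am_on maya_c p c M) k =
      (if p \<in> k \<and> p + 1 \<notin> k then min (Theta M k) (Theta M (down_swap p k) + c) else Theta M k)"
proof -
  define X where "X = {- k} \<union> (if p \<in> k \<and> p + 1 \<notin> k then {- down_swap p k} else {})"
  have "Int_c M x \<noteq> {}" if "x \<in> X" for x
    using that st[OF k] st[of "down_swap p k"] down_swap_maya[OF k] by (auto simp: X_def split: if_splits)
  moreover have "finite X" by (simp add: X_def)
  ultimately obtain I where I: "I \<in> fin_intervals" "{p..p} \<subseteq> I" "\<And>x. x \<in> X \<Longrightarrow> I \<in> Int_c M x"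
    using Int_c_common[of X M "{p..p}"] atLeastAtMost_fin_intervals by blast
  let ?v = "if p \<in> k \<and> p + 1 \<notin> k then min (Theta M k) (Theta M (down_swap p k) + c) else Theta M k"
  have *: "am_on maya_c p c M (Omega_c J (- k)) = ?v" if J: "J \<in> fin_intervals" "I \<subseteq> J" for J
  proof -
    have "J \<in> Int_c M (- k)" using I(3) Int_c_mono(1)[OF _ J] by (simp add: X_def)
    moreover have "J \<in> Int_c M (- down_swap p k)" if "p \<in> k \<and> p + 1 \<notin> k"
      using I(3) Int_c_mono(1)[OF _ J] that by (simp add: X_def)
    moreover have "p \<in> J" using I(2) J(2) by auto
    ultimately show ?thesis unfolding am_on_Omega_c[OF J(1) \<open>p \<in> J\<close>] using Theta_eq by metis
  qed
  have "- k \<in> maya_c_on I" using I(3)[of "- k"] by (simp add: X_def Int_c_iff)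
  then have II: "I \<in> Int_c (am_on maya_c p c M) (- k)" using * I(1) by (auto simp: Int_c_iff)
  then show "Int_c (am_on maya_c p c M) (- k) \<noteq> {}" by blast
  show "Theta (am_on maya_c p c M) k = ?v" using Theta_eq[OF II] *[OF I(1)] by simp
qed

lemma am_on_families: "M \<in> families D \<Longrightarrow> am_on D p c M \<in> families D"
  by (auto simp: families_def am_on_def)

lemma BZ_Z_am: "M \<in> BZ_Z \<Longrightarrow> am_on maya_c p c M \<in> BZ_Z"
  unfolding BZ_Z_iff using am_on_families bz_Z_am Theta_am_on(1) by blast

lemma atMost_maya: "{..p} \<in> maya" for p :: int
proof -
  have "{..<p} \<union> {p} = {..p}" by auto
  then show ?thesis using maya_Un[of "{p}" p] by simp
qed

section \<open>The operators f and e on BZ data for the integers\<close>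

definition swapped :: "int \<Rightarrow> int set" where
  "swapped p = {..p - 1} \<union> {p + 1}"

lemma down_swap_atMost: "down_swap p {..p} = swapped p"
  by (auto simp: swapped_def)

lemma swapped_maya: "swapped p \<in> maya"
  using down_swap_maya[OF atMost_maya, of p p] by (simp add: down_swap_atMost)

lemma Int_c_ex:
  assumes M: "M \<in> BZ_Z" and X: "finite X" "X \<subseteq> maya" and K: "K \<in> fin_intervals"
  obtains I where "I \<in> fin_intervals" "K \<subseteq> I" "\<And>k. k \<in> X \<Longrightarrow> I \<in> Int_c M (- k)"
proof -
  have "finite (uminus ` X)" using X by simp
  moreover have "Int_c M k \<noteq> {}" if "k \<in> uminus ` X" for k using that Int_c_BZ[OF M] X by auto
  ultimately obtain I where I: "I \<in> fin_intervals" "K \<subseteq> I" "\<And>k. k \<in> uminus ` X \<Longrightarrow> I \<in> Int_c M k"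
    using Int_c_common[of "uminus ` X" M K] K by auto
  show ?thesis by (rule that[OF I(1,2)]) (intro I(3) imageI)
qed

lemma atMost_maya_on:
  assumes "I \<in> fin_intervals"
  shows "{..p} \<in> maya_on I \<longleftrightarrow> p \<in> I"
proof -
  obtain a b where ab: "I = {a..b}" "a \<le> b" "Min I = a" "Max I = b" "tilde I = {a..b + 1}"
    using fin_intervalsE[OF assms] .
  show ?thesis unfolding maya_on_iff[OF assms] ab(3-5) unfolding ab(1) using ab(2) by auto
qed

lemma Int_c_atMost: "I \<in> Int_c M (- {..p}) \<Longrightarrow> p \<in> I"
  using atMost_maya_on[of I p] by (auto simp: Int_c_iff maya_c_on_iff)

text \<open>The constant of \<open>f_fin\<close>, read off on a stable interval.\<close>

definition Theta_const :: "int \<Rightarrow> family \<Rightarrow> int" where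
  "Theta_const p M = Theta M {..p} - Theta M (swapped p) - 1"

lemma Omega_c_atMost:
  assumes "I \<in> fin_intervals" "p \<in> I"
  shows "Omega_c I (- {..p}) = {Min I..p} \<union> {Max I + 2..}"
    "Omega_c I (- swapped p) = ({Min I..p - 1} \<union> {p + 1}) \<union> {Max I + 2..}"
    "{Min I..p} \<in> M_fin_x I" "{Min I..p - 1} \<union> {p + 1} \<in> M_fin_x I"
proof -
  obtain a b where ab: "I = {a..b}" "a \<le> b" "Min I = a" "Max I = b" "tilde I = {a..b + 1}"
    using fin_intervalsE[OF assms(1)] .
  show "Omega_c I (- {..p}) = {Min I..p} \<union> {Max I + 2..}"
    "Omega_c I (- swapped p) = ({Min I..p - 1} \<union> {p + 1}) \<union> {Max I + 2..}"
    unfolding Omega_c_compl ab(3-5) swapped_def using assms(2) ab(1) by auto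
  have "p + 1 \<in> tilde I" "p \<in> tilde I" "p + 1 \<notin> {Min I..p}" "p \<notin> {Min I..p - 1} \<union> {p + 1}" using assms(2) ab by auto
  then have "{Min I..p} \<noteq> tilde I" "{Min I..p - 1} \<union> {p + 1} \<noteq> tilde I" by blast+
  then show "{Min I..p} \<in> M_fin_x I" "{Min I..p - 1} \<union> {p + 1} \<in> M_fin_x I"
    using assms(2) ab by (auto simp: M_fin_x_def M_fin_def)
qed

lemma restr_c_Omega:
  assumes "I \<in> fin_intervals" "p \<in> I"
  shows "restr_c I M {Min I..p} = M (Omega_c I (- {..p}))"
    "restr_c I M ({Min I..p - 1} \<union> {p + 1}) = M (Omega_c I (- swapped p))"
  using Omega_c_atMost[OF assms] by (simp_all add: restr_c_def)

lemma f_Z_eq: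
  assumes M: "M \<in> BZ_Z"
  shows "f_Z p M = am_on maya_c p (Theta_const p M) M"
proof
  fix k
  show "f_Z p M k = am_on maya_c p (Theta_const p M) M k"
  proof (cases "k \<in> maya_c")
    case False
    then show ?thesis using M by (simp add: f_Z_def am_on_def BZ_Z_iff families_def)
  next
    case True
    define P where "P I \<longleftrightarrow> I \<in> fin_intervals \<and> k \<in> maya_c_on I \<and>
                      (\<forall>m\<in>{{..p}, {..p - 1} \<union> {p + 1}}. I \<in> Int_c M (- m))" for I
    have "- k \<in> maya" using True by (simp add: maya_c_iff)
    then obtain K where K: "K \<in> fin_intervals" "- k \<in> maya_on K" using maya_on_exists by blast
    have "\<exists>I. P I"
    proof -
      have "{{..p}, swapped p} \<subseteq> maya" using atMost_maya swapped_maya by blast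
      then obtain I where I: "I \<in> fin_intervals" "K \<subseteq> I" "\<And>x. x \<in> {{..p}, swapped p} \<Longrightarrow> I \<in> Int_c M (- x)"
        using Int_c_ex[OF M _ _ K(1), of "{{..p}, swapped p}"] by blast
      have "k \<in> maya_c_on I" using maya_c_on_mono[OF K(1) I(1,2)] K by (simp add: maya_c_on_iff)
      then show ?thesis using I unfolding P_def swapped_def[symmetric] by blast
    qed
    then have PI: "P (SOME I. P I)" by (rule someI_ex)
    define I where "I = (SOME I. P I)"
    have I: "I \<in> fin_intervals" "k \<in> maya_c_on I" "I \<in> Int_c M (- {..p})" "I \<in> Int_c M (- swapped p)"
    proof -
      have "P I" using PI by (simp only: I_def)
      then show "I \<in> fin_intervals" "k \<in> maya_c_on I" "I \<in> Int_c M (- {..p})" "I \<in> Int_c M (- swapped p)"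
        unfolding P_def swapped_def by blast+
    qed
    have p: "p \<in> I" using Int_c_atMost[OF I(3)] .
    have "f_Z p M k = f_fin I p (restr_c I M) (res I k)"
      using True unfolding f_Z_def I_def P_def by (simp add: Let_def)
    also have "\<dots> = am_on (M_fin_x I) p (Theta_const p M) (restr_c I M) (res I k)"
      using f_fin_eq[OF I(1) p, of "restr_c I M"] M I(1) restr_c_Omega[OF I(1) p]
        Theta_eq[OF I(3)] Theta_eq[OF I(4)] by (simp add: BZ_Z_iff bz_Z_def Theta_const_def)
    also have "\<dots> = restr_c I (am_on maya_c p (Theta_const p M) M) (res I k)"
      using restr_c_am_on[OF I(1), of p] p by simp
    also have "\<dots> = am_on maya_c p (Theta_const p M) M k"
      using res_Un_c[OF I(1,2)] by (simp add: restr_c_def)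
    finally show ?thesis .
  qed
qed

lemma f_Z_BZ: "M \<in> BZ_Z \<Longrightarrow> f_Z p M \<in> BZ_Z"
  by (simp add: f_Z_eq BZ_Z_am)

lemma Theta_f_Z:
  assumes "M \<in> BZ_Z" "k \<in> maya"
  shows "Theta (f_Z p M) k =
    (if p \<in> k \<and> p + 1 \<notin> k then min (Theta M k) (Theta M (down_swap p k) + Theta_const p M) else Theta M k)"
  unfolding f_Z_eq[OF assms(1)] using Theta_am_on(2)[OF Int_c_BZ[OF assms(1)] assms(2)] by blast

lemma Theta_f_Z_atMost:
  assumes "M \<in> BZ_Z"
  shows "Theta (f_Z p M) {..q} = Theta M {..q} - (if q = p then 1 else 0)"
proof (cases "q = p")
  case True
  then show ?thesis using Theta_f_Z[OF assms atMost_maya[of q], of p] down_swap_atMost[of p] by (simp add: Theta_const_def)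
next
  case False
  then have "\<not> (p \<in> {..q} \<and> p + 1 \<notin> {..q})" by auto
  then show ?thesis using Theta_f_Z[OF assms atMost_maya[of q], of p] False by auto
qed

lemma Theta_f_Z_swapped:
  assumes "M \<in> BZ_Z" "q \<noteq> p - 1" "q \<noteq> p + 1"
  shows "Theta (f_Z p M) (swapped q) = Theta M (swapped q)"
proof -
  have "\<not> (p \<in> swapped q \<and> p + 1 \<notin> swapped q)" using assms by (auto simp: swapped_def)
  then show ?thesis using Theta_f_Z[OF assms(1) swapped_maya, of p] by (simp only: if_False)
qed

lemma eps_Z_alt: "eps_Z p M = - (Theta M {..p} + Theta M (swapped p) - Theta M {..p + 1} - Theta M {..p - 1})"
  by (simp add: eps_Z_def swapped_def)

lemma eps_Z_f_Z: "M \<in> BZ_Z \<Longrightarrow> eps_Z p (f_Z p M) = eps_Z p M + 1"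
  unfolding eps_Z_alt by (simp add: Theta_f_Z_atMost Theta_f_Z_swapped)

lemma BZ_rel:
  assumes M: "bz_Z M" and K: "K \<in> fin_intervals"
  shows "bz1 (tilde K) (restr_c K M)" "bz2 (tilde K) (restr_c K M)"
  using assms by (auto simp: bz_Z_def BZ_fin_def bz_data_iff)

lemma eps_fin_eq:
  assumes I: "I \<in> fin_intervals" "p - 1 \<in> I" "p + 1 \<in> I"
  shows "eps_fin I p (restr_c I M) = - (M (Omega_c I (- {..p})) + M (Omega_c I (- swapped p))
     - M (Omega_c I (- {..p + 1})) - M (Omega_c I (- {..p - 1})))"
proof -
  obtain a b where ab: "I = {a..b}" "a \<le> b" "Min I = a" "Max I = b" "tilde I = {a..b + 1}"
    using fin_intervalsE[OF I(1)] .
  have "p \<in> I" using I(2,3) ab by auto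
  then show ?thesis unfolding eps_fin_def using restr_c_Omega[OF I(1)] I(2,3) by simp
qed

text \<open>BZ-1 for the elements p and p + 1 over the initial segment ending in p - 1, on an
  interval stable for all four components.\<close>

lemma eps_Z_nonneg:
  assumes M: "M \<in> BZ_Z"
  shows "0 \<le> eps_Z p M"
proof -
  let ?X = "{{..p}, swapped p, {..p + 1}, {..p - 1}}"
  have "?X \<subseteq> maya" using atMost_maya swapped_maya by blast
  then obtain I where I: "I \<in> fin_intervals" "{p - 1..p + 1} \<subseteq> I" "\<And>x. x \<in> ?X \<Longrightarrow> I \<in> Int_c M (- x)"
    using Int_c_ex[OF M _ _ atLeastAtMost_fin_intervals[of "p - 1" "p + 1"], of ?X] by auto
  obtain a b where ab: "I = {a..b}" "a \<le> b" "Min I = a" "Max I = b" "tilde I = {a..b + 1}"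
    using fin_intervalsE[OF I(1)] .
  have p: "p - 1 \<in> I" "p + 1 \<in> I" using I(2) by auto
  have pa: "a \<le> p - 1" "p + 1 \<le> b" using p unfolding ab(1) by auto
  have eps: "eps_Z p M = eps_fin I p (restr_c I M)"
  proof -
    have "Theta M x = M (Omega_c I (- x))" if "x \<in> ?X" for x using Theta_eq I(3) that by blast
    then show ?thesis unfolding eps_Z_alt eps_fin_eq[OF I(1) p] by simp
  qed
  have "bz1 (tilde I) (restr_c I M)" using BZ_rel M I(1) by (simp add: BZ_Z_iff)
  then have "restr_c I M (insert p {a..p - 1}) + restr_c I M (insert (p + 1) {a..p - 1}) \<le>
    restr_c I M (insert p (insert (p + 1) {a..p - 1})) + restr_c I M {a..p - 1}"
    by (rule bz1D) (use pa in \<open>auto simp: ab(5)\<close>)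
  moreover have s1: "insert p {a..p - 1} = {a..p}" using pa by (intro set_eqI, simp, presburger)
  moreover have s2: "insert p (insert (p + 1) {a..p - 1}) = {a..p + 1}" using pa by (intro set_eqI, simp, presburger)
  moreover have s3: "{a..p - 1} \<union> {p + 1} = insert (p + 1) {a..p - 1}" by (simp only: Un_insert_right Un_empty_right)
  ultimately show ?thesis unfolding eps eps_fin_def ab(3) s3 s1 s2 by linarith
qed

text \<open>Three-term relations in which the new end of the window is the third index: n - 1, p, p
  + 1 for growth to the left and p, p + 1, N + 2 for growth to the right. They carry stable values
  between neighbouring windows.\<close>

lemma Omega_c_step:
  assumes M: "bz_Z M" and K: "n \<le> p" "p \<le> N"
  shows "M (Omega_c {n..N} (- {..p})) + M (Omega_c {n - 1..N} (- swapped p)) =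
      min (M (Omega_c {n - 1..N} (- {..p})) + M (Omega_c {n..N} (- swapped p)))
          (M (Omega_c {n..N} (- {..p + 1})) + M (Omega_c {n - 1..N} (- {..p - 1})))"
    and "M (Omega_c {n..N} (- {..p})) + M (Omega_c {n..N + 1} (- swapped p)) =
      min (M (Omega_c {n..N + 1} (- {..p})) + M (Omega_c {n..N} (- swapped p)))
          (M (Omega_c {n..N + 1} (- {..p + 1})) + M (Omega_c {n..N} (- {..p - 1})))"
proof -
  have t: "tilde {x..y} = {x..y + 1}" "Max {x..y} = y" if "x \<le> y" for x y :: int
    using that by (auto simp: tilde_def intro: Min_eqI Max_eqI)
  have 0: "restr_c J M {} = 0" "restr_c J M (tilde J) = 0" for J by (auto simp: restr_c_def M_fin_x_def)
  \<comment> \<open>By the normalization of \<open>BZ_fin\<close>, half-lines carry the value 0.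
    Thus the convention for the empty and the full set of a window agrees with the actual values of
    M.\<close>
  have full: "M ({i..}) = 0" for i
  proof -
    have J: "{i - 1..i} \<in> fin_intervals" by (simp add: atLeastAtMost_fin_intervals)
    have tJ: "tilde {i - 1..i} = {i - 1..i + 1}" "Max {i - 1..i} = i" using t[of "i - 1" i] by auto
    have "\<forall>x\<in>{i - 1..i}. restr_c {i - 1..i} M {x + 1..Max {i - 1..i} + 1} = 0"
      using M J unfolding bz_Z_def BZ_fin_def by blast
    then have "restr_c {i - 1..i} M {i - 1 + 1..Max {i - 1..i} + 1} = 0" by (rule bspec) simp
    moreover have "{i..i + 1} \<in> M_fin_x {i - 1..i}" unfolding M_fin_x_def M_fin_def tJ by auto
    moreover have "{i..i + 1} \<union> {i + 2..} = {i..}" by auto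
    ultimately show ?thesis unfolding tJ restr_c_def by (simp split: if_splits)
  qed
  have R: "restr_c {x..y} M k = M (k \<union> {y + 2..})" if "x \<le> y" "k \<subseteq> {x..y + 1}" "k \<noteq> {}" for x y k
  proof (cases "k = {x..y + 1}")
    case True
    have "k \<union> {y + 2..} = {x..}" using True that by auto
    then show ?thesis using full[of x] 0(2)[of "{x..y}"] True t[OF that(1)] by simp
  next
    case False
    then show ?thesis using that t[OF that(1)] by (simp add: restr_c_def M_fin_x_def M_fin_def)
  qed
  have R0: "restr_c {x..y} M {} = M {y + 2..}" if "x \<le> y" for x y using full 0(1) by simp
  note R = R R0
  have RR: "restr_c {x..y} M k = M (k \<union> {y + 2..})" if "x \<le> y" "k \<subseteq> {x..y + 1}" for x y k
    using R that by (cases "k = {}") auto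
  have nN: "n \<le> N" "n - 1 \<le> N" "n \<le> N + 1" using K by auto
  show "M (Omega_c {n..N} (- {..p})) + M (Omega_c {n - 1..N} (- swapped p)) =
      min (M (Omega_c {n - 1..N} (- {..p})) + M (Omega_c {n..N} (- swapped p)))
          (M (Omega_c {n..N} (- {..p + 1})) + M (Omega_c {n - 1..N} (- {..p - 1})))"
  proof -
    let ?J = "{n - 1..N}" let ?k = "{n..p - 1}" let ?h = "n - 1"
    have J: "?J \<in> fin_intervals" using nN by (simp add: atLeastAtMost_fin_intervals)
    have bz: "bz2 {n - 1..N + 1} (restr_c ?J M)" using BZ_rel(2)[OF M J] t[OF nN(2)] by simp
    have "restr_c ?J M (insert ?h (insert (p + 1) ?k)) + restr_c ?J M (insert p ?k) =
       min (restr_c ?J M (insert ?h (insert p ?k)) + restr_c ?J M (insert (p + 1) ?k))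
           (restr_c ?J M (insert p (insert (p + 1) ?k)) + restr_c ?J M (insert ?h ?k))"
      by (rule bz2D[OF bz]) (use K in auto)
    moreover have "insert ?h (insert (p + 1) ?k) \<union> {N + 2..} = Omega_c {n - 1..N} (- swapped p)"
      "insert p ?k \<union> {N + 2..} = Omega_c {n..N} (- {..p})"
      "insert ?h (insert p ?k) \<union> {N + 2..} = Omega_c {n - 1..N} (- {..p})"
      "insert (p + 1) ?k \<union> {N + 2..} = Omega_c {n..N} (- swapped p)"
      "insert p (insert (p + 1) ?k) \<union> {N + 2..} = Omega_c {n..N} (- {..p + 1})"
      "insert ?h ?k \<union> {N + 2..} = Omega_c {n - 1..N} (- {..p - 1})"
      unfolding Omega_c_compl t[OF nN(1)] t[OF nN(2)] swapped_def using K by auto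
    moreover have "insert ?h (insert (p + 1) ?k) \<subseteq> {n - 1..N + 1}" "insert p ?k \<subseteq> {n - 1..N + 1}"
      "insert ?h (insert p ?k) \<subseteq> {n - 1..N + 1}" "insert (p + 1) ?k \<subseteq> {n - 1..N + 1}"
      "insert p (insert (p + 1) ?k) \<subseteq> {n - 1..N + 1}" "insert ?h ?k \<subseteq> {n - 1..N + 1}" using K by auto
    ultimately show ?thesis using RR[OF nN(2)] by simp
  qed
  show "M (Omega_c {n..N} (- {..p})) + M (Omega_c {n..N + 1} (- swapped p)) =
      min (M (Omega_c {n..N + 1} (- {..p})) + M (Omega_c {n..N} (- swapped p)))
          (M (Omega_c {n..N + 1} (- {..p + 1})) + M (Omega_c {n..N} (- {..p - 1})))"
  proof -
    let ?J = "{n..N + 1}" let ?k = "{n..p - 1}" let ?j = "N + 2"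
    have J: "?J \<in> fin_intervals" using nN by (simp add: atLeastAtMost_fin_intervals)
    have n2: "N + 1 + 1 = N + 2" "N + 1 + 2 = N + 3" by simp_all
    have bz: "bz2 {n..N + 2} (restr_c ?J M)" using BZ_rel(2)[OF M J] unfolding t(1)[OF nN(3)] n2 .
    have "restr_c ?J M (insert p (insert ?j ?k)) + restr_c ?J M (insert (p + 1) ?k) =
       min (restr_c ?J M (insert p (insert (p + 1) ?k)) + restr_c ?J M (insert ?j ?k))
           (restr_c ?J M (insert (p + 1) (insert ?j ?k)) + restr_c ?J M (insert p ?k))"
      by (rule bz2D[OF bz]) (use K in auto)
    moreover have "insert p (insert ?j ?k) \<union> {N + 3..} = Omega_c {n..N} (- {..p})"
      "insert (p + 1) ?k \<union> {N + 3..} = Omega_c {n..N + 1} (- swapped p)"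
      "insert p (insert (p + 1) ?k) \<union> {N + 3..} = Omega_c {n..N + 1} (- {..p + 1})"
      "insert ?j ?k \<union> {N + 3..} = Omega_c {n..N} (- {..p - 1})"
      "insert (p + 1) (insert ?j ?k) \<union> {N + 3..} = Omega_c {n..N} (- swapped p)"
      "insert p ?k \<union> {N + 3..} = Omega_c {n..N + 1} (- {..p})"
      unfolding Omega_c_compl t[OF nN(1)] t[OF nN(3)] swapped_def using K by auto
    moreover have "insert p (insert ?j ?k) \<subseteq> {n..N + 2}" "insert (p + 1) ?k \<subseteq> {n..N + 2}"
      "insert p (insert (p + 1) ?k) \<subseteq> {n..N + 2}" "insert ?j ?k \<subseteq> {n..N + 2}"
      "insert (p + 1) (insert ?j ?k) \<subseteq> {n..N + 2}" "insert p ?k \<subseteq> {n..N + 2}" using K by auto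
    ultimately show ?thesis using RR[OF nN(3), unfolded n2] by (simp add: min.commute add.commute)
  qed
qed

text \<open>\<open>e_Z\<close> chooses intervals stable for \<open>f_Z p M\<close>, but inverting f
  needs the stable values of M on them. The components at p - 1, p + 1 and the exchanged set are
  untouched by f. The one at p is carried down from a larger interval stable for M, one end point at
  a time; nonnegativity of \<open>eps_Z\<close> decides the branch of the minimum.\<close>

lemma Omega_c_Theta_of_f_Z:
  assumes M: "M \<in> BZ_Z" and I: "I \<in> fin_intervals"
    and st: "\<And>x. x \<in> {{..p}, swapped p, {..p + 1}, {..p - 1}} \<Longrightarrow> I \<in> Int_c (f_Z p M) (- x)"
  shows "M (Omega_c I (- {..p})) = Theta M {..p}" "M (Omega_c I (- swapped p)) = Theta M (swapped p)"
proof -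
  have p: "p \<in> I" using Int_c_atMost[OF st] by simp
  have bz: "bz_Z M" using M by (simp add: BZ_Z_iff)
  have stable: "M (Omega_c K (- x)) = Theta M x"
    if K: "K \<in> fin_intervals" "I \<subseteq> K" and x: "x \<in> {swapped p, {..p + 1}, {..p - 1}}" for K x
  proof -
    have xb: "\<not> (p \<in> x \<and> p + 1 \<notin> x)" using x by (auto simp: swapped_def)
    have xm: "x \<in> maya" using x atMost_maya swapped_maya by auto
    have "K \<in> Int_c (f_Z p M) (- x)" using Int_c_mono(1)[OF st K] x by auto
    then have "f_Z p M (Omega_c K (- x)) = Theta (f_Z p M) x" using Theta_eq by simp
    moreover have "f_Z p M (Omega_c K (- x)) = M (Omega_c K (- x))"
      unfolding f_Z_eq[OF M] using am_on_Omega_c[OF K(1), of p] p K(2) xb by auto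
    moreover have "Theta (f_Z p M) x = Theta M x" using Theta_f_Z[OF M xm] xb by (simp only: if_False)
    ultimately show ?thesis by simp
  qed
  show "M (Omega_c I (- swapped p)) = Theta M (swapped p)" using stable[OF I order_refl] by simp
  have ge: "Theta M {..p} + Theta M (swapped p) \<le> Theta M {..p + 1} + Theta M {..p - 1}"
    using eps_Z_nonneg[OF M, of p] by (simp add: eps_Z_alt)
  obtain J where J: "J \<in> fin_intervals" "I \<subseteq> J" "J \<in> Int_c M (- {..p})"
    using Int_c_ex[OF M _ _ I, of "{{..p}}"] atMost_maya by auto
  obtain n0 N0 where I0: "I = {n0..N0}" "n0 \<le> N0" using I by (auto simp: fin_intervals_def)
  obtain n1 N1 where J1: "J = {n1..N1}" "n1 \<le> N1" using J(1) by (auto simp: fin_intervals_def)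
  have le: "n1 \<le> n0" "N0 \<le> N1" using J(2) I0 J1 by auto
  have p0: "n0 \<le> p" "p \<le> N0" using p I0 by auto
  have fin: "{n..N} \<in> fin_intervals" "I \<subseteq> {n..N}" if "n \<le> n0" "N0 \<le> N" for n N
    using that I0 by (auto intro: atLeastAtMost_fin_intervals)
  have left: "M (Omega_c {n..N} (- {..p})) = Theta M {..p}"
    if "n \<le> n0" "N0 \<le> N" "M (Omega_c {n - 1..N} (- {..p})) = Theta M {..p}" for n N
    using Omega_c_step(1)[OF bz, of n p N] stable[OF fin[of n N]] stable[OF fin[of "n - 1" N]] that p0 ge by simp
  have right: "M (Omega_c {n..N} (- {..p})) = Theta M {..p}"
    if "n \<le> n0" "N0 \<le> N" "M (Omega_c {n..N + 1} (- {..p})) = Theta M {..p}" for n N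
    using Omega_c_step(2)[OF bz, of n p N] stable[OF fin[of n N]] stable[OF fin[of n "N + 1"]] that p0 ge by simp
  have "n \<le> n0 \<longrightarrow> M (Omega_c {n..N1} (- {..p})) = Theta M {..p}" if "n1 \<le> n" for n
    using that
  proof (induction n rule: int_ge_induct)
    case base
    then show ?case using Theta_eq[OF J(3)] J1 by simp
  next
    case (step i)
    then show ?case using left[of "i + 1" N1] le by auto
  qed
  then have b: "M (Omega_c {n0..N1} (- {..p})) = Theta M {..p}" using le by simp
  have "N0 \<le> N \<longrightarrow> M (Omega_c {n0..N} (- {..p})) = Theta M {..p}" if "N \<le> N1" for N
    using that
  proof (induction N rule: int_le_induct)
    case (step i)
    then show ?case using right[of n0 "i - 1"] by auto
  qed (use b in simp)
  then show "M (Omega_c I (- {..p})) = Theta M {..p}" using le I0 by simp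
qed

lemma e_Z_f_Z:
  assumes M: "M \<in> BZ_Z"
  shows "e_Z p (f_Z p M) = Some M"
proof -
  let ?M = "f_Z p M"
  have M': "?M \<in> BZ_Z" using f_Z_BZ[OF M] .
  have eps: "eps_Z p ?M \<noteq> 0" using eps_Z_f_Z[OF M] eps_Z_nonneg[OF M, of p] by simp
  let ?X = "{{..p}, {..p - 1} \<union> {p + 1}, {..p + 1}, {..p - 1}}"
  define P where "P k I \<longleftrightarrow> I \<in> fin_intervals \<and> k \<in> maya_c_on I \<and> (\<forall>m\<in>?X. I \<in> Int_c ?M (- m))" for k I
  have main: "the (e_fin I p (restr_c I ?M)) (res I k) = M k" if "P k I" for I k
  proof -
    have I: "I \<in> fin_intervals" "k \<in> maya_c_on I"
      and st: "\<And>x. x \<in> {{..p}, swapped p, {..p + 1}, {..p - 1}} \<Longrightarrow> I \<in> Int_c ?M (- x)"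
      using that unfolding P_def swapped_def by blast+
    have p: "p \<in> I" "p + 1 \<in> I" "p - 1 \<in> I"
      using Int_c_atMost[OF st[of "{..p}"]] Int_c_atMost[OF st[of "{..p + 1}"]] Int_c_atMost[OF st[of "{..p - 1}"]] by auto
    note T = Omega_c_Theta_of_f_Z[OF M I(1) st]
    have MI: "restr_c I M \<in> BZ_fin I" using M I(1) by (simp add: BZ_Z_iff bz_Z_def)
    have ff: "restr_c I ?M = f_fin I p (restr_c I M)"
      unfolding f_fin_eq[OF I(1) p(1) MI] f_Z_eq[OF M] restr_c_am_on[OF I(1)] restr_c_Omega[OF I(1) p(1)]
      using T p(1) by (simp add: Theta_const_def)
    have "Theta ?M x = ?M (Omega_c I (- x))" if "x \<in> {{..p}, swapped p, {..p + 1}, {..p - 1}}" for x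
      using Theta_eq st[OF that] by blast
    then have "eps_fin I p (restr_c I ?M) \<noteq> 0"
      using eps unfolding eps_fin_eq[OF I(1) p(3,2)] eps_Z_alt by simp
    then have "e_fin I p (restr_c I ?M) = Some (restr_c I M)"
      using e_fin_eq[OF I(1) p(1) MI] ff by simp
    then show ?thesis using res_Un_c[OF I] by (simp add: restr_c_def)
  qed
  have ex: "\<exists>I. P k I" if "k \<in> maya_c" for k
  proof -
    have "- k \<in> maya" using that by (simp add: maya_c_iff)
    then obtain K where K: "K \<in> fin_intervals" "- k \<in> maya_on K" using maya_on_exists by blast
    have "?X \<subseteq> maya" using atMost_maya swapped_maya unfolding swapped_def by blast
    then obtain I where I: "I \<in> fin_intervals" "K \<subseteq> I" "\<And>x. x \<in> ?X \<Longrightarrow> I \<in> Int_c ?M (- x)"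
      using Int_c_ex[OF M' _ _ K(1), of ?X] by blast
    have "k \<in> maya_c_on I" using maya_c_on_mono[OF K(1) I(1,2)] K by (simp add: maya_c_on_iff)
    then show ?thesis using I unfolding P_def by blast
  qed
  have "(if k \<in> maya_c then (let I = (SOME I. P k I) in the (e_fin I p (restr_c I ?M)) (res I k)) else 0) = M k" for k
  proof (cases "k \<in> maya_c")
    case True
    then show ?thesis using main[OF someI_ex[OF ex[OF True]]] by (simp add: Let_def)
  next
    case False
    then show ?thesis using M by (simp add: BZ_Z_iff families_def)
  qed
  then have "(\<lambda>k. if k \<in> maya_c then (let I = (SOME I. P k I) in the (e_fin I p (restr_c I ?M)) (res I k)) else 0) = M"
    by (rule ext)
  then show ?thesis using eps unfolding e_Z_def P_def by simp
qed

section \<open>Affine operators\<close>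

abbreviation Psi :: "lusztig \<Rightarrow> family" where
  "Psi a \<equiv> star (Phi_Z a)"

text \<open>All operators with index in Q at once, Q possibly infinite. Each row is read off from a
  single operator, so this is their product when Q contains no two neighbours.\<close>

definition f_on :: "int set \<Rightarrow> lusztig \<Rightarrow> lusztig" where
  "f_on Q a = (\<lambda>i j. if i \<in> Q then f_star i a i j else if i - 1 \<in> Q then f_star (i - 1) a i j else a i j)"

lemma f_on_empty [simp]: "f_on {} a = a"
  by (simp add: f_on_def)

lemma A_star_cong:
  assumes "\<And>t. a q t = b q t" "\<And>t. a (q + 1) t = b (q + 1) t"
  shows "A_star q a = A_star q b"
  using assms by (simp add: A_star_def fun_eq_iff)

lemma k_cong:
  assumes "A_star q a = A_star q b"
  shows "eps_star q a = eps_star q b" "k_f q a = k_f q b" "k_e q a = k_e q b"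
  using assms by (simp_all add: eps_star_def k_f_def k_e_def)

lemma f_on_rows:
  assumes "q \<notin> Q" "q - 1 \<notin> Q" "q + 1 \<notin> Q"
  shows "f_on Q a q t = a q t" "f_on Q a (q + 1) t = a (q + 1) t" "A_star q (f_on Q a) = A_star q a"
proof -
  show 1: "f_on Q a q t = a q t" "f_on Q a (q + 1) t = a (q + 1) t" for t
    using assms by (auto simp: f_on_def)
  show "A_star q (f_on Q a) = A_star q a" by (rule A_star_cong[OF 1])
qed

text \<open>No operator of Q touches the rows q and q + 1, so the partial sums that steer the
  operator q are still those of a.\<close>

lemma f_on_insert:
  assumes "q \<notin> Q" "q - 1 \<notin> Q" "q + 1 \<notin> Q"
  shows "f_on (insert q Q) a = f_star q (f_on Q a)"
proof (intro ext)
  fix i j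
  note R = f_on_rows[OF assms, of a]
  have k: "k_f q (f_on Q a) = k_f q a" using k_cong(2)[OF R(3)] .
  consider "i = q" | "i = q + 1" | "i \<noteq> q" "i \<noteq> q + 1" by blast
  then show "f_on (insert q Q) a i j = f_star q (f_on Q a) i j"
  proof cases
    case 1
    then show ?thesis using R k by (simp add: f_on_def[of "insert q Q"] f_star_def)
  next
    case 2
    then show ?thesis using R k assms by (simp add: f_on_def[of "insert q Q"] f_star_def)
  next
    case 3
    then have "i - 1 \<noteq> q" by auto
    then show ?thesis using 3 by (simp add: f_on_def f_star_def[of q])
  qed
qed

lemma k_f_le: "band N a \<Longrightarrow> k_f p a \<le> p + N"
proof (rule ccontr)
  assume a: "band N a" and "\<not> k_f p a \<le> p + N"
  then have "A_star p a (p + N) < eps_star p a" using k_f_props(3)[OF a, of p "p + N"] by (simp add: band_def)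
  moreover have "A_star p a (p + N) = 0" using A_star_zero[OF a, of p "p + N"] by simp
  moreover have "eps_star p a = 0" using A_star_zero[OF a, of p "k_f p a"] k_f_props(2)[OF a, of p] \<open>\<not> k_f p a \<le> p + N\<close> by simp
  ultimately show False by simp
qed

lemma band_f_on:
  assumes a: "band N a"
  shows "band (N + 2) (f_on Q a)"
proof -
  have "f_star q a i j = 0" if "\<not> i < j \<or> N + 2 \<le> j - i" for q i j
    using band_f_star[OF a, of "N + 2" q] k_f_le[OF a, of q] that by (auto simp: band_def)
  then show ?thesis using a by (auto simp: band_def f_on_def)
qed

lemma f_on_lusztig_Z: "a \<in> lusztig_Z \<Longrightarrow> f_on Q a \<in> lusztig_Z"
  using band_f_on lusztig_Z_band by blast

lemma f_on_cong:
  assumes "i \<in> Q \<longleftrightarrow> i \<in> Q'" "i - 1 \<in> Q \<longleftrightarrow> i - 1 \<in> Q'"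
  shows "f_on Q a i j = f_on Q' a i j"
  using assms by (simp add: f_on_def)

definition separated :: "int set \<Rightarrow> bool" where
  "separated Q \<longleftrightarrow> (\<forall>q\<in>Q. q + 1 \<notin> Q)"

lemma separatedD: "separated Q \<Longrightarrow> q \<in> Q \<Longrightarrow> q + 1 \<notin> Q \<and> q - 1 \<notin> Q"
  unfolding separated_def by (metis diff_add_cancel)

lemma separated_subset: "separated Q \<Longrightarrow> Q' \<subseteq> Q \<Longrightarrow> separated Q'"
  unfolding separated_def by blast

lemma f_on_insert':
  assumes "separated (insert q Q)" "q \<notin> Q"
  shows "f_on (insert q Q) a = f_star q (f_on Q a)"
  using f_on_insert[of q Q] separatedD[OF assms(1), of q] assms(2) by auto

lemma Psi_f_on_finite:
  assumes a: "a \<in> lusztig_Z" "Psi a \<in> BZ_Z" and Q: "finite Q" "separated Q"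
  shows "Psi (f_on Q a) \<in> BZ_Z"
  using Q
proof (induction Q rule: finite_induct)
  case (insert q Q)
  then have "Psi (f_on Q a) \<in> BZ_Z" using separated_subset by blast
  then show ?case unfolding f_on_insert'[OF insert(4,2)]
    using star_Phi_f_star[OF f_on_lusztig_Z[OF a(1)]] BZ_Z_am by simp
qed (use a in simp)

lemma maya_bounds:
  assumes "k \<in> maya"
  obtains lo hi where "{..<lo} \<subseteq> k" "k \<subseteq> {..hi}"
proof -
  obtain I where I: "I \<in> fin_intervals" "k \<in> maya_on I" using maya_on_exists[OF assms] .
  then show ?thesis using that[of "Min I" "Max I + 1"] by (simp add: maya_on_iff)
qed

text \<open>Locality first makes Q finite. Then the operators outside L are dropped one by one; none
  of them changes the component at k, because their positions are not bad for k.\<close>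

lemma f_on_trim:
  assumes a: "a \<in> lusztig_Z" and k: "k \<in> maya_c" and Q: "separated Q"
    and L: "{q \<in> Q. q \<in> k \<and> q + 1 \<notin> k} \<subseteq> L" "L \<subseteq> Q"
  shows "Psi (f_on Q a) k = Psi (f_on L a) k"
proof -
  obtain N where N: "band N a" using a lusztig_Z_band by blast
  have mk: "- k \<in> maya" using k by (simp add: maya_c_iff)
  obtain lo hi where lh: "{..<lo} \<subseteq> - k" "- k \<subseteq> {..hi}" using maya_bounds[OF mk] .
  define W where "W = {lo - 1 - (N + 2) - 2..hi + 1}"
  have loc: "Psi (f_on R a) k = Psi (f_on (R \<inter> W) a) k" for R
    unfolding star_def
  proof (rule Phi_Z_local[OF band_f_on[OF N] band_f_on[OF N] lh mk])
    fix i j assume ij: "lo - 1 - (N + 2) \<le> i" "j \<le> hi"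
    show "f_on R a i j = f_on (R \<inter> W) a i j"
    proof (cases "i < j")
      case True
      then show ?thesis using ij by (intro f_on_cong) (auto simp: W_def)
    next
      case False
      then show ?thesis using band_f_on[OF N] by (simp add: band_def)
    qed
  qed
  have "Psi (f_on (L \<inter> W \<union> R) a) k = Psi (f_on (L \<inter> W) a) k"
    if "finite R" "R \<subseteq> Q - L" for R
    using that
  proof (induction R rule: finite_induct)
    case (insert q R)
    have "q \<notin> L \<inter> W \<union> R" using insert by auto
    moreover have "separated (insert q (L \<inter> W \<union> R))" using Q L(2) insert by (intro separated_subset[OF Q]) auto
    ultimately have "f_on (insert q (L \<inter> W \<union> R)) a = f_star q (f_on (L \<inter> W \<union> R) a)" by (rule f_on_insert'[rotated])
    moreover have "\<not> (q \<in> k \<and> q + 1 \<notin> k)" using insert L by auto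
    ultimately show ?case
      using insert star_Phi_f_star[OF f_on_lusztig_Z[OF a]] by (simp add: am_on_unbad)
  qed simp
  then have "Psi (f_on (L \<inter> W \<union> ((Q - L) \<inter> W)) a) k = Psi (f_on (L \<inter> W) a) k" by (simp add: W_def)
  moreover have "L \<inter> W \<union> ((Q - L) \<inter> W) = Q \<inter> W" using L by auto
  ultimately show ?thesis using loc[of Q] loc[of L] by simp
qed

lemma finite_bad:
  assumes "k \<in> maya"
  shows "finite {q. q \<in> k \<and> q + 1 \<notin> k}"
proof -
  obtain lo hi where "{..<lo} \<subseteq> k" "k \<subseteq> {..hi}" using maya_bounds[OF assms] .
  then have "{q. q \<in> k \<and> q + 1 \<notin> k} \<subseteq> {lo - 1..hi}" by force
  then show ?thesis by (rule finite_subset) simp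
qed

text \<open>For large J the bad positions of \<open>Omega_c J (- k)\<close> are among the finitely
  many bad positions of k. Trimming thus reduces the stability of an infinite product to that of a
  finite one.\<close>

lemma Psi_f_on:
  assumes a: "a \<in> lusztig_Z" "Psi a \<in> BZ_Z" and Q: "separated Q"
  shows "Psi (f_on Q a) \<in> BZ_Z"
    and "k \<in> maya \<Longrightarrow> Theta (Psi (f_on Q a)) k = Theta (Psi (f_on {q \<in> Q. q \<in> k \<and> q + 1 \<notin> k} a)) k"
proof -
  have main: "Int_c (Psi (f_on Q a)) (- k) \<noteq> {} \<and>
      Theta (Psi (f_on Q a)) k = Theta (Psi (f_on {q \<in> Q. q \<in> k \<and> q + 1 \<notin> k} a)) k"
    if k: "k \<in> maya" for k
  proof -
    let ?L = "{q \<in> Q. q \<in> k \<and> q + 1 \<notin> k}"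
    have L: "finite ?L" "separated ?L" using finite_bad[OF k] separated_subset[OF Q] by auto
    note B = Psi_f_on_finite[OF a L]
    obtain lo hi where lh: "{..<lo} \<subseteq> k" "k \<subseteq> {..hi}" using maya_bounds[OF k] .
    define K where "K = {min (lo - 1) hi..hi}"
    have K: "K \<in> fin_intervals" by (simp add: K_def atLeastAtMost_fin_intervals)
    obtain I where I: "I \<in> fin_intervals" "K \<subseteq> I" "I \<in> Int_c (Psi (f_on ?L a)) (- k)"
      using Int_c_ex[OF B _ _ K, of "{k}"] k by auto
    have eq: "Psi (f_on Q a) (Omega_c J (- k)) = Psi (f_on ?L a) (Omega_c J (- k))"
      if J: "J \<in> fin_intervals" "I \<subseteq> J" for J
    proof (rule f_on_trim[OF a(1) Omega_c_maya_c[OF J(1)] Q])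
      obtain x y where xy: "J = {x..y}" "x \<le> y" "Min J = x" "Max J = y" "tilde J = {x..y + 1}"
        using fin_intervalsE[OF J(1)] .
      have "{min (lo - 1) hi..hi} \<subseteq> {x..y}" using I(2) J(2) unfolding K_def xy(1) by blast
      then have "hi \<le> y" by simp
      then show "{q \<in> Q. q \<in> Omega_c J (- k) \<and> q + 1 \<notin> Omega_c J (- k)} \<subseteq> ?L"
        unfolding Omega_c_compl xy(4,5) using lh by auto
    qed auto
    have "- k \<in> maya_c_on I" using I(3) by (simp add: Int_c_iff)
    moreover have "Psi (f_on Q a) (Omega_c J (- k)) = Psi (f_on Q a) (Omega_c I (- k))"
      if J: "J \<in> fin_intervals" "I \<subseteq> J" for J
      by (rule trans[OF eq[OF J] trans[OF Int_c_mono(2)[OF I(3) J] eq[OF I(1) order_refl, symmetric]]])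
    ultimately have II: "I \<in> Int_c (Psi (f_on Q a)) (- k)"
      unfolding Int_c_iff using I(1) by blast
    then show ?thesis unfolding Theta_eq[OF II] Theta_eq[OF I(3)] using eq[OF I(1) order_refl] by blast
  qed
  have "Psi (f_on Q a) \<in> families maya_c" by (auto simp: families_def star_def Phi_Z_def maya_c_iff)
  then show "Psi (f_on Q a) \<in> BZ_Z"
    unfolding BZ_Z_iff using main bz_Z_star_Phi[OF f_on_lusztig_Z[OF a(1)]] by blast
  show "k \<in> maya \<Longrightarrow> Theta (Psi (f_on Q a)) k = Theta (Psi (f_on {q \<in> Q. q \<in> k \<and> q + 1 \<notin> k} a)) k"
    using main by blast
qed

text \<open>Read off from the price change at time 0, which can occur at the site p + 1
  only.\<close>

lemma col_sum_f_star:
  assumes a: "a \<in> lusztig_Z" and x: "x \<noteq> p + 1"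
  shows "col_sum (f_star p a) x = col_sum a x"
proof -
  obtain N0 where "band N0 a" using a lusztig_Z_band by blast
  then obtain N where N: "band N a" "band N (f_star p a)"
    using band_f_star[of N0 a "max N0 (k_f p a - p + 2)" p] band_mono by (metis max.cobounded1 max.cobounded2)
  define A where "A = min p x - N"
  interpret gt_move "gt_weight a A" "gt_weight (f_star p a) A" p "k_f p a + 1 - p" "f_const p a"
    by (rule gt_move_f_star[OF N(1)]) (simp add: A_def)
  have "gt_weight (f_star p a) A x 0 = gt_weight a A x 0" using w'[of x 0] x s0 by simp
  then show ?thesis using col_sum_eq[OF N(1), of A x] col_sum_eq[OF N(2), of A x] by (simp add: gt_weight_def A_def)
qed

lemma col_sum_f_on:
  assumes a: "a \<in> lusztig_Z" and Q: "separated Q" "x - 1 \<notin> Q"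
  shows "col_sum (f_on Q a) x = col_sum a x"
proof -
  obtain N where N: "band N a" using a lusztig_Z_band by blast
  define W where "W = {x - (N + 2) - 2..x}"
  have "finite R \<Longrightarrow> R \<subseteq> Q \<Longrightarrow> col_sum (f_on R a) x = col_sum a x" for R
  proof (induction R rule: finite_induct)
    case (insert q R)
    moreover have "x \<noteq> q + 1" using insert.prems Q(2) by auto
    ultimately show ?case
      using col_sum_f_star[OF f_on_lusztig_Z[OF a], of x q R] f_on_insert'[of q R a] separated_subset[OF Q(1), of "insert q R"] Q(2)
      by auto
  qed simp
  then have "col_sum (f_on (Q \<inter> W) a) x = col_sum a x" by (simp add: W_def)
  moreover have "(\<Sum>i\<in>{x - (N + 2)..x - 1}. int (f_on Q a i x)) = (\<Sum>i\<in>{x - (N + 2)..x - 1}. int (f_on (Q \<inter> W) a i x))"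
  proof (rule sum.cong)
    fix i assume "i \<in> {x - (N + 2)..x - 1}"
    then have "f_on Q a i x = f_on (Q \<inter> W) a i x" by (intro f_on_cong) (auto simp: W_def)
    then show "int (f_on Q a i x) = int (f_on (Q \<inter> W) a i x)" by simp
  qed simp
  ultimately show ?thesis
    using col_sum_eq[OF band_f_on[OF N], of "x - (N + 2)" x Q] col_sum_eq[OF band_f_on[OF N], of "x - (N + 2)" x "Q \<inter> W"] by simp
qed

lemma f_const_f_on:
  assumes a: "a \<in> lusztig_Z" and Q: "separated Q" "q \<notin> Q" "q - 1 \<notin> Q" "q + 1 \<notin> Q"
  shows "f_const q (f_on Q a) = f_const q a"
  using f_on_rows(3)[OF Q(2-4), of a] k_cong(1)[OF f_on_rows(3)[OF Q(2-4), of a]]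
    col_sum_f_on[OF a Q(1), of q] col_sum_f_on[OF a Q(1), of "q + 1"] Q by (simp add: f_const_def)

section \<open>The affine operators as products over a residue class\<close>

definition residue_class :: "nat \<Rightarrow> int \<Rightarrow> int set" where
  "residue_class l p = {q. q mod int l = p mod int l}"

lemma f_hat_star_f_on: "f_hat_star l p a = f_on (residue_class l p) a"
  unfolding f_hat_star_def f_on_def residue_class_def mem_Collect_eq ..

lemma residue_class_apart:
  assumes "3 \<le> l" "q \<in> residue_class l p" "q' \<in> residue_class l p"
  shows "q' \<noteq> q + 1" "q' \<noteq> q - 1" "q' \<noteq> q + 2" "q' \<noteq> q - 2"
proof -
  have "q' mod int l = q mod int l" using assms(2,3) by (simp add: residue_class_def)
  then have "int l dvd q' - q" by (simp add: mod_eq_dvd_iff)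
  moreover have "\<not> int l dvd 1" "\<not> int l dvd -1" "\<not> int l dvd 2" "\<not> int l dvd -2"
    using assms(1) zdvd_imp_le[of "int l" 1] zdvd_imp_le[of "int l" 2] by auto
  ultimately show "q' \<noteq> q + 1" "q' \<noteq> q - 1" "q' \<noteq> q + 2" "q' \<noteq> q - 2" by auto
qed

text \<open>The equality of the two constants makes each factor \<open>f_star\<close> on the Lusztig
  side correspond to \<open>f_Z\<close> on the BZ side. For aperiodic data it comes from evaluating
  \<Theta>.\<close>

locale affine_f =
  fixes l :: nat and p :: int and a :: lusztig
  assumes l: "3 \<le> l" and a: "a \<in> lusztig_Z" "Psi a \<in> BZ_Z"
    and const_eq: "\<And>q. q \<in> residue_class l p \<Longrightarrow> f_const q a = Theta_const q (Psi a)"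
begin

abbreviation "P \<equiv> residue_class l p"

lemma sep: "Q \<subseteq> P \<Longrightarrow> separated Q"
  using residue_class_apart(1)[OF l] unfolding separated_def by blast

lemma apart: "Q \<subseteq> P \<Longrightarrow> q \<in> P \<Longrightarrow> q - 1 \<notin> Q \<and> q + 1 \<notin> Q"
  using residue_class_apart(1,2)[OF l, of q p] by blast

text \<open>The four sets have bad positions only among q - 1, q and q + 1, and the neighbours of q
  are not in the class. Hence earlier factors do not disturb the constant of a later one.\<close>

lemma Theta_f_on:
  assumes "Q \<subseteq> P" "q \<in> P"
  shows "Theta (Psi (f_on Q a)) {..q} = Theta (Psi a) {..q} - (if q \<in> Q then 1 else 0)"
    "Theta (Psi (f_on Q a)) {..q - 1} = Theta (Psi a) {..q - 1}"
    "Theta (Psi (f_on Q a)) {..q + 1} = Theta (Psi a) {..q + 1}"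
    "Theta (Psi (f_on Q a)) (swapped q) = Theta (Psi a) (swapped q)"
proof -
  note T = Psi_f_on(2)[OF a sep[OF assms(1)]]
  note qq = apart[OF assms]
  have "{q' \<in> Q. q' \<in> {..q - 1} \<and> q' + 1 \<notin> {..q - 1}} = {}"
  proof -
    have "q' = q - 1" if "q' \<in> {..q - 1}" "q' + 1 \<notin> {..q - 1}" for q' using that by auto
    then show ?thesis using qq by blast
  qed
  from T[OF atMost_maya, of "q - 1", unfolded this]
  show "Theta (Psi (f_on Q a)) {..q - 1} = Theta (Psi a) {..q - 1}" by simp
  have "{q' \<in> Q. q' \<in> {..q + 1} \<and> q' + 1 \<notin> {..q + 1}} = {}"
  proof -
    have "q' = q + 1" if "q' \<in> {..q + 1}" "q' + 1 \<notin> {..q + 1}" for q' using that by auto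
    then show ?thesis using qq by blast
  qed
  from T[OF atMost_maya, of "q + 1", unfolded this]
  show "Theta (Psi (f_on Q a)) {..q + 1} = Theta (Psi a) {..q + 1}" by simp
  have "{q' \<in> Q. q' \<in> swapped q \<and> q' + 1 \<notin> swapped q} = {}"
  proof -
    have "q' = q + 1 \<or> q' = q - 1" if "q' \<in> swapped q" "q' + 1 \<notin> swapped q" for q' using that by (auto simp: swapped_def)
    then show ?thesis using qq by blast
  qed
  from T[OF swapped_maya, of q, unfolded this]
  show "Theta (Psi (f_on Q a)) (swapped q) = Theta (Psi a) (swapped q)" by simp
  have *: "{q' \<in> Q. q' \<in> {..q} \<and> q' + 1 \<notin> {..q}} = Q \<inter> {q}" by auto
  show "Theta (Psi (f_on Q a)) {..q} = Theta (Psi a) {..q} - (if q \<in> Q then 1 else 0)"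
  proof (cases "q \<in> Q")
    case True
    have "f_on {q} a = f_star q a" using f_on_insert[of q "{}" a] by simp
    moreover have "Psi (f_star q a) = f_Z q (Psi a)"
      using star_Phi_f_star[OF a(1)] f_Z_eq[OF a(2)] const_eq[OF assms(2)] by simp
    moreover have "Q \<inter> {q} = {q}" using True by auto
    ultimately show ?thesis using T[OF atMost_maya, of q, unfolded *] True Theta_f_Z_atMost[OF a(2), of q q] by simp
  next
    case False
    then have "Q \<inter> {q} = {}" by auto
    then show ?thesis using T[OF atMost_maya, of q, unfolded *] False by simp
  qed
qed

lemma f_Z_f_on:
  assumes "Q \<subseteq> P" "q \<in> P" "q \<notin> Q"
  shows "f_Z q (Psi (f_on Q a)) = Psi (f_on (insert q Q) a)"
proof -
  note qq = apart[OF assms(1,2)]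
  have "Theta_const q (Psi (f_on Q a)) = f_const q (f_on Q a)"
    using Theta_f_on[OF assms(1,2)] assms(3) f_const_f_on[OF a(1) sep[OF assms(1)], of q] qq const_eq[OF assms(2)]
    by (simp add: Theta_const_def)
  then show ?thesis
    using f_Z_eq[OF Psi_f_on(1)[OF a sep[OF assms(1)]]] star_Phi_f_star[OF f_on_lusztig_Z[OF a(1)]]
      f_on_insert[of q Q a] qq assms(3) by simp
qed

lemma fold_f_Z:
  "distinct qs \<Longrightarrow> set qs \<subseteq> P \<Longrightarrow> Q \<subseteq> P \<Longrightarrow> set qs \<inter> Q = {} \<Longrightarrow>
    fold f_Z qs (Psi (f_on Q a)) = Psi (f_on (Q \<union> set qs) a)"
proof (induction qs arbitrary: Q)
  case (Cons q qs)
  then have "fold f_Z qs (Psi (f_on (insert q Q) a)) = Psi (f_on (insert q Q \<union> set qs) a)"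
    by (intro Cons.IH) auto
  then show ?case using f_Z_f_on[of Q q] Cons.prems by simp
qed simp

lemma L_set_facts:
  assumes "k \<in> maya_c"
  shows "L_set l k p = {q \<in> P. q \<in> k \<and> q + 1 \<notin> k}" "finite (L_set l k p)" "L_set l k p \<subseteq> P"
proof -
  show 1: "L_set l k p = {q \<in> P. q \<in> k \<and> q + 1 \<notin> k}" by (auto simp: L_set_def residue_class_def)
  then show "L_set l k p \<subseteq> P" by auto
  have "- k \<in> maya" using assms by (simp add: maya_c_iff)
  then obtain lo hi where "{..<lo} \<subseteq> - k" "- k \<subseteq> {..hi}" using maya_bounds by blast
  then have "{q. q \<in> k \<and> q + 1 \<notin> k} \<subseteq> {lo..hi}" by force
  then have "finite {q. q \<in> k \<and> q + 1 \<notin> k}" by (rule finite_subset) simp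
  then show "finite (L_set l k p)" unfolding 1 by (rule rev_finite_subset) auto
qed

text \<open>On the BZ side only the factors in \<open>L_set\<close> are applied at the component k;
  on the Lusztig side the others can be trimmed.\<close>

lemma f_hat_Psi: "f_hat l p (Psi a) = Psi (f_hat_star l p a)"
proof
  fix k
  show "f_hat l p (Psi a) k = Psi (f_hat_star l p a) k"
  proof (cases "k \<in> maya_c")
    case True
    note L = L_set_facts[OF True]
    have "fold f_Z (sorted_list_of_set (L_set l k p)) (Psi a) = Psi (f_on (L_set l k p) a)"
      using fold_f_Z[of "sorted_list_of_set (L_set l k p)" "{}"] L(2,3) by simp
    moreover have "Psi (f_on P a) k = Psi (f_on (L_set l k p) a) k"
      by (rule f_on_trim[OF a(1) True sep]) (use L in auto)
    ultimately show ?thesis using True by (simp add: f_hat_def f_hat_star_f_on)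
  qed (simp add: f_hat_def star_def Phi_Z_def maya_c_iff)
qed

lemma e_Z_f_on:
  assumes "Q \<subseteq> P" "q \<in> Q"
  shows "e_Z q (Psi (f_on Q a)) = Some (Psi (f_on (Q - {q}) a))"
proof -
  have "Psi (f_on Q a) = f_Z q (Psi (f_on (Q - {q}) a))"
  proof -
    have "Q - {q} \<subseteq> P" "q \<in> P" "insert q (Q - {q}) = Q" using assms by auto
    then show ?thesis using f_Z_f_on[of "Q - {q}" q] by simp
  qed
  moreover have "Q - {q} \<subseteq> P" using assms by auto
  ultimately show ?thesis using e_Z_f_Z[OF Psi_f_on(1)[OF a sep]] by simp
qed

lemma fold_e_Z:
  "distinct qs \<Longrightarrow> set qs \<subseteq> Q \<Longrightarrow> Q \<subseteq> P \<Longrightarrow>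
    fold (\<lambda>q x. Option.bind x (e_Z q)) qs (Some (Psi (f_on Q a))) = Some (Psi (f_on (Q - set qs) a))"
proof (induction qs arbitrary: Q)
  case (Cons q qs)
  then have "fold (\<lambda>q x. Option.bind x (e_Z q)) qs (Some (Psi (f_on (Q - {q}) a))) = Some (Psi (f_on (Q - {q} - set qs) a))"
    by (intro Cons.IH) auto
  then show ?case using e_Z_f_on[of Q q] Cons.prems by (simp add: Diff_insert2[symmetric])
qed simp

lemma eps_Z_f_hat: "eps_Z p (Psi (f_hat_star l p a)) = eps_Z p (Psi a) + 1"
proof -
  have "p \<in> P" by (simp add: residue_class_def)
  then show ?thesis using Theta_f_on[of P p] unfolding eps_Z_alt f_hat_star_f_on by simp
qed

text \<open>At the component k the factors in \<open>L_set\<close> are undone. The rest of the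
  infinite product contains no position bad for k and can be trimmed away.\<close>

lemma e_hat_Psi: "e_hat l p (Psi (f_hat_star l p a)) = Some (Psi a)"
proof -
  have eps: "eps_Z p (Psi (f_hat_star l p a)) \<noteq> 0"
    using eps_Z_f_hat eps_Z_nonneg[OF a(2), of p] by simp
  have "(if k \<in> maya_c then the (fold (\<lambda>q x. Option.bind x (e_Z q)) (sorted_list_of_set (L_set l k p))
      (Some (Psi (f_hat_star l p a)))) k else 0) = Psi a k" for k
  proof (cases "k \<in> maya_c")
    case True
    note L = L_set_facts[OF True]
    have "Psi (f_on (P - L_set l k p) a) k = Psi (f_on {} a) k"
      by (rule f_on_trim[OF a(1) True sep]) (use L(1) in auto)
    then show ?thesis
      using True fold_e_Z[of "sorted_list_of_set (L_set l k p)" P] L by (simp add: f_hat_star_f_on)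
  qed (simp add: star_def Phi_Z_def maya_c_iff)
  then show ?thesis using eps by (simp add: e_hat_def)
qed

end

section \<open>Theta of aperiodic data\<close>

lemma sum_triangle:
  fixes f :: "int \<Rightarrow> int \<Rightarrow> int"
  shows "(\<Sum>x\<in>{lo..hi}. \<Sum>i\<in>{lo..x - 1}. f i x) = (\<Sum>x\<in>{lo..hi}. \<Sum>t\<in>{1..hi - x}. f x (x + t))"
proof -
  have "(\<Sum>x\<in>{lo..hi}. \<Sum>i\<in>{lo..x - 1}. f i x) = (\<Sum>x\<in>{lo..hi}. \<Sum>i | i \<in> {lo..hi} \<and> i < x. f i x)"
    by (intro sum.cong) auto
  also have "\<dots> = (\<Sum>i\<in>{lo..hi}. \<Sum>x | x \<in> {lo..hi} \<and> i < x. f i x)"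
    by (rule sum.swap_restrict) auto
  also have "\<dots> = (\<Sum>x\<in>{lo..hi}. \<Sum>t\<in>{1..hi - x}. f x (x + t))"
  proof (rule sum.cong)
    fix x assume "x \<in> {lo..hi}"
    then show "(\<Sum>y | y \<in> {lo..hi} \<and> x < y. f x y) = (\<Sum>t\<in>{1..hi - x}. f x (x + t))"
      by (intro sum.reindex_bij_witness[of _ "\<lambda>t. x + t" "\<lambda>y. y - x"]) auto
  qed simp
  finally show ?thesis .
qed

text \<open>For resting particles packed on an interval, the row sums paid at positive times cancel
  the column sums gained at time 0.\<close>

lemma sum_weight_triangle:
  "(\<Sum>x\<in>{lo..hi}. \<Sum>t\<in>{0..hi - x}. gt_weight a lo x t) = 0"
proof -
  have "(\<Sum>t\<in>{0..hi - x}. gt_weight a lo x t) =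
      (\<Sum>t\<in>{1..hi - x}. int (a x (x + t))) - (\<Sum>i\<in>{lo..x - 1}. int (a i x))" if "x \<in> {lo..hi}" for x
  proof -
    have "{0..hi - x} = insert 0 {1..hi - x}" using that by auto
    then have "(\<Sum>t\<in>{0..hi - x}. gt_weight a lo x t) = gt_weight a lo x 0 + (\<Sum>t\<in>{1..hi - x}. gt_weight a lo x t)" by simp
    also have "(\<Sum>t\<in>{1..hi - x}. gt_weight a lo x t) = (\<Sum>t\<in>{1..hi - x}. int (a x (x + t)))"
      by (intro sum.cong) (auto simp: gt_weight_def)
    finally show ?thesis by (simp add: gt_weight_def)
  qed
  then show ?thesis using sum_triangle[where f = "\<lambda>i x. int (a i x)" and lo = lo and hi = hi] by (simp add: sum_subtractf)
qed

lemma r_coeff_eq: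
  assumes a: "band N a" and A: "A + N \<le> p + 1" "p + N \<le> T"
  shows "int (r_coeff p a) = (\<Sum>x\<in>{p + 1..T}. \<Sum>i\<in>{A..p}. int (a i x))"
proof -
  have "{(s, t). s \<le> p \<and> p + 1 \<le> t \<and> a s t \<noteq> 0} \<subseteq> {A..p} \<times> {p + 1..T}"
  proof
    fix x assume "x \<in> {(s, t). s \<le> p \<and> p + 1 \<le> t \<and> a s t \<noteq> 0}"
    then obtain s t where x: "x = (s, t)" "s \<le> p" "p + 1 \<le> t" "a s t \<noteq> 0" by auto
    then show "x \<in> {A..p} \<times> {p + 1..T}" using bandD[OF a x(4)] A by auto
  qed
  then have "r_coeff p a = (\<Sum>(s, t)\<in>{A..p} \<times> {p + 1..T}. a s t)"
    unfolding r_coeff_def by (intro sum.mono_neutral_left) auto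
  also have "\<dots> = (\<Sum>s\<in>{A..p}. \<Sum>t\<in>{p + 1..T}. a s t)" by (rule sum.cartesian_product[symmetric])
  also have "\<dots> = (\<Sum>t\<in>{p + 1..T}. \<Sum>s\<in>{A..p}. a s t)" by (rule sum.swap)
  finally show ?thesis by simp
qed

lemma sum_split_int:
  fixes f :: "int \<Rightarrow> int"
  assumes "lo \<le> m" "m \<le> hi + 1"
  shows "(\<Sum>x\<in>{lo..hi}. f x) = (\<Sum>x\<in>{lo..m - 1}. f x) + (\<Sum>x\<in>{m..hi}. f x)"
proof -
  have "{lo..hi} = {lo..m - 1} \<union> {m..hi}" using assms by auto
  then show ?thesis using sum.union_disjoint[of "{lo..m - 1}" "{m..hi}" f] by auto
qed

text \<open>What parking takes from periodicity and aperiodicity: on every diagonal the zeros have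
  bounded gaps.\<close>

definition zero_rich :: "nat \<Rightarrow> lusztig \<Rightarrow> bool" where
  "zero_rich l a \<longleftrightarrow> (\<forall>t\<ge>1. \<forall>x. \<exists>z. x \<le> z \<and> z < x + int l \<and> a z (z + t) = 0)"

text \<open>Particles that start below the gap can be parked at zero entries: the particle that is
  \<open>\<rho>\<close>-th from the top sits, \<open>\<sigma>\<close> steps after it was released, in its own window of length \<open>l\<close>.\<close>

lemma parking:
  assumes a: "band N a" and z: "zero_rich l a" and l: "0 < l"
  obtains g :: "int \<Rightarrow> int \<Rightarrow> int" where
    "\<And>\<rho> \<sigma>. 0 \<le> \<rho> \<Longrightarrow> 0 \<le> \<sigma> \<Longrightarrow> a (g \<rho> \<sigma>) (g \<rho> \<sigma> + (\<rho> + \<sigma> + 1)) = 0"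
    "\<And>\<rho> \<sigma>. 0 \<le> \<rho> \<Longrightarrow> 0 \<le> \<sigma> \<Longrightarrow> g \<rho> \<sigma> \<le> g \<rho> (\<sigma> + 1)"
    "\<And>\<rho> \<sigma>. 0 \<le> \<rho> \<Longrightarrow> 0 \<le> \<sigma> \<Longrightarrow> g (\<rho> + 1) \<sigma> < g \<rho> \<sigma>"
    "\<And>\<sigma>. 0 \<le> \<sigma> \<Longrightarrow> g 0 \<sigma> < b + 2 * int l * N + int l"
    "\<And>\<rho>. 0 \<le> \<rho> \<Longrightarrow> b - \<rho> \<le> g \<rho> 0"
proof -
  have N: "0 < N" using a by (simp add: band_def)
  define Z where "Z t x = (SOME z. x \<le> z \<and> z < x + int l \<and> a z (z + t) = 0)" for t x
  have Z: "x \<le> Z t x" "Z t x < x + int l" "a (Z t x) (Z t x + t) = 0" if "1 \<le> t" for t x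
    using someI_ex[of "\<lambda>z. x \<le> z \<and> z < x + int l \<and> a z (z + t) = 0"] z that
    unfolding zero_rich_def Z_def by blast+
  define L where "L = int l"
  have L: "0 < L" using l by (simp add: L_def)
  \<comment> \<open>\<open>h \<rho> \<sigma>\<close> is the left end of the window of particle
    \<rho> at step \<sigma>. Windows move by L per particle and per step until the count reaches N.
    After that the band condition makes all prices zero, so unit spacing between particles and no
    motion in time suffice. The offset L * N keeps g above the starting points b - \<rho>.\<close>
  define h where "h \<rho> \<sigma> = b + L * N + L * min \<sigma> N - (if \<rho> \<le> N then L * \<rho> else L * N + (\<rho> - N))" for \<rho> \<sigma>
  define g where "g \<rho> \<sigma> = (if \<rho> + \<sigma> + 1 < N then Z (\<rho> + \<sigma> + 1) (h \<rho> \<sigma>) else h \<rho> \<sigma>)" for \<rho> \<sigma>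
  have gh: "h \<rho> \<sigma> \<le> g \<rho> \<sigma>" "g \<rho> \<sigma> < h \<rho> \<sigma> + L" if "0 \<le> \<rho>" "0 \<le> \<sigma>" for \<rho> \<sigma>
    using Z(1,2)[of "\<rho> + \<sigma> + 1" "h \<rho> \<sigma>"] that L by (auto simp: g_def L_def)
  have g': "g \<rho> \<sigma> = h \<rho> \<sigma>" if "N \<le> \<rho> + \<sigma> + 1" for \<rho> \<sigma> using that by (simp add: g_def)
  show ?thesis
  proof (rule that)
    show "a (g \<rho> \<sigma>) (g \<rho> \<sigma> + (\<rho> + \<sigma> + 1)) = 0" if "0 \<le> \<rho>" "0 \<le> \<sigma>" for \<rho> \<sigma>
      using Z(3)[of "\<rho> + \<sigma> + 1" "h \<rho> \<sigma>"] that a by (auto simp: g_def band_def)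
    show "g \<rho> \<sigma> \<le> g \<rho> (\<sigma> + 1)" if "0 \<le> \<rho>" "0 \<le> \<sigma>" for \<rho> \<sigma>
    proof (cases "\<sigma> < N")
      case True
      then have "h \<rho> (\<sigma> + 1) = h \<rho> \<sigma> + L" by (simp add: h_def min_def algebra_simps)
      then show ?thesis using gh[of \<rho> \<sigma>] gh[of \<rho> "\<sigma> + 1"] that by simp
    next
      case False
      then show ?thesis using that by (simp add: g' h_def)
    qed
    show "g (\<rho> + 1) \<sigma> < g \<rho> \<sigma>" if "0 \<le> \<rho>" "0 \<le> \<sigma>" for \<rho> \<sigma>
    proof (cases "\<rho> < N")
      case True
      then have "h (\<rho> + 1) \<sigma> = h \<rho> \<sigma> - L" by (simp add: h_def algebra_simps)
      then show ?thesis using gh[of \<rho> \<sigma>] gh[of "\<rho> + 1" \<sigma>] that by simp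
    next
      case False
      then show ?thesis using that by (simp add: g' h_def)
    qed
    show "g 0 \<sigma> < b + 2 * int l * N + int l" if "0 \<le> \<sigma>" for \<sigma>
    proof -
      have "L * min \<sigma> N \<le> L * N" using L by simp
      then have "h 0 \<sigma> \<le> b + 2 * L * N" using N by (simp add: h_def)
      then show ?thesis using gh(2)[of 0 \<sigma>] that by (simp add: L_def)
    qed
    show "b - \<rho> \<le> g \<rho> 0" if "0 \<le> \<rho>" for \<rho>
    proof -
      have "L * \<rho> \<le> L * N" if "\<rho> \<le> N" using that L by simp
      then have "b - \<rho> \<le> h \<rho> 0" using that N by (auto simp: h_def)
      then show ?thesis using gh(1)[of \<rho> 0] that by simp
    qed
  qed
qed

text \<open>Above the gap the particles are packed and cannot move, except particle n if it starts
  at p. Those below are released when q reaches n and are parked at price 0; the gap is long enough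
  to keep them below p. The only choice left is the time u at which particle n steps from p to p +
  1, and u = s0 is best.\<close>

lemma Phi_Z_gap:
  assumes a: "band N a" and z: "zero_rich l a" and l: "0 < l"
    and n: "n + 2 * int l * N + int l \<le> p" and T: "p + N + 1 \<le> T"
  shows "Phi_Z a ({..<n} \<union> {p + 1..T}) = - int (r_coeff p a)"
    "Phi_Z a ({..<n} \<union> ({p} \<union> {p + 2..T})) = - int (r_coeff p a) - (f_const p a + 1)"
proof -
  have N: "0 < N" using a by (simp add: band_def)
  have "0 \<le> 2 * int l * N" using N by simp
  then have np: "n \<le> p" using n by linarith
  define A where "A = n - 1 - N"
  define r where "r = n + T - p - 1"
  define E where "E v j = (if j < n then j else if j = n then v else p + 1 + (j - n))" for v j
  let ?w = "gt_weight a A"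
  let ?s = "k_f p a + 1 - p"
  have A: "A + N \<le> p" "A \<le> n" "n \<le> r" "p < T" "n \<le> p" using np T N by (auto simp: A_def r_def)
  interpret gt_move ?w "gt_weight (f_star p a) A" p ?s "f_const p a" A r
    by (rule gt_move_f_star[OF a A(1)])
  have sN: "?s \<le> N + 1"
  proof (rule ccontr)
    assume "\<not> ?s \<le> N + 1"
    then have k: "p + N < k_f p a" by simp
    then have "A_star p a (p + N) < eps_star p a" using k_f_props(3)[OF a, of p "p + N"] N by simp
    then show False using A_star_zero[OF a, of p "p + N"] A_star_zero[OF a, of p "k_f p a"] k_f_props(2)[OF a, of p] k by simp
  qed
  have Em: "strict_mono_on {..r} (E v)" if "v \<in> {p, p + 1}" for v
    using that A by (auto simp: strict_mono_on_def E_def)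
  have EA: "strict_mono_on {A..r} (E v)" if "v \<in> {p, p + 1}" for v
    using Em[OF that] by (rule monotone_on_subset) auto
  have enum: "is_enum ({..<n} \<union> ({v} \<union> {p + 2..T})) r (E v) (n - 1)" if v: "v \<in> {p, p + 1}" for v
  proof -
    have "E v ` {..r} = {..<n} \<union> ({v} \<union> {p + 2..T})"
    proof (intro set_eqI iffI)
      fix x assume x: "x \<in> {..<n} \<union> ({v} \<union> {p + 2..T})"
      consider "x < n" | "x = v" | "p + 2 \<le> x" "x \<le> T" using x by auto
      then show "x \<in> E v ` {..r}"
      proof cases
        case 1
        then show ?thesis using A by (intro image_eqI[of _ _ x]) (auto simp: E_def)
      next
        case 2
        then show ?thesis using A by (intro image_eqI[of _ _ n]) (auto simp: E_def)
      next
        case 3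
        then show ?thesis using A by (intro image_eqI[of _ _ "x - p - 1 + n"]) (auto simp: E_def r_def)
      qed
    qed (auto simp: E_def r_def)
    then show ?thesis using Em[OF v] A by (auto simp: is_enum_def E_def)
  qed
  define W where "W = (\<Sum>i\<in>{n + 1..r}. \<Sum>t\<in>{0..r - i}. ?w (p + 1 + (i - n)) t)"
  define S where "S = (\<Sum>t\<in>{0..r - n}. ?w (p + 1) t)"
  define X where "X C = (\<Sum>t\<in>{0..r - n}. ?w (C n (n + t)) t)" for C :: "int \<Rightarrow> int \<Rightarrow> int"
  define Y where "Y C = (\<Sum>i\<in>{A..n - 1}. \<Sum>t\<in>{n - i..r - i}. int (a (C i (i + t)) (C i (i + t) + t)))" for C :: "int \<Rightarrow> int \<Rightarrow> int"
  have cost: "gt_cost ?w A r C = Y C + X C + W" if v: "v \<in> {p, p + 1}" and C: "C \<in> gt_patterns A r (E v)" for v C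
  proof -
    have hi: "(\<Sum>t\<in>{0..r - i}. ?w (C i (i + t)) t) = (\<Sum>t\<in>{0..r - i}. ?w (p + 1 + (i - n)) t)"
      if "i \<in> {n + 1..r}" for i
    proof (rule sum.cong)
      fix t assume "t \<in> {0..r - i}"
      then have "C i (i + t) = p + 1 + (i - n)"
        using gt_bounds[OF C, of i "i + t"] that A by (simp add: E_def)
      then show "?w (C i (i + t)) t = ?w (p + 1 + (i - n)) t" by simp
    qed simp
    have low: "(\<Sum>t\<in>{0..r - i}. ?w (C i (i + t)) t) =
        (\<Sum>t\<in>{0..n - 1 - i}. ?w i t) + (\<Sum>t\<in>{n - i..r - i}. int (a (C i (i + t)) (C i (i + t) + t)))"
      if i: "i \<in> {A..n - 1}" for i
    proof -
      have "(\<Sum>t\<in>{0..n - 1 - i}. ?w (C i (i + t)) t) = (\<Sum>t\<in>{0..n - 1 - i}. ?w i t)"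
      proof (rule sum.cong)
        fix t assume "t \<in> {0..n - 1 - i}"
        then have "C i (i + t) = i" using gt_bounds[OF C, of i "i + t"] i A by (simp add: E_def)
        then show "?w (C i (i + t)) t = ?w i t" by simp
      qed simp
      moreover have "(\<Sum>t\<in>{n - i..r - i}. ?w (C i (i + t)) t) = (\<Sum>t\<in>{n - i..r - i}. int (a (C i (i + t)) (C i (i + t) + t)))"
        using i by (intro sum.cong) (auto simp: gt_weight_def)
      ultimately show ?thesis using sum_split_int[of 0 "n - i" "r - i" "\<lambda>t. ?w (C i (i + t)) t"] i A by (simp add: algebra_simps)
    qed
    have "gt_cost ?w A r C = (\<Sum>i\<in>{A..n - 1}. \<Sum>t\<in>{0..r - i}. ?w (C i (i + t)) t) + (\<Sum>i\<in>{n..r}. \<Sum>t\<in>{0..r - i}. ?w (C i (i + t)) t)"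
      unfolding gt_cost_def using A by (intro sum_split_int) auto
    also have "(\<Sum>i\<in>{A..n - 1}. \<Sum>t\<in>{0..r - i}. ?w (C i (i + t)) t) = Y C"
      using low sum_weight_triangle[where lo = A and hi = "n - 1" and a = a] by (simp add: sum.distrib Y_def)
    also have "(\<Sum>i\<in>{n..r}. \<Sum>t\<in>{0..r - i}. ?w (C i (i + t)) t) = X C + W"
      using sum_split_int[of n "n + 1" r "\<lambda>i. \<Sum>t\<in>{0..r - i}. ?w (C i (i + t)) t"] A hi by (simp add: W_def X_def)
    finally show ?thesis by simp
  qed
  have Y0: "0 \<le> Y C" for C by (simp add: Y_def sum_nonneg)
  \<comment> \<open>\<open>f_const p a + 1\<close> is the maximum of the partial sums of price
    differences.\<close>
  have Snu: "(\<Sum>t\<in>{0..<u}. ?w (p + 1) t - ?w p t) \<le> f_const p a + 1" if "1 \<le> u" for u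
  proof (cases "u < ?s")
    case True
    have "(\<Sum>t\<in>{0..<?s}. ?w (p + 1) t - ?w p t) = (\<Sum>t\<in>{0..<u}. ?w (p + 1) t - ?w p t) + (\<Sum>t\<in>{u..<?s}. ?w (p + 1) t - ?w p t)"
      using True that by (subst sum.union_disjoint[symmetric]) (auto intro: sum.cong)
    then show ?thesis using before[of u] that True c by simp
  next
    case False
    have "(\<Sum>t\<in>{0..<u}. ?w (p + 1) t - ?w p t) = (\<Sum>t\<in>{0..<?s}. ?w (p + 1) t - ?w p t) + (\<Sum>t\<in>{?s..<u}. ?w (p + 1) t - ?w p t)"
      using False s0 by (subst sum.union_disjoint[symmetric]) (auto intro: sum.cong)
    then show ?thesis using after[of u] False c by simp
  qed
  have Xu: "(\<Sum>t\<in>{0..r - n}. if t < u then ?w p t else ?w (p + 1) t) = S - (\<Sum>t\<in>{0..<u}. ?w (p + 1) t - ?w p t)"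
    if "0 \<le> u" "u \<le> r - n + 1" for u
  proof -
    have "(\<Sum>t\<in>{0..r - n}. if t < u then ?w p t else ?w (p + 1) t) =
      (\<Sum>t\<in>{0..r - n}. ?w (p + 1) t - (if t < u then ?w (p + 1) t - ?w p t else 0))"
      by (intro sum.cong) auto
    also have "\<dots> = S - (\<Sum>t\<in>{0..r - n}. if t < u then ?w (p + 1) t - ?w p t else 0)"
      by (simp add: sum_subtractf S_def)
    also have "(\<Sum>t\<in>{0..r - n}. if t < u then ?w (p + 1) t - ?w p t else 0) = (\<Sum>t\<in>{0..<u}. ?w (p + 1) t - ?w p t)"
      using that by (intro sum.mono_neutral_cong_right) auto
    finally show ?thesis .
  qed
  obtain g :: "int \<Rightarrow> int \<Rightarrow> int" where g:
    "\<And>\<rho> \<sigma>. 0 \<le> \<rho> \<Longrightarrow> 0 \<le> \<sigma> \<Longrightarrow> a (g \<rho> \<sigma>) (g \<rho> \<sigma> + (\<rho> + \<sigma> + 1)) = 0"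
    "\<And>\<rho> \<sigma>. 0 \<le> \<rho> \<Longrightarrow> 0 \<le> \<sigma> \<Longrightarrow> g \<rho> \<sigma> \<le> g \<rho> (\<sigma> + 1)"
    "\<And>\<rho> \<sigma>. 0 \<le> \<rho> \<Longrightarrow> 0 \<le> \<sigma> \<Longrightarrow> g (\<rho> + 1) \<sigma> < g \<rho> \<sigma>"
    "\<And>\<sigma>. 0 \<le> \<sigma> \<Longrightarrow> g 0 \<sigma> < n + 2 * int l * N + int l"
    "\<And>\<rho>. 0 \<le> \<rho> \<Longrightarrow> n - \<rho> \<le> g \<rho> 0"
    by (rule parking[OF a z l, of n]) (rule that)
  \<comment> \<open>The candidate with switching time u. In the parking function, n - 1 - i counts
    the particles from the top and q - n the steps since release; their sum plus one is the time q -
    i.\<close>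
  define D where "D u i q = (if i < n then (if q < n then i else g (n - 1 - i) (q - n))
    else if i = n then (if q - n < u then p else p + 1) else p + 1 + (i - n))" for u i q
  have DP: "D u \<in> gt_patterns A r (E (if 0 < u then p else p + 1))" for u
    unfolding gt_patterns_def
  proof (intro CollectI conjI ballI allI impI)
    fix i assume i: "i \<in> {A..r}"
    show "D u i i = E (if 0 < u then p else p + 1) i" by (auto simp: D_def E_def)
    fix q assume q: "i \<le> q \<and> q + 1 \<in> {A..r}"
    consider "i < n" "q + 1 < n" | "i < n" "q + 1 = n" | "i < n" "n \<le> q" | "n \<le> i" by linarith
    then show "D u i q \<le> D u i (q + 1)"
    proof cases
      case 2
      have "i \<le> g (n - 1 - i) 0" using g(5)[of "n - 1 - i"] 2 by simp
      then show ?thesis using 2 by (simp add: D_def)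
    next
      case 3
      then show ?thesis using g(2)[of "n - 1 - i" "q - n"] by (simp add: D_def algebra_simps)
    qed (use i q in \<open>auto simp: D_def\<close>)
  next
    fix i q assume iq: "i \<in> {A..r}" "q \<in> {A..r}" "i < q"
    consider "i + 1 < n" "q < n" | "i + 1 = n" | "i + 1 < n" "n \<le> q" | "n \<le> i" | "n \<le> i + 1" "q < n" by linarith
    then show "D u i q < D u (i + 1) q"
    proof cases
      case 2
      then show ?thesis using g(4)[of "q - n"] n iq by (auto simp: D_def)
    next
      case 3
      have e: "n - 1 - (i + 1) + 1 = n - 1 - i" by simp
      show ?thesis using g(3)[of "n - 1 - (i + 1)" "q - n", unfolded e] 3 by (simp add: D_def)
    qed (use iq in \<open>auto simp: D_def\<close>)
  qed
  have YD: "Y (D u) = 0" for u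
    unfolding Y_def
  proof (intro sum.neutral ballI)
    fix i t assume i: "i \<in> {A..n - 1}" "t \<in> {n - i..r - i}"
    have "D u i (i + t) = g (n - 1 - i) (i + t - n)" using i by (simp add: D_def)
    moreover have "n - 1 - i + (i + t - n) + 1 = t" by simp
    ultimately show "int (a (D u i (i + t)) (D u i (i + t) + t)) = 0"
      using g(1)[of "n - 1 - i" "i + t - n"] i by simp
  qed
  have XD: "X (D u) = S - (\<Sum>t\<in>{0..<u}. ?w (p + 1) t - ?w p t)" if "0 \<le> u" "u \<le> r - n + 1" for u
    unfolding Xu[OF that, symmetric] X_def by (intro sum.cong) (auto simp: D_def)
  \<comment> \<open>Splitting the column sums at p leaves the packed triangle on
    \<open>{p + 1..T}\<close>, of cost 0, and minus the sum of the entries a i x with i <= p < x,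
    which is \<open>r_coeff\<close>.\<close>
  have total: "S + W = - int (r_coeff p a)"
  proof -
    have "S + W = (\<Sum>i\<in>{n..r}. \<Sum>t\<in>{0..r - i}. ?w (p + 1 + (i - n)) t)"
      using sum_split_int[of n "n + 1" r "\<lambda>i. \<Sum>t\<in>{0..r - i}. ?w (p + 1 + (i - n)) t"] A by (simp add: S_def W_def)
    also have "\<dots> = (\<Sum>x\<in>{p + 1..T}. \<Sum>t\<in>{0..T - x}. ?w x t)"
      by (rule sum.reindex_bij_witness[of _ "\<lambda>x. x - p - 1 + n" "\<lambda>i. p + 1 + (i - n)"]) (auto simp: r_def algebra_simps)
    also have "\<dots> = (\<Sum>x\<in>{p + 1..T}. (\<Sum>t\<in>{0..T - x}. gt_weight a (p + 1) x t) - (\<Sum>i\<in>{A..p}. int (a i x)))"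
    proof (rule sum.cong)
      fix x assume x: "x \<in> {p + 1..T}"
      have "(\<Sum>i\<in>{A..x - 1}. int (a i x)) = (\<Sum>i\<in>{A..p}. int (a i x)) + (\<Sum>i\<in>{p + 1..x - 1}. int (a i x))"
        using sum_split_int[of A "p + 1" "x - 1" "\<lambda>i. int (a i x)"] x A N by simp
      then have "?w x t = gt_weight a (p + 1) x t - (if t = 0 then (\<Sum>i\<in>{A..p}. int (a i x)) else 0)" for t
        by (simp add: gt_weight_def)
      then show "(\<Sum>t\<in>{0..T - x}. ?w x t) = (\<Sum>t\<in>{0..T - x}. gt_weight a (p + 1) x t) - (\<Sum>i\<in>{A..p}. int (a i x))"
        using x by (simp add: sum_subtractf)
    qed simp
    also have "\<dots> = - int (r_coeff p a)"
      using sum_weight_triangle[where lo = "p + 1" and hi = T and a = a] r_coeff_eq[OF a, of A p T] A T N by (simp add: sum_subtractf)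
    finally show ?thesis .
  qed
  have Eq: "A + N \<le> n - 1" by (simp add: A_def)
  have set1: "{..<n} \<union> ({p + 1} \<union> {p + 2..T}) = {..<n} \<union> {p + 1..T}" using A by auto
  have "Phi_Z a ({..<n} \<union> ({p + 1} \<union> {p + 2..T})) = gt_min ?w A r (E (p + 1))"
    by (rule Phi_Z_eq[OF a enum Eq]) simp
  also have "\<dots> = S + W"
  proof (rule gt_min_eqI[OF EA])
    show "D 0 \<in> gt_patterns A r (E (p + 1))" using DP[of 0] by simp
    then show "gt_cost ?w A r (D 0) \<le> S + W" using cost[of "p + 1" "D 0"] YD[of 0] XD[of 0] A by simp
    fix C assume C: "C \<in> gt_patterns A r (E (p + 1))"
    have "X C = S" unfolding X_def S_def
    proof (rule sum.cong)
      fix t assume "t \<in> {0..r - n}"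
      then have "C n (n + t) = p + 1" using gt_bounds[OF C, of n "n + t"] A
        by (cases "t = 0") (auto simp: E_def)
      then show "?w (C n (n + t)) t = ?w (p + 1) t" by simp
    qed simp
    then show "S + W \<le> gt_cost ?w A r C" using cost[OF _ C] Y0[of C] by simp
  qed simp
  finally show "Phi_Z a ({..<n} \<union> {p + 1..T}) = - int (r_coeff p a)" unfolding set1 total .
  \<comment> \<open>T was taken beyond p + N so that the switch at s0 <= N + 1 happens within the
    lifetime of particle n.\<close>
  have sr: "0 \<le> ?s" "?s \<le> r - n + 1" using sN T s0 by (auto simp: r_def)
  have "Phi_Z a ({..<n} \<union> ({p} \<union> {p + 2..T})) = gt_min ?w A r (E p)"
    by (rule Phi_Z_eq[OF a enum Eq]) simp
  also have "\<dots> = S + W - (f_const p a + 1)"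
  proof (rule gt_min_eqI[OF EA])
    show "D ?s \<in> gt_patterns A r (E p)" using DP[of ?s] s0 by simp
    then show "gt_cost ?w A r (D ?s) \<le> S + W - (f_const p a + 1)"
      using cost[of p "D ?s"] YD[of ?s] XD[OF sr] c by simp
    fix C assume C: "C \<in> gt_patterns A r (E p)"
    define V where "V = {t \<in> {0..r - n}. C n (n + t) = p}"
    have V: "finite V" "0 \<in> V" using gt_diag[OF C, of n] A unfolding V_def
      by (auto simp: E_def intro: finite_subset[of _ "{0..r - n}"])
    define u where "u = Max V + 1"
    have MV: "Max V \<in> V" using V Max_in by blast
    have u: "1 \<le> u" "u \<le> r - n + 1" using MV by (auto simp: V_def u_def)
    have Cn: "C n (n + t) = (if t < u then p else p + 1)" if "t \<in> {0..r - n}" for t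
    proof -
      have "p \<le> C n (n + t)" using gt_bounds(1)[OF C, of n "n + t"] that A by (simp add: E_def)
      moreover have "C n (n + t) \<le> p + 1"
        using gt_bounds(2)[OF C, of n "n + t"] that A by (cases "t = 0") (auto simp: E_def)
      moreover have "C n (n + t) \<le> p" if "t < u"
        using gt_row[OF C, of n "n + t" "n + Max V"] \<open>t \<in> {0..r - n}\<close> that MV A by (auto simp: V_def u_def)
      moreover have "C n (n + t) \<noteq> p" if "\<not> t < u"
        using Max_ge[OF V(1), of t] that \<open>t \<in> {0..r - n}\<close> by (auto simp: V_def u_def)
      ultimately show ?thesis by force
    qed
    have "X C = (\<Sum>t\<in>{0..r - n}. if t < u then ?w p t else ?w (p + 1) t)"
      unfolding X_def by (intro sum.cong) (auto simp: Cn)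
    then have "X C \<ge> S - (f_const p a + 1)" using Xu[of u] Snu[of u] u by simp
    then show "S + W - (f_const p a + 1) \<le> gt_cost ?w A r C" using cost[OF _ C] Y0[of C] by simp
  qed simp
  finally show "Phi_Z a ({..<n} \<union> ({p} \<union> {p + 2..T})) = - int (r_coeff p a) - (f_const p a + 1)"
    unfolding total .
qed

text \<open>On a large stable interval the complements of the reflected half-line and of its
  exchange are exactly the two sets with a gap.\<close>

lemma Theta_Psi:
  assumes a: "band N a" and z: "zero_rich l a" and l: "0 < l" and BZ: "star (Phi_Z a) \<in> BZ_Z"
  shows "Theta (star (Phi_Z a)) {..p} = - int (r_coeff p a)"
    "Theta (star (Phi_Z a)) (swapped p) = - int (r_coeff p a) - (f_const p a + 1)"
proof -
  define n0 where "n0 = p - (2 * int l * N + int l)"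
  have N: "0 < N" using a by (simp add: band_def)
  have lN: "0 \<le> 2 * int l * N" using N by simp
  have "{{..p}, swapped p} \<subseteq> maya" using atMost_maya swapped_maya by blast
  then obtain J where J: "J \<in> fin_intervals" "{n0..p + N} \<subseteq> J" "\<And>x. x \<in> {{..p}, swapped p} \<Longrightarrow> J \<in> Int_c (star (Phi_Z a)) (- x)"
    using Int_c_ex[OF BZ _ _ atLeastAtMost_fin_intervals[of n0 "p + N"], of "{{..p}, swapped p}"] N lN
    by (auto simp: n0_def)
  obtain n M where nM: "J = {n..M}" "n \<le> M" "Min J = n" "Max J = M" "tilde J = {n..M + 1}"
    using fin_intervalsE[OF J(1)] .
  have le: "n \<le> n0" "p + N \<le> M" using J(2) N lN unfolding nM(1) by (auto simp: n0_def)
  have np: "n + 2 * int l * N + int l \<le> p" "p + N + 1 \<le> M + 1" using le by (auto simp: n0_def)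
  have s: "n \<le> p" "p \<le> M" using np le N lN by linarith+
  have "- Omega_c J (- {..p}) = {..<n} \<union> {p + 1..M + 1}"
    unfolding Omega_c_compl nM(4,5) using s by auto
  moreover have "- Omega_c J (- swapped p) = {..<n} \<union> ({p} \<union> {p + 2..M + 1})"
    unfolding Omega_c_compl nM(4,5) swapped_def using s by auto
  ultimately show "Theta (star (Phi_Z a)) {..p} = - int (r_coeff p a)"
    "Theta (star (Phi_Z a)) (swapped p) = - int (r_coeff p a) - (f_const p a + 1)"
    using Theta_eq[OF J(3), of "{..p}"] Theta_eq[OF J(3), of "swapped p"] Phi_Z_gap[OF a z l np]
    by (simp_all add: star_def)
qed

section \<open>The crystal of aperiodic data\<close>

definition e_on :: "int set \<Rightarrow> lusztig \<Rightarrow> lusztig" where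
  "e_on Q a = (\<lambda>i j. if i \<in> Q then e_fun i a i j else if i - 1 \<in> Q then e_fun (i - 1) a i j else a i j)"

lemma f_star_row_cong:
  assumes "k_f q a = k_f q b" "a i j = b i j"
  shows "f_star q a i j = f_star q b i j"
  unfolding f_star_def assms ..

lemma e_fun_row_cong:
  assumes "k_e q a = k_e q b" "a i j = b i j"
  shows "e_fun q a i j = e_fun q b i j"
  unfolding e_fun_def assms ..

lemma f_on_row:
  assumes "separated Q" "q \<in> Q"
  shows "f_on Q a q j = f_star q a q j" "f_on Q a (q + 1) j = f_star q a (q + 1) j"
    "A_star q (f_on Q a) = A_star q (f_star q a)"
proof -
  show *: "f_on Q a q j = f_star q a q j" "f_on Q a (q + 1) j = f_star q a (q + 1) j" for j
    using assms separatedD[OF assms] by (auto simp: f_on_def)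
  show "A_star q (f_on Q a) = A_star q (f_star q a)" by (rule A_star_cong[OF *])
qed

lemma e_on_row:
  assumes "separated Q" "q \<in> Q"
  shows "e_on Q a q j = e_fun q a q j" "e_on Q a (q + 1) j = e_fun q a (q + 1) j"
    "A_star q (e_on Q a) = A_star q (e_fun q a)"
proof -
  show *: "e_on Q a q j = e_fun q a q j" "e_on Q a (q + 1) j = e_fun q a (q + 1) j" for j
    using assms separatedD[OF assms] by (auto simp: e_on_def)
  show "A_star q (e_on Q a) = A_star q (e_fun q a)" by (rule A_star_cong[OF *])
qed

lemma e_on_f_on:
  assumes a: "band N a" and Q: "separated Q"
  shows "e_on Q (f_on Q a) = a"
proof (intro ext)
  fix i j
  have *: "e_fun q (f_on Q a) x j = a x j" if "q \<in> Q" "x \<in> {q, q + 1}" for q x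
  proof -
    have "f_on Q a x j = f_star q a x j" using f_on_row[OF Q that(1)] that(2) by auto
    then have "e_fun q (f_on Q a) x j = e_fun q (f_star q a) x j"
      using k_cong(3)[OF f_on_row(3)[OF Q that(1)]] by (intro e_fun_row_cong)
    then show ?thesis using e_fun_f_star[OF a] by simp
  qed
  show "e_on Q (f_on Q a) i j = a i j"
    using *[of i i] *[of "i - 1" i] by (auto simp: e_on_def f_on_def)
qed

lemma f_on_e_on:
  assumes a: "band N a" and Q: "separated Q" and eps: "\<And>q. q \<in> Q \<Longrightarrow> 0 < eps_star q a"
  shows "f_on Q (e_on Q a) = a"
proof (intro ext)
  fix i j
  have *: "f_star q (e_on Q a) x j = a x j" if "q \<in> Q" "x \<in> {q, q + 1}" for q x
  proof -
    have "e_on Q a x j = e_fun q a x j" using e_on_row[OF Q that(1)] that(2) by auto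
    then have "f_star q (e_on Q a) x j = f_star q (e_fun q a) x j"
      using k_cong(2)[OF e_on_row(3)[OF Q that(1)]] by (intro f_star_row_cong)
    then show ?thesis using f_star_e_fun[OF a eps[OF that(1)]] by simp
  qed
  show "f_on Q (e_on Q a) i j = a i j"
    using *[of i i] *[of "i - 1" i] by (auto simp: e_on_def f_on_def)
qed

section \<open>Periodicity, and stability of aperiodic data under f and e\<close>

definition periodic :: "int \<Rightarrow> lusztig \<Rightarrow> bool" where
  "periodic c a \<longleftrightarrow> (\<forall>i j. a (i + c) (j + c) = a i j)"

lemma periodic_mult:
  assumes "periodic c a"
  shows "periodic (c * m) a"
proof -
  have 1: "a (i + c * int n) (j + c * int n) = a i j" for i j n
  proof (induction n arbitrary: i j)
    case (Suc n)
    have "a (i + c * int (Suc n)) (j + c * int (Suc n)) = a ((i + c * int n) + c) ((j + c * int n) + c)"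
      by (simp add: algebra_simps)
    then show ?case using assms Suc by (simp add: periodic_def)
  qed simp
  show ?thesis
    unfolding periodic_def
  proof (intro allI)
    fix i j
    show "a (i + c * m) (j + c * m) = a i j"
    proof (cases "0 \<le> m")
      case True
      then show ?thesis using 1[of i "nat m" j] by simp
    next
      case False
      then show ?thesis using 1[of "i + c * m" "nat (- m)" "j + c * m"] by simp
    qed
  qed
qed

lemma periodic_A_star:
  assumes a: "band N a" and c: "periodic c a"
  shows "A_star (q + c) a (k + c) = A_star q a k"
proof -
  have "A_star (q + c) a (k + c) = (\<Sum>t\<in>{k + c + 1..q + c + N}. int (a (q + c) t) - int (a (q + c + 1) (t + 1)))"
    by (rule A_star_sum[OF a]) simp
  also have "\<dots> = (\<Sum>t\<in>{k + 1..q + N}. int (a q t) - int (a (q + 1) (t + 1)))"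
  proof (rule sum.reindex_bij_witness[of _ "\<lambda>t. t + c" "\<lambda>t. t - c"])
    fix t
    have "a (q + c) (t - c + c) = a q (t - c)" "a (q + 1 + c) (t - c + 1 + c) = a (q + 1) (t - c + 1)"
      using c unfolding periodic_def by blast+
    then show "int (a q (t - c)) - int (a (q + 1) (t - c + 1)) = int (a (q + c) t) - int (a (q + c + 1) (t + 1))"
      by (simp add: algebra_simps)
  qed auto
  also have "\<dots> = A_star q a k" by (rule A_star_sum[OF a, symmetric]) simp
  finally show ?thesis .
qed

lemma periodic_eps:
  assumes a: "band N a" and c: "periodic c a"
  shows "eps_star (q + c) a = eps_star q a"
proof -
  note K = k_f_props[OF a, of q]
  have "A_star (q + c) a k \<le> eps_star q a" if "q + c \<le> k" for k
    using periodic_A_star[OF a c, of q "k - c"] eps_star_ge[OF a, of q "k - c"] that by simp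
  then show ?thesis using eps_starI[OF a, of "q + c" "eps_star q a" "k_f q a + c"] periodic_A_star[OF a c, of q] K by simp
qed

lemma periodic_k_f:
  assumes a: "band N a" and c: "periodic c a"
  shows "k_f (q + c) a = k_f q a + c"
proof (rule k_fI)
  note K = k_f_props[OF a, of q]
  show "q + c \<le> k_f q a + c" "A_star (q + c) a (k_f q a + c) = eps_star (q + c) a"
    using K periodic_A_star[OF a c, of q] periodic_eps[OF a c] by auto
  show "A_star (q + c) a k' < eps_star (q + c) a" if "q + c \<le> k'" "k' < k_f q a + c" for k'
    using K(3)[of "k' - c"] periodic_A_star[OF a c, of q "k' - c"] periodic_eps[OF a c] that by simp
qed

lemma periodic_k_e:
  assumes a: "band N a" and c: "periodic c a" and eps: "0 < eps_star q a"
  shows "k_e (q + c) a = k_e q a + c"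
proof (rule k_eI)
  note K = k_e_props[OF a eps]
  show "q + c \<le> k_e q a + c" "A_star (q + c) a (k_e q a + c) = eps_star (q + c) a"
    using K periodic_A_star[OF a c, of q] periodic_eps[OF a c] by auto
  show "A_star (q + c) a k' < eps_star (q + c) a" if "k_e q a + c < k'" for k'
    using K(4)[of "k' - c"] periodic_A_star[OF a c, of q "k' - c"] periodic_eps[OF a c] that by simp
qed

lemma lusztig_ap_iff:
  "a \<in> lusztig_ap l \<longleftrightarrow> a \<in> lusztig_Z \<and> periodic (int l) a \<and>
    (\<forall>i j. i < j \<longrightarrow> (\<exists>s\<in>{0..<int l}. a (i + s) (j + s) = 0))"
proof -
  have "(\<forall>i j. i < j \<longrightarrow> a i j = a (i + int l) (j + int l)) \<longleftrightarrow> periodic (int l) a" if "a \<in> lusztig_Z"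
  proof -
    have z: "a i j = 0" if "\<not> i < j" for i j using \<open>a \<in> lusztig_Z\<close> that unfolding lusztig_Z_def by blast
    show ?thesis unfolding periodic_def by (metis z add_less_cancel_right)
  qed
  then show ?thesis unfolding lusztig_ap_def lusztig_aff_def by blast
qed

lemma zero_rich_ap:
  assumes "a \<in> lusztig_ap l"
  shows "zero_rich l a"
  unfolding zero_rich_def
proof (intro allI impI)
  fix t x :: int assume t: "1 \<le> t"
  have "\<forall>i j. i < j \<longrightarrow> (\<exists>s\<in>{0..<int l}. a (i + s) (j + s) = 0)" using assms lusztig_ap_iff by blast
  moreover have "x < x + t" using t by simp
  ultimately obtain s where "s \<in> {0..<int l}" "a (x + s) (x + t + s) = 0" by blast
  then show "\<exists>z\<ge>x. z < x + int l \<and> a z (z + t) = 0" by (intro exI[of _ "x + s"]) (auto simp: algebra_simps)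
qed

lemma residue_class_mem:
  assumes "q \<in> residue_class l p"
  obtains m where "q = p + int l * m"
proof -
  have "int l dvd q - p" using assms by (simp add: residue_class_def mod_eq_dvd_iff)
  then obtain m where "q - p = int l * m" by blast
  then show ?thesis using that[of m] by simp
qed

lemma residue_class_shift: "i + int l \<in> residue_class l p \<longleftrightarrow> i \<in> residue_class l p"
  by (simp add: residue_class_def)

lemma residue_class_shift': "i + int l - 1 \<in> residue_class l p \<longleftrightarrow> i - 1 \<in> residue_class l p"
  using residue_class_shift[of "i - 1" l p] by (simp add: algebra_simps)

lemma eps_residue_class:
  assumes "band N a" "periodic (int l) a" "q \<in> residue_class l p"
  shows "eps_star q a = eps_star p a"
  using residue_class_mem[OF assms(3)] periodic_eps[OF assms(1) periodic_mult[OF assms(2)]] by metis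

lemma separated_residue_class: "3 \<le> l \<Longrightarrow> separated (residue_class l p)"
  using residue_class_apart(1) unfolding separated_def by blast

text \<open>By periodicity one zero on a diagonal recurs in every stretch of length l, so a single
  surviving zero is enough.\<close>

lemma aperiodic_of_shift:
  assumes c: "periodic (int l) b" and z: "b x (x + d) = 0" and l: "0 < l"
  shows "\<exists>s\<in>{0..<int l}. b (i + s) (i + d + s) = 0"
proof -
  define s where "s = (x - i) mod int l"
  have s: "s \<in> {0..<int l}" using l by (simp add: s_def)
  define m where "m = (x - i) div int l"
  have x: "i + s + int l * m = x" by (simp add: s_def m_def)
  have "b (i + s + int l * m) (i + d + s + int l * m) = b (i + s) (i + d + s)"
    using periodic_mult[OF c, of m] by (simp only: periodic_def)
  moreover have "i + d + s + int l * m = x + d" using x by simp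
  ultimately have "b (i + s) (i + d + s) = 0" using z by (simp only: x)
  then show ?thesis using s by blast
qed

text \<open>If \<open>f\<close> destroys a zero at \<open>(q, K)\<close> then, by maximality of the partial sum at \<open>K\<close>, the next
  entry \<open>(q + 1, K + 1)\<close> of the same diagonal is a zero, and it survives.\<close>

lemma f_on_ap:
  assumes a: "a \<in> lusztig_ap l" and l: "3 \<le> l"
  shows "f_on (residue_class l p) a \<in> lusztig_ap l"
proof -
  let ?P = "residue_class l p"
  have aZ: "a \<in> lusztig_Z" and c: "periodic (int l) a"
    and ap: "\<And>i j. i < j \<Longrightarrow> \<exists>s\<in>{0..<int l}. a (i + s) (j + s) = 0"
    using a lusztig_ap_iff by blast+
  obtain N where N: "band N a" using aZ lusztig_Z_band by blast
  note sep = separated_residue_class[OF l, of p]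
  have fs: "f_star (q + int l) a (i + int l) (j + int l) = f_star q a i j" for q i j
    using c periodic_k_f[OF N c, of q] by (simp add: f_star_def periodic_def)
  have cb: "periodic (int l) (f_on ?P a)"
    unfolding periodic_def
  proof (intro allI)
    fix i j
    have "f_star (i + int l - 1) a (i + int l) (j + int l) = f_star (i - 1) a i j"
      using fs[of "i - 1" i j] by (simp add: algebra_simps)
    then show "f_on ?P a (i + int l) (j + int l) = f_on ?P a i j"
      using c fs unfolding f_on_def residue_class_shift residue_class_shift' by (simp add: periodic_def)
  qed
  have "\<exists>s\<in>{0..<int l}. f_on ?P a (i + s) (j + s) = 0" if ij: "i < j" for i j
  proof -
    obtain s where s: "a (i + s) (j + s) = 0" using ap[OF ij] by blast
    define x where "x = i + s"
    define d where "d = j - i"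
    have x: "a x (x + d) = 0" "0 < d" using s ij by (auto simp: x_def d_def algebra_simps)
    have "\<exists>y. f_on ?P a y (y + d) = 0"
    proof (cases "x \<in> ?P \<and> x + d = k_f x a + 1")
      case True
      have "a (x + 1) (x + 1 + d) = 0"
      proof -
        have "A_star x a (k_f x a + 1) \<le> A_star x a (k_f x a)"
          using eps_star_ge[OF N, of x "k_f x a + 1"] k_f_props[OF N, of x] by simp
        then have "a (x + 1) (k_f x a + 2) \<le> a x (k_f x a + 1)" using A_star_step[OF N, of x "k_f x a"] by simp
        moreover have "k_f x a + 1 = x + d" "k_f x a + 2 = x + 1 + d" using True by auto
        ultimately show ?thesis using x(1) by simp
      qed
      then have "f_on ?P a (x + 1) (x + 1 + d) = 0"
        using f_on_row(2)[OF sep, of x a "x + 1 + d"] True by (simp add: f_star_def)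
      then show ?thesis by blast
    next
      case False
      have "f_on ?P a x (x + d) = 0"
        using False x f_on_row(2)[OF sep, of "x - 1" a "x + d"] by (auto simp: f_on_def f_star_def)
      then show ?thesis by blast
    qed
    then obtain y where "f_on ?P a y (y + d) = 0" by blast
    then show ?thesis using aperiodic_of_shift[OF cb, of y d i] l by (simp add: d_def)
  qed
  then show ?thesis using f_on_lusztig_Z[OF aZ] cb lusztig_ap_iff by blast
qed

lemma band_e_on:
  assumes a: "band N a" and eps: "\<And>q. q \<in> Q \<Longrightarrow> 0 < eps_star q a"
  shows "band N (e_on Q a)"
  using a band_e_fun[OF a eps] by (auto simp: band_def e_on_def)

text \<open>Dual to the argument for f. If e destroys a zero at (q + 1, K), where K is
  \<open>k_e q a + 1\<close>, then maximality against the preceding partial sum makes the entry (q,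
  K - 1) on the same diagonal zero; it survives because row q changes in column K only.\<close>

lemma e_on_ap:
  assumes a: "a \<in> lusztig_ap l" and l: "3 \<le> l" and eps: "0 < eps_star p a"
  shows "e_on (residue_class l p) a \<in> lusztig_ap l"
proof -
  let ?P = "residue_class l p"
  have aZ: "a \<in> lusztig_Z" and c: "periodic (int l) a"
    and ap: "\<And>i j. i < j \<Longrightarrow> \<exists>s\<in>{0..<int l}. a (i + s) (j + s) = 0"
    using a lusztig_ap_iff by blast+
  obtain N where N: "band N a" using aZ lusztig_Z_band by blast
  note sep = separated_residue_class[OF l, of p]
  have epsq: "0 < eps_star q a" if "q \<in> ?P" for q using eps_residue_class[OF N c that] eps by simp
  have fs: "e_fun (q + int l) a (i + int l) (j + int l) = e_fun q a i j" if "q \<in> ?P" for q i j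
    using c periodic_k_e[OF N c epsq[OF that]] by (simp add: e_fun_def periodic_def)
  have cb: "periodic (int l) (e_on ?P a)"
    unfolding periodic_def
  proof (intro allI)
    fix i j
    have "e_fun (i + int l - 1) a (i + int l) (j + int l) = e_fun (i - 1) a i j" if "i - 1 \<in> ?P"
      using fs[OF that, of i j] by (simp add: algebra_simps)
    then show "e_on ?P a (i + int l) (j + int l) = e_on ?P a i j"
      using c fs unfolding e_on_def residue_class_shift residue_class_shift' by (simp add: periodic_def)
  qed
  have "\<exists>s\<in>{0..<int l}. e_on ?P a (i + s) (j + s) = 0" if ij: "i < j" for i j
  proof -
    obtain s where s: "a (i + s) (j + s) = 0" using ap[OF ij] by blast
    define x where "x = i + s"
    define d where "d = j - i"
    have x: "a x (x + d) = 0" "0 < d" using s ij by (auto simp: x_def d_def algebra_simps)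
    have "\<exists>y. e_on ?P a y (y + d) = 0"
    proof (cases "x - 1 \<in> ?P \<and> x + d = k_e (x - 1) a + 1")
      case True
      let ?q = "x - 1"
      have q: "?q \<in> ?P" "k_e ?q a = ?q + d" using True by auto
      have "a ?q (?q + d) = 0"
      proof -
        have "A_star ?q a (k_e ?q a - 1) \<le> A_star ?q a (k_e ?q a)"
          using eps_star_ge[OF N, of ?q "k_e ?q a - 1"] k_e_props(2)[OF N epsq[OF q(1)]] q x(2) by simp
        then have "a ?q (k_e ?q a) \<le> a (?q + 1) (k_e ?q a + 1)" using A_star_step[OF N, of ?q "k_e ?q a - 1"] by (simp add: add.commute)
        moreover have "k_e ?q a + 1 = x + d" using True by simp
        ultimately show ?thesis using x(1) q(2) by simp
      qed
      then have "e_on ?P a ?q (?q + d) = 0"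
        using e_on_row(1)[OF sep q(1), of a "?q + d"] by (simp add: e_fun_def)
      then show ?thesis by blast
    next
      case False
      have "e_on ?P a x (x + d) = 0"
        using False x by (auto simp: e_on_def e_fun_def)
      then show ?thesis by blast
    qed
    then obtain y where "e_on ?P a y (y + d) = 0" by blast
    then show ?thesis using aperiodic_of_shift[OF cb, of y d i] l by (simp add: d_def)
  qed
  moreover have "e_on ?P a \<in> lusztig_Z" using band_e_on[OF N epsq] lusztig_Z_band by blast
  ultimately show ?thesis using cb lusztig_ap_iff by blast
qed

lemma e_hat_star_e_on:
  assumes a: "a \<in> lusztig_ap l"
  shows "e_hat_star l p a = (if eps_star p a = 0 then None else Some (e_on (residue_class l p) a))"
proof -
  have c: "periodic (int l) a" "a \<in> lusztig_Z" using a lusztig_ap_iff by blast+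
  obtain N where N: "band N a" using c lusztig_Z_band by blast
  have "the (e_star q a) = e_fun q a" if "eps_star p a \<noteq> 0" "q \<in> residue_class l p" for q
    using eps_residue_class[OF N c(1) that(2)] that(1) by (simp add: e_star_eq)
  then have "the (e_star q a) i j = e_fun q a i j" if "eps_star p a \<noteq> 0" "q mod int l = p mod int l" for q i j
    using that by (simp add: residue_class_def)
  then show ?thesis unfolding e_hat_star_def e_on_def residue_class_def mem_Collect_eq by (auto simp: fun_eq_iff)
qed

lemma eps_f_hat_star:
  assumes "a \<in> lusztig_Z" "3 \<le> l"
  shows "eps_star p (f_on (residue_class l p) a) = eps_star p a + 1"
proof -
  obtain N where N: "band N a" using assms lusztig_Z_band by blast
  have "p \<in> residue_class l p" by (simp add: residue_class_def)
  then show ?thesis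
    using k_cong(1)[OF f_on_row(3)[OF separated_residue_class[OF assms(2)]]] eps_k_e_f_star(1)[OF N] by simp
qed

text \<open>If every \<open>eps_star\<close> vanishes, tail sums of rows increase weakly along
  diagonals, and periodicity returns them to their start after l steps; so they are constant. Then a
  is constant along diagonals, and aperiodicity supplies a zero on each.\<close>

lemma highest_weight_ap:
  assumes a: "a \<in> lusztig_ap l" and l: "3 \<le> l" and eps: "\<And>p. p \<in> Ihat l \<Longrightarrow> eps_star p a = 0"
  shows "a = (\<lambda>i j. 0)"
proof -
  have c: "periodic (int l) a" "a \<in> lusztig_Z"
    and ap: "\<And>i j. i < j \<Longrightarrow> \<exists>s\<in>{0..<int l}. a (i + s) (j + s) = 0" using a lusztig_ap_iff by blast+
  obtain N where N: "band N a" using c lusztig_Z_band by blast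
  have eps0: "eps_star q a = 0" for q
  proof -
    have "q \<in> residue_class l (q mod int l)" by (simp add: residue_class_def)
    then show ?thesis using eps_residue_class[OF N c(1)] eps[of "q mod int l"] l by (simp add: Ihat_def)
  qed
  define tail where "tail q k = (\<Sum>t\<in>{k + 1..k + N}. int (a q t))" for q k
  have At: "A_star q a k = tail q k - tail (q + 1) (k + 1)" if "q \<le> k" for q k
  proof -
    have "A_star q a k = (\<Sum>t\<in>{k + 1..k + N}. int (a q t) - int (a (q + 1) (t + 1)))"
      using that by (intro A_star_sum[OF N]) simp
    moreover have "(\<Sum>t\<in>{k + 1..k + N}. int (a (q + 1) (t + 1))) = tail (q + 1) (k + 1)"
      unfolding tail_def by (rule sum.reindex_bij_witness[of _ "\<lambda>t. t - 1" "\<lambda>t. t + 1"]) auto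
    ultimately show ?thesis by (simp add: sum_subtractf tail_def)
  qed
  have tp: "tail (q + int l) (k + int l) = tail q k" for q k
    unfolding tail_def using c(1)
    by (intro sum.reindex_bij_witness[of _ "\<lambda>t. t + int l" "\<lambda>t. t - int l"])
      (auto simp: periodic_def, metis diff_add_cancel)
  have le: "tail q k \<le> tail (q + 1) (k + 1)" if "q \<le> k" for q k
    using At[OF that] eps_star_ge[OF N that] eps0[of q] by simp
  have le': "tail (q + 1) (k + 1) \<le> tail (q + 1 + int n) (k + 1 + int n)" if "q \<le> k" for q k n
  proof (induction n)
    case (Suc n)
    then show ?case using le[of "q + 1 + int n" "k + 1 + int n"] that by (simp add: algebra_simps)
  qed simp
  have A0: "A_star q a k = 0" if "q \<le> k" for q k
  proof -
    have "tail (q + 1) (k + 1) \<le> tail q k" using le'[OF that, of "l - 1"] tp[of q k] l by (simp add: algebra_simps of_nat_diff)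
    then show ?thesis using At[OF that] le[OF that] by simp
  qed
  have diag: "a (q + 1) (j + 1) = a q j" if "q < j" for q j
    using A_star_step[OF N, of q "j - 1"] A0[of q "j - 1"] A0[of q j] that by (simp add: add.commute)
  have diag': "a (q + int n) (j + int n) = a q j" if "q < j" for q j n
  proof (induction n)
    case (Suc n)
    then show ?case using diag[of "q + int n" "j + int n"] that by (simp add: algebra_simps)
  qed simp
  show ?thesis
  proof (intro ext)
    fix i j
    show "a i j = 0"
    proof (cases "i < j")
      case True
      then obtain s where s: "s \<in> {0..<int l}" "a (i + s) (j + s) = 0" using ap by blast
      then show ?thesis using diag'[OF True, of "nat s"] by simp
    next
      case False
      then show ?thesis using N by (simp add: band_def)
    qed
  qed
qed

text \<open>The contribution of row i to the total height. Summed over one period it gives a finite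
  measure although the datum has infinite support.\<close>

definition row_size :: "int \<Rightarrow> lusztig \<Rightarrow> int \<Rightarrow> int" where
  "row_size N a i = (\<Sum>t\<in>{1..N}. t * int (a i (i + t)))"

lemma row_size_e_fun:
  assumes a: "band N a" and eps: "0 < eps_star q a"
  shows "row_size N (e_fun q a) q = row_size N a q - (k_e q a + 1 - q)"
    "row_size N (e_fun q a) (q + 1) = row_size N a (q + 1) + (k_e q a - q)"
proof -
  note K = k_e_props(1,3)[OF a eps]
  have "row_size N (e_fun q a) q = (\<Sum>t\<in>{1..N}. t * int (a q (q + t)) - (if t = k_e q a + 1 - q then k_e q a + 1 - q else 0))"
    unfolding row_size_def
  proof (rule sum.cong)
    fix t
    show "t * int (e_fun q a q (q + t)) = t * int (a q (q + t)) - (if t = k_e q a + 1 - q then k_e q a + 1 - q else 0)"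
      using e_fun_pos[OF a eps] by (auto simp: e_fun_def of_nat_diff algebra_simps)
  qed simp
  then show "row_size N (e_fun q a) q = row_size N a q - (k_e q a + 1 - q)"
    using K by (simp add: sum_subtractf row_size_def)
  have "row_size N (e_fun q a) (q + 1) = (\<Sum>t\<in>{1..N}. t * int (a (q + 1) (q + 1 + t)) + (if t = k_e q a - q then k_e q a - q else 0))"
    unfolding row_size_def by (intro sum.cong) (auto simp: e_fun_def algebra_simps)
  also have "\<dots> = row_size N a (q + 1) + (\<Sum>t\<in>{1..N}. if t = k_e q a - q then k_e q a - q else 0)"
    by (simp add: sum.distrib row_size_def)
  also have "(\<Sum>t\<in>{1..N}. if t = k_e q a - q then k_e q a - q else 0) = k_e q a - q"
    using K by (cases "k_e q a = q") auto
  finally show "row_size N (e_fun q a) (q + 1) = row_size N a (q + 1) + (k_e q a - q)" .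
qed

lemma row_size_cong: "(\<And>j. a i j = b i j) \<Longrightarrow> row_size N a i = row_size N b i"
  by (simp add: row_size_def)

text \<open>Row p loses a root of height k_e + 1 - p, and row p + 1, taken modulo l, gains one of
  height k_e - p.\<close>

lemma row_size_e_on:
  assumes a: "a \<in> lusztig_ap l" "band N a" and l: "3 \<le> l" and eps: "0 < eps_star p a" and p: "p \<in> Ihat l"
  shows "(\<Sum>i\<in>Ihat l. row_size N (e_on (residue_class l p) a) i) = (\<Sum>i\<in>Ihat l. row_size N a i) - 1"
proof -
  let ?P = "residue_class l p" and ?n = "(p + 1) mod int l"
  have c: "periodic (int l) a" using a lusztig_ap_iff by blast
  note sep = separated_residue_class[OF l, of p]
  have pP: "p \<in> ?P" by (simp add: residue_class_def)
  have pI: "0 \<le> p" "p < int l" using p by (auto simp: Ihat_def)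
  have iff: "i \<in> ?P \<longleftrightarrow> i = p" if "i \<in> Ihat l" for i using that pI by (auto simp: residue_class_def Ihat_def)
  have iff': "i - 1 \<in> ?P \<longleftrightarrow> i = ?n" if "i \<in> Ihat l" for i
  proof -
    have "i - 1 \<in> ?P \<longleftrightarrow> i mod int l = (p + 1) mod int l"
      unfolding residue_class_def mem_Collect_eq mod_eq_dvd_iff by (simp add: algebra_simps)
    also have "i mod int l = i" using that by (simp add: Ihat_def)
    finally show ?thesis .
  qed
  have epsq: "0 < eps_star q a" if "q \<in> ?P" for q using eps_residue_class[OF a(2) c that] eps by simp
  have n: "?n \<in> Ihat l" "?n \<noteq> p"
  proof -
    show "?n \<in> Ihat l" using l by (simp add: Ihat_def)
    show "?n \<noteq> p" using iff'[of p] pI residue_class_apart(2)[OF l pP, of "p - 1"] p by auto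
  qed
  have ke: "k_e (?n - 1) a - (?n - 1) = k_e p a - p"
  proof -
    have "?n - 1 \<in> ?P" using iff'[OF n(1)] by simp
    then obtain m where "?n - 1 = p + int l * m" using residue_class_mem by blast
    then show ?thesis using periodic_k_e[OF a(2) periodic_mult[OF c, of m] eps] by simp
  qed
  have row: "row_size N (e_on ?P a) i = row_size N a i + ((if i = p then - (k_e p a + 1 - p) else 0) + (if i = ?n then k_e p a - p else 0))"
    if i: "i \<in> Ihat l" for i
  proof -
    consider "i = p" | "i = ?n" | "i \<noteq> p" "i \<noteq> ?n" by blast
    then show ?thesis
    proof cases
      case 1
      then show ?thesis
        using row_size_cong[of "e_on ?P a" p "e_fun p a" N] e_on_row(1)[OF sep pP] row_size_e_fun(1)[OF a(2) eps] n by auto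
    next
      case 2
      have q: "?n - 1 \<in> ?P" using iff'[OF n(1)] by simp
      have "row_size N (e_on ?P a) ?n = row_size N (e_fun (?n - 1) a) ?n"
        using e_on_row(2)[OF sep q, of a] by (intro row_size_cong) simp
      then show ?thesis using 2 row_size_e_fun(2)[OF a(2) epsq[OF q]] ke n(2) by simp
    next
      case 3
      then have "row_size N (e_on ?P a) i = row_size N a i"
        using iff[OF i] iff'[OF i] by (intro row_size_cong) (simp add: e_on_def)
      then show ?thesis using 3 by simp
    qed
  qed
  have fin: "finite (Ihat l)" by (simp add: Ihat_def)
  have "(\<Sum>i\<in>Ihat l. row_size N (e_on ?P a) i) = (\<Sum>i\<in>Ihat l. row_size N a i +
     ((if i = p then - (k_e p a + 1 - p) else 0) + (if i = ?n then k_e p a - p else 0)))"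
    using row by (intro sum.cong) auto
  also have "\<dots> = (\<Sum>i\<in>Ihat l. row_size N a i) - 1"
    using fin p n(1) by (simp add: sum.distrib)
  finally show ?thesis .
qed

lemma zero_ap: "3 \<le> l \<Longrightarrow> (\<lambda>i j. 0) \<in> lusztig_ap l"
  using lusztig_Z_band[of "\<lambda>i j. 0"] by (auto simp: lusztig_ap_iff periodic_def band_def intro!: exI[of _ 1] bexI[of _ 0])

text \<open>Raising stops because the height over one period is nonnegative and falls, and it stops
  at zero because no other aperiodic datum is of highest weight.\<close>

lemma lusztig_ap_induct [consumes 2, case_names zero step]:
  assumes a: "a \<in> lusztig_ap l" and l: "3 \<le> l"
    and zero: "R (\<lambda>i j. 0)"
    and step: "\<And>b p. b \<in> lusztig_ap l \<Longrightarrow> p \<in> Ihat l \<Longrightarrow> R b \<Longrightarrow> R (f_on (residue_class l p) b)"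
  shows "R a"
proof -
  obtain N where N: "band N a" using a lusztig_ap_iff lusztig_Z_band by blast
  have "a \<in> lusztig_ap l \<Longrightarrow> band N a \<Longrightarrow> R a"
  proof (induction "nat (\<Sum>i\<in>Ihat l. row_size N a i)" arbitrary: a rule: less_induct)
    case less
    show ?case
    proof (cases "\<forall>p\<in>Ihat l. eps_star p a = 0")
      case True
      then show ?thesis using highest_weight_ap[OF less(2) l] zero by simp
    next
      case False
      then obtain p where p: "p \<in> Ihat l" "eps_star p a \<noteq> 0" by blast
      then have eps: "0 < eps_star p a" using eps_star_nonneg[OF less(3), of p] by simp
      let ?b = "e_on (residue_class l p) a"
      have c: "periodic (int l) a" using less(2) lusztig_ap_iff by blast
      have epsq: "0 < eps_star q a" if "q \<in> residue_class l p" for q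
        using eps_residue_class[OF less(3) c that] eps by simp
      have b: "?b \<in> lusztig_ap l" "band N ?b" using e_on_ap[OF less(2) l eps] band_e_on[OF less(3) epsq] by auto
      have "0 \<le> (\<Sum>i\<in>Ihat l. row_size N ?b i)" unfolding row_size_def by (intro sum_nonneg) auto
      then have "nat (\<Sum>i\<in>Ihat l. row_size N ?b i) < nat (\<Sum>i\<in>Ihat l. row_size N a i)"
        using row_size_e_on[OF less(2,3) l eps p(1)] by simp
      then have "R ?b" using less(1) b by blast
      then have "R (f_on (residue_class l p) ?b)" using step b(1) p(1) by blast
      then show ?thesis using f_on_e_on[OF less(3) separated_residue_class[OF l] epsq] by simp
    qed
  qed
  then show ?thesis using a N by blast
qed

lemma zero_BZ_Z: "(\<lambda>k. 0) \<in> BZ_Z"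
proof -
  have "Int_c (\<lambda>k. 0) (- k) \<noteq> {}" if k: "k \<in> maya" for k
  proof -
    obtain I where "I \<in> fin_intervals" "k \<in> maya_on I" using maya_on_exists[OF k] .
    then have "I \<in> Int_c (\<lambda>k. 0) (- k)" by (simp add: Int_c_iff maya_c_on_iff)
    then show ?thesis by blast
  qed
  then show ?thesis using bz_Z_zero by (simp add: BZ_Z_iff families_def)
qed

lemma Psi_zero: "Psi (\<lambda>i j. 0) = (\<lambda>k. 0)"
  by (simp add: Phi_Z_zero star_def)

text \<open>Stabilization holds at zero and is inherited under the affine f, which gives it for all
  aperiodic data.\<close>

lemma Psi_ap_BZ_Z:
  assumes "a \<in> lusztig_ap l" "3 \<le> l"
  shows "Psi a \<in> BZ_Z"
  using assms
proof (induction rule: lusztig_ap_induct)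
  case zero
  then show ?case using zero_BZ_Z by (simp add: Psi_zero)
next
  case (step b p)
  then show ?case using Psi_f_on(1)[OF _ step(3) separated_residue_class[OF assms(2)]] lusztig_ap_iff by blast
qed

text \<open>The values of \<Theta> at the half-line and at its exchange differ by
  \<open>f_const q a + 1\<close>; this is the matching of constants.\<close>

lemma affine_f_ap:
  assumes a: "a \<in> lusztig_ap l" and l: "3 \<le> l"
  shows "affine_f l p a"
proof
  show "3 \<le> l" by (rule l)
  show aZ: "a \<in> lusztig_Z" using a lusztig_ap_iff by blast
  show BZ: "Psi a \<in> BZ_Z" using Psi_ap_BZ_Z[OF a l] .
  obtain N where N: "band N a" using aZ lusztig_Z_band by blast
  have l0: "0 < l" using l by simp
  show "f_const q a = Theta_const q (Psi a)" if "q \<in> residue_class l p" for q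
    using Theta_Psi[OF N zero_rich_ap[OF a] l0 BZ, of q] by (simp add: Theta_const_def)
qed

lemma Theta_Psi_ap:
  assumes a: "a \<in> lusztig_ap l" and l: "3 \<le> l"
  shows "Theta (Psi a) {..q} = - int (r_coeff q a)"
proof -
  obtain N where N: "band N a" using a lusztig_ap_iff lusztig_Z_band by blast
  show ?thesis using Theta_Psi(1)[OF N zero_rich_ap[OF a] _ Psi_ap_BZ_Z[OF a l]] l by simp
qed

lemma r_coeff_diff:
  assumes a: "band N a"
  shows "int (r_coeff p a) - int (r_coeff (p + 1) a) = col_sum a (p + 1) - (\<Sum>t\<in>{p + 2..p + 1 + N}. int (a (p + 1) t))"
proof -
  have N: "0 < N" using a by (simp add: band_def)
  define A where "A = p + 1 - N"
  define T where "T = p + 1 + N"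
  have 1: "int (r_coeff p a) = (\<Sum>x\<in>{p + 1..T}. \<Sum>i\<in>{A..p}. int (a i x))"
    by (rule r_coeff_eq[OF a]) (auto simp: A_def T_def)
  have 2: "int (r_coeff (p + 1) a) = (\<Sum>x\<in>{p + 2..T}. \<Sum>i\<in>{A..p + 1}. int (a i x))"
    using r_coeff_eq[OF a, of A "p + 1" T] by (simp add: A_def T_def add.commute)
  have "{A..p + 1} = insert (p + 1) {A..p}" using N by (auto simp: A_def)
  then have 3: "int (r_coeff (p + 1) a) = (\<Sum>x\<in>{p + 2..T}. int (a (p + 1) x)) + (\<Sum>x\<in>{p + 2..T}. \<Sum>i\<in>{A..p}. int (a i x))"
    unfolding 2 by (simp add: sum.distrib)
  have "{p + 1..T} = insert (p + 1) {p + 2..T}" using N by (auto simp: T_def)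
  then have "int (r_coeff p a) = (\<Sum>i\<in>{A..p}. int (a i (p + 1))) + (\<Sum>x\<in>{p + 2..T}. \<Sum>i\<in>{A..p}. int (a i x))"
    unfolding 1 by simp
  moreover have "(\<Sum>i\<in>{A..p}. int (a i (p + 1))) = col_sum a (p + 1)"
    using col_sum_eq[OF a, of A "p + 1"] by (simp add: A_def)
  ultimately show ?thesis using 3 by (simp add: T_def)
qed

text \<open>The combination 2 r(p) - r(p - 1) - r(p + 1) of values of \<open>r_coeff\<close> is
  \<open>A_star p a p\<close> plus a difference of two column sums. The same terms occur in
  \<open>f_const\<close> with opposite sign, and only \<open>eps_star\<close> remains.\<close>

lemma eps_Z_Psi:
  assumes a: "a \<in> lusztig_ap l" and l: "3 \<le> l"
  shows "eps_Z p (Psi a) = eps_star p a"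
proof -
  obtain N where N: "band N a" using a lusztig_ap_iff lusztig_Z_band by blast
  note T = Theta_Psi[OF N zero_rich_ap[OF a] _ Psi_ap_BZ_Z[OF a l]]
  have N0: "0 < N" using N by (simp add: band_def)
  have "A_star p a p = (\<Sum>t\<in>{p + 1..p + N}. int (a p t)) - (\<Sum>t\<in>{p + 1..p + N}. int (a (p + 1) (t + 1)))"
    using A_star_sum[OF N, of p "p + N" p] by (simp add: sum_subtractf)
  also have "(\<Sum>t\<in>{p + 1..p + N}. int (a (p + 1) (t + 1))) = (\<Sum>t\<in>{p + 2..p + 1 + N}. int (a (p + 1) t))"
    by (rule sum.reindex_bij_witness[of _ "\<lambda>t. t - 1" "\<lambda>t. t + 1"]) auto
  finally have "A_star p a p = (\<Sum>t\<in>{p + 1..p + N}. int (a p t)) - (\<Sum>t\<in>{p + 2..p + 1 + N}. int (a (p + 1) t))" .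
  moreover have "int (r_coeff (p - 1) a) - int (r_coeff p a) = col_sum a p - (\<Sum>t\<in>{p + 1..p + N}. int (a p t))"
    using r_coeff_diff[OF N, of "p - 1"] by (simp add: add.commute)
  ultimately show ?thesis
    using T(1)[of p] T(2)[of p] T(1)[of "p + 1"] T(1)[of "p - 1"] l r_coeff_diff[OF N, of p]
    unfolding eps_Z_alt f_const_def by simp
qed

section \<open>The image of Phi\<close>

text \<open>Complementation permutes the terms of the relation, now taken over the complement of k
  with i and j removed. This symmetry lets \<open>star\<close> exchange the two kinds of BZ
  data.\<close>

lemma bz1_compl:
  assumes "bz1 T M"
  shows "bz1 T (\<lambda>k. M (T - k))"
  unfolding bz1_def
proof (intro allI impI)
  fix k i j assume k: "k \<subseteq> T" "i \<in> T - k" "j \<in> T - k" "i \<noteq> j"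
  define k' where "k' = T - insert i (insert j k)"
  have "T - insert i k = insert j k'" "T - insert j k = insert i k'" "T - k = insert i (insert j k')"
    using k by (auto simp: k'_def)
  moreover have "M (insert i k') + M (insert j k') \<le> M (insert i (insert j k')) + M k'"
    by (rule bz1D[OF assms]) (use k in \<open>auto simp: k'_def\<close>)
  ultimately show "M (T - insert i k) + M (T - insert j k) \<le> M (T - insert i (insert j k)) + M (T - k)"
    unfolding k'_def[symmetric] by simp
qed

lemma bz2_compl:
  assumes "bz2 T M"
  shows "bz2 T (\<lambda>k. M (T - k))"
  unfolding bz2_def
proof (intro allI impI)
  fix k h i j assume k: "k \<subseteq> T" "h \<in> T - k" "i \<in> T - k" "j \<in> T - k" "h < i" "i < j"
  define k' where "k' = T - insert h (insert i (insert j k))"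
  have "T - insert h (insert j k) = insert i k'" "T - insert i k = insert h (insert j k')"
    "T - insert h (insert i k) = insert j k'" "T - insert j k = insert h (insert i k')"
    "T - insert i (insert j k) = insert h k'" "T - insert h k = insert i (insert j k')"
    using k by (auto simp: k'_def)
  moreover have "M (insert h (insert j k')) + M (insert i k') =
       min (M (insert h (insert i k')) + M (insert j k')) (M (insert i (insert j k')) + M (insert h k'))"
    by (rule bz2D[OF assms]) (use k in \<open>auto simp: k'_def\<close>)
  ultimately show "M (T - insert h (insert j k)) + M (T - insert i k) =
       min (M (T - insert h (insert i k)) + M (T - insert j k)) (M (T - insert i (insert j k)) + M (T - insert h k))"
    by (simp add: add.commute)
qed

lemma star_star [simp]: "star (star M) = M"
  by (simp add: star_def)

lemma restr_star:
  assumes K: "K \<in> fin_intervals" and k: "k \<subseteq> tilde K"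
  shows "restr_c K (star M) k = restr_e K M (tilde K - k)"
proof -
  have "k \<in> M_fin_x K \<longleftrightarrow> tilde K - k \<in> M_fin_x K" using k by (auto simp: M_fin_x_def M_fin_def)
  then show ?thesis using compl_window[OF assms] by (simp add: restr_c_def restr_e_def star_def)
qed

lemma BZ_fin_star:
  assumes K: "K \<in> fin_intervals"
  shows "restr_c K (star M) \<in> BZ_fin K \<longleftrightarrow> restr_e K M \<in> BZe_fin K"
proof -
  let ?T = "tilde K"
  have c: "restr_c K (star M) k = restr_e K M (?T - k)" if "k \<subseteq> ?T" for k using restr_star[OF K that] .
  have e: "restr_e K M k = restr_c K (star M) (?T - k)" if "k \<subseteq> ?T" for k
    using c[of "?T - k"] that by (simp add: double_diff)
  have fam: "restr_c K (star M) \<in> families (M_fin_x K)" "restr_e K M \<in> families (M_fin_x K)"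
    by (auto simp: families_def restr_c_def restr_e_def)
  have b1: "bz1 ?T (restr_c K (star M)) \<longleftrightarrow> bz1 ?T (restr_e K M)"
    using bz1_compl[of ?T "restr_c K (star M)"] bz1_compl[of ?T "restr_e K M"]
      bz1_cong[of ?T "restr_e K M" "\<lambda>k. restr_c K (star M) (?T - k)"] e
      bz1_cong[of ?T "restr_c K (star M)" "\<lambda>k. restr_e K M (?T - k)"] c by blast
  have b2: "bz2 ?T (restr_c K (star M)) \<longleftrightarrow> bz2 ?T (restr_e K M)"
    using bz2_compl[of ?T "restr_c K (star M)"] bz2_compl[of ?T "restr_e K M"]
      bz2_cong[of ?T "restr_e K M" "\<lambda>k. restr_c K (star M) (?T - k)"] e
      bz2_cong[of ?T "restr_c K (star M)" "\<lambda>k. restr_e K M (?T - k)"] c by blast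
  have "restr_c K (star M) {i + 1..Max K + 1} = restr_e K M {Min K..i}" if "i \<in> K" for i
  proof -
    have i: "Min K \<le> i" "i \<le> Max K" using that fin_interval_mem[OF K] by auto
    then have "{i + 1..Max K + 1} \<subseteq> ?T" "?T - {i + 1..Max K + 1} = {Min K..i}" by (auto simp: tilde_def)
    then show ?thesis using c by simp
  qed
  then show ?thesis using fam b1 b2 by (simp add: BZ_fin_def BZe_fin_def bz_data_iff)
qed

lemma Int_e_star:
  "Int_e M k = Int_c (star M) (- k)"
proof -
  have "I \<in> Int_e M k \<longleftrightarrow> I \<in> Int_c (star M) (- k)" for I
  proof (cases "I \<in> fin_intervals")
    case True
    have "star M (Omega_c J (- k)) = M (Omega J k)" if "J \<in> fin_intervals" for J
    proof -
      have "- Omega_c J (- k) = Omega J k"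
        using compl_window[OF that, of "tilde J \<inter> k"] unfolding Omega_c_compl Omega_def by auto
      then show ?thesis by (simp add: star_def)
    qed
    then show ?thesis using True by (simp add: Int_e_def Int_c_def maya_c_on_iff)
  qed (simp add: Int_e_def Int_c_def)
  then show ?thesis by blast
qed

lemma BZe_Z_iff: "M \<in> BZe_Z \<longleftrightarrow> star M \<in> BZ_Z"
proof -
  have "M \<in> families maya \<longleftrightarrow> star M \<in> families maya_c"
    unfolding families_def star_def using maya_c_iff by (auto, metis double_complement)
  moreover have "(\<forall>K\<in>fin_intervals. restr_e K M \<in> BZe_fin K) \<longleftrightarrow> bz_Z (star M)"
    using BZ_fin_star by (simp add: bz_Z_def)
  ultimately show ?thesis by (simp add: BZe_Z_def BZ_Z_iff Int_e_star)
qed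

section \<open>Shift invariance of the image\<close>

lemma is_enum_shift:
  assumes "is_enum k r e m"
  shows "is_enum ((\<lambda>x. x - c) ` k) (r - c) (\<lambda>j. e (j + c) - c) (m - c)"
proof -
  have "{..r} = (\<lambda>j. j + c) ` {..r - c}"
  proof (intro set_eqI iffI)
    fix x assume "x \<in> {..r}"
    then show "x \<in> (\<lambda>j. j + c) ` {..r - c}" by (intro image_eqI[of _ _ "x - c"]) auto
  qed auto
  then have "k = (\<lambda>j. e (j + c)) ` {..r - c}" using assms by (simp add: is_enum_def image_image)
  then have "(\<lambda>j. e (j + c) - c) ` {..r - c} = (\<lambda>x. x - c) ` k" by (simp add: image_image)
  then show ?thesis using assms by (auto simp: is_enum_def strict_mono_on_def)
qed

lemma maya_shift: "k \<in> maya \<Longrightarrow> (\<lambda>x. x - c) ` k \<in> maya"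
  using is_enum_shift maya_iff_enum by blast

lemma gt_costs_shift:
  assumes "\<And>x t. w' (x - c) t = w x t"
  shows "gt_cost w lo hi ` gt_patterns lo hi e \<subseteq>
    gt_cost w' (lo - c) (hi - c) ` gt_patterns (lo - c) (hi - c) (\<lambda>j. e (j + c) - c)"
proof
  fix v assume "v \<in> gt_cost w lo hi ` gt_patterns lo hi e"
  then obtain C where C: "C \<in> gt_patterns lo hi e" "v = gt_cost w lo hi C" by blast
  define D where "D p q = C (p + c) (q + c) - c" for p q
  have "D \<in> gt_patterns (lo - c) (hi - c) (\<lambda>j. e (j + c) - c)"
    unfolding gt_patterns_def
  proof (intro CollectI conjI ballI allI impI)
    fix p assume p: "p \<in> {lo - c..hi - c}"
    show "D p p = e (p + c) - c" using gt_diag[OF C(1), of "p + c"] p by (simp add: D_def)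
    fix q assume q: "p \<le> q \<and> q + 1 \<in> {lo - c..hi - c}"
    have "C (p + c) (q + c) \<le> C (p + c) (q + c + 1)"
      using gt_row[OF C(1), of "p + c" "q + c" "q + c + 1"] p q by simp
    then show "D p q \<le> D p (q + 1)" by (simp add: D_def algebra_simps)
  next
    fix p q assume pq: "p \<in> {lo - c..hi - c}" "q \<in> {lo - c..hi - c}" "p < q"
    have "C (p + c) (q + c) < C (p + c + 1) (q + c)"
      using gt_col[OF C(1), of "p + c" "p + c + 1" "q + c"] pq by simp
    then show "D p q < D (p + 1) q" by (simp add: D_def algebra_simps)
  qed
  moreover have "gt_cost w' (lo - c) (hi - c) D = gt_cost w lo hi C"
    unfolding gt_cost_def
  proof (rule sum.reindex_bij_witness[of _ "\<lambda>p. p - c" "\<lambda>p. p + c"])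
    fix p
    have "w (C (p + c) (p + c + t)) t = w' (D p (p + t)) t" for t
      using assms[of "C (p + c) (p + t + c)" t] by (simp add: D_def algebra_simps)
    then show "(\<Sum>t\<in>{0..hi - (p + c)}. w (C (p + c) (p + c + t)) t) = (\<Sum>t\<in>{0..hi - c - p}. w' (D p (p + t)) t)"
      by (intro sum.cong) auto
  qed auto
  ultimately show "v \<in> gt_cost w' (lo - c) (hi - c) ` gt_patterns (lo - c) (hi - c) (\<lambda>j. e (j + c) - c)"
    using C(2) by (metis image_eqI)
qed

lemma gt_min_shift:
  assumes w: "\<And>x t. w' (x - c) t = w x t"
  shows "gt_min w' (lo - c) (hi - c) (\<lambda>j. e (j + c) - c) = gt_min w lo hi e"
proof -
  have "w (x - (- c)) t = w' x t" for x t using w[of "x + c" t] by simp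
  from gt_costs_shift[where w = w' and w' = w and c = "- c" and lo = "lo - c" and hi = "hi - c" and e = "\<lambda>j. e (j + c) - c", OF this]
  show ?thesis
    using gt_costs_shift[where w = w and w' = w' and c = c and lo = lo and hi = hi and e = e, OF w]
    by (simp add: gt_min_def)
qed

lemma Phi_Z_shift:
  assumes a: "band N a" and c: "periodic c a" and k: "k \<in> maya"
  shows "Phi_Z a ((\<lambda>x. x - c) ` k) = Phi_Z a k"
proof -
  obtain r e m where e: "is_enum k r e m" using k maya_iff_enum by blast
  define A where "A = m - N"
  have w: "gt_weight a (A - c) (x - c) t = gt_weight a A x t" for x t
  proof -
    have ac: "a (i - c) (j - c) = a i j" for i j using c unfolding periodic_def by (metis diff_add_cancel)
    have "(\<Sum>i\<in>{A - c..x - c - 1}. int (a i (x - c))) = (\<Sum>i\<in>{A..x - 1}. int (a i x))"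
      by (rule sum.reindex_bij_witness[of _ "\<lambda>i. i - c" "\<lambda>i. i + c"]) (auto simp: ac[of "_ + c", simplified])
    moreover have "a (x - c) (x - c + t) = a x (x + t)" using ac[of x "x + t"] by (simp add: algebra_simps)
    ultimately show ?thesis by (simp add: gt_weight_def)
  qed
  have "Phi_Z a ((\<lambda>x. x - c) ` k) = gt_min (gt_weight a (A - c)) (A - c) (r - c) (\<lambda>j. e (j + c) - c)"
    by (rule Phi_Z_eq[OF a is_enum_shift[OF e]]) (simp add: A_def)
  also have "\<dots> = gt_min (gt_weight a A) A r e" by (rule gt_min_shift[where w = "gt_weight a A" and w' = "gt_weight a (A - c)" and c = c, OF w])
  also have "\<dots> = Phi_Z a k" by (rule Phi_Z_eq[OF a e, symmetric]) (simp add: A_def)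
  finally show ?thesis .
qed

lemma Phi_Z_BZe_sigma:
  assumes a: "a \<in> lusztig_ap l" and l: "3 \<le> l"
  shows "Phi_Z a \<in> BZe_sigma l"
proof -
  have c: "periodic (int l) a" using a lusztig_ap_iff by blast
  obtain N where N: "band N a" using a lusztig_ap_iff lusztig_Z_band by blast
  have "sigma l (Phi_Z a) k = Phi_Z a k" for k
  proof (cases "k \<in> maya")
    case True
    then show ?thesis using Phi_Z_shift[OF N c True] by (simp add: sigma_def)
  next
    case False
    have "(\<lambda>x. x - int l) ` k \<notin> maya"
    proof
      assume "(\<lambda>x. x - int l) ` k \<in> maya"
      from maya_shift[OF this, of "- int l"] False show False by (simp add: image_image)
    qed
    then show ?thesis using False by (simp add: sigma_def Phi_Z_def)
  qed
  then show ?thesis using Psi_ap_BZ_Z[OF a l] by (auto simp: BZe_sigma_def BZe_Z_iff)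
qed

section \<open>The affine f on arbitrary BZ data\<close>

lemma Theta_transfer:
  assumes M: "M \<in> BZ_Z" and x: "x \<in> maya"
    and eq: "\<And>J. J \<in> fin_intervals \<Longrightarrow> q \<in> J \<Longrightarrow> M' (Omega_c J (- x)) = M (Omega_c J (- x))"
  shows "Theta M' x = Theta M x"
proof -
  obtain I where I: "I \<in> fin_intervals" "{q..q} \<subseteq> I" "I \<in> Int_c M (- x)"
    using Int_c_ex[OF M _ _ atLeastAtMost_fin_intervals[of q q], of "{x}"] x by auto
  have qI: "q \<in> I" using I(2) by auto
  have "M' (Omega_c J (- x)) = M' (Omega_c I (- x))" if J: "J \<in> fin_intervals" "I \<subseteq> J" for J
  proof -
    have "q \<in> J" using qI J(2) by auto
    show ?thesis by (rule trans[OF eq[OF J(1) \<open>q \<in> J\<close>] trans[OF Int_c_mono(2)[OF I(3) J] eq[OF I(1) qI, symmetric]]])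
  qed
  then have "I \<in> Int_c M' (- x)" using I(1,3) unfolding Int_c_iff by blast
  from Theta_eq[OF this] Theta_eq[OF I(3)] eq[OF I(1) qI] show ?thesis by simp
qed

lemma f_hat_empty: "k \<in> maya_c \<Longrightarrow> L_set l k p = {} \<Longrightarrow> f_hat l p M k = M k"
  by (simp add: f_hat_def)

lemma Omega_c_atMost_bad:
  assumes "J \<in> fin_intervals" "q \<in> J"
  shows "q' \<in> Omega_c J (- {..q}) \<and> q' + 1 \<notin> Omega_c J (- {..q}) \<longleftrightarrow> q' = q"
proof -
  have "Min J \<le> q" "q \<le> Max J" using assms fin_interval_mem by auto
  then show ?thesis unfolding Omega_c_compl by (auto simp: tilde_def)
qed

lemma Omega_c_swapped_bad:
  assumes "J \<in> fin_intervals" "q \<in> J" "q' \<in> Omega_c J (- swapped q)" "q' + 1 \<notin> Omega_c J (- swapped q)"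
  shows "q' = q - 1 \<or> q' = q + 1"
proof -
  have "Min J \<le> q" "q \<le> Max J" using assms fin_interval_mem by auto
  then show ?thesis using assms(3,4) unfolding Omega_c_compl by (auto simp: tilde_def swapped_def)
qed

text \<open>M is not known to come from a Lusztig datum, so the full product is out of reach. But a
  reflected half-line up to q has q as its only bad position, where the product is a single
  \<open>f_Z\<close>; on the other three sets it is empty.\<close>

lemma Theta_f_hat:
  assumes M: "M \<in> BZ_Z" and l: "3 \<le> l" and q: "q \<in> residue_class l p"
  shows "Theta (f_hat l p M) {..q} = Theta M {..q} - 1"
    "Theta (f_hat l p M) {..q + 1} = Theta M {..q + 1}"
    "Theta (f_hat l p M) {..q - 1} = Theta M {..q - 1}"
    "Theta (f_hat l p M) (swapped q) = Theta M (swapped q)"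
proof -
  let ?P = "residue_class l p"
  have L: "L_set l k p = {q \<in> ?P. q \<in> k \<and> q + 1 \<notin> k}" for k by (auto simp: L_set_def residue_class_def)
  have other: "q + 1 \<notin> ?P" "q - 1 \<notin> ?P" using residue_class_apart(1,2)[OF l q] by blast+
  have "Theta (f_hat l p M) {..q} = Theta (f_Z q M) {..q}"
  proof (rule Theta_transfer[OF f_Z_BZ[OF M] atMost_maya])
    fix J assume J: "J \<in> fin_intervals" "q \<in> J"
    have "L_set l (Omega_c J (- {..q})) p = {q}" unfolding L Omega_c_atMost_bad[OF J] using q by auto
    then show "f_hat l p M (Omega_c J (- {..q})) = f_Z q M (Omega_c J (- {..q}))"
      using Omega_c_maya_c[OF J(1)] by (simp add: f_hat_def)
  qed
  then show "Theta (f_hat l p M) {..q} = Theta M {..q} - 1" unfolding Theta_f_Z_atMost[OF M] if_P[OF refl[of q]] .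
  have shifted: "Theta (f_hat l p M) {..q'} = Theta M {..q'}" if "q' \<notin> ?P" for q'
  proof (rule Theta_transfer[OF M atMost_maya])
    fix J assume J: "J \<in> fin_intervals" "q' \<in> J"
    have "L_set l (Omega_c J (- {..q'})) p = {}" unfolding L Omega_c_atMost_bad[OF J] using that by simp
    then show "f_hat l p M (Omega_c J (- {..q'})) = M (Omega_c J (- {..q'}))"
      by (rule f_hat_empty[OF Omega_c_maya_c[OF J(1)]])
  qed
  show "Theta (f_hat l p M) {..q + 1} = Theta M {..q + 1}" "Theta (f_hat l p M) {..q - 1} = Theta M {..q - 1}"
    using shifted other by auto
  show "Theta (f_hat l p M) (swapped q) = Theta M (swapped q)"
  proof (rule Theta_transfer[OF M swapped_maya])
    fix J assume J: "J \<in> fin_intervals" "q \<in> J"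
    have "L_set l (Omega_c J (- swapped q)) p = {}" unfolding L
    proof (intro equals0I, elim CollectE conjE)
      fix q' assume q': "q' \<in> ?P" "q' \<in> Omega_c J (- swapped q)" "q' + 1 \<notin> Omega_c J (- swapped q)"
      show False using Omega_c_swapped_bad[OF J q'(2,3)] other q'(1) by auto
    qed
    then show "f_hat l p M (Omega_c J (- swapped q)) = M (Omega_c J (- swapped q))"
      by (rule f_hat_empty[OF Omega_c_maya_c[OF J(1)]])
  qed
qed

text \<open>The affine f fixes all components without bad positions in the class and lowers \<Theta>
  at each half-line ending in the class by one. By \<open>bz2_determined\<close> these values fix
  the datum on a finite window.\<close>

lemma f_hat_inj:
  assumes M: "M \<in> BZ_Z" "M' \<in> BZ_Z" and l: "3 \<le> l" and eq: "f_hat l p M = f_hat l p M'"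
  shows "M = M'"
proof
  fix k
  let ?P = "residue_class l p"
  show "M k = M' k"
  proof (cases "k \<in> maya_c")
    case False
    then show ?thesis using M by (simp add: BZ_Z_iff families_def)
  next
    case True
    define Q0 where "Q0 = {q \<in> ?P. q \<in> k \<and> q + 1 \<notin> k}"
    have mk: "- k \<in> maya" using True by (simp add: maya_c_iff)
    obtain lo hi where "{..<lo} \<subseteq> - k" "- k \<subseteq> {..hi}" using maya_bounds[OF mk] .
    then have "Q0 \<subseteq> {lo..hi}" by (force simp: Q0_def)
    then have fin: "finite Q0" by (rule finite_subset) simp
    obtain K where K: "K \<in> fin_intervals" "- k \<in> maya_on K" using maya_on_exists[OF mk] .
    have fX: "finite (atMost ` Q0)" "atMost ` Q0 \<subseteq> maya" using fin atMost_maya by auto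
    obtain I1 where I1: "I1 \<in> fin_intervals" "K \<subseteq> I1" "\<And>x. x \<in> atMost ` Q0 \<Longrightarrow> I1 \<in> Int_c M (- x)"
      by (rule Int_c_ex[OF M(1) fX K(1)]) (rule that)
    obtain I where I: "I \<in> fin_intervals" "I1 \<subseteq> I" "\<And>x. x \<in> atMost ` Q0 \<Longrightarrow> I \<in> Int_c M' (- x)"
      by (rule Int_c_ex[OF M(2) fX I1(1)]) (rule that)
    \<comment> \<open>On an interval stable for both data, the components at the initial segments
      are values of \<Theta>, for all of the finitely many bad q at once.\<close>
    have IM: "I \<in> Int_c M (- {..q})" "I \<in> Int_c M' (- {..q})" if "q \<in> Q0" for q
      using Int_c_mono(1)[OF I1(3) I(1,2)] I(3) that by auto
    have kI: "k \<in> maya_c_on I"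
      using maya_c_on_mono[OF K(1) I(1) order_trans[OF I1(2) I(2)]] K by (simp add: maya_c_on_iff)
    obtain A B where ab: "I = {A..B}" "A \<le> B" "Min I = A" "Max I = B" "tilde I = {A..B + 1}"
      using fin_intervalsE[OF I(1)] .
    define Q where "Q = ?P \<inter> {A..<B + 1}"
    have bad: "{q \<in> Q. q \<in> x \<and> q + 1 \<notin> x} = {q \<in> ?P. q \<in> x \<union> {B + 2..} \<and> q + 1 \<notin> x \<union> {B + 2..}}"
      if x: "x \<subseteq> {A..B + 1}" for x
    proof -
      have "(q \<in> {A..<B + 1} \<and> q \<in> x \<and> q + 1 \<notin> x) \<longleftrightarrow> (q \<in> x \<union> {B + 2..} \<and> q + 1 \<notin> x \<union> {B + 2..})" for q
        using x by (cases "q = B + 1") auto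
      then show ?thesis by (auto simp: Q_def)
    qed
    note R = res_Un_c[OF I(1) kI, unfolded ab(4)]
    have rs: "res I k \<subseteq> {A..B + 1}" using R(1) ab by (auto simp: M_fin_x_def M_fin_def)
    have "restr_c I M (res I k) = restr_c I M' (res I k)"
    proof (rule bz2_determined[where A = A and B = "B + 1" and Q = Q and Q0 = Q0])
      show "bz2 {A..B + 1} (restr_c I M)" "bz2 {A..B + 1} (restr_c I M')"
        using BZ_rel(2)[OF _ I(1)] M unfolding ab(5)[symmetric] by (auto simp: BZ_Z_iff)
      show "Q \<subseteq> {A..<B + 1}" by (simp add: Q_def)
      show "q + 1 \<notin> Q" if "q \<in> Q" for q
        using residue_class_apart(1)[OF l, of q p "q + 1"] that by (auto simp: Q_def)
      show "restr_c I M x = restr_c I M' x" if x: "x \<subseteq> {A..B + 1}" "{q \<in> Q. q \<in> x \<and> q + 1 \<notin> x} = {}" for x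
      proof (cases "x \<in> M_fin_x I")
        case True
        have "L_set l (x \<union> {B + 2..}) p = {}"
          using bad[OF x(1)] x(2) by (auto simp: L_set_def residue_class_def)
        moreover have "x \<union> {B + 2..} \<in> maya_c" using window_maya_c[OF I(1), of x] x(1) ab by simp
        ultimately have "M (x \<union> {B + 2..}) = M' (x \<union> {B + 2..})"
          using f_hat_empty[of "x \<union> {B + 2..}" l p] eq by metis
        then show ?thesis by (simp add: restr_c_def ab(4))
      qed (simp add: restr_c_def)
      show "restr_c I M {A..q} = restr_c I M' {A..q}" if q: "q \<in> Q0" for q
      proof -
        have qI: "q \<in> I" using Int_c_atMost[OF IM(1)[OF q]] .
        have "Theta M {..q} = Theta M' {..q}"
          using Theta_f_hat(1)[OF M(1) l, of q p] Theta_f_hat(1)[OF M(2) l, of q p] eq q by (simp add: Q0_def)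
        then show ?thesis
          using restr_c_Omega(1)[OF I(1) qI] Theta_eq[OF IM(1)[OF q]] Theta_eq[OF IM(2)[OF q]] by (simp add: ab(3))
      qed
      show "res I k \<subseteq> {A..B + 1}" by (rule rs)
      show "{q \<in> Q. q \<in> res I k \<and> q + 1 \<notin> res I k} \<subseteq> Q0" unfolding bad[OF rs] R(2) Q0_def by simp
    qed
    then show ?thesis using R by (simp add: restr_c_def ab(4))
  qed
qed

section \<open>Compatibility of Phi with the crystal structures\<close>

lemma f_op_Phi:
  assumes "a \<in> lusztig_ap l" "3 \<le> l"
  shows "f_op (BZe_crystal l) p (Phi_Z a) = Some (Phi_Z (f_hat_star l p a))"
  using affine_f.f_hat_Psi[OF affine_f_ap[OF assms, of p]] by (simp add: BZe_crystal_def)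

lemma eps_residue_pos:
  assumes "a \<in> lusztig_ap l" "0 < eps_star p a" "q \<in> residue_class l p"
  shows "0 < eps_star q a"
proof -
  obtain N where "band N a" using assms lusztig_ap_iff lusztig_Z_band by blast
  then show ?thesis using eps_residue_class[OF _ _ assms(3)] assms lusztig_ap_iff by metis
qed

lemma f_hat_star_e_on:
  assumes "a \<in> lusztig_ap l" "3 \<le> l" "0 < eps_star p a"
  shows "f_hat_star l p (e_on (residue_class l p) a) = a"
proof -
  obtain N where N: "band N a" using assms lusztig_ap_iff lusztig_Z_band by blast
  show ?thesis unfolding f_hat_star_f_on
    by (rule f_on_e_on[OF N separated_residue_class[OF assms(2)]]) (rule eps_residue_pos[OF assms(1,3)])
qed

lemma eps_star_ap_nonneg: "a \<in> lusztig_ap l \<Longrightarrow> 0 \<le> eps_star p a"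
  using eps_star_nonneg lusztig_ap_iff lusztig_Z_band by blast

lemma e_hat_star_f_hat_star:
  assumes "a \<in> lusztig_ap l" "3 \<le> l"
  shows "e_hat_star l p (f_hat_star l p a) = Some a"
proof -
  have aZ: "a \<in> lusztig_Z" using assms lusztig_ap_iff by blast
  obtain N where N: "band N a" using aZ lusztig_Z_band by blast
  have "eps_star p (f_hat_star l p a) \<noteq> 0"
    using eps_f_hat_star[OF aZ assms(2), of p] eps_star_ap_nonneg[OF assms(1), of p] by (simp add: f_hat_star_f_on)
  then show ?thesis
    using e_hat_star_e_on[OF f_on_ap[OF assms], of p p] e_on_f_on[OF N separated_residue_class[OF assms(2)]]
    by (simp add: f_hat_star_f_on)
qed

lemma e_hat_star_SomeD:
  assumes "a \<in> lusztig_ap l" "3 \<le> l" "e_hat_star l p a = Some b"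
  shows "b \<in> lusztig_ap l" "f_hat_star l p b = a"
proof -
  have e: "eps_star p a \<noteq> 0" "b = e_on (residue_class l p) a"
    using assms(3) e_hat_star_e_on[OF assms(1), of p] by (auto split: if_splits)
  then have eps: "0 < eps_star p a" using eps_star_ap_nonneg[OF assms(1), of p] by simp
  show "b \<in> lusztig_ap l" using e_on_ap[OF assms(1,2) eps] e by simp
  show "f_hat_star l p b = a" using f_hat_star_e_on[OF assms(1,2) eps] e by simp
qed

lemma e_op_Phi:
  assumes a: "a \<in> lusztig_ap l" and l: "3 \<le> l"
  shows "e_op (BZe_crystal l) p (Phi_Z a) = map_option Phi_Z (e_hat_star l p a)"
proof (cases "e_hat_star l p a")
  case None
  then have "eps_star p a = 0" using e_hat_star_e_on[OF a, of p] by (auto split: if_splits)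
  then show ?thesis using None eps_Z_Psi[OF a l] by (simp add: BZe_crystal_def e_hat_def)
next
  case (Some b)
  note b = e_hat_star_SomeD[OF a l Some]
  show ?thesis using Some affine_f.e_hat_Psi[OF affine_f_ap[OF b(1) l, of p]] b(2) by (simp add: BZe_crystal_def)
qed

lemma wt_Phi:
  assumes "a \<in> lusztig_ap l" "3 \<le> l"
  shows "wt_BZ l (Psi a) = wt_lusztig l a"
  using Theta_Psi_ap[OF assms] by (simp add: wt_BZ_def wt_lusztig_def sum_negf[symmetric])

lemma f_hat_star_ap: "a \<in> lusztig_ap l \<Longrightarrow> 3 \<le> l \<Longrightarrow> f_hat_star l p a \<in> lusztig_ap l"
  using f_on_ap by (simp add: f_hat_star_f_on)

text \<open>\<open>r_coeff\<close> is minus \<Theta>, which drops by one at p only; this avoids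
  counting the changed entries.\<close>

lemma r_coeff_f_hat_star:
  assumes ap: "a \<in> lusztig_ap l" and l: "3 \<le> l" and p: "p \<in> Ihat l" and q: "q \<in> Ihat l"
  shows "int (r_coeff q (f_hat_star l p a)) = int (r_coeff q a) + (if q = p then 1 else 0)"
proof -
  interpret affine_f l p a by (rule affine_f_ap[OF ap l])
  have qp: "q \<in> residue_class l p \<longleftrightarrow> q = p" using p q by (auto simp: residue_class_def Ihat_def)
  have "Theta (Psi (f_hat_star l p a)) {..q} = Theta (Psi a) {..q} - (if q = p then 1 else 0)"
  proof (cases "q = p")
    case True
    then show ?thesis using Theta_f_on(1)[of P q] qp by (simp add: f_hat_star_f_on)
  next
    case False
    have "{q' \<in> P. q' \<in> {..q} \<and> q' + 1 \<notin> {..q}} = P \<inter> {q}" by auto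
    also have "\<dots> = {}" using qp False by auto
    finally show ?thesis
      using Psi_f_on(2)[OF a sep[OF order_refl] atMost_maya, of q] False
      by (simp only: f_hat_star_f_on f_on_empty if_False)
  qed
  then show ?thesis using Theta_Psi_ap[OF ap l] Theta_Psi_ap[OF f_hat_star_ap[OF ap l] l] by simp
qed

lemma wt_f_hat_star:
  assumes a: "a \<in> lusztig_ap l" and l: "3 \<le> l" and p: "p \<in> Ihat l"
  shows "wt_lusztig l (f_hat_star l p a) = wt_lusztig l a - simple_root l p"
proof -
  have fin: "finite (Ihat l)" by (simp add: Ihat_def)
  have "(\<Sum>q\<in>Ihat l. frag_cmul (int (r_coeff q (f_hat_star l p a))) (simple_root l q)) =
    (\<Sum>q\<in>Ihat l. frag_cmul (int (r_coeff q a)) (simple_root l q) + (if q = p then simple_root l q else 0))"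
    using r_coeff_f_hat_star[OF a l p] by (intro sum.cong) (auto simp: frag_cmul_distrib)
  also have "\<dots> = (\<Sum>q\<in>Ihat l. frag_cmul (int (r_coeff q a)) (simple_root l q)) + simple_root l p"
    using fin p by (simp add: sum.distrib)
  finally show ?thesis by (simp add: wt_lusztig_def)
qed

lemma coroot_pairing_add: "coroot_pairing p (v + w) = coroot_pairing p v + coroot_pairing p w"
  by (simp add: coroot_pairing_def lookup_add)

lemma coroot_pairing_simple_root:
  assumes l: "3 \<le> l" and p: "p \<in> Ihat l"
  shows "coroot_pairing p (simple_root l p) = 2"
proof -
  have pP: "p \<in> residue_class l p" "p mod int l = p" using p by (auto simp: residue_class_def Ihat_def)
  have "(p - 1) mod int l \<noteq> p" "(p + 1) mod int l \<noteq> p"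
    using residue_class_apart(1,2)[OF l pP(1)] pP(2) by (auto simp: residue_class_def)
  then show ?thesis by (simp add: coroot_pairing_def simple_root_def lookup_add lookup_minus)
qed

lemma is_crystal_lusztig:
  assumes l: "3 \<le> l"
  shows "is_crystal l (lusztig_crystal l)"
proof -
  have f: "wt_lusztig l (f_hat_star l p a) = wt_lusztig l a - simple_root l p"
    "eps_star p (f_hat_star l p a) = eps_star p a + 1"
    "coroot_pairing p (wt_lusztig l (f_hat_star l p a)) = coroot_pairing p (wt_lusztig l a) - 2"
    if "p \<in> Ihat l" "a \<in> lusztig_ap l" for p a
  proof -
    show 1: "wt_lusztig l (f_hat_star l p a) = wt_lusztig l a - simple_root l p" using wt_f_hat_star[OF that(2) l that(1)] .
    show "eps_star p (f_hat_star l p a) = eps_star p a + 1"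
      using eps_f_hat_star[OF _ l] that(2) lusztig_ap_iff by (simp add: f_hat_star_f_on)
    have "wt_lusztig l a = wt_lusztig l (f_hat_star l p a) + simple_root l p" using 1 by simp
    then have "coroot_pairing p (wt_lusztig l a) = coroot_pairing p (wt_lusztig l (f_hat_star l p a) + simple_root l p)" by simp
    then show "coroot_pairing p (wt_lusztig l (f_hat_star l p a)) = coroot_pairing p (wt_lusztig l a) - 2"
      unfolding coroot_pairing_add coroot_pairing_simple_root[OF l that(1)] by simp
  qed
  show ?thesis
    unfolding is_crystal_def
  proof (intro ballI conjI allI impI)
    fix p a assume p: "p \<in> Ihat l" and "a \<in> carrier (lusztig_crystal l)"
    then have a: "a \<in> lusztig_ap l" by (simp add: lusztig_crystal_def)
    show "phi (lusztig_crystal l) p a = eps (lusztig_crystal l) p a + coroot_pairing p (wt (lusztig_crystal l) a)"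
      by (simp add: lusztig_crystal_def)
    {
      fix b assume "e_op (lusztig_crystal l) p a = Some b"
      then have e: "e_hat_star l p a = Some b" by (simp add: lusztig_crystal_def)
      note b = e_hat_star_SomeD[OF a l e]
      show "b \<in> carrier (lusztig_crystal l)" using b by (simp add: lusztig_crystal_def)
      show "wt (lusztig_crystal l) b = wt (lusztig_crystal l) a + simple_root l p"
        using f(1)[OF p b(1)] b(2) by (simp add: lusztig_crystal_def)
      show "eps (lusztig_crystal l) p b = eps (lusztig_crystal l) p a - 1"
        using f(2)[OF p b(1)] b(2) by (simp add: lusztig_crystal_def)
      show "phi (lusztig_crystal l) p b = phi (lusztig_crystal l) p a + 1"
        using f(2,3)[OF p b(1)] b(2) by (simp add: lusztig_crystal_def)
    }
    {
      fix b assume "f_op (lusztig_crystal l) p a = Some b"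
      then have b: "b = f_hat_star l p a" by (simp add: lusztig_crystal_def)
      show "b \<in> carrier (lusztig_crystal l)" using f_hat_star_ap[OF a l] b by (simp add: lusztig_crystal_def)
      show "wt (lusztig_crystal l) b = wt (lusztig_crystal l) a - simple_root l p"
        using f(1)[OF p a] b by (simp add: lusztig_crystal_def)
      show "eps (lusztig_crystal l) p b = eps (lusztig_crystal l) p a + 1"
        using f(2)[OF p a] b by (simp add: lusztig_crystal_def)
      show "phi (lusztig_crystal l) p b = phi (lusztig_crystal l) p a - 1"
        using f(2,3)[OF p a] b by (simp add: lusztig_crystal_def)
    }
    fix b assume "b \<in> carrier (lusztig_crystal l)"
    then have b: "b \<in> lusztig_ap l" by (simp add: lusztig_crystal_def)
    show "f_op (lusztig_crystal l) p a = Some b \<longleftrightarrow> e_op (lusztig_crystal l) p b = Some a"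
      using e_hat_star_f_hat_star[OF a l, of p] e_hat_star_SomeD(2)[OF b l, of p a] by (auto simp: lusztig_crystal_def)
  qed
qed

text \<open>The crystal axioms are transported from C to D along F, so they have to be verified on
  the Lusztig data only.\<close>

lemma crystal_isoI:
  assumes C: "is_crystal l C" and inj: "inj_on F (carrier C)" and D: "carrier D = F ` carrier C"
    and wt: "\<And>b. b \<in> carrier C \<Longrightarrow> wt D (F b) = wt C b"
    and eps: "\<And>p b. p \<in> Ihat l \<Longrightarrow> b \<in> carrier C \<Longrightarrow> eps D p (F b) = eps C p b"
    and phi: "\<And>p b. p \<in> Ihat l \<Longrightarrow> b \<in> carrier C \<Longrightarrow> phi D p (F b) = phi C p b"
    and e: "\<And>p b. p \<in> Ihat l \<Longrightarrow> b \<in> carrier C \<Longrightarrow> e_op D p (F b) = map_option F (e_op C p b)"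
    and f: "\<And>p b. p \<in> Ihat l \<Longrightarrow> b \<in> carrier C \<Longrightarrow> f_op D p (F b) = map_option F (f_op C p b)"
  shows "crystal_iso l C D F"
proof -
  let ?G = "inv_into (carrier C) F"
  have G: "?G (F b) = b" if "b \<in> carrier C" for b using inv_into_f_f[OF inj that] .
  have Ce: "b' \<in> carrier C" "wt C b' = wt C b + simple_root l p" "eps C p b' = eps C p b - 1" "phi C p b' = phi C p b + 1"
    if "p \<in> Ihat l" "b \<in> carrier C" "e_op C p b = Some b'" for p b b'
    using C that unfolding is_crystal_def by blast+
  have Cf: "b' \<in> carrier C" "wt C b' = wt C b - simple_root l p" "eps C p b' = eps C p b + 1" "phi C p b' = phi C p b - 1"
    if "p \<in> Ihat l" "b \<in> carrier C" "f_op C p b = Some b'" for p b b'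
    using C that unfolding is_crystal_def by blast+
  have Cef: "f_op C p b = Some b' \<longleftrightarrow> e_op C p b' = Some b" if "p \<in> Ihat l" "b \<in> carrier C" "b' \<in> carrier C" for p b b'
    using C that unfolding is_crystal_def by blast
  have Cphi: "phi C p b = eps C p b + coroot_pairing p (wt C b)" if "p \<in> Ihat l" "b \<in> carrier C" for p b
    using C that unfolding is_crystal_def by blast
  have "is_crystal l D"
    unfolding is_crystal_def
  proof (intro ballI)
    fix p c assume p: "p \<in> Ihat l" and "c \<in> carrier D"
    then obtain b where b: "b \<in> carrier C" "c = F b" using D by blast
    have 1: "phi D p c = eps D p c + coroot_pairing p (wt D c)"
      using b wt eps[OF p] phi[OF p] Cphi[OF p] by simp
    have 2: "c' \<in> carrier D \<and> wt D c' = wt D c + simple_root l p \<and> eps D p c' = eps D p c - 1 \<and> phi D p c' = phi D p c + 1"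
      if ec: "e_op D p c = Some c'" for c'
    proof -
      obtain b' where b': "e_op C p b = Some b'" "c' = F b'" using ec e[OF p b(1)] b(2) by auto
      note B = Ce[OF p b(1) b'(1)]
      show ?thesis using B b b'(2) D wt eps[OF p] phi[OF p] by simp
    qed
    have 3: "c' \<in> carrier D \<and> wt D c' = wt D c - simple_root l p \<and> eps D p c' = eps D p c + 1 \<and> phi D p c' = phi D p c - 1"
      if fc: "f_op D p c = Some c'" for c'
    proof -
      obtain b' where b': "f_op C p b = Some b'" "c' = F b'" using fc f[OF p b(1)] b(2) by auto
      note B = Cf[OF p b(1) b'(1)]
      show ?thesis using B b b'(2) D wt eps[OF p] phi[OF p] by simp
    qed
    have 4: "f_op D p c = Some c' \<longleftrightarrow> e_op D p c' = Some c" if c': "c' \<in> carrier D" for c'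
    proof -
      obtain b' where b': "b' \<in> carrier C" "c' = F b'" using c' D by blast
      have "f_op D p c = Some c' \<longleftrightarrow> f_op C p b = Some b'"
        using f[OF p b(1)] b(2) b' Cf(1)[OF p b(1)] inj_onD[OF inj] by (cases "f_op C p b") auto
      moreover have "e_op D p c' = Some c \<longleftrightarrow> e_op C p b' = Some b"
        using e[OF p b'(1)] b b'(2) Ce(1)[OF p b'(1)] inj_onD[OF inj] by (cases "e_op C p b'") auto
      ultimately show ?thesis using Cef[OF p b(1) b'(1)] by simp
    qed
    show "phi D p c = eps D p c + coroot_pairing p (wt D c) \<and>
     (\<forall>b'. e_op D p c = Some b' \<longrightarrow> b' \<in> carrier D \<and>
        wt D b' = wt D c + simple_root l p \<and> eps D p b' = eps D p c - 1 \<and> phi D p b' = phi D p c + 1) \<and>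
     (\<forall>b'. f_op D p c = Some b' \<longrightarrow> b' \<in> carrier D \<and>
        wt D b' = wt D c - simple_root l p \<and> eps D p b' = eps D p c + 1 \<and> phi D p b' = phi D p c - 1) \<and>
     (\<forall>b'\<in>carrier D. f_op D p c = Some b' \<longleftrightarrow> e_op D p b' = Some c)"
      using 1 2 3 4 by blast
  qed
  moreover have "bij_betw F (carrier C) (carrier D)" using inj D by (simp add: bij_betw_def)
  moreover have "crystal_morphism l C D (map_option F)"
    unfolding crystal_morphism_def using D wt eps phi e f by auto
  moreover have "crystal_morphism l D C (map_option ?G)"
    unfolding crystal_morphism_def
  proof (intro conjI ballI allI impI)
    fix c b' assume "c \<in> carrier D" and s: "map_option ?G (Some c) = Some b'"
    then obtain b where b: "b \<in> carrier C" "c = F b" using D by blast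
    then have bb: "b' = b" using s G by simp
    show "b' \<in> carrier C" "wt C b' = wt D c" using b bb wt by auto
    fix p assume p: "p \<in> Ihat l"
    show "eps C p b' = eps D p c" "phi C p b' = phi D p c" using b bb eps[OF p] phi[OF p] by auto
    show "map_option ?G (e_op D p c) = e_op C p b'"
      using e[OF p b(1)] b(2) bb G Ce(1)[OF p b(1)] by (cases "e_op C p b") auto
    show "map_option ?G (f_op D p c) = f_op C p b'"
      using f[OF p b(1)] b(2) bb G Cf(1)[OF p b(1)] by (cases "f_op C p b") auto
  qed simp
  ultimately show ?thesis using C by (simp add: crystal_iso_def)
qed

text \<open>Induction along f: since \<Phi> commutes with e, a datum with the same image also admits
  e, and the two preimages have equal images. At zero, equal images force every
  \<open>eps_star\<close> to vanish.\<close>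

lemma inj_on_Phi_Z:
  assumes l: "3 \<le> l"
  shows "inj_on Phi_Z (lusztig_ap l)"
proof -
  have "\<forall>b\<in>lusztig_ap l. Phi_Z a = Phi_Z b \<longrightarrow> a = b" if "a \<in> lusztig_ap l" for a
    using that l
  proof (induction a rule: lusztig_ap_induct)
    case zero
    show ?case
    proof (intro ballI impI)
      fix b assume b: "b \<in> lusztig_ap l" and eq: "Phi_Z (\<lambda>i j. 0) = Phi_Z b"
      have "eps_star p b = 0" for p
      proof -
        have "eps_star p b = eps_star p (\<lambda>i j. 0)"
          using eps_Z_Psi[OF b l] eps_Z_Psi[OF zero_ap[OF l] l] eq by metis
        also have "\<dots> = 0" by (simp add: eps_star_def A_star_def image_constant_conv)
        finally show ?thesis .
      qed
      then show "(\<lambda>i j. 0) = b" using highest_weight_ap[OF b l] by simp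
    qed
  next
    case (step a p)
    show ?case
    proof (intro ballI impI)
      fix b assume b: "b \<in> lusztig_ap l" and eq: "Phi_Z (f_on (residue_class l p) a) = Phi_Z b"
      have fa: "f_hat_star l p a \<in> lusztig_ap l" "f_on (residue_class l p) a = f_hat_star l p a"
        using f_hat_star_ap[OF step(1) l] by (auto simp: f_hat_star_f_on)
      have "map_option Phi_Z (e_hat_star l p b) = Some (Phi_Z a)"
        using e_op_Phi[OF b l, of p] e_op_Phi[OF fa(1) l, of p] e_hat_star_f_hat_star[OF step(1) l, of p] eq fa(2) by simp
      then obtain b' where b': "e_hat_star l p b = Some b'" "Phi_Z b' = Phi_Z a" by auto
      note B = e_hat_star_SomeD[OF b l b'(1)]
      have "a = b'" using step(3) B(1) b'(2) by simp
      then show "f_on (residue_class l p) a = b" using B(2) fa(2) by simp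
    qed
  qed
  then show ?thesis by (auto simp: inj_on_def)
qed

text \<open>\<open>eps_Z\<close> rises by one under f even for arbitrary M, so
  \<open>eps_star p a\<close> is positive and a has a preimage under f among the aperiodic data.
  Injectivity of f on BZ data identifies the image of that preimage with M.\<close>

lemma Phi_Z_image_closed:
  assumes a: "a \<in> lusztig_ap l" and l: "3 \<le> l" and M: "M \<in> BZe_sigma l"
    and f: "f_op (BZe_crystal l) p M = Some (Phi_Z a)"
  shows "M \<in> Phi_Z ` lusztig_ap l"
proof -
  have m: "star M \<in> BZ_Z" using M by (simp add: BZe_sigma_def BZe_Z_iff)
  have "star (f_hat l p (star M)) = Phi_Z a" using f by (simp add: BZe_crystal_def)
  then have fm: "f_hat l p (star M) = Psi a" by (metis star_star)
  have p: "p \<in> residue_class l p" by (simp add: residue_class_def)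
  have "eps_Z p (Psi a) = eps_Z p (star M) + 1"
    using Theta_f_hat[OF m l p] unfolding fm eps_Z_alt by simp
  then have eps: "0 < eps_star p a" using eps_Z_Psi[OF a l, of p] eps_Z_nonneg[OF m, of p] by simp
  let ?b = "e_on (residue_class l p) a"
  have b: "?b \<in> lusztig_ap l" using e_on_ap[OF a l eps] .
  have "f_hat l p (Psi ?b) = Psi a"
    using affine_f.f_hat_Psi[OF affine_f_ap[OF b l, of p]] f_hat_star_e_on[OF a l eps] by simp
  then have "star M = Psi ?b" by (rule f_hat_inj[OF m Psi_ap_BZ_Z[OF b l] l, of p, OF trans[OF fm, OF sym]])
  then have "M = Phi_Z ?b" by (metis star_star)
  then show ?thesis using b by blast
qed

text \<open>Edges are given by f. Forward edges stay in the image since \<Phi> commutes with f,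
  backward ones by \<open>Phi_Z_image_closed\<close>; conversely f reaches every aperiodic datum
  from zero.\<close>

lemma component_eq:
  assumes l: "3 \<le> l"
  shows "connected_component l (BZe_crystal l) O_star = Phi_Z ` lusztig_ap l"
proof
  let ?E = "crystal_edges l (BZe_crystal l)"
  have O: "O_star = Phi_Z (\<lambda>i j. 0)" by (simp add: O_star_def Phi_Z_zero)
  have car: "carrier (BZe_crystal l) = BZe_sigma l" by (simp add: BZe_crystal_def)
  have "b \<in> Phi_Z ` lusztig_ap l" if "(O_star, b) \<in> (?E \<union> ?E\<inverse>)\<^sup>*" for b
    using that
  proof (induction rule: rtrancl_induct)
    case base
    show ?case using zero_ap[OF l] O by blast
  next
    case (step y z)
    then obtain a where a: "a \<in> lusztig_ap l" "y = Phi_Z a" by blast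
    show ?case
    proof (cases "(y, z) \<in> ?E")
      case True
      then obtain p where "f_op (BZe_crystal l) p y = Some z" by (auto simp: crystal_edges_def)
      then show ?thesis using f_op_Phi[OF a(1) l] a f_hat_star_ap[OF a(1) l] by auto
    next
      case False
      then have "(z, y) \<in> ?E" using step(2) by blast
      then obtain p where "z \<in> BZe_sigma l" "f_op (BZe_crystal l) p z = Some y" by (auto simp: crystal_edges_def car)
      then show ?thesis using Phi_Z_image_closed[OF a(1) l] a(2) by blast
    qed
  qed
  then show "connected_component l (BZe_crystal l) O_star \<subseteq> Phi_Z ` lusztig_ap l"
    by (auto simp: connected_component_def)
  have "(O_star, Phi_Z a) \<in> (?E \<union> ?E\<inverse>)\<^sup>*" if "a \<in> lusztig_ap l" for a
    using that l
  proof (induction a rule: lusztig_ap_induct)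
    case zero
    show ?case by (simp add: O)
  next
    case (step b p)
    have "(Phi_Z b, Phi_Z (f_hat_star l p b)) \<in> ?E"
      using f_op_Phi[OF step(1) l] step(2) Phi_Z_BZe_sigma[OF _ l] step(1) f_hat_star_ap[OF step(1) l]
      by (auto simp: crystal_edges_def car)
    then show ?case using step(3) by (auto simp: f_hat_star_f_on intro: rtrancl_into_rtrancl)
  qed
  then show "Phi_Z ` lusztig_ap l \<subseteq> connected_component l (BZe_crystal l) O_star"
    using Phi_Z_BZe_sigma[OF _ l] by (auto simp: connected_component_def car)
qed

theorem theorem6p4p3:
  fixes l :: nat
  assumes "3 \<le> l"
  shows "Phi_Z ` lusztig_ap l = connected_component l (BZe_crystal l) O_star \<and>
         crystal_iso l (lusztig_crystal l) (BZe_component l) Phi_Z"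
proof
  show img: "Phi_Z ` lusztig_ap l = connected_component l (BZe_crystal l) O_star"
    using component_eq[OF assms] by simp
  show "crystal_iso l (lusztig_crystal l) (BZe_component l) Phi_Z"
  proof (rule crystal_isoI[OF is_crystal_lusztig[OF assms]])
    have car: "carrier (lusztig_crystal l) = lusztig_ap l" by (simp add: lusztig_crystal_def)
    show "inj_on Phi_Z (carrier (lusztig_crystal l))" using inj_on_Phi_Z[OF assms] car by simp
    show "carrier (BZe_component l) = Phi_Z ` carrier (lusztig_crystal l)"
      using img car by (simp add: BZe_component_def)
    fix b assume "b \<in> carrier (lusztig_crystal l)"
    then have b: "b \<in> lusztig_ap l" by (simp add: car)
    show "wt (BZe_component l) (Phi_Z b) = wt (lusztig_crystal l) b"
      using wt_Phi[OF b assms] by (simp add: BZe_component_def BZe_crystal_def lusztig_crystal_def)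
    fix p
    show "eps (BZe_component l) p (Phi_Z b) = eps (lusztig_crystal l) p b"
      using eps_Z_Psi[OF b assms] by (simp add: BZe_component_def BZe_crystal_def lusztig_crystal_def)
    show "phi (BZe_component l) p (Phi_Z b) = phi (lusztig_crystal l) p b"
      using eps_Z_Psi[OF b assms] wt_Phi[OF b assms] by (simp add: BZe_component_def BZe_crystal_def lusztig_crystal_def)
    show "e_op (BZe_component l) p (Phi_Z b) = map_option Phi_Z (e_op (lusztig_crystal l) p b)"
      using e_op_Phi[OF b assms, of p] by (simp add: BZe_component_def lusztig_crystal_def)
    show "f_op (BZe_component l) p (Phi_Z b) = map_option Phi_Z (f_op (lusztig_crystal l) p b)"
      using f_op_Phi[OF b assms, of p] by (simp add: BZe_component_def lusztig_crystal_def)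
  qed
qed

end
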